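(* Let $L_1>0$, let $0<L_2<2\pi$, and let $u:[0,L_2)\to\mathbb{R}$ be a smooth ($L_2$-periodic) function with a finite number of critical points, of order at most $m\ge 2$. Then, given $\phi_0\in L^2(\mathbb{T}^2)$, there exists $0<\nu_0<1$, depending on $L_1$, $L_2$, $u$ and $\|\phi_0\|_{L^2}$, with the following property: for any $0<\nu<\nu_0$ there exists a global-in-time weak solution $\phi$ of $$\partial_t\phi+u(y)\,\partial_x\phi+\frac{\nu}{2}|\nabla\phi|^2+\nu\Delta^2\phi+\nu\Delta\phi=0$$ on $\mathbb{T}^2$ with initial data $\phi_0$, such that $\phi\in L^\infty([0,T);L^2(\mathbb{T}^2))\cap L^2([0,T);H^2(\mathbb{T}^2))$ for all $0<T<\infty$.
   Context: $\mathbb{T}^2$ denotes the two-dimensional torus obtained from $[0,L_1]\times[0,L_2]$ with periodic boundary conditions, with coordinates $(x,y)$. Functions are real-valued. A smooth function $u$ has critical points of order at most $m$ if at every critical point at most $m-1$ derivatives vanish, i.e. if $u'(y_c)=0$ then $u^{(j)}(y_c)\neq 0$ for some $2\le j\le m$. A weak solution on $[0,T)$ with initial data $\phi_0$ is a function in $L^\infty([0,T);L^2)\cap L^2([0,T);H^2)$ which satisfies the equation in the sense of distributions on $[0,T)\times\mathbb{T}^2$ and attains the initial value $\phi_0$ (equivalently, the equation tested against smooth functions compactly supported in $[0,T)\times\mathbb{T}^2$, with the initial datum appearing as boundary term at $t=0$). Global-in-time means this holds for every $T<\infty$. *)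

theory Defs
  imports "HOL-Analysis.Analysis"
begin

definition dirD :: "'a::real_normed_vector \<Rightarrow> ('a \<Rightarrow> real) \<Rightarrow> 'a \<Rightarrow> real" where
  "dirD v f x = frechet_derivative f (at x) v"

(* All iterated directional derivatives exist and are Frechet differentiable, hence continuous;
   on a finite-dimensional space this is C^infinity. *)
definition smooth_fun :: "('a::real_normed_vector \<Rightarrow> real) \<Rightarrow> bool" where
  "smooth_fun f \<longleftrightarrow> (\<forall>vs x. foldr dirD vs f differentiable (at x))"

definition critical_points_of_order_at_most :: "nat \<Rightarrow> (real \<Rightarrow> real) \<Rightarrow> bool" where
  "critical_points_of_order_at_most m u \<longleftrightarrow>
     (\<forall>y. deriv u y = 0 \<longrightarrow> (\<exists>j\<in>{2..m}. (deriv ^^ j) u y \<noteq> 0))"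


subsection \<open>Function spaces on the torus\<close>

(* The torus is modelled by a fundamental domain with Lebesgue measure. Elements of L^2 are
   represented by functions on the plane of which only the values on that domain matter;
   periodicity is imposed on test functions. *)
definition torus :: "real \<Rightarrow> real \<Rightarrow> (real \<times> real) measure" where
  "torus L1 L2 = lebesgue_on ({0..<L1} \<times> {0..<L2})"

definition in_L2 :: "real \<Rightarrow> real \<Rightarrow> (real \<times> real \<Rightarrow> real) \<Rightarrow> bool" where
  "in_L2 L1 L2 f \<longleftrightarrow>
     f \<in> borel_measurable (torus L1 L2) \<and> integrable (torus L1 L2) (\<lambda>z. (f z)\<^sup>2)"

definition L2norm :: "real \<Rightarrow> real \<Rightarrow> (real \<times> real \<Rightarrow> real) \<Rightarrow> real" where
  "L2norm L1 L2 f = sqrt (LINT z|torus L1 L2. (f z)\<^sup>2)"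

definition torus_test :: "real \<Rightarrow> real \<Rightarrow> (real \<times> real \<Rightarrow> real) \<Rightarrow> bool" where
  "torus_test L1 L2 \<psi> \<longleftrightarrow>
     smooth_fun \<psi> \<and> (\<forall>x y. \<psi> (x + L1, y) = \<psi> (x, y) \<and> \<psi> (x, y + L2) = \<psi> (x, y))"

definition partialD :: "nat \<Rightarrow> nat \<Rightarrow> (real \<times> real \<Rightarrow> real) \<Rightarrow> real \<times> real \<Rightarrow> real" where
  "partialD i j \<psi> = (dirD (1, 0) ^^ i) ((dirD (0, 1) ^^ j) \<psi>)"

definition has_weak_deriv ::
  "real \<Rightarrow> real \<Rightarrow> nat \<Rightarrow> nat \<Rightarrow> (real \<times> real \<Rightarrow> real) \<Rightarrow> (real \<times> real \<Rightarrow> real) \<Rightarrow> bool" where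
  "has_weak_deriv L1 L2 i j f g \<longleftrightarrow>
     in_L2 L1 L2 g \<and>
     (\<forall>\<psi>. torus_test L1 L2 \<psi> \<longrightarrow>
        (LINT z|torus L1 L2. f z * partialD i j \<psi> z)
          = (-1) ^ (i + j) * (LINT z|torus L1 L2. g z * \<psi> z))"

(* A representative of the weak derivative, which is unique up to null sets. *)
definition weakD ::
  "real \<Rightarrow> real \<Rightarrow> nat \<Rightarrow> nat \<Rightarrow> (real \<times> real \<Rightarrow> real) \<Rightarrow> real \<times> real \<Rightarrow> real" where
  "weakD L1 L2 i j f = (SOME g. has_weak_deriv L1 L2 i j f g)"

definition in_H2 :: "real \<Rightarrow> real \<Rightarrow> (real \<times> real \<Rightarrow> real) \<Rightarrow> bool" where
  "in_H2 L1 L2 f \<longleftrightarrow>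
     in_L2 L1 L2 f \<and> (\<forall>i j. i + j \<le> 2 \<longrightarrow> (\<exists>g. has_weak_deriv L1 L2 i j f g))"

definition H2norm :: "real \<Rightarrow> real \<Rightarrow> (real \<times> real \<Rightarrow> real) \<Rightarrow> real" where
  "H2norm L1 L2 f =
     sqrt (\<Sum>(i, j)\<in>{(i, j). i + j \<le> 2}. (L2norm L1 L2 (weakD L1 L2 i j f))\<^sup>2)"


subsection \<open>Space-time function spaces\<close>

(* Joint measurability stands for strong measurability of t \<mapsto> \<phi> t as a map into the
   separable space L^2 (into H^2, if almost all values lie there). *)
definition spacetime_measurable ::
  "real \<Rightarrow> real \<Rightarrow> real \<Rightarrow> (real \<Rightarrow> real \<times> real \<Rightarrow> real) \<Rightarrow> bool" where
  "spacetime_measurable L1 L2 T \<phi> \<longleftrightarrow>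
     (\<lambda>(t, z). \<phi> t z) \<in> borel_measurable (lebesgue_on ({0..<T} \<times> {0..<L1} \<times> {0..<L2}))"

definition in_Linf_L2 ::
  "real \<Rightarrow> real \<Rightarrow> real \<Rightarrow> (real \<Rightarrow> real \<times> real \<Rightarrow> real) \<Rightarrow> bool" where
  "in_Linf_L2 L1 L2 T \<phi> \<longleftrightarrow>
     spacetime_measurable L1 L2 T \<phi> \<and>
     (\<exists>C. AE t in lebesgue_on {0..<T}. in_L2 L1 L2 (\<phi> t) \<and> L2norm L1 L2 (\<phi> t) \<le> C)"

definition in_L2_H2 ::
  "real \<Rightarrow> real \<Rightarrow> real \<Rightarrow> (real \<Rightarrow> real \<times> real \<Rightarrow> real) \<Rightarrow> bool" where
  "in_L2_H2 L1 L2 T \<phi> \<longleftrightarrow>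
     spacetime_measurable L1 L2 T \<phi> \<and>
     (AE t in lebesgue_on {0..<T}. in_H2 L1 L2 (\<phi> t)) \<and>
     integrable (lebesgue_on {0..<T}) (\<lambda>t. (H2norm L1 L2 (\<phi> t))\<^sup>2)"


subsection \<open>Weak solutions\<close>

abbreviation Dt :: "(real \<times> real \<times> real \<Rightarrow> real) \<Rightarrow> real \<times> real \<times> real \<Rightarrow> real" where
  "Dt \<equiv> dirD (1, 0, 0)"

abbreviation Dx :: "(real \<times> real \<times> real \<Rightarrow> real) \<Rightarrow> real \<times> real \<times> real \<Rightarrow> real" where
  "Dx \<equiv> dirD (0, 1, 0)"

abbreviation Dy :: "(real \<times> real \<times> real \<Rightarrow> real) \<Rightarrow> real \<times> real \<times> real \<Rightarrow> real" where
  "Dy \<equiv> dirD (0, 0, 1)"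

definition Lap :: "(real \<times> real \<times> real \<Rightarrow> real) \<Rightarrow> real \<times> real \<times> real \<Rightarrow> real" where
  "Lap \<psi> p = Dx (Dx \<psi>) p + Dy (Dy \<psi>) p"

(* Smooth functions with compact support in [0,T) x torus, as restrictions to t \<ge> 0 of smooth
   functions on the whole space; they need not vanish at t = 0. *)
definition spacetime_test ::
  "real \<Rightarrow> real \<Rightarrow> real \<Rightarrow> (real \<times> real \<times> real \<Rightarrow> real) \<Rightarrow> bool" where
  "spacetime_test L1 L2 T \<psi> \<longleftrightarrow>
     smooth_fun \<psi> \<and>
     (\<forall>t x y. \<psi> (t, x + L1, y) = \<psi> (t, x, y) \<and> \<psi> (t, x, y + L2) = \<psi> (t, x, y)) \<and>
     (\<exists>T'<T. \<forall>t\<ge>T'. \<forall>z. \<psi> (t, z) = 0)"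

definition grad_sq :: "real \<Rightarrow> real \<Rightarrow> (real \<times> real \<Rightarrow> real) \<Rightarrow> real \<times> real \<Rightarrow> real" where
  "grad_sq L1 L2 f z = (weakD L1 L2 1 0 f z)\<^sup>2 + (weakD L1 L2 0 1 f z)\<^sup>2"

(* The space-time integral is iterated because weakD selects a representative separately for
   each t: the inner integral does not depend on that choice, whereas joint measurability
   of the selected representatives could fail. *)
definition weak_solution ::
  "real \<Rightarrow> real \<Rightarrow> (real \<Rightarrow> real) \<Rightarrow> real \<Rightarrow> (real \<times> real \<Rightarrow> real) \<Rightarrow> real \<Rightarrow>
   (real \<Rightarrow> real \<times> real \<Rightarrow> real) \<Rightarrow> bool" where
  "weak_solution L1 L2 u \<nu> \<phi>0 T \<phi> \<longleftrightarrow>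
     in_Linf_L2 L1 L2 T \<phi> \<and> in_L2_H2 L1 L2 T \<phi> \<and>
     (\<forall>\<psi>. spacetime_test L1 L2 T \<psi> \<longrightarrow>
        (LINT t|lebesgue_on {0..<T}. LINT z|torus L1 L2.
            \<phi> t z * (- Dt \<psi> (t, z) - u (snd z) * Dx \<psi> (t, z)
                     + \<nu> * Lap (Lap \<psi>) (t, z) + \<nu> * Lap \<psi> (t, z))
            + \<nu> / 2 * grad_sq L1 L2 (\<phi> t) z * \<psi> (t, z))
        = (LINT z|torus L1 L2. \<phi>0 z * \<psi> (0, z)))"

end

theory Submission
 imports Defs "HOL-Complex_Analysis.Great_Picard"
begin

text \<open>Expand the unknown in the characters of the torus and pass to the time \<open>\<nu> t\<close>, so that the shear
 acquires the amplitude \<open>A = 1 / \<nu>\<close>. On a short time interval, independent of \<open>A\<close>, the \<open>L\<close>-2 norm of a Galerkin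
 approximation stays bounded. There the modes depending on \<open>x\<close> lose their mass: since the level sets of
 \<open>u\<close> are finite, a rank-one operator is, up to a small Hilbert--Schmidt error, a commutator \<open>[u, h]\<close>, so
 the square of each such mode is, up to small terms, \<open>1 / A\<close> times the time derivative of a bounded quantity.
 The \<open>x\<close>-average satisfies a one-dimensional equation whose linear part is strictly dissipative because
 \<open>L2 < 2 * pi\<close> and whose nonlinearity is orthogonal to its Laplacian; hence it stays bounded as long as the other
 modes are small, and these stay small by the same averaging argument on later windows. The Galerkin
 limit follows from equicontinuity of the coefficients and uniformly small tails of the quadratic term.\<close>

text \<open>The quadratic term contributes a cubic expression without a sign to the L2 balance, so
  the energy estimate alone gives a bound only on a short time interval. Mixing therefore has to be
  exploited inside the Galerkin systems, with thresholds for \<open>A\<close> and for the truncation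
  that depend on the size of the datum and not on the individual solution. This works because the
  approximate commutator \<open>h\<close> is a trigonometric polynomial: as soon as the truncation
  contains its modes, truncated multiplication by \<open>u\<close> produces the commutator terms
  exactly. Since \<open>h\<close> comes from an approximation argument, the decay has no explicit
  rate and the thresholds are not explicit either.

  The mean of the solution is driven by the other modes and acts on none of them, since only
  gradients enter the nonlinearity and the transport term vanishes on functions of \<open>y\<close>.
  It is left out of the Galerkin system and of every energy and is recovered at the end by one
  integration in time.\<close>

type_synonym coeffs = "int \<times> int => complex"

section \<open>Characters and integration on the fundamental domain\<close>

locale torus2 =
 fixes L1 L2 :: real
 assumes L1: "0 < L1" and L2: "0 < L2"
begin

abbreviation M :: "(real \<times> real) measure" where "M \<equiv> torus L1 L2"

definition e :: "int \<times> int => real \<times> real => complex" where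
 "e a z = cis (2 * pi * (of_int (fst a) * fst z / L1 + of_int (snd a) * snd z / L2))"

lemma dom_borel [measurable]: "{0..<L1} \<times> {0..<L2} \<in> sets (borel :: (real \<times> real) measure)" by (intro borel_Times) auto

lemma dom_lebesgue: "{0..<L1} \<times> {0..<L2} \<in> sets lebesgue" using dom_borel by auto

lemma space_M: "space M = {0..<L1} \<times> {0..<L2}" by (simp add: torus_def)

lemma measurable_M:
 "f \<in> borel_measurable borel ==> f \<in> borel_measurable M"
 unfolding torus_def by (auto intro!: measurable_restrict_space1 measurable_completion)

lemma emeasure_M: "emeasure M (space M) = ennreal (L1 * L2)"
proof -
 have "emeasure M (space M) = emeasure lborel ({0..<L1} \<times> {0..<L2})" unfolding space_M unfolding torus_def using dom_lebesgue dom_borel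
  by (subst emeasure_restrict_space) (auto simp: main_part_sets)
 also have "\<dots> = emeasure (lborel \<Otimes>\<^sub>M lborel) ({0..<L1} \<times> {0..<L2})" by (simp add: lborel_prod)
 also have "\<dots> = emeasure lborel {0..<L1} * emeasure lborel {0..<L2}" by (rule lborel.emeasure_pair_measure_Times) auto
 also have "\<dots> = ennreal (L1 * L2)" using L1 L2 by (simp add: ennreal_mult)
 finally show ?thesis .
qed

lemma finite_M: "finite_measure M" by (rule finite_measureI) (simp add: emeasure_M)

sublocale finite_measure M by (rule finite_M)

lemma measure_M: "measure M (space M) = L1 * L2" using emeasure_M L1 L2 by (simp add: measure_def)

lemma integral_M:
 fixes f :: "real \<times> real => 'b::{banach, second_countable_topology}"
 assumes "f \<in> borel_measurable borel"
 shows "(LINT z|M. f z) = (LINT z|lborel. indicator ({0..<L1} \<times> {0..<L2}) z *\<^sub>R f z)"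
 unfolding torus_def using dom_lebesgue dom_borel assms by (subst integral_restrict_space) (auto intro!: integral_completion)

lemma integrable_M_iff:
 fixes f :: "real \<times> real => 'b::{banach, second_countable_topology}"
 assumes "f \<in> borel_measurable borel"
 shows "integrable M f \<longleftrightarrow> integrable lborel (%z. indicator ({0..<L1} \<times> {0..<L2}) z *\<^sub>R f z)"
 unfolding torus_def using dom_lebesgue dom_borel assms by (subst integrable_restrict_space) (auto intro!: integrable_completion)

lemma integrable_M_bounded:
 fixes f :: "real \<times> real => 'b::{banach, second_countable_topology}"
 assumes "f \<in> borel_measurable M" "!!z. norm (f z) \<le> B"
 shows "integrable M f" by (rule integrable_const_bound[of _ B]) (use assms in auto)

lemma integral_M_fst:
 fixes f :: "real \<times> real => 'b::{banach, second_countable_topology}"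
 assumes [measurable]: "f \<in> borel_measurable borel" and "integrable M f"
 shows "(LINT z|M. f z) =
  (LINT x|lborel. indicator {0..<L1} x *\<^sub>R (LINT y|lborel. indicator {0..<L2} y *\<^sub>R f (x, y)))"
proof -
 have i: "integrable (lborel \<Otimes>\<^sub>M lborel) (%z. indicator ({0..<L1} \<times> {0..<L2}) z *\<^sub>R f z)"
  using assms(2) by (simp add: integrable_M_iff lborel_prod)
 have "(LINT z|M. f z) = (LINT z|(lborel \<Otimes>\<^sub>M lborel). indicator ({0..<L1} \<times> {0..<L2}) z *\<^sub>R f z)"
  by (simp add: integral_M lborel_prod)
 also have "\<dots> = (LINT x|lborel. LINT y|lborel. indicator ({0..<L1} \<times> {0..<L2}) (x, y) *\<^sub>R f (x, y))"
  by (rule lborel_pair.integral_fst'[OF i, symmetric])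
 also have "\<dots> = (LINT x|lborel. indicator {0..<L1} x *\<^sub>R (LINT y|lborel. indicator {0..<L2} y *\<^sub>R f (x, y)))"
  by (intro Bochner_Integration.integral_cong refl)
    (auto simp: indicator_def intro!: Bochner_Integration.integral_cong)
 finally show ?thesis .
qed

lemma integral_M_snd:
 fixes f :: "real \<times> real => 'b::{banach, second_countable_topology}"
 assumes [measurable]: "f \<in> borel_measurable borel" and "integrable M f"
 shows "(LINT z|M. f z) =
  (LINT y|lborel. indicator {0..<L2} y *\<^sub>R (LINT x|lborel. indicator {0..<L1} x *\<^sub>R f (x, y)))"
proof -
 have i: "integrable (lborel \<Otimes>\<^sub>M lborel) (%(x, y). indicator ({0..<L1} \<times> {0..<L2}) (x, y) *\<^sub>R f (x, y))"
  using assms(2) by (simp add: integrable_M_iff lborel_prod case_prod_beta')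
 have "(LINT z|M. f z) = (LINT z|(lborel \<Otimes>\<^sub>M lborel). indicator ({0..<L1} \<times> {0..<L2}) z *\<^sub>R f z)"
  by (simp add: integral_M lborel_prod)
 also have "\<dots> = (LINT y|lborel. LINT x|lborel. indicator ({0..<L1} \<times> {0..<L2}) (x, y) *\<^sub>R f (x, y))"
  using lborel_pair.integral_snd[OF i] by (simp add: case_prod_beta')
 also have "\<dots> = (LINT y|lborel. indicator {0..<L2} y *\<^sub>R (LINT x|lborel. indicator {0..<L1} x *\<^sub>R f (x, y)))"
  by (intro Bochner_Integration.integral_cong refl)
    (auto simp: indicator_def intro!: Bochner_Integration.integral_cong)
 finally show ?thesis .
qed

text \<open>The fundamental domain is half open whereas the fundamental theorem of calculus concerns
  closed intervals; the right end point is a null set.\<close>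

lemma FTC_half_open:
 fixes F :: "real => complex"
 assumes "0 < L" "!!x. (F has_vector_derivative f x) (at x)" "continuous_on UNIV f"
 shows "(LINT x|lborel. indicator {0..<L} x *\<^sub>R f x) = F L - F 0"
proof -
 have [measurable]: "f \<in> borel_measurable borel" using assms(3) by (rule borel_measurable_continuous_onI)
 have "AE x in lborel. indicator {0..<L} x *\<^sub>R f x = indicator {0..L} x *\<^sub>R f x"
  using AE_lborel_singleton[of L] by eventually_elim (auto simp: indicator_def)
 hence "(LINT x|lborel. indicator {0..<L} x *\<^sub>R f x) = (LINT x|lborel. indicator {0..L} x *\<^sub>R f x)" by (intro integral_cong_AE) simp_all
 also have "\<dots> = F L - F 0" using assms continuous_on_subset[OF assms(3), of "{0..L}"]
  by (intro integral_FTC_atLeastAtMost) (auto intro: has_vector_derivative_at_within)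
 finally show ?thesis .
qed

text \<open>Source of both the orthogonality of the characters and integration by parts on the
  torus: the inner integral is the difference of \<open>F\<close> at two identified boundary
  points.\<close>

lemma integral_dx_0:
 fixes F :: "real \<times> real => complex"
 assumes d: "!!x y. ((%x. F (x, y)) has_vector_derivative f (x, y)) (at x)"
  and c: "continuous_on UNIV f" and p: "!!x y. F (x + L1, y) = F (x, y)"
  and "integrable M f"
 shows "(LINT z|M. f z) = 0"
proof -
 have f: "f \<in> borel_measurable borel" using c by (rule borel_measurable_continuous_onI)
 have "(LINT x|lborel. indicator {0..<L1} x *\<^sub>R f (x, y)) = 0" for y
 proof -
  have "(LINT x|lborel. indicator {0..<L1} x *\<^sub>R f (x, y)) = F (L1, y) - F (0, y)"
   by (intro FTC_half_open L1 d continuous_on_compose2[OF c]) (auto intro!: continuous_intros)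
  thus ?thesis using p[of 0 y] by simp
 qed
 thus ?thesis by (subst integral_M_snd[OF f assms(4)]) simp
qed

lemma integral_dy_0:
 fixes F :: "real \<times> real => complex"
 assumes d: "!!x y. ((%y. F (x, y)) has_vector_derivative f (x, y)) (at y)"
  and c: "continuous_on UNIV f" and p: "!!x y. F (x, y + L2) = F (x, y)"
  and "integrable M f"
 shows "(LINT z|M. f z) = 0"
proof -
 have f: "f \<in> borel_measurable borel" using c by (rule borel_measurable_continuous_onI)
 have "(LINT y|lborel. indicator {0..<L2} y *\<^sub>R f (x, y)) = 0" for x
 proof -
  have "(LINT y|lborel. indicator {0..<L2} y *\<^sub>R f (x, y)) = F (x, L2) - F (x, 0)"
   by (intro FTC_half_open L2 d continuous_on_compose2[OF c]) (auto intro!: continuous_intros)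
  thus ?thesis using p[of x 0] by simp
 qed
 thus ?thesis by (subst integral_M_fst[OF f assms(4)]) simp
qed

lemma norm_e [simp]: "norm (e a z) = 1" by (simp add: e_def)

lemma e_add: "e (a + b) z = e a z * e b z" by (simp add: e_def cis_mult algebra_simps add_divide_distrib)

lemma e_0 [simp]: "e 0 z = 1" by (simp add: e_def)

lemma cnj_e: "cnj (e a z) = e (- a) z" by (simp add: e_def cis_cnj algebra_simps)

lemma continuous_e [continuous_intros]: "continuous_on S (e a)" unfolding e_def cis_conv_exp by (intro continuous_intros) (use L1 L2 in auto)

lemma measurable_e [measurable]: "e a \<in> borel_measurable borel" by (intro borel_measurable_continuous_onI continuous_e)

lemma integrable_e: "integrable M (e a)" by (rule integrable_M_bounded[of _ 1]) (auto intro: measurable_M)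

lemma cis_chain:
 assumes "(f has_real_derivative d) (at x within S)"
 shows "((%x. cis (f x)) has_vector_derivative (\<i> * of_real d) * cis (f x)) (at x within S)"
proof -
 have "((%x. cis (f x)) has_derivative (%t. (d * t) *\<^sub>R (\<i> * cis (f x)))) (at x within S)"
  using assms by (intro has_derivative_cis) (simp add: has_field_derivative_def)
 thus ?thesis by (simp add: has_vector_derivative_def scaleR_conv_of_real mult_ac)
qed

lemma e_dx: "((%x. e (k, l) (x, y)) has_vector_derivative
  (\<i> * of_real (2 * pi * k / L1)) * e (k, l) (x, y)) (at x within S)"
proof -
 have "((%x. 2 * pi * (of_int k * x / L1 + of_int l * y / L2)) has_real_derivative 2 * pi * k / L1)
   (at x within S)" by (rule derivative_eq_intros refl | use L1 in simp)+
 from cis_chain[OF this] show ?thesis by (simp add: e_def)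
qed

lemma e_dy: "((%y. e (k, l) (x, y)) has_vector_derivative
  (\<i> * of_real (2 * pi * l / L2)) * e (k, l) (x, y)) (at y within S)"
proof -
 have "((%y. 2 * pi * (of_int k * x / L1 + of_int l * y / L2)) has_real_derivative 2 * pi * l / L2)
   (at y within S)" by (rule derivative_eq_intros refl | use L2 in simp)+
 from cis_chain[OF this] show ?thesis by (simp add: e_def)
qed

lemma e_periodic_x: "e a (x + L1, y) = e a (x, y)"
proof -
 have "e a (x + L1, y) = e a (x, y) * cis (2 * pi * of_int (fst a))" using L1 by (simp add: e_def cis_mult algebra_simps add_divide_distrib)
 thus ?thesis by simp
qed

lemma e_periodic_y: "e a (x, y + L2) = e a (x, y)"
proof -
 have "e a (x, y + L2) = e a (x, y) * cis (2 * pi * of_int (snd a))" using L2 by (simp add: e_def cis_mult algebra_simps add_divide_distrib)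
 thus ?thesis by simp
qed

text \<open>A nontrivial character has a nonzero frequency in one of the variables, and dividing by
  it gives a periodic primitive in that variable.\<close>

lemma integral_e: "(LINT z|M. e a z) = (if a = 0 then of_real (L1 * L2) else 0)"
proof (cases "a = 0")
 case True
 thus ?thesis using measure_M by (simp add: scaleR_conv_of_real)
next
 case False
 obtain k l where a: "a = (k, l)" by fastforce
 show ?thesis
 proof (cases "k = 0")
  case True
  with False a have l: "l \<noteq> 0" by (auto simp: zero_prod_def)
  let ?c = "\<i> * of_real (2 * pi * l / L2) :: complex"
  have c0: "?c \<noteq> 0" using l L2 by simp
  have "(LINT z|M. e a z) = 0"
  proof (rule integral_dy_0[where F = "%z. e a z / ?c"])
   fix x y show "((%y. e a (x, y) / ?c) has_vector_derivative e a (x, y)) (at y)"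
    using has_vector_derivative_mult_right[OF e_dy[of k l x y UNIV], of "inverse ?c"] c0 by (simp add: a field_simps)
  qed (auto simp: e_periodic_y integrable_e intro: continuous_e)
  thus ?thesis using False by simp
 next
  case k: False
  let ?c = "\<i> * of_real (2 * pi * k / L1) :: complex"
  have c0: "?c \<noteq> 0" using k L1 by simp
  have "(LINT z|M. e a z) = 0"
  proof (rule integral_dx_0[where F = "%z. e a z / ?c"])
   fix x y show "((%x. e a (x, y) / ?c) has_vector_derivative e a (x, y)) (at x)"
    using has_vector_derivative_mult_right[OF e_dx[of k l y x UNIV], of "inverse ?c"] c0 by (simp add: a field_simps)
  qed (auto simp: e_periodic_x integrable_e intro: continuous_e)
  thus ?thesis using False by simp
 qed
qed

end

section \<open>Completeness of the characters\<close>

text \<open>Arcs of the circle are superlevel sets of shifted cosines, which makes their indicators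
  accessible from characters. The distance \<open>d\<close> may exceed half a period; there the
  reflection of the cosine about \<open>pi\<close> takes over.\<close>

lemma cos_arc:
 fixes L w d :: real
 assumes "0 < L" "0 < w" "w \<le> L / 2" "0 \<le> d" "d \<le> L - w"
 shows "cos (2 * pi / L * d) > cos (2 * pi / L * w) \<longleftrightarrow> d < w"
proof -
 have w: "2 * pi / L * w \<le> pi" "0 \<le> 2 * pi / L * w" using assms by (auto simp: field_simps)
 show ?thesis
 proof (cases "d < w")
  case True
  hence "2 * pi / L * d < 2 * pi / L * w" using assms(1) by (intro mult_strict_left_mono) auto
  thus ?thesis using cos_monotone_0_pi[of "2 * pi / L * d" "2 * pi / L * w"] w assms True by auto
 next
  case False
  hence le: "2 * pi / L * w \<le> 2 * pi / L * d" using assms(1) by (intro mult_left_mono) auto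
  have "cos (2 * pi / L * d) \<le> cos (2 * pi / L * w)"
  proof (cases "2 * pi / L * d \<le> pi")
   case True
   thus ?thesis using le w by (intro cos_monotone_0_pi_le) auto
  next
   case False
   have eq: "cos (2 * pi / L * d) = cos (2 * pi - 2 * pi / L * d)" by (simp add: cos_diff)
   have "2 * pi / L * d \<le> 2 * pi / L * (L - w)" using assms by (intro mult_left_mono) auto
   hence "2 * pi / L * w \<le> 2 * pi - 2 * pi / L * d" using assms(1) by (simp add: field_simps)
   thus ?thesis unfolding eq using w False by (intro cos_monotone_0_pi_le) auto
  qed
  with False show ?thesis by auto
 qed
qed

lemma interval_arc:
 fixes L x x1 x2 :: real
 assumes "0 \<le> x1" "x1 < x2" "x2 \<le> L" "0 \<le> x" "x < L"
 shows "cos (2 * pi / L * (x - (x1 + x2) / 2)) > cos (2 * pi / L * ((x2 - x1) / 2)) \<longleftrightarrow> x1 < x \<and> x < x2"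
proof -
 have "cos (2 * pi / L * (x - (x1 + x2) / 2)) = cos (2 * pi / L * \<bar>x - (x1 + x2) / 2\<bar>)"
  using assms cos_abs_real[of "2 * pi / L * (x - (x1 + x2) / 2)"] by (simp add: abs_mult)
 moreover have "\<bar>x - (x1 + x2) / 2\<bar> \<le> L - (x2 - x1) / 2" using assms by (simp add: abs_le_iff field_simps)
 moreover have "\<bar>x - (x1 + x2) / 2\<bar> < (x2 - x1) / 2 \<longleftrightarrow> x1 < x \<and> x < x2" by (auto simp: abs_less_iff field_simps)
 ultimately show ?thesis using cos_arc[of L "(x2 - x1) / 2" "\<bar>x - (x1 + x2) / 2\<bar>"] assms by simp
qed

context torus2
begin

context
 fixes f :: "real \<times> real => complex"
 assumes int: "integrable M f" and zero: "!!a. (LINT z|M. f z * e a z) = 0"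
begin

text \<open>The multipliers that keep \<open>f\<close> orthogonal to all characters. Boundedness is
  part of the definition so that products with the merely integrable \<open>f\<close> stay
  integrable.\<close>

definition orth :: "(real \<times> real => complex) => bool" where
 "orth h \<longleftrightarrow> h \<in> borel_measurable borel \<and> (\<exists>B. \<forall>z. norm (h z) \<le> B) \<and>
   (\<forall>a. (LINT z|M. f z * h z * e a z) = 0)"

lemma orthD: "orth h ==> (LINT z|M. f z * h z * e a z) = 0" "orth h ==> h \<in> borel_measurable borel"
 unfolding orth_def by blast+

lemma orthI: "h \<in> borel_measurable borel ==> (!!z. norm (h z) \<le> B) ==>
  (!!a. (LINT z|M. f z * h z * e a z) = 0) ==> orth h" unfolding orth_def by blast

text \<open>These functions form an algebra that contains the characters and is closed under bounded
  pointwise limits; the lemmas below enlarge it until it reaches indicators of boxes.\<close>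

definition orth_mult :: "(real \<times> real => complex) => bool" where
 "orth_mult g \<longleftrightarrow> (\<forall>h. orth h --> orth (%z. h z * g z))"

lemma integrable_mult_bdd:
 assumes "h \<in> borel_measurable borel" "!!z. norm (h z :: complex) \<le> B"
 shows "integrable M (%z. f z * h z)"
proof (rule Bochner_Integration.integrable_bound[where f = "%z. f z * of_real B"])
 show "integrable M (%z. f z * of_real B)" using int by simp
 have [measurable]: "f \<in> borel_measurable M" "h \<in> borel_measurable M" using int assms measurable_M by auto
 show "(%z. f z * h z) \<in> borel_measurable M" by measurable
 have "0 \<le> B" using assms(2)[of undefined] norm_ge_zero order_trans by blast
 thus "AE z in M. norm (f z * h z) \<le> norm (f z * of_real B)" by (intro AE_I2) (auto simp: norm_mult intro!: mult_left_mono assms)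
qed

lemma integrable_mult_bdd_e:
 assumes "h \<in> borel_measurable borel" "!!z. norm (h z :: complex) \<le> B"
 shows "integrable M (%z. f z * h z * e a z)"
proof -
 have "integrable M (%z. f z * (h z * e a z))" using assms by (intro integrable_mult_bdd[where B = B]) (auto simp: norm_mult)
 thus ?thesis by (simp add: mult.assoc)
qed

lemma orth_1: "orth (%z. 1)" by (rule orthI[where B = 1]) (simp_all add: zero)

lemma orth_add: "orth g ==> orth h ==> orth (%z. g z + h z)"
proof -
 assume g: "orth g" and h: "orth h"
 then obtain B C where B: "!!z. norm (g z) \<le> B" and C: "!!z. norm (h z) \<le> C" by (auto simp: orth_def)
 have "norm (g z + h z) \<le> B + C" for z using norm_triangle_ineq[of "g z" "h z"] B[of z] C[of z] by linarith
 moreover have "(LINT z|M. f z * (g z + h z) * e a z) = 0" for a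
 proof -
  have "(LINT z|M. f z * (g z + h z) * e a z) = (LINT z|M. f z * g z * e a z + f z * h z * e a z)" by (simp only: distrib_left distrib_right)
  also have "\<dots> = 0" using g h integrable_mult_bdd_e[of g B a] integrable_mult_bdd_e[of h C a] B C
   by (subst Bochner_Integration.integral_add) (simp_all add: orthD)
  finally show ?thesis .
 qed
 moreover have "(%z. g z + h z) \<in> borel_measurable borel" by (intro borel_measurable_add orthD(2) g h)
 ultimately show ?thesis using orthI by blast
qed

lemma orth_mult_add: "orth_mult g ==> orth_mult h ==> orth_mult (%z. g z + h z)" unfolding orth_mult_def
proof (intro allI impI)
 fix q assume gh: "\<forall>q. orth q --> orth (%z. q z * g z)" "\<forall>q. orth q --> orth (%z. q z * h z)" and q: "orth q"
 have "orth (%z. q z * g z + q z * h z)" by (rule orth_add[OF gh(1)[rule_format, OF q] gh(2)[rule_format, OF q]])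
 thus "orth (%z. q z * (g z + h z))" by (simp only: distrib_left)
qed

lemma orth_mult_mult: "orth_mult g ==> orth_mult h ==> orth_mult (%z. g z * h z)" unfolding orth_mult_def
proof (intro allI impI)
 fix q assume gh: "\<forall>q. orth q --> orth (%z. q z * g z)" "\<forall>q. orth q --> orth (%z. q z * h z)" and q: "orth q"
 have "orth (%z. q z * g z * h z)" by (rule gh(2)[rule_format, OF gh(1)[rule_format, OF q]])
 thus "orth (%z. q z * (g z * h z))" by (simp only: mult.assoc)
qed

lemma orth_mult_const: "orth_mult (%z. c)" unfolding orth_mult_def
proof (intro allI impI)
 fix h assume h: "orth h"
 then obtain B where B: "!!z. norm (h z) \<le> B" by (auto simp: orth_def)
 have "(LINT z|M. f z * (h z * c) * e a z) = 0" for a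
 proof -
  have "(LINT z|M. f z * (h z * c) * e a z) = (LINT z|M. c * (f z * h z * e a z))" by (simp add: algebra_simps)
  also have "\<dots> = 0" using h by (simp add: orthD)
  finally show ?thesis .
 qed
 moreover have "norm (h z * c) \<le> B * norm c" for z by (auto simp: norm_mult intro!: mult_right_mono B)
 moreover have "(%z. h z * c) \<in> borel_measurable borel" by (intro borel_measurable_times orthD(2) h borel_measurable_const)
 ultimately show "orth (%z. h z * c)" using orthI by blast
qed

lemma orth_mult_e: "orth_mult (e b)" unfolding orth_mult_def
proof (intro allI impI)
 fix h assume h: "orth h"
 hence "(LINT z|M. f z * h z * e (b + a) z) = 0" for a by (rule orthD)
 hence "(LINT z|M. f z * (h z * e b z) * e a z) = 0" for a by (simp only: e_add mult.assoc)
 moreover obtain B where "!!z. norm (h z) \<le> B" using h by (auto simp: orth_def)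
 hence "norm (h z * e b z) \<le> B" for z by (simp only: norm_mult norm_e mult_1_right)
 moreover have "(%z. h z * e b z) \<in> borel_measurable borel" by (intro borel_measurable_times orthD(2) h measurable_e)
 ultimately show "orth (%z. h z * e b z)" using orthI by blast
qed

lemma orth_mult_lim:
 assumes g: "!!n. orth_mult (g n)" and lim: "!!z. (%n. g n z) \<longlonglongrightarrow> h z"
  and B: "!!n z. norm (g n z) \<le> B"
 shows "orth_mult h" unfolding orth_mult_def
proof (intro allI impI)
 fix q assume q: "orth q"
 then obtain C where C: "!!z. norm (q z) \<le> C" and qm[measurable]: "q \<in> borel_measurable borel" by (auto simp: orth_def)
 have o: "orth (%z. q z * g n z)" for n using g q by (auto simp: orth_mult_def)
 hence om[measurable]: "(%z. q z * g n z) \<in> borel_measurable borel" for n by (auto simp: orth_def)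
 have lim2: "(%n. q z * g n z) \<longlonglongrightarrow> q z * h z" for z by (intro tendsto_intros lim)
 have hm[measurable]: "(%z. q z * h z) \<in> borel_measurable borel" by (rule borel_measurable_LIMSEQ_metric[OF om lim2])
 have C0: "0 \<le> C" using C[of undefined] norm_ge_zero order_trans by blast
 have bd: "norm (q z * g n z) \<le> C * B" for n z unfolding norm_mult using C B C0 by (intro mult_mono) auto
 have bd2: "norm (q z * h z) \<le> C * B" for z by (rule Lim_bounded[OF tendsto_norm[OF lim2]]) (use bd in auto)
 have fm[measurable]: "f \<in> borel_measurable M" using int by auto
 have "(LINT z|M. f z * (q z * h z) * e a z) = 0" for a
 proof -
  have "(%n. LINT z|M. f z * (q z * g n z) * e a z) \<longlonglongrightarrow> (LINT z|M. f z * (q z * h z) * e a z)"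
  proof (rule integral_dominated_convergence[where w = "%z. norm (f z) * (C * B)"])
   have em[measurable]: "e a \<in> borel_measurable M" by (rule measurable_M[OF measurable_e])
   have [measurable]: "(%z. q z * h z) \<in> borel_measurable M" "(%z. q z * g n z) \<in> borel_measurable M" for n
    using om hm measurable_M by blast+
   show "(%z. f z * (q z * h z) * e a z) \<in> borel_measurable M"
    "(%z. f z * (q z * g n z) * e a z) \<in> borel_measurable M" for n by measurable
   show "integrable M (%z. norm (f z) * (C * B))" using int by simp
   show "AE z in M. (%n. f z * (q z * g n z) * e a z) \<longlonglongrightarrow> f z * (q z * h z) * e a z"
    by (intro AE_I2 tendsto_intros lim)
   show "AE z in M. norm (f z * (q z * g n z) * e a z) \<le> norm (f z) * (C * B)" for n
    unfolding norm_mult[of _ "e a _"] norm_mult[of "f _"] norm_e using bd by (auto intro!: mult_left_mono)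
  qed
  moreover have "(LINT z|M. f z * (q z * g n z) * e a z) = 0" for n by (rule orthD[OF o])
  ultimately show ?thesis by (simp add: LIMSEQ_const_iff)
 qed
 thus "orth (%z. q z * h z)" unfolding orth_def using hm bd2 by blast
qed

text \<open>Polynomials in \<open>C\<close> belong to the algebra, and the Weierstrass theorem gives
  every continuous function of \<open>C\<close> as a bounded limit.\<close>

lemma orth_mult_compose:
 fixes C :: "real \<times> real => real" and F :: "real => real"
 assumes C: "orth_mult (%z. of_real (C z))" "!!z. C z \<in> {-1..1}" and F: "continuous_on {-1..1} F"
 shows "orth_mult (%z. of_real (F (C z)))"
proof -
 have poly: "orth_mult (%z. of_real (p (C z)))" if "real_polynomial_function p" for p using that
 proof induction
  case (linear h)
  then obtain k where "h = (%x. x * k)" using real_bounded_linear[of h] by blast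
  thus ?case using orth_mult_mult[OF C(1) orth_mult_const[of "of_real k"]] by simp
 qed (auto intro: orth_mult_const orth_mult_add orth_mult_mult)
 have "\<exists>p. real_polynomial_function p \<and> (\<forall>x\<in>{-1..1}. \<bar>F x - p x\<bar> < 1 / real (Suc n))" for n
 proof -
  obtain p where "real_polynomial_function p" "!!x. x \<in> {-1..1} ==> \<bar>F x - p x\<bar> < 1 / real (Suc n)"
   using Stone_Weierstrass_real_polynomial_function[of "{-1..1::real}" F "1 / real (Suc n)"] F by auto
  thus ?thesis by blast
 qed
 then obtain p where p: "!!n. real_polynomial_function (p n)"
  "!!n x. x \<in> {-1..1} ==> \<bar>F x - p n x\<bar> < 1 / real (Suc n)" by metis
 have "compact (F ` {-1..1})" using F by (intro compact_continuous_image) auto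
 then obtain B where B: "!!x. x \<in> {-1..1} ==> \<bar>F x\<bar> \<le> B"
  using compact_imp_bounded[THEN bounded_iff[THEN iffD1]] by (metis imageI real_norm_def)
 show ?thesis
 proof (rule orth_mult_lim[where g = "%n z. of_real (p n (C z))" and B = "B + 1"])
  show "orth_mult (%z. of_real (p n (C z)))" for n by (intro poly p)
  show "(%n. complex_of_real (p n (C z))) \<longlonglongrightarrow> of_real (F (C z))" for z
  proof (intro tendsto_of_real LIM_zero_cancel[where l = "F (C z)"])
   show "(%n. p n (C z) - F (C z)) \<longlonglongrightarrow> 0" using p(2)[OF C(2)[of z]]
    by (intro tendsto_rabs_zero_cancel[OF tendsto_sandwich[OF _ _ tendsto_const LIMSEQ_inverse_real_of_nat]])
      (auto simp: abs_minus_commute inverse_eq_divide less_imp_le)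
  qed
  show "norm (complex_of_real (p n (C z))) \<le> B + 1" for n z using p(2)[OF C(2)[of z], of n] B[OF C(2)[of z]]
   by (simp add: norm_of_real) (smt (verit) divide_le_eq_1_pos of_nat_0_less_iff of_nat_Suc of_nat_0_le_iff)
 qed
qed

text \<open>The indicator is the limit of ramps of slope \<open>n\<close> that start at level
  \<open>r\<close> and are cut off at 1.\<close>

lemma orth_mult_level:
 fixes C :: "real \<times> real => real"
 assumes C: "orth_mult (%z. of_real (C z))" "!!z. C z \<in> {-1..1}"
 shows "orth_mult (%z. of_real (if C z > r then 1 else 0))"
proof (rule orth_mult_lim[where g = "%n z. of_real (min 1 (max 0 (real n * (C z - r))))" and B = 1])
 show "orth_mult (%z. of_real (min 1 (max 0 (real n * (C z - r)))))" for n by (rule orth_mult_compose[OF C]) (auto intro!: continuous_intros)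
 show "(%n. complex_of_real (min 1 (max 0 (real n * (C z - r))))) \<longlonglongrightarrow> of_real (if C z > r then 1 else 0)" for z
 proof (intro tendsto_of_real tendsto_eventually)
  show "\<forall>\<^sub>F n in sequentially. min 1 (max 0 (real n * (C z - r))) = (if C z > r then 1 else 0)"
  proof (cases "C z > r")
   case True
   obtain N where N: "real N \<ge> 1 / (C z - r)" using real_arch_simple by blast
   show ?thesis
   proof (rule eventually_sequentiallyI[of N])
    fix n assume "N \<le> n"
    hence "1 / (C z - r) \<le> real n" using N by linarith
    hence "1 \<le> real n * (C z - r)" using True by (simp add: field_simps)
    thus "min 1 (max 0 (real n * (C z - r))) = (if C z > r then 1 else 0)" using True by simp
   qed
  next
   case False
   hence "real n * (C z - r) \<le> 0" for n by (simp add: mult_nonneg_nonpos)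
   hence "min 1 (max 0 (real n * (C z - r))) = 0" for n by (simp add: max_absorb1)
   thus ?thesis using False by simp
  qed
 qed
qed auto

lemma orth_mult_cos:
 "orth_mult (%z. of_real (cos (2 * pi / L1 * (fst z - m))))"
 "orth_mult (%z. of_real (cos (2 * pi / L2 * (snd z - m))))"
proof -
 have cc: "of_real (cos t) = (cis t + cis (- t)) * (1 / 2)" for t by (simp add: complex_eq_iff)
 have 1: "e (1, 0) z * cis (- (2 * pi / L1 * m)) = cis (2 * pi / L1 * (fst z - m))"
  "e (-1, 0) z * cis (2 * pi / L1 * m) = cis (- (2 * pi / L1 * (fst z - m)))" for z
  using L1 by (simp_all add: e_def cis_mult) (simp_all add: algebra_simps diff_divide_distrib)
 have 2: "e (0, 1) z * cis (- (2 * pi / L2 * m)) = cis (2 * pi / L2 * (snd z - m))"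
  "e (0, -1) z * cis (2 * pi / L2 * m) = cis (- (2 * pi / L2 * (snd z - m)))" for z
  using L2 by (simp_all add: e_def cis_mult) (simp_all add: algebra_simps diff_divide_distrib)
 show "orth_mult (%z. of_real (cos (2 * pi / L1 * (fst z - m))))"
  unfolding cc 1[symmetric] by (intro orth_mult_mult orth_mult_add orth_mult_e orth_mult_const)
 show "orth_mult (%z. of_real (cos (2 * pi / L2 * (snd z - m))))"
  unfolding cc 2[symmetric] by (intro orth_mult_mult orth_mult_add orth_mult_e orth_mult_const)
qed

text \<open>The arcs are open intervals, but a box reaching over the left or lower edge of the
  domain contains that edge; the edges are discarded as a null set.\<close>

lemma AE_M_nonzero: "AE z in M. fst z \<noteq> 0 \<and> snd z \<noteq> 0"
proof -
 have "negligible {z :: real \<times> real. z \<bullet> (1, 0) = 0}" "negligible {z :: real \<times> real. z \<bullet> (0, 1) = 0}"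
  by (intro negligible_standard_hyperplane; simp add: Basis_prod_def)+
 hence "{z :: real \<times> real. fst z = 0} \<in> null_sets lebesgue" "{z :: real \<times> real. snd z = 0} \<in> null_sets lebesgue"
  by (auto simp: inner_prod_def negligible_iff_null_sets)
 from AE_not_in[OF this(1)] AE_not_in[OF this(2)]
 have "AE z :: real \<times> real in lebesgue. fst z \<noteq> 0 \<and> snd z \<noteq> 0" by eventually_elim auto
 thus ?thesis unfolding torus_def using dom_lebesgue by (subst AE_restrict_space_iff) (auto elim: eventually_mono)
qed

lemma integral_box_0: "(LINT z|M. indicator (box a b) z *\<^sub>R f z) = 0"
proof -
 have fm[measurable]: "f \<in> borel_measurable M" using int by auto
 define x1 x2 y1 y2 where d: "x1 = max 0 (fst a)" "x2 = min L1 (fst b)" "y1 = max 0 (snd a)" "y2 = min L2 (snd b)"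
 have box: "z \<in> box a b \<longleftrightarrow> (x1 < fst z \<and> fst z < x2) \<and> y1 < snd z \<and> snd z < y2"
  if "z \<in> space M" "fst z \<noteq> 0" "snd z \<noteq> 0" for z
  using that by (cases z, cases a, cases b) (auto simp: space_M d mem_box Basis_prod_def)
 show ?thesis
 proof (cases "x1 < x2 \<and> y1 < y2")
  case False
  have "AE z in M. indicator (box a b) z *\<^sub>R f z = 0"
   using AE_M_nonzero AE_space by eventually_elim (use box False in \<open>auto simp: indicator_def\<close>)
  thus ?thesis by (rule integral_eq_zero_AE)
 next
  case True
  let ?C = "%z :: real \<times> real. cos (2 * pi / L1 * (fst z - (x1 + x2) / 2))"
  let ?D = "%z :: real \<times> real. cos (2 * pi / L2 * (snd z - (y1 + y2) / 2))"
  let ?r = "cos (2 * pi / L1 * ((x2 - x1) / 2))" and ?s = "cos (2 * pi / L2 * ((y2 - y1) / 2))"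
  let ?h = "%z. complex_of_real (if ?C z > ?r then 1 else 0) * of_real (if ?D z > ?s then 1 else 0)"
  have "orth_mult ?h" by (intro orth_mult_mult orth_mult_level orth_mult_cos) auto
  hence "orth (%z. 1 * ?h z)" using orth_1 unfolding orth_mult_def by blast
  hence "orth ?h" by simp
  hence h: "?h \<in> borel_measurable borel" "(LINT z|M. f z * ?h z * e 0 z) = 0" unfolding orth_def by blast+
  have "AE z in M. indicator (box a b) z *\<^sub>R f z = f z * ?h z * e 0 z" using AE_M_nonzero AE_space
  proof eventually_elim
   case (elim z)
   hence "?C z > ?r \<longleftrightarrow> x1 < fst z \<and> fst z < x2" using True by (intro interval_arc) (auto simp: d space_M)
   moreover have "?D z > ?s \<longleftrightarrow> y1 < snd z \<and> snd z < y2" using True elim by (intro interval_arc) (auto simp: d space_M)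
   ultimately show ?case using box[of z] elim by (simp add: indicator_def)
  qed
  moreover have "(%z. f z * ?h z * e 0 z) \<in> borel_measurable M"
   by (intro borel_measurable_times fm measurable_M[OF h(1)] measurable_M[OF measurable_e])
  moreover have "(%z. indicator (box a b) z *\<^sub>R f z) \<in> borel_measurable M"
   by (intro borel_measurable_scaleR fm measurable_M borel_measurable_indicator) simp
  ultimately have "(LINT z|M. indicator (box a b) z *\<^sub>R f z) = (LINT z|M. f z * ?h z * e 0 z)" by (intro integral_cong_AE)
  thus ?thesis using h(2) by (rule trans)
 qed
qed

text \<open>Dynkin's theorem: open boxes are stable under intersection and generate the Borel sets;
  disjoint unions pass to the limit with the norm of \<open>f\<close> as majorant.\<close>

lemma integral_borel_0:
 assumes "A \<in> sets (borel :: (real \<times> real) measure)"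
 shows "(LINT z|M. indicator A z *\<^sub>R f z) = 0"
proof -
 have fm: "f \<in> borel_measurable M" using int by auto
 have indm: "(indicator A :: _ => real) \<in> borel_measurable M" if "A \<in> sets borel" for A
  using that by (intro measurable_M borel_measurable_indicator)
 have indint: "integrable M (%z. indicator A z *\<^sub>R f z)" if "A \<in> sets borel" for A
 proof (rule Bochner_Integration.integrable_bound[OF int])
  show "(%z. indicator A z *\<^sub>R f z) \<in> borel_measurable M" by (rule borel_measurable_scaleR[OF indm[OF that] fm])
  show "AE z in M. norm (indicator A z *\<^sub>R f z) \<le> norm (f z)" by (intro AE_I2) (simp add: indicator_def)
 qed
 have tot: "(LINT z|M. f z) = 0" using zero[of 0] by simp
 define G :: "(real \<times> real) set set" where "G = range (%(a, b). box a b)"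
 have sb: "sets borel = sigma_sets UNIV G" unfolding G_def by (subst borel_eq_box) simp
 have "Int_stable G"
  unfolding G_def Int_stable_def by (auto simp: Int_interval) (metis (no_types, lifting) Int_interval case_prod_conv rangeI box_Int_box)
 moreover have "G \<subseteq> Pow UNIV" by simp
 moreover have "A \<in> sigma_sets UNIV G" using assms sb by simp
 ultimately show ?thesis
 proof (induction rule: sigma_sets_induct_disjoint)
  case (basic A) thus ?case using integral_box_0 by (auto simp: G_def)
 next
  case empty thus ?case by simp
 next
  case (compl A)
  hence A: "A \<in> sets borel" using sb by simp
  have "(LINT z|M. indicator (UNIV - A) z *\<^sub>R f z) = (LINT z|M. f z - indicator A z *\<^sub>R f z)"
   by (intro Bochner_Integration.integral_cong) (auto simp: indicator_def)
  also have "\<dots> = 0" using int indint[OF A] compl tot by simp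
  finally show ?case .
 next
  case (union A)
  hence A: "A i \<in> sets borel" for i using sb by auto
  hence "(\<Union>i. A i) \<in> sets borel" by auto
  have "((%n. LINT z|M. indicator (\<Union>i<n. A i) z *\<^sub>R f z)) \<longlonglongrightarrow> (LINT z|M. indicator (\<Union>i. A i) z *\<^sub>R f z)"
  proof (rule integral_dominated_convergence[where w = "%z. norm (f z)"])
   show "AE z in M. (%n. indicator (\<Union>i<n. A i) z *\<^sub>R f z) \<longlonglongrightarrow> indicator (\<Union>i. A i) z *\<^sub>R f z"
    using LIMSEQ_indicator_UN[of A] by (intro AE_I2 tendsto_scaleR) auto
   show "(%z. indicator (\<Union>i. A i) z *\<^sub>R f z) \<in> borel_measurable M"
    using A by (intro borel_measurable_integrable indint) auto
   show "(%z. indicator (\<Union>i<n. A i) z *\<^sub>R f z) \<in> borel_measurable M" for n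
    using A by (intro borel_measurable_integrable indint) auto
   show "integrable M (%z. norm (f z))" using int by simp
   show "AE z in M. norm (indicator (\<Union>i<n. A i) z *\<^sub>R f z) \<le> norm (f z)" for n by (intro AE_I2) (simp add: indicator_def)
  qed
  moreover have "(LINT z|M. indicator (\<Union>i<n. A i) z *\<^sub>R f z) = 0" for n
  proof (induction n)
   case (Suc n)
   have dj: "(\<Union>i<n. A i) \<inter> A n = {}"
   proof -
    have "A i \<inter> A n = {}" if "i < n" for i using union(1) that by (simp add: disjoint_family_on_def)
    thus ?thesis by blast
   qed
   have un: "(\<Union>i<Suc n. A i) = (\<Union>i<n. A i) \<union> A n" by (simp add: lessThan_Suc Un_commute)
   have "(LINT z|M. indicator (\<Union>i<Suc n. A i) z *\<^sub>R f z)
     = (LINT z|M. indicator (\<Union>i<n. A i) z *\<^sub>R f z + indicator (A n) z *\<^sub>R f z)"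
    unfolding un indicator_add[OF dj, symmetric] scaleR_add_left ..
   also have "\<dots> = 0" using indint[of "\<Union>i<n. A i"] indint[of "A n"] A Suc union by (subst Bochner_Integration.integral_add) auto
   finally show ?case .
  qed simp
  ultimately show ?case by (simp add: LIMSEQ_const_iff)
 qed
qed

lemma AE_zero_if_coeffs_zero: "AE z in M. f z = 0"
proof (rule density_zero[OF int])
 fix A assume A: "A \<in> sets M"
 have "A \<in> sets lebesgue" using A dom_lebesgue unfolding torus_def by (auto simp: sets_restrict_space)
 then obtain S N N' where S: "A = S \<union> N" "N \<subseteq> N'" "N' \<in> null_sets lborel" "S \<in> sets lborel" by (rule sets_completionE)
 have "AE z :: real \<times> real in lebesgue. z \<notin> N'" using S(3) by (intro AE_completion AE_not_in)
 hence ae: "AE z in M. z \<notin> N'" unfolding torus_def using dom_lebesgue by (subst AE_restrict_space_iff) (auto elim: eventually_mono)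
 have fm[measurable]: "f \<in> borel_measurable M" using int by auto
 have [measurable]: "S \<in> sets borel" using S by simp
 have "AE z in M. indicator A z *\<^sub>R f z = indicator S z *\<^sub>R f z"
  using ae by eventually_elim (use S in \<open>auto simp: indicator_def\<close>)
 moreover have "(%z. indicator S z *\<^sub>R f z) \<in> borel_measurable M"
  by (intro borel_measurable_scaleR fm measurable_M borel_measurable_indicator) simp
 moreover have "(%z. indicator A z *\<^sub>R f z) \<in> borel_measurable M" using A by measurable
 ultimately have "(LINT z|M. indicator A z *\<^sub>R f z) = (LINT z|M. indicator S z *\<^sub>R f z)" by (intro integral_cong_AE)
 thus "set_lebesgue_integral M A f = 0" using integral_borel_0[of S] S by (simp add: set_lebesgue_integral_def)
qed

end

end

section \<open>Square integrability and Cauchy-Schwarz\<close>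

definition sq_int :: "'a measure => ('a => 'b::{real_normed_field, banach, second_countable_topology}) => bool" where
 "sq_int N f \<longleftrightarrow> f \<in> borel_measurable N \<and> integrable N (%z. (norm (f z))^2)"

lemma sq_intD: "sq_int N f ==> f \<in> borel_measurable N" "sq_int N f ==> integrable N (%z. (norm (f z))^2)"
 by (simp_all add: sq_int_def)

lemma sq_int_mult_integrable:
 assumes "sq_int N f" "sq_int N g"
 shows "integrable N (%z. f z * g z)"
proof (rule Bochner_Integration.integrable_bound)
 show "integrable N (%z. (norm (f z))^2 + (norm (g z))^2)" by (intro Bochner_Integration.integrable_add sq_intD assms)
 show "(%z. f z * g z) \<in> borel_measurable N" by (intro borel_measurable_times sq_intD assms)
 have "norm (f z) * norm (g z) \<le> (norm (f z))^2 + (norm (g z))^2" for z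
  using sum_squares_bound[of "norm (f z)" "norm (g z)"] mult_nonneg_nonneg[OF norm_ge_zero[of "f z"] norm_ge_zero[of "g z"]] by linarith
 thus "AE z in N. norm (f z * g z) \<le> norm ((norm (f z))^2 + (norm (g z))^2)" by (intro AE_I2) (simp add: norm_mult)
qed

lemma integral_Cauchy_Schwarz:
 assumes f: "sq_int N f" and g: "sq_int N g"
 shows "(LINT z|N. norm (f z * g z)) \<le> sqrt (LINT z|N. (norm (f z))^2) * sqrt (LINT z|N. (norm (g z))^2)"
proof -
 define A B C where d: "A = (LINT z|N. (norm (f z))^2)" "B = (LINT z|N. (norm (g z))^2)"
  "C = (LINT z|N. norm (f z * g z))"
 have i: "integrable N (%z. norm (f z * g z))" by (intro integrable_norm sq_int_mult_integrable f g)
 have A0: "0 \<le> A" and B0: "0 \<le> B" and C0: "0 \<le> C" unfolding d by (simp_all add: Bochner_Integration.integral_nonneg)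
 have q: "0 \<le> t^2 * A - 2 * t * C + B" for t
 proof -
  have "0 \<le> (LINT z|N. (t * norm (f z) - norm (g z))^2)" by (simp add: Bochner_Integration.integral_nonneg)
  also have "\<dots> = (LINT z|N. t^2 * (norm (f z))^2 - 2 * t * norm (f z * g z) + (norm (g z))^2)"
   by (rule arg_cong[where f = "integral\<^sup>L N"], rule ext) (simp add: norm_mult power2_eq_square algebra_simps)
  also have "\<dots> = t^2 * A - 2 * t * C + B" using sq_intD(2)[OF f] sq_intD(2)[OF g] i unfolding d by simp
  finally show ?thesis .
 qed
 have "C^2 \<le> A * B"
 proof (cases "A = 0")
  case True
  \<comment> \<open>With \<open>A = 0\<close> the form in \<open>q\<close> is affine in
    \<open>t\<close>; at \<open>t = (B + 1) / (2 * C)\<close> its value would be -1.\<close>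
  have "C = 0"
  proof (rule ccontr)
   assume "C \<noteq> 0"
   thus False using q[of "(B + 1) / (2 * C)"] True C0 by (simp add: field_simps)
  qed
  thus ?thesis using True by simp
 next
  case False
  hence "0 < A" using A0 by simp
  thus ?thesis using q[of "C / A"] by (simp add: field_simps power2_eq_square)
 qed
 hence "C \<le> sqrt (A * B)" by (rule real_le_rsqrt)
 thus ?thesis by (simp add: d real_sqrt_mult)
qed

lemma sq_int_add:
 assumes f: "sq_int N f" and g: "sq_int N g"
 shows "sq_int N (%z. f z + g z)" unfolding sq_int_def
proof
 show m: "(%z. f z + g z) \<in> borel_measurable N" by (intro borel_measurable_add sq_intD f g)
 show "integrable N (%z. (norm (f z + g z))^2)"
 proof (rule Bochner_Integration.integrable_bound)
  show "integrable N (%z. 2 * (norm (f z))^2 + 2 * (norm (g z))^2)"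
   by (intro Bochner_Integration.integrable_add integrable_mult_right sq_intD f g)
  show "(%z. (norm (f z + g z))^2) \<in> borel_measurable N" using m by measurable
  have "(norm (f z + g z))^2 \<le> 2 * (norm (f z))^2 + 2 * (norm (g z))^2" for z
  proof -
   have "(norm (f z + g z))^2 \<le> (norm (f z) + norm (g z))^2" by (intro power_mono norm_triangle_ineq norm_ge_zero)
   also have "\<dots> \<le> 2 * (norm (f z))^2 + 2 * (norm (g z))^2"
    using sum_squares_bound[of "norm (f z)" "norm (g z)"] by (simp add: power2_sum)
   finally show ?thesis .
  qed
  thus "AE z in N. norm ((norm (f z + g z))^2) \<le> norm (2 * (norm (f z))^2 + 2 * (norm (g z))^2)" by (intro AE_I2) simp
 qed
qed

lemma sq_int_cmult: "sq_int N f ==> sq_int N (%z. c * f z)" unfolding sq_int_def norm_mult power_mult_distrib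
 by (intro conjI borel_measurable_times borel_measurable_const integrable_mult_right) simp_all

lemma sq_int_diff: "sq_int N f ==> sq_int N g ==> sq_int N (%z. f z - g z)"
 using sq_int_add[of N f "%z. (-1) * g z"] sq_int_cmult[of N g "-1"] by simp

lemma sq_int_mult_bdd:
 assumes f: "sq_int N f" and g: "g \<in> borel_measurable N" and B: "!!z. norm (g z) \<le> B"
 shows "sq_int N (%z. f z * g z)" unfolding sq_int_def
proof
 show m: "(%z. f z * g z) \<in> borel_measurable N" by (intro borel_measurable_times sq_intD f g)
 show "integrable N (%z. (norm (f z * g z))^2)"
 proof (rule Bochner_Integration.integrable_bound)
  show "integrable N (%z. B^2 * (norm (f z))^2)" by (intro integrable_mult_right sq_intD f)
  show "(%z. (norm (f z * g z))^2) \<in> borel_measurable N" using m by measurable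
  have "(norm (f z * g z))^2 \<le> B^2 * (norm (f z))^2" for z
   unfolding norm_mult power_mult_distrib using power_mono[OF B[of z], of 2] by (subst mult.commute) (simp add: mult_right_mono)
  thus "AE z in N. norm ((norm (f z * g z))^2) \<le> norm (B^2 * (norm (f z))^2)" by (intro AE_I2) simp
 qed
qed

lemma sq_int_cnj: "sq_int N f ==> sq_int N (%z. cnj (f z))" unfolding sq_int_def complex_mod_cnj
 by (intro conjI measurable_compose[of f N borel cnj] borel_measurable_continuous_onI continuous_intros) simp_all

section \<open>Sums over the frequency lattice\<close>

abbreviation CS :: "(int \<times> int) measure" where "CS \<equiv> count_space UNIV"

text \<open>Squares rather than discs: sums over them factor into one-dimensional sums, and the same
  sets truncate the Galerkin systems.\<close>

definition sbox :: "nat => (int \<times> int) set" where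
 "sbox n = {- int n..int n} \<times> {- int n..int n}"

lemma finite_sbox [simp]: "finite (sbox n)" by (simp add: sbox_def)

lemma sbox_mono: "m \<le> n ==> sbox m \<subseteq> sbox n" by (auto simp: sbox_def)

lemma sbox_exhaust: "\<exists>n. a \<in> sbox n"
 by (rule exI[of _ "nat \<bar>fst a\<bar> + nat \<bar>snd a\<bar>"]) (auto simp: sbox_def mem_Times_iff)

lemma finite_subset_sbox: "finite F ==> \<exists>n. F \<subseteq> sbox n"
proof (induction rule: finite_induct)
 case (insert a F)
 then obtain m n where "F \<subseteq> sbox m" "a \<in> sbox n" using sbox_exhaust by blast
 hence "insert a F \<subseteq> sbox (max m n)" using sbox_mono[of m "max m n"] sbox_mono[of n "max m n"] by fastforce
 thus ?case ..
qed simp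

lemma eventually_in_sbox: "eventually (%n. a \<in> sbox n) sequentially"
proof -
 obtain m where "a \<in> sbox m" using sbox_exhaust by blast
 thus ?thesis using sbox_mono by (intro eventually_sequentiallyI[of m]) blast
qed

lemma sum_CS_indicator:
 fixes f :: "'a => 'b::{banach, second_countable_topology}"
 assumes "finite F"
 shows "(LINT a|count_space UNIV. indicator F a *\<^sub>R f a) = sum f F"
  "integrable (count_space UNIV) (%a. indicator F a *\<^sub>R f a)"
proof -
 have "has_bochner_integral (count_space UNIV) (%a. indicator {b} a *\<^sub>R f b) (f b)" for b
  using has_bochner_integral_indicator[of "{b}" "count_space UNIV" "f b"] by simp
 hence "has_bochner_integral (count_space UNIV) (%a. \<Sum>b\<in>F. indicator {b} a *\<^sub>R f b) (sum f F)"
  by (intro has_bochner_integral_sum)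
 also have "(%a. \<Sum>b\<in>F. indicator {b} a *\<^sub>R f b) = (%a. indicator F a *\<^sub>R f a)"
 proof
  fix a
  have "(\<Sum>b\<in>F. indicator {b} a *\<^sub>R f b) = (\<Sum>b\<in>F. if b = a then f a else 0)" by (intro sum.cong refl) simp
  thus "(\<Sum>b\<in>F. indicator {b} a *\<^sub>R f b) = indicator F a *\<^sub>R f a" using assms by simp
 qed
 finally have h: "has_bochner_integral (count_space UNIV) (%a. indicator F a *\<^sub>R f a) (sum f F)" .
 thus "(LINT a|count_space UNIV. indicator F a *\<^sub>R f a) = sum f F" by (rule has_bochner_integral_integral_eq)
 from h show "integrable (count_space UNIV) (%a. indicator F a *\<^sub>R f a)" by (rule integrable.intros)
qed

lemma tendsto_sbox_sum:
 fixes f :: "int \<times> int => 'b::{banach, second_countable_topology}"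
 assumes "integrable CS f"
 shows "(%n. sum f (sbox n)) \<longlonglongrightarrow> (LINT a|CS. f a)"
proof -
 have "(%n. LINT a|CS. indicator (sbox n) a *\<^sub>R f a) \<longlonglongrightarrow> (LINT a|CS. f a)"
 proof (rule integral_dominated_convergence[where w = "%a. norm (f a)"])
  show "AE a in CS. (%n. indicator (sbox n) a *\<^sub>R f a) \<longlonglongrightarrow> f a"
  proof (intro AE_I2 tendsto_eventually)
   fix a show "eventually (%n. indicator (sbox n) a *\<^sub>R f a = f a) sequentially"
    using eventually_in_sbox[of a] by eventually_elim simp
  qed
  show "integrable CS (%a. norm (f a))" using assms by simp
  show "AE a in CS. norm (indicator (sbox n) a *\<^sub>R f a) \<le> norm (f a)" for n by (intro AE_I2) (simp add: indicator_def)
 qed simp_all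
 thus ?thesis by (simp add: sum_CS_indicator)
qed

lemma sum_le_CS:
 fixes f :: "'a => real"
 assumes "integrable (count_space UNIV) f" "!!a. 0 \<le> f a" "finite F"
 shows "sum f F \<le> (LINT a|count_space UNIV. f a)"
proof -
 have "(LINT a|count_space UNIV. indicator F a *\<^sub>R f a) \<le> (LINT a|count_space UNIV. f a)"
  using assms sum_CS_indicator(2)[OF assms(3), of f] by (intro integral_mono) (simp_all add: indicator_def)
 thus ?thesis by (simp only: sum_CS_indicator[OF assms(3)])
qed

lemma integrable_CS_sbox:
 fixes f :: "int \<times> int => real"
 assumes "!!a. 0 \<le> f a" "!!n. sum f (sbox n) \<le> C"
 shows "integrable CS f" "(LINT a|CS. f a) \<le> C"
proof -
 let ?i = "%n a. indicator (sbox n) a *\<^sub>R f a"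
 have mono: "incseq (%n. sum f (sbox n))" using sbox_mono assms(1) by (intro incseq_SucI sum_mono2) auto
 obtain L where L: "(%n. sum f (sbox n)) \<longlonglongrightarrow> L" using incseq_convergent[OF mono, of C] assms(2) by blast
 show i: "integrable CS f"
 proof (rule integrable_monotone_convergence[where f = ?i and x = L])
  show "integrable CS (?i n)" for n by (rule sum_CS_indicator) simp
  show "AE a in CS. mono (%n. ?i n a)"
  proof (intro AE_I2 monoI)
   fix a and m n :: nat assume "m \<le> n"
   thus "?i m a \<le> ?i n a" using sbox_mono[of m n] assms(1) by (auto simp: indicator_def)
  qed
  show "AE a in CS. (%n. ?i n a) \<longlonglongrightarrow> f a"
  proof (intro AE_I2 tendsto_eventually)
   fix a show "eventually (%n. ?i n a = f a) sequentially" using eventually_in_sbox[of a] by eventually_elim simp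
  qed
  show "(%n. LINT a|CS. ?i n a) \<longlonglongrightarrow> L" using L by (simp only: sum_CS_indicator finite_sbox)
 qed simp
 show "(LINT a|CS. f a) \<le> C" by (rule Lim_bounded[OF tendsto_sbox_sum[OF i]]) (use assms(2) in blast)
qed

definition ell2 :: "coeffs => bool" where
 "ell2 d \<longleftrightarrow> integrable CS (%a. (norm (d a))^2)"

section \<open>Fourier series in L2\<close>

context torus2
begin

abbreviation "LL \<equiv> L1 * L2"

lemma LL_pos: "0 < LL" using L1 L2 by simp

definition psum :: "coeffs => (int \<times> int) set => real \<times> real => complex" where
 "psum d F z = (\<Sum>a\<in>F. d a * e a z)"

definition fcoef :: "(real \<times> real => complex) => coeffs" where
 "fcoef f a = (LINT z|M. f z * e (- a) z) / LL"

text \<open>Bridge between coefficient families and functions: \<open>f\<close> is an L2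
  representative of the series with coefficients \<open>d\<close>, determined up to null
  sets.\<close>

definition L2lim :: "coeffs => (real \<times> real => complex) => bool" where
 "L2lim d f \<longleftrightarrow> sq_int M f \<and> (%n. LINT z|M. (norm (f z - psum d (sbox n) z))^2) \<longlonglongrightarrow> 0"

lemma continuous_psum: "continuous_on S (psum d F)" unfolding psum_def by (intro continuous_intros)

lemma measurable_psum [measurable]: "psum d F \<in> borel_measurable borel" by (intro borel_measurable_continuous_onI continuous_psum)

lemma norm_psum_le: "norm (psum d F z) \<le> (\<Sum>a\<in>F. norm (d a))" unfolding psum_def by (rule order_trans[OF norm_sum]) (simp add: norm_mult)

lemma sq_int_const: "sq_int M (%z. c)" by (simp add: sq_int_def)

lemma sq_int_bdd:
 assumes "f \<in> borel_measurable M" "!!z. norm (f z) \<le> B"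
 shows "sq_int M f" using sq_int_mult_bdd[OF sq_int_const[of 1] assms] by simp

lemma sq_int_psum: "sq_int M (psum d F)" by (rule sq_int_bdd[OF measurable_M[OF measurable_psum] norm_psum_le])

lemma sq_int_e: "sq_int M (e a)" by (rule sq_int_bdd[where B = 1]) (simp_all add: measurable_M[OF measurable_e])

lemma sq_int_integrable: "sq_int M f ==> integrable M f" using sq_int_mult_integrable[OF _ sq_int_const[of 1], of f] by simp

lemma integral_e_mult: "(LINT z|M. e a z * e b z) = (if a = - b then of_real LL else 0)"
 unfolding e_add[symmetric] integral_e by (simp add: add_eq_0_iff2)

lemma integral_psum_e:
 assumes "finite F"
 shows "(LINT z|M. psum d F z * e (- b) z) = (if b \<in> F then d b * LL else 0)"
proof -
 have ie: "integrable M (%z. e a z * e (- b) z)" for a by (intro sq_int_mult_integrable sq_int_e)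
 have "(LINT z|M. psum d F z * e (- b) z) = (LINT z|M. (\<Sum>a\<in>F. d a * (e a z * e (- b) z)))"
  by (simp add: psum_def sum_distrib_right mult.assoc)
 also have "\<dots> = (\<Sum>a\<in>F. d a * (LINT z|M. e a z * e (- b) z))" using ie by (subst Bochner_Integration.integral_sum) simp_all
 also have "\<dots> = (\<Sum>a\<in>F. if a = b then d a * LL else 0)" by (intro sum.cong refl) (simp add: integral_e_mult)
 also have "\<dots> = (if b \<in> F then d b * LL else 0)" using assms by simp
 finally show ?thesis .
qed

lemma integral_mult_psum:
 assumes "finite F" "sq_int M f"
 shows "(LINT z|M. f z * cnj (psum d F z)) = (\<Sum>a\<in>F. cnj (d a) * fcoef f a) * LL"
proof -
 have "(LINT z|M. f z * cnj (psum d F z)) = (LINT z|M. (\<Sum>a\<in>F. cnj (d a) * (f z * e (- a) z)))"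
  by (simp add: psum_def sum_distrib_left cnj_e mult_ac)
 also have "\<dots> = (\<Sum>a\<in>F. cnj (d a) * (LINT z|M. f z * e (- a) z))"
  using sq_int_mult_integrable[OF assms(2) sq_int_e] by (subst Bochner_Integration.integral_sum) simp_all
 finally show ?thesis using L1 L2 by (simp add: fcoef_def sum_distrib_right)
qed

lemma integral_norm_psum:
 assumes "finite F"
 shows "(LINT z|M. (norm (psum d F z))^2) = LL * (\<Sum>a\<in>F. (norm (d a))^2)"
proof -
 have "of_real (LINT z|M. (norm (psum d F z))^2) = (LINT z|M. psum d F z * cnj (psum d F z))"
  unfolding integral_complex_of_real[symmetric] complex_norm_square ..
 also have "\<dots> = (\<Sum>a\<in>F. cnj (d a) * d a) * LL"
  using assms L1 L2 by (simp add: integral_mult_psum sq_int_psum fcoef_def integral_psum_e)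
 also have "\<dots> = of_real (LL * (\<Sum>a\<in>F. (norm (d a))^2))"
  unfolding of_real_mult of_real_sum complex_norm_square by (simp add: mult_ac)
 finally show ?thesis unfolding of_real_eq_iff .
qed

text \<open>Expand the squared L2 distance from \<open>f\<close> to its partial sum: the cross term
  is twice the coefficient sum, the square of the partial sum gives it back once.\<close>

lemma Bessel:
 assumes "finite F" "sq_int M f"
 shows "LL * (\<Sum>a\<in>F. (norm (fcoef f a))^2) \<le> (LINT z|M. (norm (f z))^2)"
proof -
 let ?p = "psum (fcoef f) F"
 let ?S = "LL * (\<Sum>a\<in>F. (norm (fcoef f a))^2)"
 have c: "(LINT z|M. f z * cnj (?p z)) = of_real ?S"
  unfolding integral_mult_psum[OF assms] of_real_mult of_real_sum complex_norm_square by (simp add: mult_ac)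
 have i1: "integrable M (%z. f z * cnj (?p z))" by (intro sq_int_mult_integrable assms(2) sq_int_cnj sq_int_psum)
 define R where "R z = Re (f z * cnj (?p z))" for z
 have R: "integrable M R" "(LINT z|M. R z) = ?S" unfolding R_def[abs_def] using integrable_Re[OF i1] integral_Re[OF i1] unfolding c by simp_all
 have "0 \<le> (LINT z|M. (norm (f z - ?p z))^2)" by (simp add: Bochner_Integration.integral_nonneg)
 also have "\<dots> = (LINT z|M. (norm (f z))^2 - 2 * Re (f z * cnj (?p z)) + (norm (?p z))^2)"
  by (simp add: cmod_power2 power2_diff algebra_simps)
 also have "\<dots> = (LINT z|M. (norm (f z))^2 - 2 * R z + (norm (?p z))^2)" by (simp only: R_def)
 also have "\<dots> = (LINT z|M. (norm (f z))^2) - 2 * ?S + ?S"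
  using R sq_intD(2)[OF assms(2)] sq_intD(2)[OF sq_int_psum[of "fcoef f" F]] assms(1) by (simp add: integral_norm_psum)
 finally show ?thesis by simp
qed

lemma ell2_fcoef:
 assumes "sq_int M f"
 shows "ell2 (fcoef f)" "LL * (LINT a|CS. (norm (fcoef f a))^2) \<le> (LINT z|M. (norm (f z))^2)"
proof -
 have b: "sum (%a. (norm (fcoef f a))^2) (sbox n) \<le> (LINT z|M. (norm (f z))^2) / LL" for n
  using Bessel[OF finite_sbox assms, of n] LL_pos by (simp add: field_simps)
 show "ell2 (fcoef f)" unfolding ell2_def by (rule integrable_CS_sbox(1)[OF _ b]) simp
 have "(LINT a|CS. (norm (fcoef f a))^2) \<le> (LINT z|M. (norm (f z))^2) / LL" by (rule integrable_CS_sbox(2)[OF _ b]) simp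
 thus "LL * (LINT a|CS. (norm (fcoef f a))^2) \<le> (LINT z|M. (norm (f z))^2)" using LL_pos by (simp add: field_simps)
qed

end

lemma ell2_sum:
 assumes "ell2 d"
 shows "(%n. \<Sum>a\<in>sbox n. (norm (d a))^2) \<longlonglongrightarrow> (LINT a|CS. (norm (d a))^2)"
  "(\<Sum>a\<in>sbox n. (norm (d a))^2) \<le> (LINT a|CS. (norm (d a))^2)"
 using assms unfolding ell2_def by (auto intro: tendsto_sbox_sum sum_le_CS)

context torus2
begin

lemma psum_diff:
 assumes "n \<le> m"
 shows "psum d (sbox m) z - psum d (sbox n) z = psum d (sbox m - sbox n) z" unfolding psum_def using sbox_mono[OF assms] by (simp add: sum_diff)

lemma norm_psum_diff:
 assumes "ell2 d" "n \<le> m"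
 shows "(LINT z|M. (norm (psum d (sbox m) z - psum d (sbox n) z))^2)
  \<le> LL * ((LINT a|CS. (norm (d a))^2) - (\<Sum>a\<in>sbox n. (norm (d a))^2))"
proof -
 have "(LINT z|M. (norm (psum d (sbox m) z - psum d (sbox n) z))^2)
   = LL * (\<Sum>a\<in>sbox m - sbox n. (norm (d a))^2)" unfolding psum_diff[OF assms(2)] by (rule integral_norm_psum) simp
 also have "\<dots> = LL * ((\<Sum>a\<in>sbox m. (norm (d a))^2) - (\<Sum>a\<in>sbox n. (norm (d a))^2))"
  using sbox_mono[OF assms(2)] by (simp add: sum_diff)
 also have "\<dots> \<le> LL * ((LINT a|CS. (norm (d a))^2) - (\<Sum>a\<in>sbox n. (norm (d a))^2))"
  using ell2_sum(2)[OF assms(1), of m] LL_pos by (intro mult_left_mono) simp_all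
 finally show ?thesis .
qed

lemma norm_integral_le_CS:
 assumes "sq_int M f" "sq_int M g"
 shows "norm (LINT z|M. f z * g z) \<le> sqrt (LINT z|M. (norm (f z))^2) * sqrt (LINT z|M. (norm (g z))^2)"
 using integral_Cauchy_Schwarz[OF assms] integral_norm_bound[of M "%z. f z * g z"] by linarith

text \<open>Along a sparse subsequence the L1 norms of the increments are bounded by a geometric
  sequence, so the partial sums converge almost everywhere; Fatou's lemma then gives L2 convergence
  of the whole sequence.\<close>

theorem Riesz_Fischer:
 assumes d: "ell2 d"
 shows "\<exists>F. L2lim d F"
proof -
 define s where "s n = (\<Sum>a\<in>sbox n. (norm (d a))^2)" for n
 define T where "T = (LINT a|CS. (norm (d a))^2)"
 let ?S = "%n. psum d (sbox n)"
 have sT: "s \<longlonglongrightarrow> T" and sle: "s n \<le> T" for n using ell2_sum[OF d] unfolding s_def[abs_def] T_def by simp_all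
 have nd: "(LINT z|M. (norm (?S m z - ?S n z))^2) \<le> LL * (T - s n)" if "n \<le> m" for m n
  using norm_psum_diff[OF d that] by (simp add: s_def T_def)
 have "(%n. LL * (T - s n)) \<longlonglongrightarrow> LL * (T - T)" by (intro tendsto_intros sT)
 hence tail: "(%n. LL * (T - s n)) \<longlonglongrightarrow> 0" by simp
 have "\<exists>N. \<forall>n\<ge>N. LL * (T - s n) < (1/4)^k" for k :: nat
  using order_tendstoD(2)[OF tail, of "(1/4)^k"] by (simp add: eventually_sequentially)
 then obtain N where N: "!!k n. N k \<le> n ==> LL * (T - s n) < (1/4)^k" by metis
 \<comment> \<open>Summing the \<open>N i\<close> makes the index sequence monotone and at least
   \<open>N k\<close>; the added \<open>k\<close> makes it tend to infinity.\<close>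
 define r where "r k = (\<Sum>i\<le>k. N i) + k" for k
 have rN: "N k \<le> r k" for k unfolding r_def using member_le_sum[of k "{..k}" N] by simp
 have rmono: "r k \<le> r (Suc k)" and rk: "k \<le> r k" for k by (simp_all add: r_def)
 define D where "D k z = ?S (r (Suc k)) z - ?S (r k) z" for k z
 have Dsq: "sq_int M (D k)" for k unfolding D_def[abs_def] by (intro sq_int_diff sq_int_psum)
 have Dint: "(LINT z|M. norm (D k z)) \<le> sqrt LL * (1/2)^k" for k
 proof -
  have "(LINT z|M. norm (D k z)) \<le> sqrt (LINT z|M. (norm (D k z))^2) * sqrt LL"
   using integral_Cauchy_Schwarz[OF Dsq sq_int_const[of 1], of k] measure_M by simp
  also have "(LINT z|M. (norm (D k z))^2) \<le> ((1/2)^k)^2"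
  proof -
   have "((1/2)^k)^2 = (1/4 :: real)^k" by (simp add: power2_eq_square flip: power_mult_distrib)
   thus ?thesis using nd[OF rmono, of k] N[OF rN, of k] unfolding D_def by linarith
  qed
  hence "sqrt (LINT z|M. (norm (D k z))^2) * sqrt LL \<le> (1/2)^k * sqrt LL"
   using LL_pos by (intro mult_right_mono real_le_lsqrt) (simp_all add: Bochner_Integration.integral_nonneg)
  finally show ?thesis by (simp add: mult.commute)
 qed
 have "(\<integral>\<^sup>+z. (\<Sum>k. ennreal (norm (D k z))) \<partial>M) = (\<Sum>k. \<integral>\<^sup>+z. ennreal (norm (D k z)) \<partial>M)"
  using sq_intD(1)[OF Dsq] by (intro nn_integral_suminf) measurable
 also have "\<dots> = (\<Sum>k. ennreal (LINT z|M. norm (D k z)))"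
  by (intro suminf_cong nn_integral_eq_integral integrable_norm sq_int_integrable Dsq) simp
 also have "\<dots> \<le> (\<Sum>k. ennreal (sqrt LL * (1/2)^k))" by (intro suminf_le ennreal_leI Dint) simp_all
 also have "\<dots> = ennreal (\<Sum>k. sqrt LL * (1/2)^k)" using LL_pos by (intro suminf_ennreal2 summable_mult summable_geometric) simp_all
 also have "\<dots> < \<infinity>" by simp
 finally have fin: "(\<integral>\<^sup>+z. (\<Sum>k. ennreal (norm (D k z))) \<partial>M) \<noteq> \<infinity>" by simp
 have "AE z in M. (\<Sum>k. ennreal (norm (D k z))) \<noteq> \<infinity>"
  using sq_intD(1)[OF Dsq] by (intro nn_integral_noteq_infinite fin) measurable
 hence conv: "AE z in M. convergent (%k. ?S (r k) z)"
 proof eventually_elim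
  case (elim z)
  have "summable (%k. norm (D k z))" by (rule summable_suminf_not_top) (use elim in simp_all)
  hence "summable (%k. D k z)" by (rule summable_norm_cancel)
  hence "convergent (%n. \<Sum>k<n. D k z)" by (simp only: summable_iff_convergent)
  hence "convergent (%n. ?S (r 0) z + (\<Sum>k<n. D k z))" by (intro convergent_add convergent_const)
  moreover have "?S (r 0) z + (\<Sum>k<n. D k z) = ?S (r n) z" for n unfolding D_def by (subst sum_lessThan_telescope) simp
  ultimately show ?case by simp
 qed
 define F where "F z = lim (%k. ?S (r k) z)" for z
 have Fm: "F \<in> borel_measurable M" unfolding F_def[abs_def] by (intro borel_measurable_lim_metric measurable_M measurable_psum)
 have est: "(\<integral>\<^sup>+z. ennreal ((norm (F z - ?S n z))^2) \<partial>M) \<le> ennreal (LL * (T - s n))" for n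
 proof -
  let ?u = "%k z. ennreal ((norm (?S (r k) z - ?S n z))^2)"
  have um: "?u k \<in> borel_measurable M" for k using sq_int_diff[OF sq_int_psum[of d "sbox (r k)"] sq_int_psum[of d "sbox n"], THEN sq_intD(2)]
   by (intro measurable_compose[OF _ measurable_ennreal]) (rule borel_measurable_integrable)
  have "(\<integral>\<^sup>+z. ennreal ((norm (F z - ?S n z))^2) \<partial>M) = (\<integral>\<^sup>+z. liminf (%k. ?u k z) \<partial>M)"
  proof (rule nn_integral_cong_AE)
   show "AE z in M. ennreal ((norm (F z - ?S n z))^2) = liminf (%k. ?u k z)" using conv
   proof eventually_elim
    case (elim z)
    hence "(%k. ?S (r k) z) \<longlonglongrightarrow> F z" unfolding F_def by (simp add: convergent_LIMSEQ_iff)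
    hence "(%k. ?u k z) \<longlonglongrightarrow> ennreal ((norm (F z - ?S n z))^2)" by (intro tendsto_intros)
    thus ?case by (intro lim_imp_Liminf[symmetric]) simp_all
   qed
  qed
  also have "\<dots> \<le> liminf (%k. \<integral>\<^sup>+z. ?u k z \<partial>M)" by (intro nn_integral_liminf um)
  also have "\<dots> \<le> ennreal (LL * (T - s n))"
  proof (rule Liminf_le)
   show "eventually (%k. (\<integral>\<^sup>+z. ?u k z \<partial>M) \<le> ennreal (LL * (T - s n))) sequentially"
   proof (rule eventually_sequentiallyI[of n])
    fix k assume "n \<le> k"
    hence "n \<le> r k" using rk[of k] by linarith
    have "(\<integral>\<^sup>+z. ?u k z \<partial>M) = ennreal (LINT z|M. (norm (?S (r k) z - ?S n z))^2)"
     by (intro nn_integral_eq_integral sq_intD(2) sq_int_diff sq_int_psum) simp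
    also have "\<dots> \<le> ennreal (LL * (T - s n))" by (intro ennreal_leI nd \<open>n \<le> r k\<close>)
    finally show "(\<integral>\<^sup>+z. ?u k z \<partial>M) \<le> ennreal (LL * (T - s n))" .
   qed
  qed simp
  finally show ?thesis .
 qed
 have FSm: "(%z. F z - ?S n z) \<in> borel_measurable M" for n by (intro borel_measurable_diff Fm measurable_M measurable_psum)
 have FS: "sq_int M (%z. F z - ?S n z)" for n unfolding sq_int_def
 proof
  show "integrable M (%z. (norm (F z - ?S n z))^2)"
  proof (rule integrableI_bounded)
   show "(%z. (norm (F z - ?S n z))^2) \<in> borel_measurable M" using FSm by measurable
   have "(\<integral>\<^sup>+z. ennreal (norm ((norm (F z - ?S n z))^2)) \<partial>M) \<le> ennreal (LL * (T - s n))" using est[of n] by simp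
   thus "(\<integral>\<^sup>+z. ennreal (norm ((norm (F z - ?S n z))^2)) \<partial>M) < \<infinity>"
    unfolding infinity_ennreal_def by (rule le_less_trans[OF _ ennreal_less_top])
  qed
 qed (rule FSm)
 have F: "sq_int M F" using sq_int_add[OF FS[of 0] sq_int_psum[of d "sbox 0"]] by simp
 have "(LINT z|M. (norm (F z - ?S n z))^2) \<le> LL * (T - s n)" for n
 proof -
  have "ennreal (LINT z|M. (norm (F z - ?S n z))^2) = (\<integral>\<^sup>+z. ennreal ((norm (F z - ?S n z))^2) \<partial>M)"
   by (intro nn_integral_eq_integral[symmetric] sq_intD(2) FS) simp
  with est[of n] have "ennreal (LINT z|M. (norm (F z - ?S n z))^2) \<le> ennreal (LL * (T - s n))" by (simp only:)
  moreover have "0 \<le> LL * (T - s n)" using sle[of n] L1 L2 by simp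
  ultimately show ?thesis by (simp only: ennreal_le_iff)
 qed
 hence "(%n. LINT z|M. (norm (F z - ?S n z))^2) \<longlonglongrightarrow> 0"
  by (intro tendsto_sandwich[OF _ _ tendsto_const tail] always_eventually allI)
    (simp_all add: Bochner_Integration.integral_nonneg)
 with F show ?thesis unfolding L2lim_def by blast
qed

lemma L2lim_integral:
 assumes F: "L2lim d F" and g: "sq_int M g"
 shows "(%n. LINT z|M. psum d (sbox n) z * g z) \<longlonglongrightarrow> (LINT z|M. F z * g z)"
proof -
 let ?S = "%n. psum d (sbox n)"
 have Fs: "sq_int M F" and l: "(%n. LINT z|M. (norm (F z - ?S n z))^2) \<longlonglongrightarrow> 0"
  using F by (simp_all add: L2lim_def)
 have "(%n. sqrt (LINT z|M. (norm (F z - ?S n z))^2) * sqrt (LINT z|M. (norm (g z))^2)) \<longlonglongrightarrow> sqrt 0 * sqrt (LINT z|M. (norm (g z))^2)"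
  by (intro tendsto_intros l)
 hence z: "(%n. sqrt (LINT z|M. (norm (F z - ?S n z))^2) * sqrt (LINT z|M. (norm (g z))^2)) \<longlonglongrightarrow> 0" by simp
 have "(%n. LINT z|M. (F z - ?S n z) * g z) \<longlonglongrightarrow> 0"
  by (rule Lim_null_comparison[OF _ z]) (intro always_eventually allI norm_integral_le_CS sq_int_diff Fs sq_int_psum g)
 hence "(%n. (LINT z|M. F z * g z) - (LINT z|M. ?S n z * g z)) \<longlonglongrightarrow> 0"
  using sq_int_mult_integrable[OF Fs g] sq_int_mult_integrable[OF sq_int_psum g] by (simp add: left_diff_distrib)
 thus ?thesis using tendsto_diff[OF tendsto_const[of "LINT z|M. F z * g z"]] by fastforce
qed

lemma L2lim_fcoef:
 assumes "L2lim d F"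
 shows "fcoef F a = d a"
proof -
 have "(%n. LINT z|M. psum d (sbox n) z * e (- a) z) \<longlonglongrightarrow> (LINT z|M. F z * e (- a) z)"
  by (rule L2lim_integral[OF assms sq_int_e])
 moreover have "(%n. LINT z|M. psum d (sbox n) z * e (- a) z) \<longlonglongrightarrow> d a * LL"
  by (rule tendsto_eventually) (use eventually_in_sbox[of a] in eventually_elim, simp add: integral_psum_e)
 ultimately have "(LINT z|M. F z * e (- a) z) = d a * LL" by (rule LIMSEQ_unique)
 thus ?thesis using L1 L2 by (simp add: fcoef_def)
qed

lemma L2lim_ell2: "L2lim d F ==> ell2 d" using ell2_fcoef(1)[of F] L2lim_fcoef[of d F] by (simp add: L2lim_def ell2_def)

lemma L2lim_norm:
 assumes "L2lim d F"
 shows "(LINT z|M. (norm (F z))^2) = LL * (LINT a|CS. (norm (d a))^2)"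
proof -
 have F: "sq_int M F" using assms by (simp add: L2lim_def)
 have "(%n. LINT z|M. psum d (sbox n) z * cnj (F z)) \<longlonglongrightarrow> (LINT z|M. F z * cnj (F z))"
  by (intro L2lim_integral[OF assms] sq_int_cnj F)
 moreover have "(LINT z|M. psum d (sbox n) z * cnj (F z)) = of_real (LL * (\<Sum>a\<in>sbox n. (norm (d a))^2))" for n
 proof -
  have "(LINT z|M. psum d (sbox n) z * cnj (F z)) = cnj (LINT z|M. F z * cnj (psum d (sbox n) z))"
   unfolding Bochner_Integration.integral_cnj[symmetric] by (simp add: mult.commute)
  also have "\<dots> = cnj (\<Sum>a\<in>sbox n. cnj (d a) * d a) * LL" by (simp add: integral_mult_psum F L2lim_fcoef[OF assms])
  also have "\<dots> = of_real (LL * (\<Sum>a\<in>sbox n. (norm (d a))^2))"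
   unfolding of_real_mult of_real_sum complex_norm_square by (simp add: mult_ac)
  finally show ?thesis .
 qed
 moreover have "(%n. of_real (LL * (\<Sum>a\<in>sbox n. (norm (d a))^2))) \<longlonglongrightarrow> complex_of_real (LL * (LINT a|CS. (norm (d a))^2))"
  by (intro tendsto_intros ell2_sum(1) L2lim_ell2[OF assms])
 ultimately have "(LINT z|M. F z * cnj (F z)) = of_real (LL * (LINT a|CS. (norm (d a))^2))" using LIMSEQ_unique by fastforce
 hence "complex_of_real (LINT z|M. (norm (F z))^2) = of_real (LL * (LINT a|CS. (norm (d a))^2))"
  unfolding integral_complex_of_real[symmetric] complex_norm_square .
 thus ?thesis unfolding of_real_eq_iff .
qed

lemma L2lim_sum: "L2lim d F ==> sq_int M g ==>
  (%n. \<Sum>a\<in>sbox n. d a * (LINT z|M. e a z * g z)) \<longlonglongrightarrow> (LINT z|M. F z * g z)"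
proof -
 assume F: "L2lim d F" and g: "sq_int M g"
 have "(LINT z|M. psum d (sbox n) z * g z) = (\<Sum>a\<in>sbox n. d a * (LINT z|M. e a z * g z))" for n
 proof -
  have "(LINT z|M. psum d (sbox n) z * g z) = (LINT z|M. (\<Sum>a\<in>sbox n. d a * (e a z * g z)))"
   by (simp add: psum_def sum_distrib_right mult.assoc)
  thus ?thesis using sq_int_mult_integrable[OF sq_int_e g] by (simp add: Bochner_Integration.integral_sum)
 qed
 thus ?thesis using L2lim_integral[OF F g] by simp
qed

text \<open>The Riesz-Fischer limit has the same coefficients as \<open>f\<close>, so the uniqueness
  theorem identifies the two almost everywhere.\<close>

theorem fourier_L2lim:
 assumes f: "sq_int M f"
 shows "L2lim (fcoef f) f"
proof -
 obtain F where F: "L2lim (fcoef f) F" using Riesz_Fischer[OF ell2_fcoef(1)[OF f]] by blast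
 hence Fs: "sq_int M F" by (simp add: L2lim_def)
 have "(LINT z|M. (f z - F z) * e a z) = 0" for a
 proof -
  have "(LINT z|M. f z * e a z) = (LINT z|M. F z * e a z)" using L2lim_fcoef[OF F, of "- a"] LL_pos L1 L2 by (simp add: fcoef_def)
  thus ?thesis using sq_int_mult_integrable[OF f sq_int_e, of a] sq_int_mult_integrable[OF Fs sq_int_e, of a] by (simp add: left_diff_distrib)
 qed
 hence ae: "AE z in M. f z - F z = 0" by (intro AE_zero_if_coeffs_zero sq_int_integrable sq_int_diff f Fs)
 have "(LINT z|M. (norm (f z - psum (fcoef f) (sbox n) z))^2) = (LINT z|M. (norm (F z - psum (fcoef f) (sbox n) z))^2)" for n
 proof (rule integral_cong_AE)
  show "AE z in M. (norm (f z - psum (fcoef f) (sbox n) z))^2 = (norm (F z - psum (fcoef f) (sbox n) z))^2"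
   using ae by eventually_elim simp
 qed (intro borel_measurable_integrable sq_intD(2) sq_int_diff f Fs sq_int_psum)+
 thus ?thesis using F f by (simp add: L2lim_def)
qed

end

section \<open>Test functions\<close>

lemma smooth_fun_dirD: "smooth_fun f ==> smooth_fun (dirD v f)" unfolding smooth_fun_def
proof (intro allI)
 fix vs x assume "\<forall>vs x. foldr dirD vs f differentiable at x"
 hence "foldr dirD (vs @ [v]) f differentiable at x" by blast
 thus "foldr dirD vs (dirD v f) differentiable at x" by simp
qed

lemma smooth_fun_differentiable: "smooth_fun f ==> f differentiable at x" unfolding smooth_fun_def by (drule spec[of _ "[]"]) simp

lemma smooth_fun_has_derivative:
 assumes "smooth_fun f"
 shows "(f has_derivative (%v. dirD v f x)) (at x)"
 using smooth_fun_differentiable[OF assms, of x] unfolding dirD_def frechet_derivative_works .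

lemma smooth_fun_continuous: "smooth_fun f ==> continuous_on S f"
 using smooth_fun_has_derivative by (intro continuous_at_imp_continuous_on) (blast intro: has_derivative_continuous)

text \<open>Affine substitutions serve twice: as translations by a period, which shows that
  derivatives of periodic functions are periodic, and as restrictions to a time slice.\<close>

lemma dirD_compose_affine:
 fixes f :: "'a::real_normed_vector => real" and g :: "'b::real_normed_vector => 'a"
 assumes "smooth_fun f" and g: "bounded_linear g"
 shows "dirD v (%x. f (c + g x)) = (%x. dirD (g v) f (c + g x))"
proof
 fix x
 have "((%x. c + g x) has_derivative g) (at x)" using bounded_linear_imp_has_derivative[OF g] by (auto intro!: derivative_eq_intros)
 from has_derivative_compose[OF this smooth_fun_has_derivative[OF assms(1)]]
 have "((%x. f (c + g x)) has_derivative (%v. dirD (g v) f (c + g x))) (at x)" .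
 from frechet_derivative_at[OF this] show "dirD v (%x. f (c + g x)) x = dirD (g v) f (c + g x)" unfolding dirD_def by metis
qed

lemma foldr_dirD_compose_affine:
 fixes f :: "'a::real_normed_vector => real" and g :: "'b::real_normed_vector => 'a"
 assumes "smooth_fun f" and g: "bounded_linear g"
 shows "foldr dirD vs (%x. f (c + g x)) = (%x. foldr dirD (map g vs) f (c + g x))
  \<and> smooth_fun (foldr dirD (map g vs) f)"
proof (induction vs)
 case (Cons v vs)
 thus ?case using dirD_compose_affine[OF _ g, of "foldr dirD (map g vs) f" v c] smooth_fun_dirD[of "foldr dirD (map g vs) f" "g v"] by simp
qed (use assms in simp)

lemma smooth_fun_compose_affine:
 fixes f :: "'a::real_normed_vector => real" and g :: "'b::real_normed_vector => 'a"
 assumes "smooth_fun f" and g: "bounded_linear g"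
 shows "smooth_fun (%x. f (c + g x))" unfolding smooth_fun_def
proof (intro allI)
 fix vs x
 have d: "((%x. c + g x) has_derivative g) (at x)" using bounded_linear_imp_has_derivative[OF g] by (auto intro!: derivative_eq_intros)
 have "smooth_fun (foldr dirD (map g vs) f)" using foldr_dirD_compose_affine[OF assms, of vs c] by simp
 from has_derivative_compose[OF d smooth_fun_has_derivative[OF this]]
 show "foldr dirD vs (%x. f (c + g x)) differentiable at x" using foldr_dirD_compose_affine[OF assms, of vs c] by (metis differentiableI)
qed

context torus2
begin

text \<open>Test functions are real, so characters are tested through real waves. The complex
  amplitude keeps the family closed under differentiation.\<close>

definition wave :: "complex => int \<times> int => real \<times> real => real" where
 "wave c a z = Re (c * e a z)"

lemma wave_has_derivative:
 "(wave c a has_derivative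
  (%v. wave (c * (\<i> * of_real (2 * pi * (of_int (fst a) * fst v / L1 + of_int (snd a) * snd v / L2)))) a z)) (at z)"
proof -
 have "((%z. 2 * pi * (of_int (fst a) * fst z / L1 + of_int (snd a) * snd z / L2)) has_derivative
   (%v. 2 * pi * (of_int (fst a) * fst v / L1 + of_int (snd a) * snd v / L2))) (at z)" using L1 L2 by (auto intro!: derivative_eq_intros)
 from has_derivative_cis[OF this]
 have "(e a has_derivative (%v. (2 * pi * (of_int (fst a) * fst v / L1 + of_int (snd a) * snd v / L2)) *\<^sub>R (\<i> * e a z))) (at z)"
  unfolding e_def[abs_def] .
 hence "((%z. Re (c * e a z)) has_derivative
   (%v. Re (c * ((2 * pi * (of_int (fst a) * fst v / L1 + of_int (snd a) * snd v / L2)) *\<^sub>R (\<i> * e a z))))) (at z)"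
  by (intro has_derivative_Re has_derivative_mult_right)
 note D = this
 have key: "Re (c * (t *\<^sub>R (\<i> * e a z))) = Re (c * (\<i> * of_real t) * e a z)" for t
 proof -
  have "c * (t *\<^sub>R (\<i> * e a z)) = c * (\<i> * of_real t) * e a z" unfolding scaleR_conv_of_real by algebra
  thus ?thesis by (rule arg_cong)
 qed
 show ?thesis unfolding wave_def[abs_def] by (rule has_derivative_eq_rhs[OF D]) (rule ext, rule key)
qed

lemma dirD_wave: "\<exists>c'. dirD v (wave c a) = wave c' a"
proof
 show "dirD v (wave c a) = wave (c * (\<i> * of_real (2 * pi * (of_int (fst a) * fst v / L1 + of_int (snd a) * snd v / L2)))) a"
 proof
  fix z
  show "dirD v (wave c a) z = wave (c * (\<i> * of_real (2 * pi * (of_int (fst a) * fst v / L1 + of_int (snd a) * snd v / L2)))) a z"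
   unfolding dirD_def by (rule fun_cong[OF frechet_derivative_at[OF wave_has_derivative[of c a z], symmetric]])
 qed
qed

lemma torus_test_wave: "torus_test L1 L2 (wave c a)"
proof -
 have "\<exists>c'. foldr dirD vs (wave c a) = wave c' a" for vs
 proof (induction vs)
  case (Cons v vs)
  then obtain c' where "foldr dirD vs (wave c a) = wave c' a" by blast
  thus ?case using dirD_wave[of v c' a] by simp
 qed auto
 note ex = this
 have "smooth_fun (wave c a)" unfolding smooth_fun_def
 proof (intro allI)
  fix vs x
  obtain c' where "foldr dirD vs (wave c a) = wave c' a" using ex by blast
  thus "foldr dirD vs (wave c a) differentiable at x" using differentiableI[OF wave_has_derivative[of c' a x]] by (simp only:)
 qed
 thus ?thesis unfolding torus_test_def by (simp add: wave_def e_periodic_x e_periodic_y)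
qed

lemma torus_test_dirD:
 assumes "torus_test L1 L2 f"
 shows "torus_test L1 L2 (dirD v f)"
proof -
 have s: "smooth_fun f" and p: "!!x y. f (x + L1, y) = f (x, y)" "!!x y. f (x, y + L2) = f (x, y)" using assms by (auto simp: torus_test_def)
 have 1: "(%z. f ((L1, 0) + id z)) = f" and 2: "(%z. f ((0, L2) + id z)) = f" using p by (auto simp: fun_eq_iff add.commute)
 have e1: "dirD v f = (%z. dirD v f ((L1, 0) + z))" and e2: "dirD v f = (%z. dirD v f ((0, L2) + z))"
  using dirD_compose_affine[OF s bounded_linear_ident, of v "(L1, 0)"]
   dirD_compose_affine[OF s bounded_linear_ident, of v "(0, L2)"] 1 2 by simp_all
 have "dirD v f ((L1, 0) + (x, y)) = dirD v f (x, y)" "dirD v f ((0, L2) + (x, y)) = dirD v f (x, y)" for x y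
  by (rule fun_cong[OF e1, symmetric], rule fun_cong[OF e2, symmetric])
 hence "dirD v f (x + L1, y) = dirD v f (x, y)" "dirD v f (x, y + L2) = dirD v f (x, y)" for x y
  by (simp_all add: add.commute[of x] add.commute[of y])
 thus ?thesis unfolding torus_test_def using smooth_fun_dirD[OF s] by blast
qed

lemma torus_test_dx:
 assumes "torus_test L1 L2 f"
 shows "((%x. f (x, y)) has_vector_derivative dirD (1, 0) f (x, y)) (at x)"
  "((%y. f (x, y)) has_vector_derivative dirD (0, 1) f (x, y)) (at y)"
proof -
 have s: "smooth_fun f" using assms by (simp add: torus_test_def)
 have D: "(f has_derivative (%v. dirD v f (x, y))) (at (x, y))" by (rule smooth_fun_has_derivative[OF s])
 have lin: "dirD (t *\<^sub>R v) f (x, y) = t *\<^sub>R dirD v f (x, y)" for t v using linear_scale[OF has_derivative_linear[OF D]] by simp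
 have l: "dirD (t, 0) f (x, y) = t *\<^sub>R dirD (1, 0) f (x, y)" "dirD (0, t) f (x, y) = t *\<^sub>R dirD (0, 1) f (x, y)" for t
  using lin[of t "(1, 0)"] lin[of t "(0, 1)"] by (simp_all only: scaleR_Pair scaleR_zero_right real_scaleR_def mult_1_right mult_zero_right)
 have "((%x. (x, y)) has_derivative (%t. (t, 0))) (at x)" "((%y. (x, y)) has_derivative (%t. (0, t))) (at y)"
  by (intro has_derivative_Pair has_derivative_ident has_derivative_const)+
 note hd = has_derivative_compose[OF this(1) D] has_derivative_compose[OF this(2) D]
 show "((%x. f (x, y)) has_vector_derivative dirD (1, 0) f (x, y)) (at x)"
  unfolding has_vector_derivative_def by (rule has_derivative_eq_rhs[OF hd(1)]) (rule ext, rule l(1))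
 show "((%y. f (x, y)) has_vector_derivative dirD (0, 1) f (x, y)) (at y)"
  unfolding has_vector_derivative_def by (rule has_derivative_eq_rhs[OF hd(2)]) (rule ext, rule l(2))
qed

lemma torus_test_continuous: "torus_test L1 L2 f ==> continuous_on S f" unfolding torus_test_def by (blast intro: smooth_fun_continuous)

lemma integrable_continuous:
 fixes f :: "real \<times> real => 'b::{banach, second_countable_topology}"
 assumes "continuous_on UNIV f"
 shows "integrable M f"
proof -
 have "compact (f ` ({0..L1} \<times> {0..L2}))" by (intro compact_continuous_image compact_Times continuous_on_subset[OF assms]) auto
 then obtain B where B: "!!z. z \<in> {0..L1} \<times> {0..L2} ==> norm (f z) \<le> B"
  using compact_imp_bounded bounded_iff by (metis imageI)
 have "AE z in M. norm (f z) \<le> B" by (rule AE_I2, rule B) (auto simp: space_M)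
 thus ?thesis by (rule integrable_const_bound) (rule measurable_M[OF borel_measurable_continuous_onI[OF assms]])
qed

lemma sq_int_continuous:
 fixes f :: "real \<times> real => complex"
 assumes "continuous_on UNIV f"
 shows "sq_int M f" unfolding sq_int_def by (intro conjI measurable_M borel_measurable_continuous_onI assms integrable_continuous continuous_intros)

lemma continuous_of_real_test: "torus_test L1 L2 f ==> continuous_on S (%z. complex_of_real (f z))"
 by (intro continuous_intros torus_test_continuous)

text \<open>Fourier symbols of the two partial derivatives.\<close>

definition mx :: "coeffs" where "mx a = \<i> * of_real (2 * pi * of_int (fst a) / L1)"
definition my :: "coeffs" where "my a = \<i> * of_real (2 * pi * of_int (snd a) / L2)"

lemma integral_dx_test:
 assumes f: "torus_test L1 L2 f"
 shows "(LINT z|M. dirD (1, 0) f z * e a z) = - mx a * (LINT z|M. f z * e a z)"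
proof -
 note fd = torus_test_dirD[OF f, of "(1, 0)"]
 have i: "integrable M (%z. of_real (dirD (1, 0) f z) * e a z)" "integrable M (%z. of_real (f z) * e a z)"
  by (intro integrable_continuous continuous_intros continuous_of_real_test fd f)+
 have "(LINT z|M. mx a * (f z * e a z) + dirD (1, 0) f z * e a z) = 0"
 proof (rule integral_dx_0[where F = "%z. of_real (f z) * e a z"])
  fix x y
  have "((%x. complex_of_real (f (x, y))) has_vector_derivative of_real (dirD (1, 0) f (x, y))) (at x)"
   by (intro has_vector_derivative_of_real torus_test_dx(1)[unfolded has_real_derivative_iff_has_vector_derivative[symmetric]] f)
  from has_vector_derivative_mult[OF this e_dx[of "fst a" "snd a" y x UNIV]]
  show "((%x. complex_of_real (f (x, y)) * e a (x, y)) has_vector_derivative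
    mx a * (f (x, y) * e a (x, y)) + dirD (1, 0) f (x, y) * e a (x, y)) (at x)" by (simp add: mx_def algebra_simps)
 next
  fix x y show "complex_of_real (f (x + L1, y)) * e a (x + L1, y) = complex_of_real (f (x, y)) * e a (x, y)"
   using f by (simp add: e_periodic_x torus_test_def)
 qed (intro integrable_continuous continuous_intros continuous_of_real_test fd f)+
 thus ?thesis using i by (simp add: add_eq_0_iff)
qed

lemma integral_dy_test:
 assumes f: "torus_test L1 L2 f"
 shows "(LINT z|M. dirD (0, 1) f z * e a z) = - my a * (LINT z|M. f z * e a z)"
proof -
 note fd = torus_test_dirD[OF f, of "(0, 1)"]
 have i: "integrable M (%z. of_real (dirD (0, 1) f z) * e a z)" "integrable M (%z. of_real (f z) * e a z)"
  by (intro integrable_continuous continuous_intros continuous_of_real_test fd f)+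
 have "(LINT z|M. my a * (f z * e a z) + dirD (0, 1) f z * e a z) = 0"
 proof (rule integral_dy_0[where F = "%z. of_real (f z) * e a z"])
  fix x y
  have "((%y. complex_of_real (f (x, y))) has_vector_derivative of_real (dirD (0, 1) f (x, y))) (at y)"
   by (intro has_vector_derivative_of_real torus_test_dx(2)[unfolded has_real_derivative_iff_has_vector_derivative[symmetric]] f)
  from has_vector_derivative_mult[OF this e_dy[of "fst a" "snd a" x y UNIV]]
  show "((%y. complex_of_real (f (x, y)) * e a (x, y)) has_vector_derivative
    my a * (f (x, y) * e a (x, y)) + dirD (0, 1) f (x, y) * e a (x, y)) (at y)" by (simp add: my_def algebra_simps)
 next
  fix x y show "complex_of_real (f (x, y + L2)) * e a (x, y + L2) = complex_of_real (f (x, y)) * e a (x, y)"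
   using f by (simp add: e_periodic_y torus_test_def)
 qed (intro integrable_continuous continuous_intros continuous_of_real_test fd f)+
 thus ?thesis using i by (simp add: add_eq_0_iff)
qed

lemma torus_test_partialD: "torus_test L1 L2 f ==> torus_test L1 L2 (partialD i j f)"
proof -
 assume f: "torus_test L1 L2 f"
 have "torus_test L1 L2 ((dirD v ^^ n) g)" if "torus_test L1 L2 g" for n v g using that by (induction n) (simp_all add: torus_test_dirD)
 thus ?thesis using f by (simp add: partialD_def)
qed

lemma integral_partialD_test:
 assumes f: "torus_test L1 L2 f"
 shows "(LINT z|M. partialD i j f z * e a z) = (-1) ^ (i + j) * (mx a ^ i * my a ^ j) * (LINT z|M. f z * e a z)"
proof (induction i)
 case 0
 show ?case
 proof (induction j)
  case 0 show ?case by (simp add: partialD_def)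
 next
  case (Suc j)
  have "partialD 0 (Suc j) f = dirD (0, 1) (partialD 0 j f)" by (simp add: partialD_def)
  thus ?case using integral_dy_test[OF torus_test_partialD[OF f, of 0 j], of a] Suc by simp
 qed
next
 case (Suc i)
 have "partialD (Suc i) j f = dirD (1, 0) (partialD i j f)" by (simp add: partialD_def)
 thus ?case using integral_dx_test[OF torus_test_partialD[OF f, of i j], of a] Suc by simp
qed

end

section \<open>Weights, convolution and absolutely convergent series\<close>

definition wt :: "int \<times> int => real" where
 "wt a = 1 / ((1 + (of_int (fst a))^2) * (1 + (of_int (snd a))^2))"

lemma wt_pos: "0 < wt a" unfolding wt_def by (intro divide_pos_pos mult_pos_pos add_pos_nonneg) simp_all

text \<open>The subtracted term makes the induction close: the two new summands are dominated by
  \<open>4 / Suc n - 4 / Suc (Suc n)\<close>, and the resulting bound 5 is uniform in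
  \<open>n\<close>.\<close>

lemma sum_inverse_squares: "(\<Sum>k=- int n..int n. 1 / (1 + (of_int k)^2)) \<le> 5 - 4 / real (Suc n)"
proof (induction n)
 case (Suc n)
 have set: "{- int (Suc n)..int (Suc n)} = insert (int (Suc n)) (insert (- int (Suc n)) {- int n..int n})" by auto
 have "(\<Sum>k=- int (Suc n)..int (Suc n). 1 / (1 + (real_of_int k)^2))
   = 2 / (1 + (real (Suc n))^2) + (\<Sum>k=- int n..int n. 1 / (1 + (of_int k)^2))"
  unfolding set by (subst sum.insert, simp, simp, subst sum.insert)
   (simp_all add: power2_eq_square algebra_simps add_divide_distrib[symmetric])
 also have "2 / (1 + (real (Suc n))^2) \<le> 4 / real (Suc n) - 4 / real (Suc (Suc n))"
 proof -
  have "4 / real (Suc n) - 4 / real (Suc (Suc n)) = 4 / (real (Suc n) * real (Suc (Suc n)))" by (simp add: field_simps)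
  moreover have "2 / (1 + (real (Suc n))^2) \<le> 4 / (real (Suc n) * real (Suc (Suc n)))"
  proof -
   define x where "x = real (Suc n)"
   have x: "0 < x" "0 < x * (x + 1)" by (simp_all add: x_def)
   have p: "0 < 1 + x^2" by (intro add_pos_nonneg) simp_all
   have "0 \<le> (x - 1)^2 + x^2 + 3" by (intro add_nonneg_nonneg) simp_all
   hence "2 * (x * (x + 1)) \<le> 4 * (1 + x^2)" by (simp add: power2_eq_square algebra_simps)
   hence "2 \<le> 4 * (1 + x^2) / (x * (x + 1))" using x by (simp only: pos_le_divide_eq)
   hence "2 / (1 + x^2) \<le> 4 / (x * (x + 1))" using p by (simp only: pos_divide_le_eq times_divide_eq_left)
   thus ?thesis by (simp add: x_def)
  qed
  ultimately show ?thesis by simp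
 qed
 finally show ?case using Suc by simp
qed simp

lemma integrable_wt: "integrable CS wt"
proof (rule integrable_CS_sbox(1))
 fix n
 let ?s = "\<Sum>k=- int n..int n. 1 / (1 + (real_of_int k)^2)"
 have "sum wt (sbox n) = ?s * ?s" unfolding sbox_def sum_product sum.cartesian_product by (simp add: wt_def case_prod_unfold)
 also have "\<dots> \<le> 5 * 5"
 proof (intro mult_mono)
  have "0 \<le> 4 / real (Suc n)" by simp
  thus "?s \<le> 5" using sum_inverse_squares[of n] by linarith
  thus "?s \<le> 5" .
  show "0 \<le> ?s" by (intro sum_nonneg) simp
 qed simp
 finally show "sum wt (sbox n) \<le> 25" by simp
qed (use wt_pos less_imp_le in blast)

definition conv :: "coeffs => coeffs => coeffs" where
 "conv d1 d2 a = (LINT b|CS. d1 b * d2 (a - b))"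

lemma integrable_CS_shift:
 fixes f :: "int \<times> int => 'b::{banach, second_countable_topology}"
 shows "integrable CS (%b. f (a - b)) \<longleftrightarrow> integrable CS f"
  "(LINT b|CS. f (a - b)) = (LINT b|CS. f b)"
proof -
 have b: "bij_betw (%b. a - b) UNIV UNIV" by (rule bij_betwI[where g = "%b. a - b"]) simp_all
 show "integrable CS (%b. f (a - b)) \<longleftrightarrow> integrable CS f" by (rule integrable_bij_count_space[OF b])
 show "(LINT b|CS. f (a - b)) = (LINT b|CS. f b)" by (rule integral_bij_count_space[OF b])
qed

lemma sq_int_ell2: "ell2 d ==> sq_int CS d" by (simp add: ell2_def sq_int_def)

lemma ell2_shift: "ell2 d ==> ell2 (%b. d (a - b))"
 unfolding ell2_def by (subst integrable_CS_shift(1)[of "%b. (norm (d b))^2"])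

lemma conv_integrable: "ell2 d1 ==> ell2 d2 ==> integrable CS (%b. d1 b * d2 (a - b))"
 by (intro sq_int_mult_integrable sq_int_ell2 ell2_shift)

lemma norm_conv_le:
 assumes "ell2 d1" "ell2 d2"
 shows "norm (conv d1 d2 a) \<le> sqrt (LINT b|CS. (norm (d1 b))^2) * sqrt (LINT b|CS. (norm (d2 b))^2)"
proof -
 have "norm (conv d1 d2 a) \<le> (LINT b|CS. norm (d1 b * d2 (a - b)))" unfolding conv_def by (rule integral_norm_bound)
 also have "\<dots> \<le> sqrt (LINT b|CS. (norm (d1 b))^2) * sqrt (LINT b|CS. (norm (d2 (a - b)))^2)"
  by (intro integral_Cauchy_Schwarz sq_int_ell2 ell2_shift assms)
 finally show ?thesis using integrable_CS_shift(2)[of "%b. (norm (d2 b))^2" a] by simp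
qed

definition hermitian :: "coeffs => bool" where
 "hermitian d \<longleftrightarrow> (\<forall>a. d (- a) = cnj (d a))"

lemma uminus_sbox: "uminus ` sbox n = sbox n"
proof -
 have "- a \<in> sbox n" if "a \<in> sbox n" for a using that by (auto simp: sbox_def)
 thus ?thesis by (metis (no_types, opaque_lifting) add.inverse_inverse image_eqI image_subsetI subset_antisym subsetI)
qed

context torus2
begin

text \<open>Symbol of minus the Laplacian.\<close>

definition nf :: "int \<times> int => real" where
 "nf a = (2 * pi * of_int (fst a) / L1)^2 + (2 * pi * of_int (snd a) / L2)^2"

lemma nf_nonneg: "0 \<le> nf a" by (simp add: nf_def)

text \<open>In two dimensions the left side is summable; it is compared with the product weight
  through \<open>(1 + k^2) * (1 + l^2) \<le> (1 + k^2 + l^2)^2\<close>.\<close>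

lemma nf_wt: "\<exists>K>0. \<forall>a. 1 / (1 + nf a)^2 \<le> K * wt a"
proof -
 define c where "c = min 1 (min ((2 * pi / L1)^2) ((2 * pi / L2)^2))"
 have c: "0 < c" "c \<le> 1" "c \<le> (2 * pi / L1)^2" "c \<le> (2 * pi / L2)^2" using L1 L2 by (auto simp: c_def)
 have "1 / (1 + nf a)^2 \<le> 1 / c^2 * wt a" for a
 proof -
  let ?k = "real_of_int (fst a)" and ?l = "real_of_int (snd a)"
  have "c * ?k^2 \<le> (2 * pi / L1)^2 * ?k^2" "c * ?l^2 \<le> (2 * pi / L2)^2 * ?l^2"
   using c by (intro mult_right_mono; simp)+
  hence "c * (1 + ?k^2 + ?l^2) \<le> 1 + nf a" using c(2) by (simp add: nf_def power_mult_distrib power_divide algebra_simps)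
  hence "(c * (1 + ?k^2 + ?l^2))^2 \<le> (1 + nf a)^2" using c(1) by (intro power_mono) simp_all
  moreover have "(1 + ?k^2) * (1 + ?l^2) \<le> (1 + ?k^2 + ?l^2)^2"
  proof -
   have "0 \<le> ?k^2" "0 \<le> ?l^2" "0 \<le> ?k^2 * ?l^2" "0 \<le> ?k^2 * ?k^2" "0 \<le> ?l^2 * ?l^2" by simp_all
   thus ?thesis unfolding power2_eq_square[of "1 + _ + _"] by (simp add: algebra_simps)
  qed
  hence "c^2 * ((1 + ?k^2) * (1 + ?l^2)) \<le> (c * (1 + ?k^2 + ?l^2))^2"
   by (simp add: power_mult_distrib mult_left_mono)
  ultimately have "c^2 * ((1 + ?k^2) * (1 + ?l^2)) \<le> (1 + nf a)^2" by linarith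
  moreover have "0 < c^2 * ((1 + ?k^2) * (1 + ?l^2))" using c(1) by (intro mult_pos_pos add_pos_nonneg) simp_all
  ultimately have "1 / (1 + nf a)^2 \<le> 1 / (c^2 * ((1 + ?k^2) * (1 + ?l^2)))"
   using nf_nonneg[of a] c(1) by (intro divide_left_mono mult_pos_pos zero_less_power add_pos_nonneg) simp_all
  thus ?thesis by (simp add: wt_def)
 qed
 thus ?thesis using c(1) by (intro exI[of _ "1 / c^2"]) simp
qed

definition H2c :: "coeffs => bool" where
 "H2c d \<longleftrightarrow> integrable CS (%a. (1 + nf a)^2 * (norm (d a))^2)"

lemma H2c_weighted:
 assumes "H2c d" "!!a. norm (m a) \<le> C * (1 + nf a)"
 shows "ell2 (%a. m a * d a)" unfolding ell2_def
proof (rule Bochner_Integration.integrable_bound)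
 show "integrable CS (%a. C^2 * ((1 + nf a)^2 * (norm (d a))^2))"
  using assms(1) unfolding H2c_def by (rule integrable_mult_right)
 have "(norm (m a * d a))^2 \<le> C^2 * ((1 + nf a)^2 * (norm (d a))^2)" for a
 proof -
  have "(norm (m a))^2 * (norm (d a))^2 \<le> (C * (1 + nf a))^2 * (norm (d a))^2"
   using assms(2)[of a] by (intro mult_right_mono power_mono) simp_all
  thus ?thesis by (simp add: norm_mult power_mult_distrib mult.assoc)
 qed
 thus "AE a in CS. norm ((norm (m a * d a))^2) \<le> norm (C^2 * ((1 + nf a)^2 * (norm (d a))^2))" by (intro AE_I2) simp
qed simp

text \<open>Sobolev embedding: split \<open>norm (d a)\<close> into the H2 quantity
  \<open>(1 + nf a) * norm (d a)\<close> and the square summable factor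
  \<open>1 / (1 + nf a)\<close>.\<close>

lemma H2c_abs:
 assumes "H2c d"
 shows "integrable CS d"
proof -
 obtain K where K: "0 < K" "!!a. 1 / (1 + nf a)^2 \<le> K * wt a" using nf_wt by blast
 show ?thesis
 proof (rule Bochner_Integration.integrable_bound)
  show "integrable CS (%a. (1 + nf a)^2 * (norm (d a))^2 + K * wt a)"
   using assms unfolding H2c_def by (intro Bochner_Integration.integrable_add integrable_mult_right integrable_wt)
  have "norm (d a) \<le> (1 + nf a)^2 * (norm (d a))^2 + K * wt a" for a
  proof -
   have n: "0 < 1 + nf a" using nf_nonneg[of a] by simp
   have "norm (d a) = ((1 + nf a) * norm (d a)) * (1 / (1 + nf a))" using n by simp
   also have "\<dots> \<le> ((1 + nf a) * norm (d a))^2 + (1 / (1 + nf a))^2"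
   proof -
    have le: "x * y \<le> x^2 + y^2" if "0 \<le> x * y" for x y :: real using sum_squares_bound[of x y] that by linarith
    show ?thesis by (rule le) (use n in simp)
   qed
   also have "\<dots> = (1 + nf a)^2 * (norm (d a))^2 + 1 / (1 + nf a)^2" by (simp add: power_mult_distrib power_divide)
   finally show ?thesis using K(2)[of a] by linarith
  qed
  moreover have "0 \<le> (1 + nf a)^2 * (norm (d a))^2 + K * wt a" for a using K(1) wt_pos[of a] by simp
  ultimately show "AE a in CS. norm (d a) \<le> norm ((1 + nf a)^2 * (norm (d a))^2 + K * wt a)" by (intro AE_I2) simp
 qed simp
qed

definition fser :: "coeffs => real \<times> real => complex" where
 "fser d z = (LINT a|CS. d a * e a z)"

lemma integrable_fser: "integrable CS d ==> integrable CS (%a. d a * e a z)"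
 by (rule Bochner_Integration.integrable_bound[of CS d]) (simp_all add: norm_mult)

lemma psum_fser: "integrable CS d ==> (%n. psum d (sbox n) z) \<longlonglongrightarrow> fser d z"
 unfolding psum_def fser_def by (intro tendsto_sbox_sum integrable_fser)

lemma measurable_fser:
 assumes "integrable CS d"
 shows "fser d \<in> borel_measurable borel" by (rule borel_measurable_LIMSEQ_metric[OF measurable_psum psum_fser[OF assms]])

lemma norm_psum_le_CS:
 assumes "integrable CS d"
 shows "norm (psum d (sbox n) z) \<le> (LINT a|CS. norm (d a))" by (rule order_trans[OF norm_psum_le sum_le_CS]) (use assms in simp_all)

lemma norm_fser_le: "norm (fser d z) \<le> (LINT a|CS. norm (d a))"
 unfolding fser_def by (rule order_trans[OF integral_norm_bound]) (simp add: norm_mult)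

lemma L2lim_fser:
 assumes d: "integrable CS d"
 shows "L2lim d (fser d)"
proof -
 let ?B = "LINT a|CS. norm (d a)"
 have m: "fser d \<in> borel_measurable M" by (intro measurable_M measurable_fser d)
 have s: "sq_int M (fser d)" by (rule sq_int_bdd[OF m norm_fser_le])
 have "(%n. LINT z|M. (norm (fser d z - psum d (sbox n) z))^2) \<longlonglongrightarrow> (LINT z|M. 0)"
 proof (rule integral_dominated_convergence[where w = "%z. (2 * ?B)^2"])
  show "(%z. (norm (fser d z - psum d (sbox n) z))^2) \<in> borel_measurable M" for n
   by (rule borel_measurable_integrable[OF sq_intD(2)[OF sq_int_diff[OF s sq_int_psum]]])
  show "AE z in M. (%n. (norm (fser d z - psum d (sbox n) z))^2) \<longlonglongrightarrow> 0"
  proof (rule AE_I2)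
   fix z
   have "(%n. (norm (fser d z - psum d (sbox n) z))^2) \<longlonglongrightarrow> (norm (fser d z - fser d z))^2"
    by (intro tendsto_intros psum_fser d)
   thus "(%n. (norm (fser d z - psum d (sbox n) z))^2) \<longlonglongrightarrow> 0" by simp
  qed
  have "(norm (fser d z - psum d (sbox n) z))^2 \<le> (2 * ?B)^2" for n z
   using norm_triangle_ineq4[of "fser d z" "psum d (sbox n) z"] norm_fser_le[of d z] norm_psum_le_CS[OF d, of n z] by (intro power_mono) simp_all
  thus "AE z in M. norm ((norm (fser d z - psum d (sbox n) z))^2) \<le> (2 * ?B)^2" for n by (intro AE_I2) simp
 qed simp_all
 thus ?thesis using s by (simp add: L2lim_def)
qed

lemma psum_real:
 assumes "hermitian d"
 shows "of_real (Re (psum d (sbox n) z)) = psum d (sbox n) z"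
proof -
 have "cnj (psum d (sbox n) z) = (\<Sum>a\<in>sbox n. d (- a) * e (- a) z)" unfolding psum_def cnj_sum complex_cnj_mult cnj_e
  by (intro sum.cong refl arg_cong2[where f = "(*)"] assms[unfolded hermitian_def, rule_format, symmetric])
 also have "\<dots> = (\<Sum>a\<in>uminus ` sbox n. d a * e a z)" by (subst sum.reindex) (simp_all add: inj_on_def)
 also have "\<dots> = psum d (sbox n) z" by (simp add: uminus_sbox psum_def)
 finally show ?thesis by (simp add: complex_eq_iff)
qed

text \<open>For a hermitian family the partial sums are real, so taking the real part of the limit
  does not increase the distance to them. This turns complex limits into the real functions that the
  definitions demand.\<close>

lemma L2lim_Re:
 assumes F: "L2lim d F" and h: "hermitian d"
 shows "L2lim d (%z. of_real (Re (F z)))"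
proof -
 have s: "sq_int M F" and l: "(%n. LINT z|M. (norm (F z - psum d (sbox n) z))^2) \<longlonglongrightarrow> 0"
  using F by (simp_all add: L2lim_def)
 have m: "(%z. complex_of_real (Re (F z))) \<in> borel_measurable M" using sq_intD(1)[OF s] by measurable
 have s2: "sq_int M (%z. complex_of_real (Re (F z)))" unfolding sq_int_def
 proof
  show "integrable M (%z. (norm (complex_of_real (Re (F z))))^2)"
  proof (rule Bochner_Integration.integrable_bound[OF sq_intD(2)[OF s]])
   show "(%z. (norm (complex_of_real (Re (F z))))^2) \<in> borel_measurable M" using m by measurable
   have "(norm (complex_of_real (Re (F z))))^2 \<le> (norm (F z))^2" for z
    using abs_Re_le_cmod[of "F z"] by (intro power_mono) simp_all
   thus "AE z in M. norm ((norm (complex_of_real (Re (F z))))^2) \<le> norm ((norm (F z))^2)" by (intro AE_I2) simp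
  qed
 qed (rule m)
 have "(%n. LINT z|M. (norm (complex_of_real (Re (F z)) - psum d (sbox n) z))^2) \<longlonglongrightarrow> 0"
 proof (rule tendsto_sandwich[OF _ _ tendsto_const l])
  show "\<forall>\<^sub>F n in sequentially. 0 \<le> (LINT z|M. (norm (complex_of_real (Re (F z)) - psum d (sbox n) z))^2)"
   by (intro always_eventually allI Bochner_Integration.integral_nonneg) simp
  have "(norm (complex_of_real (Re (F z)) - psum d (sbox n) z))^2 \<le> (norm (F z - psum d (sbox n) z))^2" for n z
  proof -
   have "complex_of_real (Re (F z)) - psum d (sbox n) z = of_real (Re (F z - psum d (sbox n) z))" by (subst psum_real[OF h, symmetric]) simp
   thus ?thesis using abs_Re_le_cmod[of "F z - psum d (sbox n) z"] by (intro power_mono) (simp_all only: norm_of_real norm_ge_zero)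
  qed
  thus "\<forall>\<^sub>F n in sequentially. (LINT z|M. (norm (complex_of_real (Re (F z)) - psum d (sbox n) z))^2)
    \<le> (LINT z|M. (norm (F z - psum d (sbox n) z))^2)"
   by (intro always_eventually allI integral_mono sq_intD(2) sq_int_diff s s2 sq_int_psum)
 qed
 with s2 show ?thesis by (simp add: L2lim_def)
qed

text \<open>Pairing with \<open>e a\<close> itself and without normalisation: summed against
  coefficients it gives the integral against the test function (\<open>L2lim_test\<close>,
  \<open>Parseval_test\<close>).\<close>

definition pc :: "(real \<times> real => real) => coeffs" where
 "pc f a = (LINT z|M. of_real (f z) * e a z)"

lemma norm_pc_le:
 assumes "torus_test L1 L2 f" "!!z. z \<in> space M ==> \<bar>f z\<bar> \<le> B"
 shows "norm (pc f a) \<le> LL * B"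
proof -
 have i: "integrable M (%z. complex_of_real (f z) * e a z)" by (intro integrable_continuous continuous_intros continuous_of_real_test assms)
 have "norm (pc f a) \<le> (LINT z|M. norm (complex_of_real (f z) * e a z))" unfolding pc_def by (rule integral_norm_bound)
 also have "\<dots> \<le> (LINT z|M. B)" using i assms(2) by (intro integral_mono integrable_norm) (simp_all add: norm_mult)
 finally show ?thesis using measure_M by simp
qed

lemma pc_partialD: "torus_test L1 L2 f ==> pc (partialD i j f) a = (-1) ^ (i + j) * (mx a ^ i * my a ^ j) * pc f a"
 unfolding pc_def by (rule integral_partialD_test)

text \<open>Two derivatives in each variable: the coefficients of
  \<open>(1 - d_x^2) (1 - d_y^2) f\<close> are those of \<open>f\<close> times a factor bounded
  below by a multiple of \<open>1 / wt a\<close>. The constant does not depend on \<open>f\<close>,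
  which makes the estimate uniform over time slices.\<close>

lemma pc_decay:
 "\<exists>K>0. \<forall>f B a. torus_test L1 L2 f -->
   (\<forall>z\<in>space M. \<bar>f z\<bar> \<le> B \<and> \<bar>partialD 2 0 f z\<bar> \<le> B \<and> \<bar>partialD 0 2 f z\<bar> \<le> B \<and> \<bar>partialD 2 2 f z\<bar> \<le> B)
   --> norm (pc f a) \<le> K * B * wt a"
proof -
 define c where "c = min 1 (min ((2 * pi / L1)^2) ((2 * pi / L2)^2))"
 have c: "0 < c" "c \<le> 1" "c \<le> (2 * pi / L1)^2" "c \<le> (2 * pi / L2)^2" using L1 L2 by (auto simp: c_def)
 have "norm (pc f a) \<le> (4 * LL / c^2) * B * wt a"
  if f: "torus_test L1 L2 f" and B: "\<forall>z\<in>space M. \<bar>f z\<bar> \<le> B \<and> \<bar>partialD 2 0 f z\<bar> \<le> B \<and> \<bar>partialD 0 2 f z\<bar> \<le> B \<and> \<bar>partialD 2 2 f z\<bar> \<le> B"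
  for f B a
 proof -
  let ?k = "real_of_int (fst a)" and ?l = "real_of_int (snd a)"
  define P where "P = (1 + (2 * pi / L1)^2 * ?k^2) * (1 + (2 * pi / L2)^2 * ?l^2)"
  have mm: "(mx a)^2 = - of_real ((2 * pi / L1)^2 * ?k^2)" "(my a)^2 = - of_real ((2 * pi / L2)^2 * ?l^2)"
   by (simp_all add: mx_def my_def power_mult_distrib power_divide)
  have "of_real P * pc f a = pc f a - pc (partialD 2 0 f) a - pc (partialD 0 2 f) a + pc (partialD 2 2 f) a"
   unfolding pc_partialD[OF f] P_def by (simp add: mm algebra_simps)
  also have "norm \<dots> \<le> norm (pc f a) + norm (pc (partialD 2 0 f) a) + norm (pc (partialD 0 2 f) a) + norm (pc (partialD 2 2 f) a)"
   by (intro norm_triangle_mono order_refl order_trans[OF norm_triangle_ineq4] add_mono)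
  also have "\<dots> \<le> LL * B + LL * B + LL * B + LL * B" using B by (intro add_mono norm_pc_le torus_test_partialD f) blast+
  finally have "P * norm (pc f a) \<le> 4 * LL * B" unfolding norm_mult norm_of_real by (simp add: P_def abs_of_nonneg mult_ac)
  moreover have "c^2 / wt a \<le> P"
  proof -
   have "c * (1 + ?k^2) \<le> 1 + (2 * pi / L1)^2 * ?k^2" "c * (1 + ?l^2) \<le> 1 + (2 * pi / L2)^2 * ?l^2"
    using mult_right_mono[OF c(3), of "?k^2"] mult_right_mono[OF c(4), of "?l^2"] c(2) by (simp_all add: distrib_left)
   hence "(c * (1 + ?k^2)) * (c * (1 + ?l^2)) \<le> P" unfolding P_def using c(1) by (intro mult_mono) simp_all
   thus ?thesis by (simp add: wt_def power2_eq_square mult_ac)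
  qed
  ultimately have "c^2 / wt a * norm (pc f a) \<le> 4 * LL * B"
   using mult_right_mono[of "c^2 / wt a" P "norm (pc f a)"] by (simp del: times_divide_eq_left)
  thus ?thesis using c(1) wt_pos[of a] by (simp add: field_simps)
 qed
 thus ?thesis using c(1) LL_pos by (intro exI[of _ "4 * LL / c^2"]) simp
qed

end

section \<open>Weak derivatives as Fourier multipliers\<close>

context torus2
begin

definition mder :: "nat => nat => coeffs" where
 "mder i j a = mx a ^ i * my a ^ j"

lemma norm_mx: "(norm (mx a))^2 + (norm (my a))^2 = nf a"
 unfolding mx_def my_def nf_def norm_mult norm_of_real norm_ii mult_1_left power2_abs ..

lemma index_le_2: "i + j \<le> 2 \<longleftrightarrow> (i, j) \<in> {(0, 0), (1, 0), (0, 1), (2, 0), (1, 1), (0, 2 :: nat)}"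
 for i j :: nat
proof -
 have "i = 0 \<or> i = 1 \<or> i = 2 \<or> 2 < i" "j = 0 \<or> j = 1 \<or> j = 2 \<or> 2 < j" by arith+
 thus ?thesis by (elim disjE) simp_all
qed

lemma norm_mder_le:
 assumes "i + j \<le> 2"
 shows "norm (mder i j a) \<le> 1 * (1 + nf a)"
proof -
 define x y where "x = norm (mx a)" and "y = norm (my a)"
 have xy: "x^2 + y^2 = nf a" "0 \<le> x" "0 \<le> y" by (simp_all add: x_def y_def norm_mx)
 have "x \<le> 1 + x^2" "y \<le> 1 + y^2" using sum_squares_bound[of x 1] sum_squares_bound[of y 1] xy by simp_all
 moreover have "x * y \<le> x^2 + y^2" using sum_squares_bound[of x y] mult_nonneg_nonneg[OF xy(2,3)] by linarith
 moreover have "0 \<le> x^2" "0 \<le> y^2" by simp_all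
 ultimately have b: "1 \<le> 1 + nf a" "x \<le> 1 + nf a" "y \<le> 1 + nf a" "x^2 \<le> 1 + nf a" "y^2 \<le> 1 + nf a" "x * y \<le> 1 + nf a"
  using xy(1) by linarith+
 have "norm (mder i j a) = x ^ i * y ^ j" by (simp add: mder_def norm_mult norm_power x_def y_def)
 thus ?thesis using assms[unfolded index_le_2] b by auto
qed

lemma mx_uminus: "mx (- a) = cnj (mx a)" and my_uminus: "my (- a) = cnj (my a)" by (simp_all add: mx_def my_def)

lemma hermitian_mder: "hermitian d ==> hermitian (%a. mder i j a * d a)"
 unfolding hermitian_def mder_def mx_uminus my_uminus by simp

lemma in_L2_iff: "in_L2 L1 L2 f \<longleftrightarrow> sq_int M (%z. complex_of_real (f z))"
proof -
 have "f \<in> borel_measurable M" if "(%z. complex_of_real (f z)) \<in> borel_measurable M"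
 proof -
  have "(%z. Re (complex_of_real (f z))) \<in> borel_measurable M" using that by measurable
  thus ?thesis by simp
 qed
 moreover have "(%z. complex_of_real (f z)) \<in> borel_measurable M" if "f \<in> borel_measurable M" using that by measurable
 ultimately show ?thesis unfolding in_L2_def sq_int_def norm_of_real power2_abs by blast
qed

lemma L2norm_eq: "(L2norm L1 L2 f)^2 = (LINT z|M. (norm (complex_of_real (f z)))^2)"
 unfolding L2norm_def norm_of_real power2_abs by (simp add: Bochner_Integration.integral_nonneg)

lemma L2norm_L2lim: "L2lim d (%z. of_real (f z)) ==> (L2norm L1 L2 f)^2 = LL * (LINT a|CS. (norm (d a))^2)"
 unfolding L2norm_eq by (rule L2lim_norm)

lemma of_real_integral_test: "of_real (LINT z|M. f z * g z) = (LINT z|M. complex_of_real (f z) * of_real (g z))"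
 unfolding integral_complex_of_real[symmetric] by simp

lemma sq_int_test: "torus_test L1 L2 \<psi> ==> sq_int M (%z. complex_of_real (\<psi> z))"
 by (intro sq_int_continuous continuous_of_real_test)

lemma L2lim_test:
 assumes "L2lim d (%z. of_real (f z))" "torus_test L1 L2 \<psi>"
 shows "(%n. \<Sum>a\<in>sbox n. d a * pc \<psi> a) \<longlonglongrightarrow> of_real (LINT z|M. f z * \<psi> z)"
 unfolding of_real_integral_test using L2lim_sum[OF assms(1) sq_int_test[OF assms(2)]] by (simp add: pc_def mult.commute)

lemma e_wave: "e b z = of_real (wave 1 b z) + \<i> * of_real (wave (- \<i>) b z)" by (simp add: wave_def complex_eq_iff)

text \<open>One direction tests with real waves and reads off the coefficients of \<open>g\<close>;
  the other is the Parseval pairing. Consequently the unspecified representative chosen in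
  \<open>weakD\<close> has known coefficients.\<close>

lemma weak_deriv_char:
 assumes F: "L2lim d (%z. of_real (f z))"
 shows "has_weak_deriv L1 L2 i j f g \<longleftrightarrow> L2lim (%a. mder i j a * d a) (%z. of_real (g z))"
proof -
 let ?s = "(-1) ^ (i + j) :: real"
 have T: "(%n. \<Sum>a\<in>sbox n. (mder i j a * d a) * pc \<psi> a) \<longlonglongrightarrow> of_real (?s * (LINT z|M. f z * partialD i j \<psi> z))"
  if \<psi>: "torus_test L1 L2 \<psi>" for \<psi>
 proof -
  have "(%n. of_real ?s * (\<Sum>a\<in>sbox n. d a * pc (partialD i j \<psi>) a)) \<longlonglongrightarrow> of_real ?s * of_real (LINT z|M. f z * partialD i j \<psi> z)"
   by (intro tendsto_intros L2lim_test[OF F] torus_test_partialD \<psi>)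
  moreover have "of_real ?s * (\<Sum>a\<in>sbox n. d a * pc (partialD i j \<psi>) a) = (\<Sum>a\<in>sbox n. (mder i j a * d a) * pc \<psi> a)" for n
   unfolding sum_distrib_left
  proof (rule sum.cong[OF refl])
   fix a
   show "of_real ?s * (d a * pc (partialD i j \<psi>) a) = (mder i j a * d a) * pc \<psi> a"
   proof -
    have "of_real ?s * (d a * pc (partialD i j \<psi>) a)
      = (of_real ?s * (-1) ^ (i + j)) * ((mder i j a * d a) * pc \<psi> a)"
     unfolding pc_partialD[OF \<psi>] mder_def[symmetric] by (simp only: mult_ac)
    also have "of_real ?s * ((-1) ^ (i + j) :: complex) = 1" by (simp flip: power_mult_distrib)
    finally show ?thesis by (simp only: mult_1_left)
   qed
  qed
  ultimately show ?thesis unfolding of_real_mult by (simp only:)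
 qed
 have s2: "?s * (?s * x) = x" for x by (simp flip: power_mult_distrib mult.assoc)
 show ?thesis
 proof
  assume w: "has_weak_deriv L1 L2 i j f g"
  hence g: "sq_int M (%z. complex_of_real (g z))" by (simp add: has_weak_deriv_def in_L2_iff)
  have Tg: "(%n. \<Sum>a\<in>sbox n. (mder i j a * d a) * pc \<psi> a) \<longlonglongrightarrow> of_real (LINT z|M. g z * \<psi> z)"
   if "torus_test L1 L2 \<psi>" for \<psi> using T[OF that] w that s2 by (simp add: has_weak_deriv_def)
  have "fcoef (%z. of_real (g z)) b = mder i j b * d b" for b
  proof -
   let ?u = "wave 1 (- b)" and ?v = "wave (- \<i>) (- b)"
   have ge: "(LINT z|M. of_real (g z) * e (- b) z) = of_real (LINT z|M. g z * ?u z) + \<i> * of_real (LINT z|M. g z * ?v z)"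
    unfolding of_real_integral_test e_wave[of "- b"] using sq_int_mult_integrable[OF g sq_int_test[OF torus_test_wave[of 1 "- b"]]]
     sq_int_mult_integrable[OF g sq_int_test[OF torus_test_wave[of "- \<i>" "- b"]]] by (simp add: distrib_left mult.left_commute[of _ \<i>])
   have "(%n. (\<Sum>a\<in>sbox n. (mder i j a * d a) * pc ?u a) + \<i> * (\<Sum>a\<in>sbox n. (mder i j a * d a) * pc ?v a))
     \<longlonglongrightarrow> of_real (LINT z|M. g z * ?u z) + \<i> * of_real (LINT z|M. g z * ?v z)"
    by (intro tendsto_intros Tg torus_test_wave)
   moreover have "(\<Sum>a\<in>sbox n. (mder i j a * d a) * pc ?u a) + \<i> * (\<Sum>a\<in>sbox n. (mder i j a * d a) * pc ?v a)
     = (\<Sum>a\<in>sbox n. if a = b then mder i j b * d b * LL else 0)" for n unfolding sum_distrib_left sum.distrib[symmetric]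
   proof (rule sum.cong[OF refl])
    fix a
    have "pc ?u a + \<i> * pc ?v a = (LINT z|M. e (- b) z * e a z)" unfolding pc_def e_wave[of "- b"] distrib_right
     using sq_int_mult_integrable[OF sq_int_test[OF torus_test_wave[of 1 "- b"]] sq_int_e[of a]]
      sq_int_mult_integrable[OF sq_int_test[OF torus_test_wave[of "- \<i>" "- b"]] sq_int_e[of a]] by (simp add: mult.assoc)
    also have "\<dots> = (if a = b then of_real LL else 0)" by (auto simp: integral_e_mult)
    finally have *: "pc ?u a + \<i> * pc ?v a = (if a = b then of_real LL else 0)" .
    have "mder i j a * d a * pc ?u a + \<i> * (mder i j a * d a * pc ?v a) = mder i j a * d a * (pc ?u a + \<i> * pc ?v a)"
     by (simp add: algebra_simps)
    thus "mder i j a * d a * pc ?u a + \<i> * (mder i j a * d a * pc ?v a) = (if a = b then mder i j b * d b * LL else 0)" unfolding * by simp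
   qed
   moreover have "(%n. \<Sum>a\<in>sbox n. if a = b then mder i j b * d b * LL else 0) \<longlonglongrightarrow> mder i j b * d b * LL"
    by (rule tendsto_eventually) (use eventually_in_sbox[of b] in eventually_elim, simp)
   ultimately have "(LINT z|M. of_real (g z) * e (- b) z) = mder i j b * d b * LL" unfolding ge by (simp only: LIMSEQ_unique)
   thus ?thesis using L1 L2 by (simp add: fcoef_def)
  qed
  hence "fcoef (%z. of_real (g z)) = (%a. mder i j a * d a)" by (rule ext)
  thus "L2lim (%a. mder i j a * d a) (%z. of_real (g z))" using fourier_L2lim[OF g] by (simp only:)
 next
  assume g: "L2lim (%a. mder i j a * d a) (%z. of_real (g z))"
  hence "in_L2 L1 L2 g" by (simp add: in_L2_iff L2lim_def)
  moreover have "(LINT z|M. f z * partialD i j \<psi> z) = ?s * (LINT z|M. g z * \<psi> z)" if \<psi>: "torus_test L1 L2 \<psi>" for \<psi>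
  proof -
   have "complex_of_real (LINT z|M. g z * \<psi> z) = of_real (?s * (LINT z|M. f z * partialD i j \<psi> z))"
    by (rule LIMSEQ_unique[OF L2lim_test[OF g \<psi>] T[OF \<psi>]])
   hence "(LINT z|M. g z * \<psi> z) = ?s * (LINT z|M. f z * partialD i j \<psi> z)" unfolding of_real_eq_iff .
   thus ?thesis using s2 by simp
  qed
  ultimately show "has_weak_deriv L1 L2 i j f g" by (simp add: has_weak_deriv_def)
 qed
qed

text \<open>For summable \<open>d\<close> the representative is fixed at every point by an
  absolutely convergent series; joint measurability in time and space rests on this.\<close>

definition rser :: "coeffs => real \<times> real => real" where
 "rser d z = Re (fser d z)"

lemma L2lim_rser: "integrable CS d ==> hermitian d ==> L2lim d (%z. of_real (rser d z))"
 unfolding rser_def by (intro L2lim_Re L2lim_fser)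

lemma weakD_rser:
 assumes d: "H2c d" "hermitian d" and ij: "i + j \<le> 2"
 shows "L2lim (%a. mder i j a * d a) (%z. of_real (weakD L1 L2 i j (rser d) z))"
  "\<exists>g. has_weak_deriv L1 L2 i j (rser d) g"
proof -
 note F = L2lim_rser[OF H2c_abs[OF d(1)] d(2)]
 obtain G where "L2lim (%a. mder i j a * d a) G" using Riesz_Fischer[OF H2c_weighted[OF d(1) norm_mder_le[OF ij]]] by blast
 hence "L2lim (%a. mder i j a * d a) (%z. of_real (Re (G z)))" by (intro L2lim_Re hermitian_mder d)
 from exI[of "has_weak_deriv L1 L2 i j (rser d)", OF weak_deriv_char[OF F, THEN iffD2, OF this]]
 show ex: "\<exists>g. has_weak_deriv L1 L2 i j (rser d) g" .
 have "has_weak_deriv L1 L2 i j (rser d) (weakD L1 L2 i j (rser d))" unfolding weakD_def by (rule someI_ex[OF ex])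
 thus "L2lim (%a. mder i j a * d a) (%z. of_real (weakD L1 L2 i j (rser d) z))" by (rule weak_deriv_char[OF F, THEN iffD1])
qed

lemma in_L2_rser: "H2c d ==> hermitian d ==> in_L2 L1 L2 (rser d)"
 using L2lim_rser[OF H2c_abs] by (simp add: in_L2_iff L2lim_def)

lemma L2norm_rser: "H2c d ==> hermitian d ==> (L2norm L1 L2 (rser d))^2 = LL * (LINT a|CS. (norm (d a))^2)"
 by (intro L2norm_L2lim L2lim_rser H2c_abs)

lemma in_H2_rser: "H2c d ==> hermitian d ==> in_H2 L1 L2 (rser d)" using in_L2_rser weakD_rser(2) by (simp add: in_H2_def)

lemma H2norm_rser:
 assumes "H2c d" "hermitian d"
 shows "(H2norm L1 L2 (rser d))^2 = (\<Sum>(i, j)\<in>{(i, j). i + j \<le> 2}. LL * (LINT a|CS. (norm (mder i j a * d a))^2))"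
proof -
 have "(H2norm L1 L2 (rser d))^2 = (\<Sum>(i, j)\<in>{(i, j). i + j \<le> 2}. (L2norm L1 L2 (weakD L1 L2 i j (rser d)))^2)"
  unfolding H2norm_def by (subst real_sqrt_pow2) (auto intro!: sum_nonneg)
 also have "\<dots> = (\<Sum>(i, j)\<in>{(i, j). i + j \<le> 2}. LL * (LINT a|CS. (norm (mder i j a * d a))^2))"
 proof (rule sum.cong[OF refl])
  fix x assume "x \<in> {(i, j). i + j \<le> (2 :: nat)}"
  then obtain i j where x: "x = (i, j)" "i + j \<le> 2" by auto
  show "(case x of (i, j) => (L2norm L1 L2 (weakD L1 L2 i j (rser d)))^2)
    = (case x of (i, j) => LL * (LINT a|CS. (norm (mder i j a * d a))^2))"
   unfolding x(1) prod.case by (rule L2norm_L2lim[OF weakD_rser(1)[OF assms x(2)]])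
 qed
 finally show ?thesis .
qed

text \<open>The product of two L2 functions is only integrable, so the character is attached to the
  second factor and the series of the first is paired with the result in L2.\<close>

lemma fcoef_mult:
 assumes F: "L2lim d1 F" and G: "L2lim d2 G"
 shows "fcoef (%z. F z * G z) a = conv d1 d2 a"
proof -
 have Gs: "sq_int M G" using G by (simp add: L2lim_def)
 have ge: "sq_int M (%z. G z * e (- a) z)" by (rule sq_int_mult_bdd[where B = 1]) (simp_all add: Gs measurable_M[OF measurable_e])
 have coe: "(LINT z|M. e b z * (G z * e (- a) z)) = d2 (a - b) * LL" for b
 proof -
  have eq: "e b z * (G z * e (- a) z) = G z * e (- (a - b)) z" for z
  proof -
   have "e (- (a - b)) z = e b z * e (- a) z" unfolding e_add[symmetric] by (rule arg_cong2[where f = e]) simp_all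
   thus ?thesis by simp
  qed
  show ?thesis unfolding eq using L2lim_fcoef[OF G, of "a - b"] L1 L2 by (simp add: fcoef_def field_simps)
 qed
 have "(%n. \<Sum>b\<in>sbox n. d1 b * (d2 (a - b) * LL)) \<longlonglongrightarrow> (LINT z|M. F z * (G z * e (- a) z))"
  using L2lim_sum[OF F ge] unfolding coe .
 moreover have "(%n. (\<Sum>b\<in>sbox n. d1 b * d2 (a - b)) * LL) \<longlonglongrightarrow> conv d1 d2 a * LL"
  unfolding conv_def by (intro tendsto_intros tendsto_sbox_sum conv_integrable L2lim_ell2[OF F] L2lim_ell2[OF G])
 ultimately have "(LINT z|M. F z * (G z * e (- a) z)) = conv d1 d2 a * LL" using LIMSEQ_unique by (simp add: sum_distrib_right mult.assoc)
 thus ?thesis using L1 L2 by (simp add: fcoef_def mult.assoc)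
qed

lemma pc_integrable:
 assumes "torus_test L1 L2 \<psi>"
 shows "integrable CS (pc \<psi>)"
proof -
 obtain K where K: "0 < K" "!!f B a. torus_test L1 L2 f ==>
   (\<forall>z\<in>space M. \<bar>f z\<bar> \<le> B \<and> \<bar>partialD 2 0 f z\<bar> \<le> B \<and> \<bar>partialD 0 2 f z\<bar> \<le> B \<and> \<bar>partialD 2 2 f z\<bar> \<le> B)
   ==> norm (pc f a) \<le> K * B * wt a" using pc_decay by blast
 have bd: "\<exists>B. \<forall>z\<in>space M. \<bar>f z\<bar> \<le> B" if "torus_test L1 L2 f" for f
 proof -
  have "compact (f ` ({0..L1} \<times> {0..L2}))" by (intro compact_continuous_image compact_Times torus_test_continuous[OF that] compact_Icc)
  then obtain B where "\<forall>x\<in>f ` ({0..L1} \<times> {0..L2}). norm x \<le> B" using compact_imp_bounded bounded_iff by blast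
  hence "\<forall>z\<in>space M. \<bar>f z\<bar> \<le> B" by (auto simp: space_M)
  thus ?thesis ..
 qed
 note tt = torus_test_partialD[OF assms]
 obtain B0 B1 B2 B3 where B: "\<forall>z\<in>space M. \<bar>\<psi> z\<bar> \<le> B0" "\<forall>z\<in>space M. \<bar>partialD 2 0 \<psi> z\<bar> \<le> B1"
  "\<forall>z\<in>space M. \<bar>partialD 0 2 \<psi> z\<bar> \<le> B2" "\<forall>z\<in>space M. \<bar>partialD 2 2 \<psi> z\<bar> \<le> B3"
  using bd[OF assms] bd[OF tt[of 2 0]] bd[OF tt[of 0 2]] bd[OF tt[of 2 2]] by blast
 define B where "B = max (max B0 B1) (max B2 B3)"
 have "norm (pc \<psi> a) \<le> K * B * wt a" for a using B by (intro K(2) assms) (auto simp: B_def le_max_iff_disj)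
 hence "norm (pc \<psi> a) \<le> norm (K * B * wt a)" for a unfolding real_norm_def using abs_ge_self order_trans by blast
 thus ?thesis by (intro Bochner_Integration.integrable_bound[OF integrable_mult_right[OF integrable_wt, of "K * B"]] AE_I2) simp_all
qed

text \<open>Applied to the squared gradient, which is handled as a merely integrable function.
  Convergence comes from the side of the test function, whose series converges absolutely and hence
  boundedly.\<close>

theorem Parseval_test:
 assumes f: "integrable M f" and \<psi>: "torus_test L1 L2 \<psi>"
 shows "(%n. \<Sum>a\<in>sbox n. fcoef f a * pc \<psi> a) \<longlonglongrightarrow> (LINT z|M. f z * of_real (\<psi> z))"
proof -
 \<comment> \<open>The sign change and the division turn the pairing \<open>pc\<close> into ordinary
   Fourier coefficients.\<close>
 define q where "q a = pc \<psi> (- a) / LL" for a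
 have q: "integrable CS q" using integrable_CS_shift(1)[of "pc \<psi>" 0] pc_integrable[OF \<psi>] unfolding q_def[abs_def] by simp
 have fq: "fcoef (%z. of_real (\<psi> z)) a = q a" for a by (simp add: fcoef_def q_def pc_def)
 have s: "sq_int M (%z. complex_of_real (\<psi> z))" "sq_int M (fser q)"
  using sq_int_test[OF \<psi>] L2lim_fser[OF q] by (simp_all add: L2lim_def)
 have "(LINT z|M. (of_real (\<psi> z) - fser q z) * e a z) = 0" for a
 proof -
  have "(LINT z|M. of_real (\<psi> z) * e a z) = (LINT z|M. fser q z * e a z)"
  proof -
   have "(LINT z|M. of_real (\<psi> z) * e a z) / complex_of_real LL = (LINT z|M. fser q z * e a z) / complex_of_real LL"
    using trans[OF fq[of "- a"] L2lim_fcoef[OF L2lim_fser[OF q], of "- a", symmetric]] unfolding fcoef_def minus_minus .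
   moreover have "complex_of_real LL \<noteq> 0" using L1 L2 by simp
   ultimately show ?thesis by (simp only: divide_cancel_right simp_thms)
  qed
  thus ?thesis using sq_int_mult_integrable[OF s(1) sq_int_e, of a] sq_int_mult_integrable[OF s(2) sq_int_e, of a] by (simp add: left_diff_distrib)
 qed
 hence ae: "AE z in M. of_real (\<psi> z) - fser q z = 0" by (intro AE_zero_if_coeffs_zero sq_int_integrable sq_int_diff s)
 have fm: "f \<in> borel_measurable M" using f by (rule borel_measurable_integrable)
 have "(%n. LINT z|M. f z * psum q (sbox n) z) \<longlonglongrightarrow> (LINT z|M. f z * of_real (\<psi> z))"
 proof (rule integral_dominated_convergence[where w = "%z. norm (f z) * (LINT a|CS. norm (q a))"])
  show "(%z. f z * of_real (\<psi> z)) \<in> borel_measurable M" by (intro borel_measurable_times fm sq_intD(1) s)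
  show "(%z. f z * psum q (sbox n) z) \<in> borel_measurable M" for n by (intro borel_measurable_times fm measurable_M measurable_psum)
  show "integrable M (%z. norm (f z) * (LINT a|CS. norm (q a)))" using f by simp
  show "AE z in M. (%n. f z * psum q (sbox n) z) \<longlonglongrightarrow> f z * of_real (\<psi> z)" using ae
  proof eventually_elim
   case (elim z)
   hence "of_real (\<psi> z) = fser q z" by simp
   thus ?case by (simp only:) (intro tendsto_intros psum_fser q)
  qed
  show "AE z in M. norm (f z * psum q (sbox n) z) \<le> norm (f z) * (LINT a|CS. norm (q a))" for n
   unfolding norm_mult by (intro AE_I2 mult_left_mono norm_psum_le_CS q norm_ge_zero)
 qed
 moreover have "(LINT z|M. f z * psum q (sbox n) z) = (\<Sum>a\<in>sbox n. fcoef f a * pc \<psi> a)" for n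
 proof -
  have ie: "integrable M (%z. f z * e a z)" for a by (rule Bochner_Integration.integrable_bound[OF f])
     (simp_all add: norm_mult borel_measurable_times[OF fm measurable_M[OF measurable_e]])
  have "(LINT z|M. f z * psum q (sbox n) z) = (LINT z|M. (\<Sum>a\<in>sbox n. q a * (f z * e a z)))"
   by (simp add: psum_def sum_distrib_left mult.left_commute)
  also have "\<dots> = (\<Sum>a\<in>sbox n. q a * (LINT z|M. f z * e a z))" using ie by (simp add: Bochner_Integration.integral_sum)
  also have "\<dots> = (\<Sum>a\<in>sbox n. fcoef f (- a) * pc \<psi> (- a))" using L1 L2 by (intro sum.cong refl) (simp add: q_def fcoef_def)
  also have "\<dots> = (\<Sum>a\<in>uminus ` sbox n. fcoef f a * pc \<psi> a)" by (subst sum.reindex) (simp_all add: inj_on_def)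
  finally show ?thesis by (simp add: uminus_sbox)
 qed
 ultimately show ?thesis by simp
qed

end

section \<open>Time integrals and time slices of test functions\<close>

definition Nt :: "real => real measure" where "Nt T = lebesgue_on {0..<T}"

lemma measurable_Nt: "f \<in> borel_measurable borel ==> f \<in> borel_measurable (Nt T)"
 unfolding Nt_def by (intro measurable_restrict_space1 measurable_completion) simp

lemma space_Nt: "space (Nt T) = {0..<T}" by (simp add: Nt_def)

lemma integral_Nt:
 fixes g :: "real => 'b::euclidean_space"
 assumes "continuous_on UNIV g"
 shows "integrable (Nt T) g" "(LINT t|Nt T. g t) = integral {0..T} g"
proof -
 have s: "set_integrable lebesgue {0..T} g" by (rule absolutely_integrable_continuous_real[OF continuous_on_subset[OF assms]]) simp
 hence s2: "set_integrable lebesgue {0..<T} g" by (rule set_integrable_subset) auto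
 show "integrable (Nt T) g" using s2 unfolding Nt_def set_integrable_def by (subst integrable_restrict_space) simp_all
 have "(LINT t|Nt T. g t) = (LINT t:{0..<T}|lebesgue. g t)" unfolding Nt_def set_lebesgue_integral_def by (subst integral_restrict_space) simp_all
 also have "\<dots> = integral {0..<T} g" by (rule set_lebesgue_integral_eq_integral(2)[OF s2])
 also have "\<dots> = integral {0..T} g"
  by (rule integral_subset_negligible[symmetric, OF _ negligible_subset[OF negligible_sing[of T]], symmetric]) auto
 finally show "(LINT t|Nt T. g t) = integral {0..T} g" .
qed

lemma finite_measure_Nt: "finite_measure (Nt T)"
proof (rule finite_measureI)
 have "emeasure (Nt T) (space (Nt T)) = emeasure lborel {0..<T}" unfolding Nt_def by (subst emeasure_restrict_space) (simp_all add: main_part_sets)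
 also have "\<dots> \<noteq> \<infinity>" by (cases "0 \<le> T") simp_all
 finally show "emeasure (Nt T) (space (Nt T)) \<noteq> \<infinity>" .
qed

lemma measurable_LINT_CS:
 fixes g :: "'a => int \<times> int => 'b::{banach, second_countable_topology}"
 assumes "!!a. (%t. g t a) \<in> borel_measurable N"
 shows "(%t. LINT a|CS. g t a) \<in> borel_measurable N"
proof -
 interpret C: sigma_finite_measure CS by (rule sigma_finite_measure_count_space_countable) simp
 have "(%p. g (snd p) (fst p)) \<in> borel_measurable (CS \<Otimes>\<^sub>M N)"
  by (rule measurable_pair_measure_countable1) (simp_all add: assms)
 from measurable_pair_swap[OF this]
 have "case_prod g \<in> borel_measurable (N \<Otimes>\<^sub>M CS)" by (simp add: case_prod_unfold)
 thus ?thesis by (rule C.borel_measurable_lebesgue_integral)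
qed

context torus2
begin

text \<open>Coefficients of the squared gradient.\<close>

definition Qc :: "coeffs => coeffs" where
 "Qc d a = conv (%b. mx b * d b) (%b. mx b * d b) a + conv (%b. my b * d b) (%b. my b * d b) a"

definition Uc :: "(real => real) => coeffs" where
 "Uc u = fcoef (%z. of_real (u (snd z)))"

text \<open>Coefficients of all terms of the equation except the time derivative;
  \<open>(nf a)^2 - nf a\<close> is the symbol of the bi-Laplacian plus the Laplacian.\<close>

definition Fc :: "(real => real) => real => coeffs => coeffs" where
 "Fc u \<nu> d a = mx a * conv d (Uc u) a + of_real (\<nu> * ((nf a)^2 - nf a)) * d a + of_real (\<nu> / 2) * Qc d a"

definition st_per :: "(real \<times> real \<times> real => real) => bool" where
 "st_per \<psi> \<longleftrightarrow> smooth_fun \<psi> \<and>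
   (\<forall>t x y. \<psi> (t, x + L1, y) = \<psi> (t, x, y) \<and> \<psi> (t, x, y + L2) = \<psi> (t, x, y))"

lemma st_per_dirD:
 assumes "st_per f"
 shows "st_per (dirD v f)"
proof -
 have s: "smooth_fun f" and p: "!!t x y. f (t, x + L1, y) = f (t, x, y)" "!!t x y. f (t, x, y + L2) = f (t, x, y)"
  using assms by (auto simp: st_per_def)
 have 1: "(%z. f ((0, L1, 0) + id z)) = f" and 2: "(%z. f ((0, 0, L2) + id z)) = f" using p by (auto simp: fun_eq_iff add.commute)
 have e1: "dirD v f = (%z. dirD v f ((0, L1, 0) + z))" and e2: "dirD v f = (%z. dirD v f ((0, 0, L2) + z))"
  using dirD_compose_affine[OF s bounded_linear_ident, of v "(0, L1, 0)"]
   dirD_compose_affine[OF s bounded_linear_ident, of v "(0, 0, L2)"] 1 2 by simp_all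
 have "dirD v f ((0, L1, 0) + (t, x, y)) = dirD v f (t, x, y)" "dirD v f ((0, 0, L2) + (t, x, y)) = dirD v f (t, x, y)" for t x y
  by (rule fun_cong[OF e1, symmetric], rule fun_cong[OF e2, symmetric])
 hence "dirD v f (t, x + L1, y) = dirD v f (t, x, y)" "dirD v f (t, x, y + L2) = dirD v f (t, x, y)" for t x y
  by (simp_all add: add.commute[of x] add.commute[of y])
 thus ?thesis unfolding st_per_def using smooth_fun_dirD[OF s] by blast
qed

lemma slice_eq: "(%z. \<psi> (t, z)) = (%z. \<psi> ((t, 0) + (0, z)))"
 for \<psi> :: "real \<times> real \<times> real => real" by simp

lemma bounded_linear_slice: "bounded_linear (%z :: real \<times> real. (0 :: real, z))"
 by (intro bounded_linear_Pair bounded_linear_zero bounded_linear_ident)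

lemma torus_test_slice:
 assumes "st_per \<psi>"
 shows "torus_test L1 L2 (%z. \<psi> (t, z))"
proof -
 have "smooth_fun (%z. \<psi> ((t, 0) + (0, z)))"
  using assms by (intro smooth_fun_compose_affine bounded_linear_slice) (simp add: st_per_def)
 hence "smooth_fun (%z. \<psi> (t, z))" unfolding slice_eq[symmetric] .
 thus ?thesis using assms by (simp add: torus_test_def st_per_def)
qed

lemma dirD_slice:
 assumes "st_per \<psi>"
 shows "dirD v (%z. \<psi> (t, z)) = (%z. dirD (0, v) \<psi> (t, z))"
proof -
 have "smooth_fun \<psi>" using assms by (simp add: st_per_def)
 from dirD_compose_affine[OF this bounded_linear_slice, of v "(t, 0)"]
 show ?thesis by simp
qed

lemma partialD_slice:
 assumes "st_per \<psi>"
 shows "partialD i j (%z. \<psi> (t, z)) = (%z. (Dx ^^ i) ((Dy ^^ j) \<psi>) (t, z)) \<and> st_per ((Dx ^^ i) ((Dy ^^ j) \<psi>))"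
proof (induction i)
 case 0
 show ?case
 proof (induction j)
  case 0 show ?case using assms by (simp add: partialD_def)
 next
  case (Suc j)
  have "partialD 0 (Suc j) (%z. \<psi> (t, z)) = dirD (0, 1) (partialD 0 j (%z. \<psi> (t, z)))" by (simp add: partialD_def)
  thus ?case using Suc dirD_slice[of "(Dy ^^ j) \<psi>" "(0, 1)" t] by (simp add: st_per_dirD)
 qed
next
 case (Suc i)
 have "partialD (Suc i) j (%z. \<psi> (t, z)) = dirD (1, 0) (partialD i j (%z. \<psi> (t, z)))" by (simp add: partialD_def)
 thus ?case using Suc dirD_slice[of "(Dx ^^ i) ((Dy ^^ j) \<psi>)" "(1, 0)" t] by (simp add: st_per_dirD)
qed

lemma st_per_bounded:
 assumes "st_per \<psi>"
 shows "\<exists>B. \<forall>t\<in>{0..T}. \<forall>z\<in>space M. \<bar>\<psi> (t, z)\<bar> \<le> B"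
proof -
 have c: "continuous_on S \<psi>" for S using assms unfolding st_per_def by (blast intro: smooth_fun_continuous)
 have "compact (\<psi> ` ({0..T} \<times> {0..L1} \<times> {0..L2}))" by (intro compact_continuous_image compact_Times c compact_Icc)
 then obtain B where B: "\<forall>x\<in>\<psi> ` ({0..T} \<times> {0..L1} \<times> {0..L2}). norm x \<le> B"
  using compact_imp_bounded bounded_iff by blast
 have "\<bar>\<psi> (t, z)\<bar> \<le> B" if "t \<in> {0..T}" "z \<in> space M" for t z
 proof -
  have "z \<in> {0..L1} \<times> {0..L2}" using that(2) by (cases z) (simp add: space_M)
  hence "\<psi> (t, z) \<in> \<psi> ` ({0..T} \<times> {0..L1} \<times> {0..L2})" using that(1) by blast
  thus ?thesis using B by fastforce
 qed
 thus ?thesis by blast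
qed

lemma pc_slice_decay:
 assumes "st_per \<psi>"
 shows "\<exists>C\<ge>0. \<forall>t\<in>{0..T}. \<forall>a. norm (pc (%z. \<psi> (t, z)) a) \<le> C * wt a"
proof -
 obtain K where K: "0 < K" "!!f B a. torus_test L1 L2 f ==>
   (\<forall>z\<in>space M. \<bar>f z\<bar> \<le> B \<and> \<bar>partialD 2 0 f z\<bar> \<le> B \<and> \<bar>partialD 0 2 f z\<bar> \<le> B \<and> \<bar>partialD 2 2 f z\<bar> \<le> B)
   ==> norm (pc f a) \<le> K * B * wt a" using pc_decay by blast
 let ?D = "%i j. (Dx ^^ i) ((Dy ^^ j) \<psi>)"
 have D: "st_per (?D i j)" for i j using partialD_slice[OF assms] by blast
 obtain B0 B1 B2 B3 where B: "\<forall>t\<in>{0..T}. \<forall>z\<in>space M. \<bar>\<psi> (t, z)\<bar> \<le> B0"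
  "\<forall>t\<in>{0..T}. \<forall>z\<in>space M. \<bar>?D 2 0 (t, z)\<bar> \<le> B1"
  "\<forall>t\<in>{0..T}. \<forall>z\<in>space M. \<bar>?D 0 2 (t, z)\<bar> \<le> B2"
  "\<forall>t\<in>{0..T}. \<forall>z\<in>space M. \<bar>?D 2 2 (t, z)\<bar> \<le> B3"
  using st_per_bounded[OF assms, of T] st_per_bounded[OF D[of 2 0], of T]
   st_per_bounded[OF D[of 0 2], of T] st_per_bounded[OF D[of 2 2], of T] by blast
 define B where "B = max 0 (max (max B0 B1) (max B2 B3))"
 have "norm (pc (%z. \<psi> (t, z)) a) \<le> K * B * wt a" if t: "t \<in> {0..T}" for t a
 proof (rule K(2)[OF torus_test_slice[OF assms]], rule ballI)
  fix z assume z: "z \<in> space M"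
  have p: "partialD i j (%z. \<psi> (t, z)) z = ?D i j (t, z)" for i j using partialD_slice[OF assms, of i j t] by (simp only:)
  have "\<bar>\<psi> (t, z)\<bar> \<le> B0" "\<bar>?D 2 0 (t, z)\<bar> \<le> B1" "\<bar>?D 0 2 (t, z)\<bar> \<le> B2" "\<bar>?D 2 2 (t, z)\<bar> \<le> B3"
   using B t z by blast+
  moreover have "B0 \<le> B" "B1 \<le> B" "B2 \<le> B" "B3 \<le> B" by (simp_all add: B_def)
  ultimately show "\<bar>\<psi> (t, z)\<bar> \<le> B \<and> \<bar>partialD 2 0 (%z. \<psi> (t, z)) z\<bar> \<le> B \<and>
    \<bar>partialD 0 2 (%z. \<psi> (t, z)) z\<bar> \<le> B \<and> \<bar>partialD 2 2 (%z. \<psi> (t, z)) z\<bar> \<le> B"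
   unfolding p by linarith
 qed
 moreover have "0 \<le> K * B" using K(1) by (simp add: B_def)
 ultimately show ?thesis by blast
qed

text \<open>Passage to the gauge integral over a closed box, in which the Leibniz rule is applied in
  \<open>pc_slice_derivative\<close>.\<close>

lemma integral_M_HK:
 fixes f :: "real \<times> real => 'b::euclidean_space"
 assumes "continuous_on UNIV f"
 shows "(LINT z|M. f z) = integral (cbox (0, 0) (L1, L2)) f"
proof -
 have i: "integrable M f" by (rule integrable_continuous[OF assms])
 have s: "set_integrable lebesgue ({0..<L1} \<times> {0..<L2}) f"
  using i dom_lebesgue unfolding torus_def set_integrable_def by (subst (asm) integrable_restrict_space) simp_all
 have "(LINT z|M. f z) = (LINT z:{0..<L1} \<times> {0..<L2}|lebesgue. f z)"
  unfolding torus_def set_lebesgue_integral_def using dom_lebesgue by (subst integral_restrict_space) simp_all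
 also have "\<dots> = integral ({0..<L1} \<times> {0..<L2}) f" by (rule set_lebesgue_integral_eq_integral(2)[OF s])
 also have "\<dots> = integral (cbox (0, 0) (L1, L2)) f"
 proof (rule integral_spike_set)
  let ?n1 = "{z :: real \<times> real. z \<bullet> (1, 0) = L1}" and ?n2 = "{z :: real \<times> real. z \<bullet> (0, 1) = L2}"
  have n: "negligible (?n1 \<union> ?n2)" by (intro negligible_Un negligible_standard_hyperplane; simp add: Basis_prod_def)
  show "negligible {x \<in> {0..<L1} \<times> {0..<L2} - cbox (0, 0) (L1, L2). f x \<noteq> 0}"
   by (rule negligible_subset[OF n]) (auto simp: cbox_Pair_eq)
  show "negligible {x \<in> cbox (0, 0) (L1, L2) - {0..<L1} \<times> {0..<L2}. f x \<noteq> 0}"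
   by (rule negligible_subset[OF n]) (auto simp: cbox_Pair_eq)
 qed
 finally show ?thesis .
qed

lemma pc_slice_derivative:
 assumes "st_per \<psi>"
 shows "((%t. pc (%z. \<psi> (t, z)) a) has_vector_derivative pc (%z. Dt \<psi> (t, z)) a) (at t)"
proof -
 have s: "smooth_fun \<psi>" using assms by (simp add: st_per_def)
 have c: "continuous_on S \<psi>" "continuous_on S (Dt \<psi>)" for S by (intro smooth_fun_continuous smooth_fun_dirD s)+
 have cc: "continuous_on UNIV (%z. complex_of_real (\<psi> (t, z)) * e a z)" for t
  by (intro continuous_intros continuous_of_real_test torus_test_slice assms)
 have cd: "continuous_on UNIV (%z. complex_of_real (Dt \<psi> (t, z)) * e a z)" for t
  by (intro continuous_intros continuous_of_real_test torus_test_slice st_per_dirD assms)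
 have "((%t. integral (cbox (0, 0) (L1, L2)) (%z. complex_of_real (\<psi> (t, z)) * e a z)) has_vector_derivative
   integral (cbox (0, 0) (L1, L2)) (%z. complex_of_real (Dt \<psi> (t, z)) * e a z)) (at t within UNIV)"
 proof (rule leibniz_rule_vector_derivative)
  fix x and z :: "real \<times> real"
  have D: "(\<psi> has_derivative (%v. dirD v \<psi> (x, z))) (at (x, z))" by (rule smooth_fun_has_derivative[OF s])
  have "((%x. (x, z)) has_derivative (%h. (h, 0))) (at x)" by (intro has_derivative_Pair has_derivative_ident has_derivative_const)
  note hd = has_derivative_compose[OF this D]
  have l: "dirD (h, 0) \<psi> (x, z) = h * Dt \<psi> (x, z)" for h
  proof -
   have "dirD (h *\<^sub>R (1, 0, 0)) \<psi> (x, z) = h *\<^sub>R Dt \<psi> (x, z)" by (rule linear_scale[OF has_derivative_linear[OF D]])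
   thus ?thesis by (simp add: zero_prod_def)
  qed
  have "((%x. \<psi> (x, z)) has_vector_derivative Dt \<psi> (x, z)) (at x)" unfolding has_vector_derivative_def real_scaleR_def
   by (rule has_derivative_eq_rhs[OF hd]) (rule ext, rule l)
  hence "((%x. complex_of_real (\<psi> (x, z))) has_vector_derivative of_real (Dt \<psi> (x, z))) (at x)"
   by (intro has_vector_derivative_of_real) (simp only: has_real_derivative_iff_has_vector_derivative)
  from has_vector_derivative_mult_left[OF this, of "e a z"]
  show "((%x. complex_of_real (\<psi> (x, z)) * e a z) has_vector_derivative complex_of_real (Dt \<psi> (x, z)) * e a z) (at x within UNIV)"
   by simp
 next
  show "(%z. complex_of_real (\<psi> (x, z)) * e a z) integrable_on cbox (0, 0) (L1, L2)" for x
   by (rule integrable_continuous[where f = "%z. complex_of_real (\<psi> (x, z)) * e a z", THEN _] continuous_on_subset[OF cc] Henstock_Kurzweil_Integration.integrable_continuous)+ simp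
 next
  have "continuous_on UNIV (%p. complex_of_real (Dt \<psi> p) * e a (snd p))"
   by (intro continuous_intros c(2) continuous_on_compose2[OF continuous_e[of UNIV a]]) auto
  hence "continuous_on (UNIV \<times> cbox (0, 0) (L1, L2)) (%p. complex_of_real (Dt \<psi> p) * e a (snd p))"
   by (rule continuous_on_subset) simp
  thus "continuous_on (UNIV \<times> cbox (0, 0) (L1, L2)) (%(x, z). complex_of_real (Dt \<psi> (x, z)) * e a z)"
   by (simp add: case_prod_unfold)
 qed simp_all
 thus ?thesis unfolding pc_def integral_M_HK[OF cc] integral_M_HK[OF cd] by simp
qed

lemma pc_slice_continuous: "st_per \<psi> ==> continuous_on S (%t. pc (%z. \<psi> (t, z)) a)"
 by (intro continuous_at_imp_continuous_on ballI has_vector_derivative_continuous[OF pc_slice_derivative])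

end

section \<open>Weak solutions from Fourier coefficients\<close>

text \<open>The bounds concern finite partial sums, uniformly in \<open>n\<close> and locally in
  time, because this is the form that survives the limit of the Galerkin systems.\<close>

locale spectral_regular = torus2 +
 fixes c :: "int \<times> int => real => complex"
 assumes cont: "!!a. continuous_on UNIV (c a)"
  and herm: "!!t. hermitian (%a. c a t)"
  and l2: "!!T. \<exists>C. \<forall>t\<in>{0..T}. \<forall>n. (\<Sum>a\<in>sbox n. (norm (c a t))^2) \<le> C"
  and h2: "!!T. \<exists>C. \<forall>n. integral {0..T} (%t. \<Sum>a\<in>sbox n. (1 + nf a)^2 * (norm (c a t))^2) \<le> C"
begin

definition good :: "real => bool" where "good t \<longleftrightarrow> H2c (%a. c a t)"

text \<open>At the exceptional times, a null set by \<open>AE_good\<close>, the coefficients are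
  replaced by 0. Thus every time slice of the solution lies in H2 and its series converges
  absolutely.\<close>

definition d :: "real => coeffs" where "d t a = (if good t then c a t else 0)"

definition K :: "nat => real => real" where
 "K n t = (\<Sum>a\<in>sbox n. (1 + nf a)^2 * (norm (c a t))^2)"

definition KK :: "real => real" where "KK t = (LINT a|CS. (1 + nf a)^2 * (norm (d t a))^2)"

definition \<phi> :: "real => real \<times> real => real" where "\<phi> t = rser (d t)"

lemma c_measurable [measurable]: "c a \<in> borel_measurable borel" by (rule borel_measurable_continuous_onI[OF cont])

lemma K_continuous: "continuous_on S (K n)" unfolding K_def by (intro continuous_intros continuous_on_subset[OF cont]) simp

lemma K_measurable [measurable]: "K n \<in> borel_measurable borel" by (rule borel_measurable_continuous_onI[OF K_continuous])

lemma K_mono: "m \<le> n ==> K m t \<le> K n t" unfolding K_def using sbox_mono by (intro sum_mono2) simp_all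

lemma K_nonneg: "0 \<le> K n t" unfolding K_def by (intro sum_nonneg) simp

text \<open>Natural-number bounds make the condition countable, which yields the measurability of
  \<open>good\<close>.\<close>

lemma good_iff: "good t \<longleftrightarrow> (\<exists>N :: nat. \<forall>n. K n t \<le> real N)"
proof
 assume g: "good t"
 have "K n t \<le> (LINT a|CS. (1 + nf a)^2 * (norm (c a t))^2)" for n
  unfolding K_def by (rule sum_le_CS) (use g in \<open>simp_all add: good_def H2c_def\<close>)
 moreover obtain N :: nat where "(LINT a|CS. (1 + nf a)^2 * (norm (c a t))^2) \<le> real N" using real_arch_simple by blast
 ultimately show "\<exists>N :: nat. \<forall>n. K n t \<le> real N" using order_trans by blast
next
 assume "\<exists>N :: nat. \<forall>n. K n t \<le> real N"
 then obtain N :: nat where "!!n. K n t \<le> real N" by blast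
 thus "good t" unfolding good_def H2c_def K_def by (intro integrable_CS_sbox(1)[of _ "real N"]) simp_all
qed

lemma good_measurable [measurable]: "Measurable.pred borel good" unfolding good_iff[abs_def] by measurable

lemma d_measurable [measurable]: "(%t. d t a) \<in> borel_measurable borel" unfolding d_def[abs_def] by measurable

lemma H2c_d: "H2c (d t)" by (cases "good t") (simp_all add: d_def[abs_def] good_def H2c_def)

lemma hermitian_d: "hermitian (d t)" using herm[of t] by (cases "good t") (simp_all add: d_def[abs_def] hermitian_def)

lemma good_d: "good t ==> d t = (%a. c a t)" by (simp add: d_def[abs_def])

lemma KK_nonneg: "0 \<le> KK t" unfolding KK_def by (intro Bochner_Integration.integral_nonneg) simp

lemma KK_measurable: "KK \<in> borel_measurable borel" unfolding KK_def[abs_def] by (intro measurable_LINT_CS) measurable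

lemma KK_le_SUP: "ennreal (KK t) \<le> (SUP n. ennreal (K n t))"
proof (cases "good t")
 case True
 have "(%n. K n t) \<longlonglongrightarrow> KK t" unfolding K_def KK_def good_d[OF True] using True
  by (intro tendsto_sbox_sum) (simp add: good_def H2c_def)
 hence "(%n. ennreal (K n t)) \<longlonglongrightarrow> ennreal (KK t)" by (rule tendsto_ennrealI)
 thus ?thesis by (rule LIMSEQ_le_const2) (intro exI allI impI SUP_upper UNIV_I)
next
 case False
 hence "KK t = 0" by (simp add: KK_def d_def)
 thus ?thesis by simp
qed

lemma SUP_K_finite: "(\<integral>\<^sup>+t. (SUP n. ennreal (K n t)) \<partial>Nt T) < \<infinity>"
proof -
 obtain C where C: "!!n. integral {0..T} (K n) \<le> C" using h2[of T] unfolding K_def[symmetric, abs_def] by blast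
 have "(\<integral>\<^sup>+t. (SUP n. ennreal (K n t)) \<partial>Nt T) = (SUP n. \<integral>\<^sup>+t. ennreal (K n t) \<partial>Nt T)"
 proof (rule nn_integral_monotone_convergence_SUP)
  show "incseq (%n t. ennreal (K n t))" by (intro monoI le_funI ennreal_leI K_mono)
  show "(%t. ennreal (K n t)) \<in> borel_measurable (Nt T)" for n
   by (intro measurable_Nt measurable_compose[OF K_measurable measurable_ennreal])
 qed
 also have "\<dots> \<le> ennreal C"
 proof (rule SUP_least)
  fix n
  have "(\<integral>\<^sup>+t. ennreal (K n t) \<partial>Nt T) = ennreal (LINT t|Nt T. K n t)"
   by (intro nn_integral_eq_integral integral_Nt(1) K_continuous) (simp add: K_nonneg)
  also have "\<dots> \<le> ennreal C" unfolding integral_Nt(2)[OF K_continuous] by (intro ennreal_leI C)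
  finally show "(\<integral>\<^sup>+t. ennreal (K n t) \<partial>Nt T) \<le> ennreal C" .
 qed
 also have "\<dots> < \<infinity>" by simp
 finally show ?thesis .
qed

lemma SUP_measurable: "(%t. SUP n. ennreal (K n t)) \<in> borel_measurable (Nt T)"
 by (intro measurable_Nt borel_measurable_SUP measurable_compose[OF K_measurable measurable_ennreal]) simp

lemma AE_good: "AE t in Nt T. good t"
proof -
 have "(\<integral>\<^sup>+t. (SUP n. ennreal (K n t)) \<partial>Nt T) \<noteq> \<infinity>" using SUP_K_finite[of T] by simp
 from nn_integral_noteq_infinite[OF SUP_measurable this]
 show ?thesis
 proof eventually_elim
  case (elim t)
  have up: "ennreal (K n t) \<le> (SUP n. ennreal (K n t))" for n by (rule SUP_upper[OF UNIV_I])
  obtain r where r: "0 \<le> r" "(SUP n. ennreal (K n t)) = ennreal r" using elim by (cases "SUP n. ennreal (K n t)") simp_all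
  obtain N :: nat where N: "r \<le> real N" using real_arch_simple by blast
  have "K n t \<le> real N" for n
  proof -
   have "ennreal (K n t) \<le> ennreal r" using up[of n] unfolding r(2) .
   hence "K n t \<le> r" using r(1) by (simp only: ennreal_le_iff)
   thus ?thesis using N by linarith
  qed
  thus ?case unfolding good_iff by blast
 qed
qed

lemma KK_integrable: "integrable (Nt T) KK"
proof (rule integrableI_bounded)
 show "KK \<in> borel_measurable (Nt T)" by (intro measurable_Nt KK_measurable)
 have "(\<integral>\<^sup>+t. ennreal (norm (KK t)) \<partial>Nt T) \<le> (\<integral>\<^sup>+t. (SUP n. ennreal (K n t)) \<partial>Nt T)"
  using KK_le_SUP KK_nonneg by (intro nn_integral_mono) simp
 also have "\<dots> < \<infinity>" by (rule SUP_K_finite)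
 finally show "(\<integral>\<^sup>+t. ennreal (norm (KK t)) \<partial>Nt T) < \<infinity>" .
qed

lemma phi_spacetime_measurable: "spacetime_measurable L1 L2 T \<phi>"
proof -
 have "(%p :: real \<times> real \<times> real. \<phi> (fst p) (snd p)) \<in> borel_measurable borel"
 proof (rule borel_measurable_LIMSEQ_metric)
  fix n
  have "(%p :: real \<times> real \<times> real. \<Sum>a\<in>sbox n. d (fst p) a * e a (snd p)) \<in> borel_measurable (borel \<Otimes>\<^sub>M borel)"
   by (intro borel_measurable_sum borel_measurable_times measurable_compose[OF measurable_fst d_measurable]
     measurable_compose[OF measurable_snd measurable_e])
  hence "(%p :: real \<times> real \<times> real. Re (\<Sum>a\<in>sbox n. d (fst p) a * e a (snd p))) \<in> borel_measurable (borel \<Otimes>\<^sub>M borel)"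
   by (rule measurable_compose[OF _ borel_measurable_continuous_onI[OF continuous_on_Re[OF continuous_on_id]]])
  thus "(%p :: real \<times> real \<times> real. Re (psum (d (fst p)) (sbox n) (snd p))) \<in> borel_measurable borel"
   unfolding psum_def borel_prod .
 next
  fix p :: "real \<times> real \<times> real"
  show "(%n. Re (psum (d (fst p)) (sbox n) (snd p))) \<longlonglongrightarrow> \<phi> (fst p) (snd p)"
   unfolding \<phi>_def rser_def by (intro tendsto_intros psum_fser H2c_abs H2c_d)
 qed
 hence "(%(t, z). \<phi> t z) \<in> borel_measurable borel" by (simp add: case_prod_unfold)
 thus ?thesis unfolding spacetime_measurable_def by (intro measurable_restrict_space1 measurable_completion) simp
qed

lemma L2_bound:
 "\<exists>C\<ge>0. \<forall>t\<in>{0..T}. ell2 (d t) \<and> (LINT a|CS. (norm (d t a))^2) \<le> C"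
proof -
 obtain C where C: "\<forall>t\<in>{0..T}. \<forall>n. (\<Sum>a\<in>sbox n. (norm (c a t))^2) \<le> C" using l2 by blast
 have "ell2 (d t) \<and> (LINT a|CS. (norm (d t a))^2) \<le> max 0 C" if t: "t \<in> {0..T}" for t
 proof -
  have "(\<Sum>a\<in>sbox n. (norm (d t a))^2) \<le> max 0 C" for n
  proof (cases "good t")
   case True thus ?thesis using C t good_d[of t] by (simp add: le_max_iff_disj)
  qed (simp add: d_def)
  from integrable_CS_sbox[OF _ this] show ?thesis unfolding ell2_def by simp
 qed
 thus ?thesis by (intro exI[of _ "max 0 C"]) simp
qed

lemma phi_Linf_L2: "in_Linf_L2 L1 L2 T \<phi>"
proof -
 obtain C where C: "\<forall>t\<in>{0..T}. ell2 (d t) \<and> (LINT a|CS. (norm (d t a))^2) \<le> C" using L2_bound by blast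
 have "in_L2 L1 L2 (\<phi> t) \<and> L2norm L1 L2 (\<phi> t) \<le> sqrt (LL * C)" if "t \<in> {0..<T}" for t
 proof
  show "in_L2 L1 L2 (\<phi> t)" unfolding \<phi>_def by (intro in_L2_rser H2c_d hermitian_d)
  have "(L2norm L1 L2 (\<phi> t))^2 = LL * (LINT a|CS. (norm (d t a))^2)" unfolding \<phi>_def by (intro L2norm_rser H2c_d hermitian_d)
  also have "\<dots> \<le> LL * C" using C that LL_pos by (intro mult_left_mono) simp_all
  finally show "L2norm L1 L2 (\<phi> t) \<le> sqrt (LL * C)" by (rule real_le_rsqrt)
 qed
 hence "AE t in lebesgue_on {0..<T}. in_L2 L1 L2 (\<phi> t) \<and> L2norm L1 L2 (\<phi> t) \<le> sqrt (LL * C)" by (intro AE_I2) simp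
 thus ?thesis unfolding in_Linf_L2_def using phi_spacetime_measurable by blast
qed

lemma phi_L2_H2: "in_L2_H2 L1 L2 T \<phi>"
proof -
 have H: "(H2norm L1 L2 (\<phi> t))^2 = (\<Sum>(i, j)\<in>{(i, j). i + j \<le> 2}. LL * (LINT a|CS. (norm (mder i j a * d t a))^2))" for t
  unfolding \<phi>_def by (intro H2norm_rser H2c_d hermitian_d)
 have "integrable (Nt T) (%t. (H2norm L1 L2 (\<phi> t))^2)" unfolding H
 proof (rule Bochner_Integration.integrable_sum, clarify)
  fix i j :: nat assume ij: "i + j \<le> 2"
  have "integrable (Nt T) (%t. LINT a|CS. (norm (mder i j a * d t a))^2)"
  proof (rule Bochner_Integration.integrable_bound[OF KK_integrable])
   show "(%t. LINT a|CS. (norm (mder i j a * d t a))^2) \<in> borel_measurable (Nt T)"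
    by (intro measurable_Nt measurable_LINT_CS) measurable
   have "(LINT a|CS. (norm (mder i j a * d t a))^2) \<le> KK t" for t unfolding KK_def
   proof (rule integral_mono)
    show "integrable CS (%a. (norm (mder i j a * d t a))^2)" using H2c_weighted[OF H2c_d norm_mder_le[OF ij]] unfolding ell2_def .
    show "integrable CS (%a. (1 + nf a)^2 * (norm (d t a))^2)" using H2c_d unfolding H2c_def .
    fix a show "(norm (mder i j a * d t a))^2 \<le> (1 + nf a)^2 * (norm (d t a))^2"
     unfolding norm_mult power_mult_distrib using norm_mder_le[OF ij, of a] by (intro mult_right_mono power_mono) simp_all
   qed
   moreover have "0 \<le> (LINT a|CS. (norm (mder i j a * d t a))^2)" for t by (intro Bochner_Integration.integral_nonneg) simp
   ultimately show "AE t in Nt T. norm (LINT a|CS. (norm (mder i j a * d t a))^2) \<le> norm (KK t)" using KK_nonneg by (intro AE_I2) simp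
  qed
  thus "integrable (Nt T) (%t. LL * (LINT a|CS. (norm (mder i j a * d t a))^2))" by (rule integrable_mult_right)
 qed
 hence "integrable (lebesgue_on {0..<T}) (%t. (H2norm L1 L2 (\<phi> t))^2)" by (simp add: Nt_def)
 moreover have "in_H2 L1 L2 (\<phi> t)" for t unfolding \<phi>_def by (intro in_H2_rser H2c_d hermitian_d)
 ultimately show ?thesis unfolding in_L2_H2_def using phi_spacetime_measurable by simp
qed

end

text \<open>The equation is required one mode at a time, against functions of time only. The
  functions \<open>p\<close> used later are the coefficients of the time slices of a test
  function.\<close>

locale spectral_solution = spectral_regular +
 fixes u :: "real => real" and \<nu> :: real and \<phi>0 :: "real \<times> real => real"
 assumes u_cont: "continuous_on UNIV u"
  and init: "in_L2 L1 L2 \<phi>0" "!!a. c a 0 = fcoef (%z. of_real (\<phi>0 z)) a"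
  and eq: "!!T p p' a. 0 < T ==> (!!t. (p has_vector_derivative p' t) (at t)) ==> continuous_on UNIV p' ==> p T = 0 ==>
   (LINT t|Nt T. - c a t * p' t + Fc u \<nu> (%b. c b t) a * p t) = c a 0 * p 0"
begin

lemma u_sq: "sq_int M (%z. complex_of_real (u (snd z)))" by (intro sq_int_continuous continuous_intros continuous_on_compose2[OF u_cont]) auto

lemma u_L2lim: "L2lim (Uc u) (%z. complex_of_real (u (snd z)))" unfolding Uc_def by (rule fourier_L2lim[OF u_sq])

lemma st_per_Lap:
 assumes f: "st_per f"
 shows "st_per (Lap f) \<and> pc (%z. Lap f (t, z)) b = - of_real (nf b) * pc (%z. f (t, z)) b"
 proof -
  have sm: "smooth_fun (Dx (Dx f))" "smooth_fun (Dy (Dy f))" "st_per (Dx (Dx f))" "st_per (Dy (Dy f))"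
   using st_per_dirD[OF st_per_dirD[OF f]] by (simp_all add: st_per_def)
  have add: "foldr dirD vs (Lap f) = (%p. foldr dirD vs (Dx (Dx f)) p + foldr dirD vs (Dy (Dy f)) p)
    \<and> smooth_fun (foldr dirD vs (Dx (Dx f))) \<and> smooth_fun (foldr dirD vs (Dy (Dy f)))" for vs
  proof (induction vs)
   case Nil
   show ?case using sm by (simp add: Lap_def[abs_def])
  next
   case (Cons v vs)
   let ?g = "foldr dirD vs (Dx (Dx f))" and ?h = "foldr dirD vs (Dy (Dy f))"
   have gh: "smooth_fun ?g" "smooth_fun ?h" using Cons by blast+
   have "dirD v (%p. ?g p + ?h p) = (%p. dirD v ?g p + dirD v ?h p)"
   proof
    fix p
    have "((%p. ?g p + ?h p) has_derivative (%v. dirD v ?g p + dirD v ?h p)) (at p)"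
     by (intro has_derivative_add smooth_fun_has_derivative gh)
    from fun_cong[OF frechet_derivative_at[OF this, symmetric], of v]
    show "dirD v (%p. ?g p + ?h p) p = dirD v ?g p + dirD v ?h p" unfolding dirD_def[of v "%p. ?g p + ?h p"] .
   qed
   thus ?case using Cons smooth_fun_dirD[OF gh(1)] smooth_fun_dirD[OF gh(2)] by simp
  qed
  have "smooth_fun (Lap f)" unfolding smooth_fun_def
  proof (intro allI)
   fix vs x
   have "(%p. foldr dirD vs (Dx (Dx f)) p + foldr dirD vs (Dy (Dy f)) p) differentiable (at x)"
    by (intro differentiable_add smooth_fun_differentiable) (use add[of vs] in blast)+
   thus "foldr dirD vs (Lap f) differentiable (at x)" using add[of vs] by simp
  qed
  moreover have "Lap f (t, x + L1, y) = Lap f (t, x, y) \<and> Lap f (t, x, y + L2) = Lap f (t, x, y)" for t x y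
   using sm(3,4) by (simp add: Lap_def st_per_def)
  ultimately have st: "st_per (Lap f)" by (simp add: st_per_def)
  have tt: "torus_test L1 L2 (%z. Dx (Dx f) (t, z))" "torus_test L1 L2 (%z. Dy (Dy f) (t, z))" by (intro torus_test_slice sm)+
  have "pc (%z. Lap f (t, z)) b = pc (%z. Dx (Dx f) (t, z)) b + pc (%z. Dy (Dy f) (t, z)) b"
   using sq_int_mult_integrable[OF sq_int_test[OF tt(1)] sq_int_e[of b]]
    sq_int_mult_integrable[OF sq_int_test[OF tt(2)] sq_int_e[of b]] by (simp add: pc_def Lap_def distrib_right)
  also have "pc (%z. Dx (Dx f) (t, z)) b = mx b * mx b * pc (%z. f (t, z)) b"
   using pc_partialD[OF torus_test_slice[OF f, of t], of 2 0 b] partialD_slice[OF f, of 2 0 t] by (simp add: power2_eq_square numeral_2_eq_2)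
  also have "pc (%z. Dy (Dy f) (t, z)) b = my b * my b * pc (%z. f (t, z)) b"
   using pc_partialD[OF torus_test_slice[OF f, of t], of 0 2 b] partialD_slice[OF f, of 0 2 t] by (simp add: power2_eq_square numeral_2_eq_2)
  also have "mx b * mx b * pc (%z. f (t, z)) b + my b * my b * pc (%z. f (t, z)) b = - of_real (nf b) * pc (%z. f (t, z)) b"
  proof -
   have "mx b * mx b + my b * my b = - of_real (nf b)"
   proof -
    have ii: "(\<i> * of_real r) * (\<i> * of_real r) = - complex_of_real (r^2)" for r by (simp add: power2_eq_square complex_eq_iff)
    show ?thesis unfolding mx_def my_def nf_def ii by simp
   qed
   thus ?thesis by (simp only: distrib_right[symmetric])
  qed
  finally show ?thesis using st by blast
 qed

lemma integral_comb5:
 fixes f1 f2 f3 f4 f5 :: "'a => complex"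
 assumes "integrable N f1" "integrable N f2" "integrable N f3" "integrable N f4" "integrable N f5"
 shows "(LINT z|N. - f1 z - f2 z + r * f3 z + r * f4 z + s * f5 z)
  = - (LINT z|N. f1 z) - (LINT z|N. f2 z) + r * (LINT z|N. f3 z) + r * (LINT z|N. f4 z) + s * (LINT z|N. f5 z)" using assms by simp

lemma integrable_mult_e:
 assumes f: "integrable M f"
 shows "integrable M (%z. f z * e a z)" by (rule Bochner_Integration.integrable_bound[OF f])
   (simp_all add: norm_mult borel_measurable_times[OF borel_measurable_integrable[OF f] measurable_M[OF measurable_e]])

lemma integrable_mult_test:
 assumes f: "integrable M f" and \<psi>: "torus_test L1 L2 \<psi>"
 shows "integrable M (%z. f z * complex_of_real (\<psi> z))"
proof -
 have "compact (\<psi> ` ({0..L1} \<times> {0..L2}))" by (intro compact_continuous_image compact_Times torus_test_continuous[OF \<psi>] compact_Icc)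
 then obtain B where B: "\<forall>x\<in>\<psi> ` ({0..L1} \<times> {0..L2}). norm x \<le> B" using compact_imp_bounded bounded_iff by blast
 show ?thesis
 proof (rule Bochner_Integration.integrable_bound)
  show "integrable M (%z. norm (f z) * B)" using f by simp
  show "(%z. f z * complex_of_real (\<psi> z)) \<in> borel_measurable M"
   by (intro borel_measurable_times borel_measurable_integrable f sq_intD(1)[OF sq_int_test[OF \<psi>]])
  show "AE z in M. norm (f z * complex_of_real (\<psi> z)) \<le> norm (norm (f z) * B)"
  proof (rule AE_I2)
   fix z assume "z \<in> space M"
   hence "z \<in> {0..L1} \<times> {0..L2}" by (cases z) (simp add: space_M)
   hence "\<bar>\<psi> z\<bar> \<le> B" using B by fastforce
   hence "norm (f z) * \<bar>\<psi> z\<bar> \<le> norm (f z) * B" by (intro mult_left_mono) simp_all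
   thus "norm (f z * complex_of_real (\<psi> z)) \<le> norm (norm (f z) * B)" by (simp add: norm_mult)
  qed
 qed
qed

text \<open>Transfers the derivatives from the test function to the Fourier symbols: the left side
  is what \<open>Parseval_test\<close> produces, the right side is what the mode equation
  evaluates.\<close>

lemma Fc_pc:
 assumes "st_per \<psi>"
 shows "- x * pc (%z. Dt \<psi> (t, z)) a - conv D (Uc u) a * pc (%z. Dx \<psi> (t, z)) a
   + of_real \<nu> * D a * pc (%z. Lap (Lap \<psi>) (t, z)) a + of_real \<nu> * D a * pc (%z. Lap \<psi> (t, z)) a
   + of_real (\<nu> / 2) * Qc D a * pc (%z. \<psi> (t, z)) a
   = - x * pc (%z. Dt \<psi> (t, z)) a + Fc u \<nu> D a * pc (%z. \<psi> (t, z)) a"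
proof -
 note L = st_per_Lap
 have x: "pc (%z. Dx \<psi> (t, z)) a = - mx a * pc (%z. \<psi> (t, z)) a"
  using pc_partialD[OF torus_test_slice[OF assms, of t], of 1 0 a] partialD_slice[OF assms, of 1 0 t] by simp
 have l1: "pc (%z. Lap \<psi> (t, z)) a = - of_real (nf a) * pc (%z. \<psi> (t, z)) a" and sl: "st_per (Lap \<psi>)"
  using L[OF assms] by blast+
 have l2: "pc (%z. Lap (Lap \<psi>) (t, z)) a = - of_real (nf a) * pc (%z. Lap \<psi> (t, z)) a" using L[OF sl] by blast
 show ?thesis unfolding x l2 l1 Fc_def by (simp add: algebra_simps power2_eq_square)
qed

lemma sq_phi: "sq_int M (%z. complex_of_real (\<phi> t z))"
 unfolding \<phi>_def using in_L2_rser[OF H2c_d hermitian_d] by (simp add: in_L2_iff)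

text \<open>Contribution of a single mode to the weak formulation at time \<open>t\<close>.\<close>

definition tm :: "(real \<times> real \<times> real => real) => real => coeffs" where
 "tm \<psi> t a = - d t a * pc (%z. Dt \<psi> (t, z)) a + Fc u \<nu> (d t) a * pc (%z. \<psi> (t, z)) a"

definition inner_int :: "(real \<times> real \<times> real => real) => real => real" where
 "inner_int \<psi> t = (LINT z|M. \<phi> t z * (- Dt \<psi> (t, z) - u (snd z) * Dx \<psi> (t, z)
           + \<nu> * Lap (Lap \<psi>) (t, z) + \<nu> * Lap \<psi> (t, z))
      + \<nu> / 2 * grad_sq L1 L2 (\<phi> t) z * \<psi> (t, z))"

lemma inner_int_lim:
 assumes \<psi>: "st_per \<psi>"
 shows "(%n. \<Sum>a\<in>sbox n. tm \<psi> t a) \<longlonglongrightarrow> of_real (inner_int \<psi> t)"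
proof -
 let ?f = "%z. complex_of_real (\<phi> t z)"
 let ?fu = "%z. ?f z * complex_of_real (u (snd z))"
 let ?g = "%z. complex_of_real (weakD L1 L2 1 0 (\<phi> t) z)" and ?h = "%z. complex_of_real (weakD L1 L2 0 1 (\<phi> t) z)"
 let ?G = "%z. ?g z * ?g z + ?h z * ?h z"
 have F: "L2lim (d t) ?f" unfolding \<phi>_def by (intro L2lim_rser H2c_abs H2c_d hermitian_d)
 have g: "L2lim (%a. mx a * d t a) ?g" and h: "L2lim (%a. my a * d t a) ?h"
  using weakD_rser(1)[OF H2c_d hermitian_d, of 1 0 t] weakD_rser(1)[OF H2c_d hermitian_d, of 0 1 t] unfolding \<phi>_def mder_def by simp_all
 have gs: "sq_int M ?g" and hs: "sq_int M ?h" using g h by (simp_all add: L2lim_def)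
 have i: "integrable M ?f" "integrable M ?fu" "integrable M (%z. ?g z * ?g z)" "integrable M (%z. ?h z * ?h z)"
  by (intro sq_int_mult_integrable sq_int_integrable sq_phi u_sq gs hs)+
 hence iG: "integrable M ?G" by (intro Bochner_Integration.integrable_add)
 have c1: "fcoef ?f a = d t a" for a by (rule L2lim_fcoef[OF F])
 have c2: "fcoef ?fu a = conv (d t) (Uc u) a" for a by (rule fcoef_mult[OF F u_L2lim])
 have c3: "fcoef ?G a = Qc (d t) a" for a
 proof -
  have "integrable M (%z. ?g z * ?g z * e (- a) z)" "integrable M (%z. ?h z * ?h z * e (- a) z)" by (intro integrable_mult_e i)+
  hence "fcoef ?G a = fcoef (%z. ?g z * ?g z) a + fcoef (%z. ?h z * ?h z) a"
   by (simp add: fcoef_def distrib_right add_divide_distrib)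
  thus ?thesis unfolding Qc_def fcoef_mult[OF g g] fcoef_mult[OF h h] .
 qed
 have st: "st_per (Dt \<psi>)" "st_per (Dx \<psi>)" "st_per (Lap \<psi>)" "st_per (Lap (Lap \<psi>))"
  using st_per_Lap[OF \<psi>] st_per_Lap[of "Lap \<psi>"] by (simp_all add: st_per_dirD \<psi>)
 note tt = torus_test_slice[OF \<psi>, of t] torus_test_slice[OF st(1), of t] torus_test_slice[OF st(2), of t]
  torus_test_slice[OF st(3), of t] torus_test_slice[OF st(4), of t]
 let ?I = "%f g. LINT z|M. f z * complex_of_real (g (t, z))"
 have "(%n. - (\<Sum>a\<in>sbox n. d t a * pc (%z. Dt \<psi> (t, z)) a) - (\<Sum>a\<in>sbox n. conv (d t) (Uc u) a * pc (%z. Dx \<psi> (t, z)) a)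
   + of_real \<nu> * (\<Sum>a\<in>sbox n. d t a * pc (%z. Lap (Lap \<psi>) (t, z)) a) + of_real \<nu> * (\<Sum>a\<in>sbox n. d t a * pc (%z. Lap \<psi> (t, z)) a)
   + of_real (\<nu> / 2) * (\<Sum>a\<in>sbox n. Qc (d t) a * pc (%z. \<psi> (t, z)) a))
  \<longlonglongrightarrow> - ?I ?f (Dt \<psi>) - ?I ?fu (Dx \<psi>) + of_real \<nu> * ?I ?f (Lap (Lap \<psi>)) + of_real \<nu> * ?I ?f (Lap \<psi>)
   + of_real (\<nu> / 2) * ?I ?G \<psi>" using Parseval_test[OF i(1) tt(2)] Parseval_test[OF i(2) tt(3)] Parseval_test[OF i(1) tt(5)]
   Parseval_test[OF i(1) tt(4)] Parseval_test[OF iG tt(1)] unfolding c1 c2 c3 by (intro tendsto_intros)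
 also have "(%n. - (\<Sum>a\<in>sbox n. d t a * pc (%z. Dt \<psi> (t, z)) a) - (\<Sum>a\<in>sbox n. conv (d t) (Uc u) a * pc (%z. Dx \<psi> (t, z)) a)
   + of_real \<nu> * (\<Sum>a\<in>sbox n. d t a * pc (%z. Lap (Lap \<psi>) (t, z)) a) + of_real \<nu> * (\<Sum>a\<in>sbox n. d t a * pc (%z. Lap \<psi> (t, z)) a)
   + of_real (\<nu> / 2) * (\<Sum>a\<in>sbox n. Qc (d t) a * pc (%z. \<psi> (t, z)) a)) = (%n. \<Sum>a\<in>sbox n. tm \<psi> t a)"
  unfolding tm_def Fc_pc[OF \<psi>, symmetric] sum_distrib_left sum_negf[symmetric] sum_subtractf[symmetric] sum.distrib[symmetric]
  by (simp add: mult.assoc)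
 also have "- ?I ?f (Dt \<psi>) - ?I ?fu (Dx \<psi>) + of_real \<nu> * ?I ?f (Lap (Lap \<psi>)) + of_real \<nu> * ?I ?f (Lap \<psi>)
   + of_real (\<nu> / 2) * ?I ?G \<psi> = of_real (inner_int \<psi> t)"
 proof -
  note ii = integrable_mult_test[OF i(1) tt(2)] integrable_mult_test[OF i(2) tt(3)] integrable_mult_test[OF i(1) tt(5)]
   integrable_mult_test[OF i(1) tt(4)] integrable_mult_test[OF iG tt(1)]
  have "complex_of_real (inner_int \<psi> t) = (LINT z|M. - (?f z * of_real (Dt \<psi> (t, z))) - ?fu z * of_real (Dx \<psi> (t, z))
    + of_real \<nu> * (?f z * of_real (Lap (Lap \<psi>) (t, z))) + of_real \<nu> * (?f z * of_real (Lap \<psi> (t, z)))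
    + of_real (\<nu> / 2) * (?G z * of_real (\<psi> (t, z))))" unfolding inner_int_def integral_complex_of_real[symmetric] grad_sq_def
   by (rule arg_cong[where f = "integral\<^sup>L M"], rule ext) (simp add: power2_eq_square algebra_simps)
  also have "\<dots> = - ?I ?f (Dt \<psi>) - ?I ?fu (Dx \<psi>) + of_real \<nu> * ?I ?f (Lap (Lap \<psi>)) + of_real \<nu> * ?I ?f (Lap \<psi>)
   + of_real (\<nu> / 2) * ?I ?G \<psi>" by (rule integral_comb5[OF ii])
  finally show ?thesis by (rule sym)
 qed
 finally show ?thesis .
qed

text \<open>The majorant is integrable in time and summable over the modes, which allows the time
  integral to be exchanged with the sum. The quadratic term is bounded by \<open>KK\<close>,
  everything else by the L2 norm.\<close>

lemma tm_bound:
 assumes \<psi>: "st_per \<psi>"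
 shows "\<exists>A B. 0 \<le> A \<and> 0 \<le> B \<and> (\<forall>t\<in>{0..T}. \<forall>a. norm (tm \<psi> t a) \<le> (A + B * KK t) * wt a)"
proof -
 have st: "st_per (Dt \<psi>)" "st_per (Dx \<psi>)" "st_per (Lap \<psi>)" "st_per (Lap (Lap \<psi>))"
  using st_per_Lap[OF \<psi>] st_per_Lap[of "Lap \<psi>"] by (simp_all add: st_per_dirD \<psi>)
 obtain C0 where C0: "0 \<le> C0" "\<forall>t\<in>{0..T}. \<forall>a. norm (pc (%z. \<psi> (t, z)) a) \<le> C0 * wt a"
  using pc_slice_decay[OF \<psi>, of T] by blast
 obtain C1 where C1: "0 \<le> C1" "\<forall>t\<in>{0..T}. \<forall>a. norm (pc (%z. Dt \<psi> (t, z)) a) \<le> C1 * wt a"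
  using pc_slice_decay[OF st(1), of T] by blast
 obtain C2 where C2: "0 \<le> C2" "\<forall>t\<in>{0..T}. \<forall>a. norm (pc (%z. Dx \<psi> (t, z)) a) \<le> C2 * wt a"
  using pc_slice_decay[OF st(2), of T] by blast
 obtain C3 where C3: "0 \<le> C3" "\<forall>t\<in>{0..T}. \<forall>a. norm (pc (%z. Lap \<psi> (t, z)) a) \<le> C3 * wt a"
  using pc_slice_decay[OF st(3), of T] by blast
 obtain C4 where C4: "0 \<le> C4" "\<forall>t\<in>{0..T}. \<forall>a. norm (pc (%z. Lap (Lap \<psi>) (t, z)) a) \<le> C4 * wt a"
  using pc_slice_decay[OF st(4), of T] by blast
 note C = C0(1) C1(1) C2(1) C3(1) C4(1)
 obtain S where S: "0 \<le> S" "\<forall>t\<in>{0..T}. ell2 (d t) \<and> (LINT a|CS. (norm (d t a))^2) \<le> S" using L2_bound by blast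
 define W where "W = sqrt (LINT a|CS. (norm (Uc u a))^2)"
 have W0: "0 \<le> W" unfolding W_def by (simp add: Bochner_Integration.integral_nonneg)
 let ?s = "sqrt S"
 have "norm (tm \<psi> t a) \<le> (?s * C1 + ?s * W * C2 + \<bar>\<nu>\<bar> * ?s * C4 + \<bar>\<nu>\<bar> * ?s * C3 + \<bar>\<nu> / 2\<bar> * C0 * KK t) * wt a"
  if t: "t \<in> {0..T}" for t a
 proof -
  have e2: "ell2 (d t)" and le: "(LINT a|CS. (norm (d t a))^2) \<le> S" using S t by blast+
  have da: "norm (d t a) \<le> ?s"
  proof (rule real_le_rsqrt)
   have "(\<Sum>b\<in>{a}. (norm (d t b))^2) \<le> (LINT a|CS. (norm (d t a))^2)"
    by (rule sum_le_CS) (use e2 in \<open>simp_all add: ell2_def\<close>)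
   thus "(norm (d t a))^2 \<le> S" using le by simp
  qed
  have cv: "norm (conv (d t) (Uc u) a) \<le> ?s * W"
  proof -
   have "norm (conv (d t) (Uc u) a) \<le> sqrt (LINT a|CS. (norm (d t a))^2) * W"
    unfolding W_def by (rule norm_conv_le[OF e2 L2lim_ell2[OF u_L2lim]])
   also have "\<dots> \<le> ?s * W" using le W0 by (intro mult_right_mono) simp_all
   finally show ?thesis .
  qed
  have ex: "ell2 (%a. mder 1 0 a * d t a)" "ell2 (%a. mder 0 1 a * d t a)" by (intro H2c_weighted[OF H2c_d norm_mder_le]; simp)+
  hence ex: "ell2 (%a. mx a * d t a)" "ell2 (%a. my a * d t a)" by (simp_all add: mder_def)
  have qc: "norm (Qc (d t) a) \<le> KK t"
  proof -
   have n1: "norm (conv (%b. mx b * d t b) (%b. mx b * d t b) a) \<le> (LINT a|CS. (norm (mx a * d t a))^2)"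
    using norm_conv_le[OF ex(1) ex(1), of a] by (simp add: Bochner_Integration.integral_nonneg)
   have n2: "norm (conv (%b. my b * d t b) (%b. my b * d t b) a) \<le> (LINT a|CS. (norm (my a * d t a))^2)"
    using norm_conv_le[OF ex(2) ex(2), of a] by (simp add: Bochner_Integration.integral_nonneg)
   have "norm (Qc (d t) a) \<le> (LINT a|CS. (norm (mx a * d t a))^2) + (LINT a|CS. (norm (my a * d t a))^2)"
    unfolding Qc_def by (rule order_trans[OF norm_triangle_ineq add_mono[OF n1 n2]])
   also have "\<dots> = (LINT a|CS. (norm (mx a * d t a))^2 + (norm (my a * d t a))^2)" using ex by (simp add: ell2_def)
   also have "\<dots> \<le> KK t" unfolding KK_def
   proof (rule integral_mono)
    show "integrable CS (%a. (norm (mx a * d t a))^2 + (norm (my a * d t a))^2)" using ex by (simp add: ell2_def)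
    show "integrable CS (%a. (1 + nf a)^2 * (norm (d t a))^2)" using H2c_d unfolding H2c_def .
    fix a
    have "(norm (mx a * d t a))^2 + (norm (my a * d t a))^2 = nf a * (norm (d t a))^2"
     unfolding norm_mult power_mult_distrib distrib_right[symmetric] norm_mx ..
    also have "\<dots> \<le> (1 + nf a)^2 * (norm (d t a))^2"
    proof (rule mult_right_mono)
     have "nf a \<le> 1 + 2 * nf a + (nf a)^2" using nf_nonneg[of a] zero_le_power2[of "nf a"] by linarith
     also have "\<dots> = (1 + nf a)^2" by (simp add: power2_sum)
     finally show "nf a \<le> (1 + nf a)^2" .
    qed simp
    finally show "(norm (mx a * d t a))^2 + (norm (my a * d t a))^2 \<le> (1 + nf a)^2 * (norm (d t a))^2" .
   qed
   finally show ?thesis .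
  qed
  have p: "norm (pc (%z. \<psi> (t, z)) a) \<le> C0 * wt a" "norm (pc (%z. Dt \<psi> (t, z)) a) \<le> C1 * wt a"
   "norm (pc (%z. Dx \<psi> (t, z)) a) \<le> C2 * wt a" "norm (pc (%z. Lap \<psi> (t, z)) a) \<le> C3 * wt a"
   "norm (pc (%z. Lap (Lap \<psi>) (t, z)) a) \<le> C4 * wt a" using C0(2) C1(2) C2(2) C3(2) C4(2) t by blast+
  have tri: "norm (x1 - x2 + x3 + x4 + x5) \<le> norm x1 + norm x2 + norm x3 + norm x4 + norm x5" for x1 x2 x3 x4 x5 :: complex
   by (intro norm_triangle_mono norm_triangle_ineq4 order_refl)
  have "norm (tm \<psi> t a) \<le> norm (- d t a * pc (%z. Dt \<psi> (t, z)) a) + norm (conv (d t) (Uc u) a * pc (%z. Dx \<psi> (t, z)) a)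
    + norm (of_real \<nu> * d t a * pc (%z. Lap (Lap \<psi>) (t, z)) a) + norm (of_real \<nu> * d t a * pc (%z. Lap \<psi> (t, z)) a)
    + norm (of_real (\<nu> / 2) * Qc (d t) a * pc (%z. \<psi> (t, z)) a)" unfolding tm_def Fc_pc[OF \<psi>, symmetric] by (rule tri)
  also have "\<dots> \<le> ?s * (C1 * wt a) + (?s * W) * (C2 * wt a) + \<bar>\<nu>\<bar> * ?s * (C4 * wt a) + \<bar>\<nu>\<bar> * ?s * (C3 * wt a)
    + \<bar>\<nu> / 2\<bar> * KK t * (C0 * wt a)" unfolding norm_mult norm_minus_cancel norm_of_real using da cv qc p S(1) W0 KK_nonneg[of t]
   by (intro add_mono mult_mono mult_nonneg_nonneg) (simp_all add: W0)
  finally show ?thesis by (simp add: algebra_simps)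
 qed
 hence "norm (tm \<psi> t a) \<le> ((?s * C1 + ?s * W * C2 + \<bar>\<nu>\<bar> * ?s * C4 + \<bar>\<nu>\<bar> * ?s * C3) + (\<bar>\<nu> / 2\<bar> * C0) * KK t) * wt a"
  if "t \<in> {0..T}" for t a using that by blast
 moreover have "0 \<le> ?s * C1 + ?s * W * C2 + \<bar>\<nu>\<bar> * ?s * C4 + \<bar>\<nu>\<bar> * ?s * C3" "0 \<le> \<bar>\<nu> / 2\<bar> * C0"
  using C S(1) W0 by simp_all
 ultimately show ?thesis by blast
qed

text \<open>Both sides are limits of the same finite sums: the mode equations, summed over a box,
  give the partial Parseval sums of the initial datum.\<close>

theorem weak:
 assumes T: "0 < T"
 shows "weak_solution L1 L2 u \<nu> \<phi>0 T \<phi>" unfolding weak_solution_def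
proof (intro conjI allI impI phi_Linf_L2 phi_L2_H2)
 fix \<psi> assume "spacetime_test L1 L2 T \<psi>"
 then obtain T' where \<psi>: "st_per \<psi>" and T': "T' < T" "\<forall>t\<ge>T'. \<forall>z. \<psi> (t, z) = 0"
  unfolding spacetime_test_def st_per_def by blast
 obtain A B where AB: "0 \<le> A" "0 \<le> B" "\<forall>t\<in>{0..T}. \<forall>a. norm (tm \<psi> t a) \<le> (A + B * KK t) * wt a"
  using tm_bound[OF \<psi>] by blast
 interpret N: finite_measure "Nt T" by (rule finite_measure_Nt)
 have tm_meas: "(%t. tm \<psi> t a) \<in> borel_measurable borel" for a
 proof -
  have [measurable]: "(%t. pc (%z. \<psi> (t, z)) a) \<in> borel_measurable borel" "(%t. pc (%z. Dt \<psi> (t, z)) a) \<in> borel_measurable borel"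
   by (intro borel_measurable_continuous_onI pc_slice_continuous st_per_dirD \<psi>)+
  have [measurable]: "(%t. conv (d t) (Uc u) a) \<in> borel_measurable borel"
   "(%t. conv (%b. mx b * d t b) (%b. mx b * d t b) a) \<in> borel_measurable borel"
   "(%t. conv (%b. my b * d t b) (%b. my b * d t b) a) \<in> borel_measurable borel"
   unfolding conv_def by (intro measurable_LINT_CS, measurable)+
  show ?thesis unfolding tm_def Fc_def Qc_def by measurable
 qed
 have wi: "integrable (Nt T) (%t. (A + B * KK t) * w)" for w
  by (intro integrable_mult_left Bochner_Integration.integrable_add integrable_mult_right KK_integrable) simp
 have tm_int: "integrable (Nt T) (%t. tm \<psi> t a)" for a
 proof (rule Bochner_Integration.integrable_bound[OF wi[of "wt a"]])
  show "(%t. tm \<psi> t a) \<in> borel_measurable (Nt T)" by (intro measurable_Nt tm_meas)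
  show "AE t in Nt T. norm (tm \<psi> t a) \<le> norm ((A + B * KK t) * wt a)"
  proof (rule AE_I2)
   fix t assume "t \<in> space (Nt T)"
   hence "t \<in> {0..T}" by (simp add: space_Nt)
   hence "norm (tm \<psi> t a) \<le> (A + B * KK t) * wt a" using AB(3) by blast
   thus "norm (tm \<psi> t a) \<le> norm ((A + B * KK t) * wt a)" unfolding real_norm_def by linarith
  qed
 qed
 have tm_val: "(LINT t|Nt T. tm \<psi> t a) = c a 0 * pc (%z. \<psi> (0, z)) a" for a
 proof -
  \<comment> \<open>\<open>tm\<close> uses the corrected coefficients \<open>d\<close>, the mode
    equation the original \<open>c\<close>; they differ only on the null set of exceptional
    times.\<close>
  have "(LINT t|Nt T. tm \<psi> t a) = (LINT t|Nt T. - c a t * pc (%z. Dt \<psi> (t, z)) a + Fc u \<nu> (%b. c b t) a * pc (%z. \<psi> (t, z)) a)"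
  proof (rule integral_cong_AE)
   show ae: "AE t in Nt T. tm \<psi> t a = - c a t * pc (%z. Dt \<psi> (t, z)) a + Fc u \<nu> (%b. c b t) a * pc (%z. \<psi> (t, z)) a"
    using AE_good by eventually_elim (simp add: tm_def good_d)
   show "(%t. tm \<psi> t a) \<in> borel_measurable (Nt T)" by (intro measurable_Nt tm_meas)
   have [measurable]: "(%t. pc (%z. \<psi> (t, z)) a) \<in> borel_measurable borel" "(%t. pc (%z. Dt \<psi> (t, z)) a) \<in> borel_measurable borel"
    by (intro borel_measurable_continuous_onI pc_slice_continuous st_per_dirD \<psi>)+
   have [measurable]: "(%t. conv (%b. c b t) (Uc u) a) \<in> borel_measurable borel"
    "(%t. conv (%b. mx b * c b t) (%b. mx b * c b t) a) \<in> borel_measurable borel"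
    "(%t. conv (%b. my b * c b t) (%b. my b * c b t) a) \<in> borel_measurable borel"
    unfolding conv_def by (intro measurable_LINT_CS, measurable)+
   show "(%t. - c a t * pc (%z. Dt \<psi> (t, z)) a + Fc u \<nu> (%b. c b t) a * pc (%z. \<psi> (t, z)) a) \<in> borel_measurable (Nt T)"
    unfolding Fc_def Qc_def by (intro measurable_Nt) measurable
  qed
  also have "\<dots> = c a 0 * pc (%z. \<psi> (0, z)) a"
  proof (rule eq[OF T])
   show "((%t. pc (%z. \<psi> (t, z)) a) has_vector_derivative pc (%z. Dt \<psi> (t, z)) a) (at t)" for t
    by (rule pc_slice_derivative[OF \<psi>])
   show "continuous_on UNIV (%t. pc (%z. Dt \<psi> (t, z)) a)" by (rule pc_slice_continuous[OF st_per_dirD[OF \<psi>]])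
   show "pc (%z. \<psi> (T, z)) a = 0"
   proof -
    have "\<psi> (T, z) = 0" for z using T'(2)[rule_format, of T z] T'(1) by simp
    thus ?thesis by (simp add: pc_def)
   qed
  qed
  finally show ?thesis .
 qed
 have lim: "(%n. LINT t|Nt T. (\<Sum>a\<in>sbox n. tm \<psi> t a)) \<longlonglongrightarrow> (LINT t|Nt T. complex_of_real (inner_int \<psi> t))"
 proof (rule integral_dominated_convergence[where w = "%t. (A + B * KK t) * (LINT a|CS. wt a)"])
  have sm: "(%t. \<Sum>a\<in>sbox n. tm \<psi> t a) \<in> borel_measurable borel" for n by (intro borel_measurable_sum tm_meas)
  thus "(%t. \<Sum>a\<in>sbox n. tm \<psi> t a) \<in> borel_measurable (Nt T)" for n by (rule measurable_Nt)
  show "(%t. complex_of_real (inner_int \<psi> t)) \<in> borel_measurable (Nt T)"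
   by (rule measurable_Nt, rule borel_measurable_LIMSEQ_metric[OF sm inner_int_lim[OF \<psi>]])
  show "integrable (Nt T) (%t. (A + B * KK t) * (LINT a|CS. wt a))" by (rule wi)
  show "AE t in Nt T. (%n. \<Sum>a\<in>sbox n. tm \<psi> t a) \<longlonglongrightarrow> complex_of_real (inner_int \<psi> t)"
   by (intro AE_I2 inner_int_lim \<psi>)
  show "AE t in Nt T. norm (\<Sum>a\<in>sbox n. tm \<psi> t a) \<le> (A + B * KK t) * (LINT a|CS. wt a)" for n
  proof (rule AE_I2)
   fix t assume "t \<in> space (Nt T)"
   hence t: "t \<in> {0..T}" by (simp add: space_Nt)
   have "norm (\<Sum>a\<in>sbox n. tm \<psi> t a) \<le> (\<Sum>a\<in>sbox n. (A + B * KK t) * wt a)" by (rule sum_norm_le) (use AB(3) t in blast)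
   also have "\<dots> = (A + B * KK t) * (\<Sum>a\<in>sbox n. wt a)" by (simp only: sum_distrib_left)
   also have "\<dots> \<le> (A + B * KK t) * (LINT a|CS. wt a)"
    using AB(1,2) KK_nonneg[of t] by (intro mult_left_mono sum_le_CS integrable_wt less_imp_le[OF wt_pos]) simp_all
   finally show "norm (\<Sum>a\<in>sbox n. tm \<psi> t a) \<le> (A + B * KK t) * (LINT a|CS. wt a)" .
  qed
 qed
 have "(LINT t|Nt T. (\<Sum>a\<in>sbox n. tm \<psi> t a)) = (\<Sum>a\<in>sbox n. fcoef (%z. of_real (\<phi>0 z)) a * pc (%z. \<psi> (0, z)) a)" for n
  using tm_int by (simp add: Bochner_Integration.integral_sum tm_val init(2))
 hence l1: "(%n. \<Sum>a\<in>sbox n. fcoef (%z. of_real (\<phi>0 z)) a * pc (%z. \<psi> (0, z)) a) \<longlonglongrightarrow> (LINT t|Nt T. complex_of_real (inner_int \<psi> t))"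
  using lim by (simp only:)
 have "integrable M (%z. complex_of_real (\<phi>0 z))" using init(1) by (intro sq_int_integrable) (simp only: in_L2_iff)
 from Parseval_test[OF this torus_test_slice[OF \<psi>, of 0]]
 have l2: "(%n. \<Sum>a\<in>sbox n. fcoef (%z. of_real (\<phi>0 z)) a * pc (%z. \<psi> (0, z)) a) \<longlonglongrightarrow> of_real (LINT z|M. \<phi>0 z * \<psi> (0, z))"
  unfolding of_real_integral_test .
 have "complex_of_real (LINT t|Nt T. inner_int \<psi> t) = of_real (LINT z|M. \<phi>0 z * \<psi> (0, z))"
  unfolding integral_complex_of_real[symmetric, of "Nt T"] by (rule LIMSEQ_unique[OF l1 l2])
 hence "(LINT t|Nt T. inner_int \<psi> t) = (LINT z|M. \<phi>0 z * \<psi> (0, z))" unfolding of_real_eq_iff .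
 thus "(LINT t|lebesgue_on {0..<T}. LINT z|torus L1 L2.
      \<phi> t z * (- Dt \<psi> (t, z) - u (snd z) * Dx \<psi> (t, z)
           + \<nu> * Lap (Lap \<psi>) (t, z) + \<nu> * Lap \<psi> (t, z))
      + \<nu> / 2 * grad_sq L1 L2 (\<phi> t) z * \<psi> (t, z))
    = (LINT z|torus L1 L2. \<phi>0 z * \<psi> (0, z))" unfolding inner_int_def Nt_def .
qed

end

section \<open>Ordinary differential equations\<close>

text \<open>Integrating one bound for the increments of the Picard iteration yields the next; summed
  up, these bounds form an exponential series.\<close>

lemma integral_power_bound:
 fixes t k M :: real
 assumes "0 \<le> t"
 shows "((%s. k * (M * (k * s) ^ n / fact n)) has_integral M * (k * t) ^ Suc n / fact (Suc n)) {0..t}"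
proof -
 have "((%s. M * (k * s) ^ Suc n / fact (Suc n)) has_vector_derivative k * (M * (k * s) ^ n / fact n)) (at s within {0..t})" for s
 proof -
  have "((%s. (M / fact (Suc n)) * (k * s) ^ Suc n) has_real_derivative (M / fact (Suc n)) * (real (Suc n) * (k * (k * s) ^ n))) (at s within {0..t})"
   by (auto intro!: derivative_eq_intros simp del: power_Suc fact_Suc of_nat_Suc)
  moreover have "(M / fact (Suc n)) * (real (Suc n) * (k * (k * s) ^ n)) = k * (M * (k * s) ^ n / fact n)" by (simp add: fact_Suc del: of_nat_Suc)
  ultimately show ?thesis unfolding has_real_derivative_iff_has_vector_derivative by (simp only: times_divide_eq_left)
 qed
 from fundamental_theorem_of_calculus[OF assms this]
 show ?thesis by simp
qed

text \<open>The Lipschitz bound is global, so the iterates converge uniformly on every bounded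
  interval. The symmetry under \<open>\<sigma>\<close> is inherited by each iterate; it will express
  that the solution is real.\<close>

theorem Picard_Lindeloef:
 fixes f :: "('i => complex) => 'i => complex" and x0 :: "'i => complex"
 assumes I: "finite I" and L: "0 \<le> L"
  and lip: "!!x y i. i \<in> I ==> norm (f x i - f y i) \<le> L * (\<Sum>j\<in>I. norm (x j - y j))"
  and \<sigma>: "!!i. i \<in> I ==> \<sigma> i \<in> I" and sym0: "!!i. i \<in> I ==> x0 (\<sigma> i) = cnj (x0 i)"
  and symf: "!!x i. (!!j. j \<in> I ==> x (\<sigma> j) = cnj (x j)) ==> i \<in> I ==> f x (\<sigma> i) = cnj (f x i)"
 shows "\<exists>x. (\<forall>i\<in>I. x i 0 = x0 i) \<and> (\<forall>i\<in>I. \<forall>t\<ge>0. x (\<sigma> i) t = cnj (x i t)) \<and>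
   (\<forall>i\<in>I. \<forall>T. \<forall>t\<in>{0..T}. (x i has_vector_derivative f (%j. x j t) i) (at t within {0..T}))"
proof -
 define X where "X = rec_nat (%i (t :: real). x0 i) (%n Y i t. x0 i + integral {0..t} (%s. f (%j. Y j s) i))"
 have X0: "X 0 i t = x0 i" and XS: "X (Suc n) i t = x0 i + integral {0..t} (%s. f (%j. X n j s) i)" for n i t
  by (simp_all add: X_def)
 have fcont: "continuous_on S (%s. f (%j. Y j s) i)" if "!!j. j \<in> I ==> continuous_on S (Y j)" "i \<in> I" for S :: "real set" and Y i
  unfolding continuous_on_def
 proof
  fix t assume t: "t \<in> S"
  have "((%s. L * (\<Sum>j\<in>I. norm (Y j s - Y j t))) \<longlongrightarrow> L * (\<Sum>j\<in>I. norm (Y j t - Y j t))) (at t within S)"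
   using that(1) t unfolding continuous_on_def by (intro tendsto_intros) blast
  hence "((%s. L * (\<Sum>j\<in>I. norm (Y j s - Y j t))) \<longlongrightarrow> 0) (at t within S)" by simp
  hence "((%s. f (%j. Y j s) i - f (%j. Y j t) i) \<longlongrightarrow> 0) (at t within S)"
   by (rule Lim_null_comparison[rotated]) (intro always_eventually allI lip that(2))
  thus "((%s. f (%j. Y j s) i) \<longlongrightarrow> f (%j. Y j t) i) (at t within S)" by (rule LIM_zero_cancel)
 qed
 have intcont: "continuous_on {0..T} (%t. x0 i + integral {0..t} g)" if "continuous_on {0..T} g" for T i and g :: "real => complex"
  by (intro continuous_intros indefinite_integral_continuous_1 integrable_continuous_real that)
 have Xc: "continuous_on {0..T} (X n i)" if "i \<in> I" for n i T using that
 proof (induction n arbitrary: i)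
  case 0 show ?case unfolding X0 by simp
 next
  case (Suc n)
  have "continuous_on {0..T} (%s. f (%j. X n j s) i)" by (rule fcont[OF Suc.IH Suc.prems])
  from intcont[OF this, of i] show ?case unfolding XS[symmetric] .
 qed
 \<comment> \<open>The increments are measured by the sum over all components, each of which obeys
   the Lipschitz bound, hence the factor \<open>card I\<close>.\<close>
 define k where "k = real (card I) * L"
 have k0: "0 \<le> k" using L by (simp add: k_def)
 define D where "D n t = (\<Sum>j\<in>I. norm (X (Suc n) j t - X n j t))" for n t
 have Dc: "continuous_on {0..T} (D n)" for n T unfolding D_def by (intro continuous_intros Xc)
 have Dbound: "D n t \<le> M * (k * t) ^ n / fact n" if "!!t. t \<in> {0..T} ==> D 0 t \<le> M" "t \<in> {0..T}" for n t T M
  using that(2)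
 proof (induction n arbitrary: t)
  case 0 thus ?case using that(1) by simp
 next
  case (Suc n)
  have fi: "(%s. f (%j. X m j s) i) integrable_on {0..t}" if "i \<in> I" for m i by (intro integrable_continuous_real fcont Xc that)
  have "norm (X (Suc (Suc n)) i t - X (Suc n) i t) \<le> L * integral {0..t} (D n)" if i: "i \<in> I" for i
  proof -
   have "X (Suc (Suc n)) i t - X (Suc n) i t = integral {0..t} (%s. f (%j. X (Suc n) j s) i - f (%j. X n j s) i)"
    unfolding XS[of "Suc n" i t] XS[of n i t] using fi[OF i] by (simp add: Henstock_Kurzweil_Integration.integral_diff)
   also have "norm \<dots> \<le> integral {0..t} (%s. L * D n s)"
   proof (rule integral_norm_bound_integral)
    show "(%s. f (%j. X (Suc n) j s) i - f (%j. X n j s) i) integrable_on {0..t}"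
     by (rule Henstock_Kurzweil_Integration.integrable_diff[OF fi[OF i] fi[OF i]])
    show "(%s. L * D n s) integrable_on {0..t}" by (intro integrable_continuous_real continuous_intros Dc)
    show "norm (f (%j. X (Suc n) j s) i - f (%j. X n j s) i) \<le> L * D n s" for s unfolding D_def by (rule lip[OF i])
   qed
   finally show ?thesis by simp
  qed
  hence "D (Suc n) t \<le> (\<Sum>j\<in>I. L * integral {0..t} (D n))" unfolding D_def[of "Suc n"] by (intro sum_mono) blast
  also have "\<dots> = integral {0..t} (%s. k * D n s)" by (simp add: k_def)
  also have "\<dots> \<le> M * (k * t) ^ Suc n / fact (Suc n)"
  proof (rule has_integral_le[OF _ integral_power_bound])
   show "((%s. k * D n s) has_integral integral {0..t} (%s. k * D n s)) {0..t}"
    by (intro integrable_integral integrable_continuous_real continuous_intros Dc)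
   show "0 \<le> t" using Suc.prems by simp
   fix s assume "s \<in> {0..t}"
   hence "D n s \<le> M * (k * s) ^ n / fact n" using Suc.prems by (intro Suc.IH) simp
   thus "k * D n s \<le> k * (M * (k * s) ^ n / fact n)" using k0 by (rule mult_left_mono)
  qed
  finally show ?case .
 qed
 have conv: "\<exists>l. \<forall>i\<in>I. uniform_limit {0..T} (%n. X n i) (l i) sequentially" for T
 proof -
  have "compact (D 0 ` {0..T})" by (intro compact_continuous_image Dc compact_Icc)
  then obtain M where M: "\<forall>x\<in>D 0 ` {0..T}. norm x \<le> M" using compact_imp_bounded bounded_iff by blast
  have M': "D 0 t \<le> max 0 M" if "t \<in> {0..T}" for t
  proof -
   have "norm (D 0 t) \<le> M" using M that by blast
   thus ?thesis by (simp add: le_max_iff_disj)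
  qed
  have "\<exists>g. uniform_limit {0..T} (%n. X n i) g sequentially" if i: "i \<in> I" for i
  proof -
   have "uniform_limit {0..T} (%n t. \<Sum>m<n. X (Suc m) i t - X m i t) (%t. \<Sum>m. X (Suc m) i t - X m i t) sequentially"
   proof (rule Weierstrass_m_test)
    fix n t assume t: "t \<in> {0..T}"
    have "norm (X (Suc n) i t - X n i t) \<le> D n t" unfolding D_def by (rule member_le_sum[OF i _ I]) simp
    also have "\<dots> \<le> max 0 M * (k * t) ^ n / fact n" by (rule Dbound[OF M' t])
    also have "\<dots> \<le> max 0 M * (k * T) ^ n / fact n" using t k0 by (intro divide_right_mono mult_left_mono power_mono) simp_all
    finally show "norm (X (Suc n) i t - X n i t) \<le> max 0 M * (inverse (fact n) * (k * T) ^ n)" by (simp add: divide_inverse mult_ac)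
   next
    show "summable (%n. max 0 M * (inverse (fact n) * (k * T) ^ n))" by (intro summable_mult summable_exp)
   qed
   hence "uniform_limit {0..T} (%n t. x0 i + (\<Sum>m<n. X (Suc m) i t - X m i t)) (%t. x0 i + (\<Sum>m. X (Suc m) i t - X m i t)) sequentially"
    by (intro uniform_limit_intros)
   moreover have "x0 i + (\<Sum>m<n. X (Suc m) i t - X m i t) = X n i t" for n t
    using sum_lessThan_telescope[of "%m. X m i t" n] by (simp add: X0)
   ultimately show ?thesis by auto
  qed
  thus ?thesis by metis
 qed
 \<comment> \<open>The pointwise limit makes the solutions on different intervals
   \<open>{0..T}\<close> literally the same function.\<close>
 define x where "x i t = lim (%n. X n i t)" for i t
 have ul: "uniform_limit {0..T} (%n. X n i) (x i) sequentially" if "i \<in> I" for i T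
 proof -
  obtain l where l: "uniform_limit {0..T} (%n. X n i) (l i) sequentially" using conv[of T] \<open>i \<in> I\<close> by blast
  have "l i t = x i t" if "t \<in> {0..T}" for t using tendsto_uniform_limitI[OF l that] unfolding x_def by (rule limI[symmetric])
  thus ?thesis using l uniform_limit_cong'[of "{0..T}" "%n. X n i" "%n. X n i" "l i" "x i"] by simp
 qed
 have xlim: "(%n. X n i t) \<longlonglongrightarrow> x i t" if "i \<in> I" "0 \<le> t" for i t
  using tendsto_uniform_limitI[OF ul[OF that(1), of t]] that(2) by simp
 have xc: "continuous_on {0..T} (x i)" if "i \<in> I" for i T by (rule uniform_limit_theorem[OF _ ul[OF that]]) (simp_all add: Xc that)
 have eq: "x i t = x0 i + integral {0..t} (%s. f (%j. x j s) i)" if i: "i \<in> I" and t: "0 \<le> t" for i t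
 proof -
  have u0: "\<forall>\<^sub>F n in sequentially. \<forall>s\<in>{0..t}. (\<Sum>j\<in>I. norm (X n j s - x j s)) < r" if r: "0 < r" for r
  proof -
   have r': "0 < r / (real (card I) + 1)" using r by simp
   have "\<forall>\<^sub>F n in sequentially. \<forall>j\<in>I. \<forall>s\<in>{0..t}. dist (X n j s) (x j s) < r / (real (card I) + 1)"
    by (intro eventually_ball_finite I ballI uniform_limitD[OF ul _] r')
   thus ?thesis
   proof eventually_elim
    case (elim n)
    show ?case
    proof
     fix s assume s: "s \<in> {0..t}"
     have "(\<Sum>j\<in>I. norm (X n j s - x j s)) \<le> (\<Sum>j\<in>I. r / (real (card I) + 1))"
      by (rule sum_mono) (use elim s in \<open>auto simp: dist_norm intro: less_imp_le\<close>)
     also have "\<dots> < r" using r by (simp add: field_simps)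
     finally show "(\<Sum>j\<in>I. norm (X n j s - x j s)) < r" .
    qed
   qed
  qed
  have "uniform_limit {0..t} (%n s. f (%j. X n j s) i) (%s. f (%j. x j s) i) sequentially"
   unfolding uniform_limit_iff
  proof (intro allI impI)
   fix r :: real assume r: "0 < r"
   hence "0 < r / (L + 1)" using L by simp
   from u0[OF this] show "\<forall>\<^sub>F n in sequentially. \<forall>s\<in>{0..t}. dist (f (%j. X n j s) i) (f (%j. x j s) i) < r"
   proof eventually_elim
    case (elim n)
    show ?case
    proof
     fix s assume "s \<in> {0..t}"
     with elim have "(\<Sum>j\<in>I. norm (X n j s - x j s)) < r / (L + 1)" by blast
     hence "(L + 1) * (\<Sum>j\<in>I. norm (X n j s - x j s)) < r" using L by (simp add: field_simps)
     moreover have "L * (\<Sum>j\<in>I. norm (X n j s - x j s)) \<le> (L + 1) * (\<Sum>j\<in>I. norm (X n j s - x j s))"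
      by (intro mult_right_mono sum_nonneg) simp_all
     ultimately show "dist (f (%j. X n j s) i) (f (%j. x j s) i) < r"
      using lip[OF i, of "%j. X n j s" "%j. x j s"] unfolding dist_norm by linarith
    qed
   qed
  qed
  note U = this
  have cc: "continuous_on {0..t} (%s. f (%j. X n j s) i)" for n by (intro fcont Xc i)
  obtain J JJ where J: "!!n. ((%s. f (%j. X n j s) i) has_integral J n) {0..t}" "((%s. f (%j. x j s) i) has_integral JJ) {0..t}" "J \<longlonglongrightarrow> JJ"
   by (rule uniform_limit_integral[OF U cc trivial_limit_sequentially]) (rule that)
  have "(%n. x0 i + J n) \<longlonglongrightarrow> x0 i + JJ" by (intro tendsto_intros J)
  moreover have "x0 i + J n = X (Suc n) i t" for n unfolding XS using J(1)[of n] by (simp add: integral_unique)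
  moreover have "(%n. X (Suc n) i t) \<longlonglongrightarrow> x i t" by (intro LIMSEQ_Suc xlim i t)
  ultimately have "x i t = x0 i + JJ" using LIMSEQ_unique by simp
  thus ?thesis using J(2) by (simp add: integral_unique)
 qed
 have symX: "X n (\<sigma> i) t = cnj (X n i t)" if "i \<in> I" for n i t using that
 proof (induction n arbitrary: i t)
  case 0 thus ?case by (simp add: X0 sym0)
 next
  case (Suc n)
  have "f (%j. X n j s) (\<sigma> i) = cnj (f (%j. X n j s) i)" for s by (intro symf Suc)
  thus ?case using sym0[OF Suc.prems] by (simp add: XS Henstock_Kurzweil_Integration.integral_cnj)
 qed
 show ?thesis
 proof (intro exI[of _ x] conjI ballI allI impI)
  fix i assume i: "i \<in> I"
  show "x i 0 = x0 i" using eq[OF i, of 0] by simp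
  show "x (\<sigma> i) t = cnj (x i t)" if "0 \<le> t" for t
  proof (rule LIMSEQ_unique)
   show "(%n. X n (\<sigma> i) t) \<longlonglongrightarrow> x (\<sigma> i) t" by (intro xlim \<sigma> i that)
   show "(%n. X n (\<sigma> i) t) \<longlonglongrightarrow> cnj (x i t)" unfolding symX[OF i] by (intro tendsto_cnj xlim i that)
  qed
  fix T t :: real assume t: "t \<in> {0..T}"
  have "continuous_on {0..T} (%s. f (%j. x j s) i)" by (intro fcont xc i)
  from integral_has_vector_derivative[OF this t]
  have "((%t. x0 i + integral {0..t} (%s. f (%j. x j s) i)) has_vector_derivative f (%j. x j t) i) (at t within {0..T})"
   by (auto intro!: derivative_eq_intros)
  thus "(x i has_vector_derivative f (%j. x j t) i) (at t within {0..T})"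
   by (rule has_vector_derivative_transform[OF t, rotated]) (simp add: eq[OF i])
 qed
qed

text \<open>Real and imaginary parts are clipped separately, so the Lipschitz bound and
  compatibility with conjugation are immediate; on the disc of radius \<open>B\<close> nothing
  changes (\<open>clip_id\<close>).\<close>

definition clip :: "real => complex => complex" where
 "clip B z = Complex (max (- B) (min B (Re z))) (max (- B) (min B (Im z)))"

lemma clip_id: "norm z \<le> B ==> clip B z = z" using abs_Re_le_cmod[of z] abs_Im_le_cmod[of z] by (simp add: clip_def complex_eq_iff)

lemma clip_norm: "0 \<le> B ==> norm (clip B z) \<le> 2 * B"
proof -
 assume B: "0 \<le> B"
 have "\<bar>max (- B) (min B r)\<bar> \<le> B" for r using B by (auto simp: max_def min_def abs_if)
 hence "\<bar>Re (clip B z)\<bar> \<le> B" "\<bar>Im (clip B z)\<bar> \<le> B" by (simp_all add: clip_def)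
 thus ?thesis using cmod_le[of "clip B z"] by linarith
qed

lemma clip_lip: "norm (clip B z - clip B w) \<le> 2 * norm (z - w)"
proof -
 have c: "\<bar>max (- B) (min B r) - max (- B) (min B s)\<bar> \<le> \<bar>r - s\<bar>" for r s :: real by (simp add: max_def min_def)
 have "norm (clip B z - clip B w) \<le> \<bar>Re (clip B z - clip B w)\<bar> + \<bar>Im (clip B z - clip B w)\<bar>" by (rule cmod_le)
 also have "\<dots> \<le> \<bar>Re z - Re w\<bar> + \<bar>Im z - Im w\<bar>" unfolding clip_def by (intro add_mono) (simp_all add: c)
 also have "\<dots> \<le> norm (z - w) + norm (z - w)" using abs_Re_le_cmod[of "z - w"] abs_Im_le_cmod[of "z - w"] by (intro add_mono) simp_all
 finally show ?thesis by simp
qed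

lemma clip_cnj: "0 \<le> B ==> clip B (cnj z) = cnj (clip B z)" by (simp add: clip_def complex_eq_iff max_def min_def)

text \<open>Solve the clipped system and suppose that some component reaches
  \<open>B = B0 + 1\<close>. Up to the first such time the clipping is inactive, so the a priori
  bound \<open>B0\<close> applies there and gives a contradiction.\<close>

theorem ODE_global:
 fixes f :: "('i => complex) => 'i => complex" and x0 :: "'i => complex"
 assumes I: "finite I"
  and lip: "!!B. \<exists>L\<ge>0. \<forall>x y. (\<forall>j\<in>I. norm (x j) \<le> B \<and> norm (y j) \<le> B) --> (\<forall>i\<in>I. norm (f x i - f y i) \<le> L * (\<Sum>j\<in>I. norm (x j - y j)))"
  and \<sigma>: "!!i. i \<in> I ==> \<sigma> i \<in> I" and sym0: "!!i. i \<in> I ==> x0 (\<sigma> i) = cnj (x0 i)"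
  and symf: "!!x i. (!!j. j \<in> I ==> x (\<sigma> j) = cnj (x j)) ==> i \<in> I ==> f x (\<sigma> i) = cnj (f x i)"
  and B0: "0 \<le> B0"
  and apriori: "!!T x i t. 0 \<le> T ==> (!!i. i \<in> I ==> x i 0 = x0 i) ==> (!!i t. i \<in> I ==> t \<in> {0..T} ==> x (\<sigma> i) t = cnj (x i t)) ==>
    (!!i t. i \<in> I ==> t \<in> {0..T} ==> (x i has_vector_derivative f (%j. x j t) i) (at t within {0..T})) ==>
    i \<in> I ==> t \<in> {0..T} ==> norm (x i t) \<le> B0"
 shows "\<exists>x. (\<forall>i\<in>I. x i 0 = x0 i) \<and> (\<forall>i\<in>I. \<forall>t\<ge>0. x (\<sigma> i) t = cnj (x i t)) \<and>
   (\<forall>i\<in>I. \<forall>T. \<forall>t\<in>{0..T}. (x i has_vector_derivative f (%j. x j t) i) (at t within {0..T}))"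
proof -
 define B where "B = B0 + 1"
 have Bp: "0 \<le> B" "B0 < B" using B0 by (simp_all add: B_def)
 obtain L where L: "0 \<le> L" "!!x y i. (\<forall>j\<in>I. norm (x j) \<le> 2 * B \<and> norm (y j) \<le> 2 * B) ==> i \<in> I ==> norm (f x i - f y i) \<le> L * (\<Sum>j\<in>I. norm (x j - y j))"
  using lip[of "2 * B"] by blast
 let ?g = "%x. f (%j. clip B (x j))"
 obtain x where x: "\<forall>i\<in>I. x i 0 = x0 i" "\<forall>i\<in>I. \<forall>t\<ge>0. x (\<sigma> i) t = cnj (x i t)"
   "\<forall>i\<in>I. \<forall>T. \<forall>t\<in>{0..T}. (x i has_vector_derivative ?g (%j. x j t) i) (at t within {0..T})"
 proof (atomize_elim, rule Picard_Lindeloef[OF I, of "2 * L"])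
  show "0 \<le> 2 * L" using L by simp
  fix x y i assume i: "i \<in> I"
  have "norm (?g x i - ?g y i) \<le> L * (\<Sum>j\<in>I. norm (clip B (x j) - clip B (y j)))" by (rule L(2)) (use clip_norm[OF Bp(1)] i in simp_all)
  also have "\<dots> \<le> L * (\<Sum>j\<in>I. 2 * norm (x j - y j))" by (intro mult_left_mono sum_mono clip_lip L)
  finally show "norm (?g x i - ?g y i) \<le> 2 * L * (\<Sum>j\<in>I. norm (x j - y j))" by (simp add: sum_distrib_left mult_ac)
 next
  fix x i assume "!!j. j \<in> I ==> x (\<sigma> j) = cnj (x j)" "i \<in> I"
  thus "?g x (\<sigma> i) = cnj (?g x i)" by (intro symf) (simp_all add: clip_cnj Bp(1))
 qed (use \<sigma> sym0 in simp_all)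
 have xc: "continuous_on {0..T} (x i)" if "i \<in> I" for i T using x(3) that by (intro continuous_on_vector_derivative) blast
 have small: "norm (x i t) < B" if t: "0 \<le> t" and i: "i \<in> I" for i t
 proof (rule ccontr)
  assume "\<not> norm (x i t) < B"
  define S where "S = (\<Union>j\<in>I. {s \<in> {0..t}. B \<le> norm (x j s)})"
  have "closed {s \<in> {0..t}. B \<le> norm (x j s)}" if "j \<in> I" for j
  proof -
   have "closed ({0..t} \<inter> (%s. norm (x j s)) -` {B..})" by (intro continuous_closed_preimage continuous_on_norm xc that) simp_all
   also have "{0..t} \<inter> (%s. norm (x j s)) -` {B..} = {s \<in> {0..t}. B \<le> norm (x j s)}" by auto
   finally show ?thesis .
  qed
  hence "closed S" unfolding S_def by (intro closed_UN I) blast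
  moreover have "S \<noteq> {}" using \<open>\<not> norm (x i t) < B\<close> t i unfolding S_def by fastforce
  moreover have bb: "bdd_below S" unfolding S_def by (rule bdd_belowI[of _ 0]) auto
  ultimately have "Inf S \<in> S" by (intro closed_contains_Inf)
  define T where "T = Inf S"
  obtain j where j: "j \<in> I" "T \<in> {0..t}" "B \<le> norm (x j T)" using \<open>Inf S \<in> S\<close> unfolding T_def S_def by blast
  have before: "norm (x i s) < B" if "s \<in> {0..<T}" "i \<in> I" for s i
  proof (rule ccontr)
   assume "\<not> norm (x i s) < B"
   hence "B \<le> norm (x i s)" "s \<in> {0..t}" using that(1) j(2) by simp_all
   hence "s \<in> S" using that(2) unfolding S_def by blast
   hence "T \<le> s" unfolding T_def by (rule cInf_lower[OF _ bb])
   thus False using that by simp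
  qed
  have le: "norm (x i s) \<le> B" if "s \<in> {0..T}" "i \<in> I" for s i
  proof (cases "s < T")
   case True thus ?thesis using before[of s i] that by simp
  next
   case False
   hence sT: "s = T" using that by simp
   show ?thesis
   proof (cases "T = 0")
    case True
    \<comment> \<open>On the one-point interval the derivative condition is vacuous, so the a priori
      bound applies to the constant family \<open>x0\<close>.\<close>
    have "norm (x i 0) \<le> B0" using apriori[of 0 "%i t. x0 i" i 0] that x(1) sym0
     by (simp add: has_vector_derivative_def has_derivative_within_singleton_iff bounded_linear_scaleR_left)
    thus ?thesis using sT True Bp by simp
   next
    case False
    hence "T islimpt {0..<T}" using j(2) by (simp add: islimpt_Ico)
    have c: "continuous (at T within {0..T}) (%s. norm (x i s))"
     using continuous_on_norm[OF xc[OF that(2), of T]] j(2) by (simp add: continuous_on_eq_continuous_within)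
    have "((%s. norm (x i s)) \<longlongrightarrow> norm (x i T)) (at T within {0..<T})"
     using c unfolding continuous_within by (rule tendsto_within_subset) auto
    moreover have "\<forall>\<^sub>F s in at T within {0..<T}. norm (x i s) \<le> B"
     unfolding eventually_at_filter using before[OF _ that(2)] by (intro always_eventually) (auto intro: less_imp_le)
    moreover have "at T within {0..<T} \<noteq> bot" using \<open>T islimpt {0..<T}\<close> trivial_limit_within by blast
    ultimately show ?thesis unfolding sT by (intro tendsto_upperbound)
   qed
  qed
  have "norm (x j T) \<le> B0"
  proof (rule apriori[of T x])
   show "0 \<le> T" "T \<in> {0..T}" using j(2) by simp_all
   show "x i 0 = x0 i" if "i \<in> I" for i using x(1) that by blast
   show "x (\<sigma> i) s = cnj (x i s)" if "i \<in> I" "s \<in> {0..T}" for i s using x(2) that by simp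
   show "(x i has_vector_derivative f (%j. x j s) i) (at s within {0..T})" if "i \<in> I" "s \<in> {0..T}" for i s
   proof -
    have "(x i has_vector_derivative ?g (%j. x j s) i) (at s within {0..T})" using x(3) that by blast
    moreover have "?g (%j. x j s) i = f (%j. x j s) i"
    proof -
     have "norm (?g (%j. x j s) i - f (%j. x j s) i) \<le> L * (\<Sum>j\<in>I. norm (clip B (x j s) - x j s))"
      using le[OF that(2)] clip_norm[OF Bp(1)] Bp(1) by (intro L(2) that(1)) force
     also have "\<dots> = 0" using le[OF that(2)] by (simp add: clip_id)
     finally show ?thesis by simp
    qed
    ultimately show ?thesis by simp
   qed
  qed (rule j(1))
  thus False using j(3) Bp by simp
 qed
 show ?thesis
 proof (intro exI[of _ x] conjI x(1,2) ballI allI)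
  fix i and T t :: real assume i: "i \<in> I" and t: "t \<in> {0..T}"
  have "(x i has_vector_derivative ?g (%j. x j t) i) (at t within {0..T})" using x(3) i t by blast
  moreover have "?g (%j. x j t) i = f (%j. x j t) i"
  proof -
   have le: "norm (x j t) \<le> B" if "j \<in> I" for j using small[of t j] t that by simp
   have "norm (?g (%j. x j t) i - f (%j. x j t) i) \<le> L * (\<Sum>j\<in>I. norm (clip B (x j t) - x j t))"
    using le clip_norm[OF Bp(1)] Bp(1) by (intro L(2) i) force
   also have "\<dots> = 0" using le by (simp add: clip_id)
   finally show ?thesis by simp
  qed
  ultimately show "(x i has_vector_derivative f (%j. x j t) i) (at t within {0..T})" by simp
 qed
qed

section \<open>Energy estimates\<close>

lemma CS_sum:
 fixes f g :: "'a => real"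
 shows "(\<Sum>a\<in>P. f a * g a)^2 \<le> (\<Sum>a\<in>P. (f a)^2) * (\<Sum>a\<in>P. (g a)^2)" by (rule Cauchy_Schwarz_ineq_sum)

context torus2
begin

text \<open>Symbol of the scalar product of two gradients: minus the scalar product of the frequency
  vectors, hence real.\<close>

definition kd :: "int \<times> int => coeffs" where
 "kd b c = mx b * mx c + my b * my c"

lemma norm_kd_le: "norm (kd b c) \<le> sqrt (nf b) * sqrt (nf c)"
proof -
 let ?x = "norm (mx b)" and ?y = "norm (my b)" and ?z = "norm (mx c)" and ?w = "norm (my c)"
 have "norm (kd b c) \<le> ?x * ?z + ?y * ?w" unfolding kd_def using norm_triangle_ineq[of "mx b * mx c" "my b * my c"] by (simp only: norm_mult)
 also have "\<dots> \<le> sqrt ((?x^2 + ?y^2) * (?z^2 + ?w^2))"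
 proof (rule real_le_rsqrt)
  have "0 \<le> (?x * ?w - ?y * ?z)^2" by simp
  thus "(?x * ?z + ?y * ?w)^2 \<le> (?x^2 + ?y^2) * (?z^2 + ?w^2)" by (simp add: power2_eq_square algebra_simps)
 qed
 finally show ?thesis by (simp add: norm_mx real_sqrt_mult)
qed

text \<open>Up to the factor \<open>LL\<close>, the squared homogeneous Sobolev norm of order
  \<open>k\<close> of the modes in \<open>P\<close>.\<close>

definition wsum :: "(int \<times> int) set => nat => coeffs => real" where
 "wsum P k d = (\<Sum>a\<in>P. nf a ^ k * (norm (d a))^2)"

text \<open>Coefficient at \<open>a\<close> of the scalar product of two gradients, one of the part
  of the series with modes in \<open>P\<close>, the other of the part with modes in
  \<open>R\<close>.\<close>

definition qq :: "(int \<times> int) set => (int \<times> int) set => coeffs => coeffs" where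
 "qq P R d a = (\<Sum>b\<in>P. if a - b \<in> R then kd b (a - b) * d b * d (a - b) else 0)"

lemma wsum_nonneg: "0 \<le> wsum P k d" unfolding wsum_def using nf_nonneg by (intro sum_nonneg mult_nonneg_nonneg) simp_all

lemma wsum_mono: "finite R ==> P \<subseteq> R ==> wsum P k d \<le> wsum R k d"
 unfolding wsum_def using nf_nonneg by (intro sum_mono2) simp_all

lemma wsum_Un: "finite P ==> finite R ==> P \<inter> R = {} ==> wsum (P \<union> R) k d = wsum P k d + wsum R k d"
 unfolding wsum_def by (rule sum.union_disjoint)

lemma wsum_interp: "(wsum P 1 d)^2 \<le> wsum P 0 d * wsum P 2 d"
proof -
 have "(\<Sum>a\<in>P. norm (d a) * (nf a * norm (d a)))^2 \<le> (\<Sum>a\<in>P. (norm (d a))^2) * (\<Sum>a\<in>P. (nf a * norm (d a))^2)"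
  by (rule CS_sum)
 thus ?thesis by (simp add: wsum_def power2_eq_square mult_ac)
qed

lemma qq_bound:
 assumes "finite P" "finite R"
 shows "norm (qq P R d a) \<le> sqrt (wsum P 1 d) * sqrt (wsum R 1 d)"
proof -
 let ?P = "{b \<in> P. a - b \<in> R}"
 let ?f = "%b. sqrt (nf b) * norm (d b)"
 have "qq P R d a = (\<Sum>b\<in>?P. kd b (a - b) * d b * d (a - b))" unfolding qq_def using assms by (simp add: sum.If_cases Int_def)
 also have "norm \<dots> \<le> (\<Sum>b\<in>?P. ?f b * ?f (a - b))"
 proof (rule sum_norm_le)
  fix b
  have "norm (kd b (a - b)) * (norm (d b) * norm (d (a - b))) \<le> (sqrt (nf b) * sqrt (nf (a - b))) * (norm (d b) * norm (d (a - b)))"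
   by (intro mult_right_mono norm_kd_le) simp
  thus "norm (kd b (a - b) * d b * d (a - b)) \<le> ?f b * ?f (a - b)" by (simp add: norm_mult mult_ac)
 qed
 also have "\<dots> \<le> sqrt (\<Sum>b\<in>?P. (?f b)^2) * sqrt (\<Sum>b\<in>?P. (?f (a - b))^2)"
  unfolding real_sqrt_mult[symmetric] by (rule real_le_rsqrt[OF CS_sum])
 also have "\<dots> \<le> sqrt (wsum P 1 d) * sqrt (wsum R 1 d)"
 proof (intro mult_mono real_sqrt_le_mono)
  have sq: "(?f b)^2 = nf b ^ 1 * (norm (d b))^2" for b using nf_nonneg[of b] by (simp add: power_mult_distrib)
  show "(\<Sum>b\<in>?P. (?f b)^2) \<le> wsum P 1 d" unfolding sq wsum_def using assms nf_nonneg by (intro sum_mono2) auto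
  have "(\<Sum>b\<in>?P. (?f (a - b))^2) = (\<Sum>b\<in>(%b. a - b) ` ?P. (?f b)^2)"
   by (subst sum.reindex) (simp_all add: inj_on_def)
  also have "\<dots> \<le> (\<Sum>b\<in>R. (?f b)^2)" using assms by (intro sum_mono2) auto
  finally show "(\<Sum>b\<in>?P. (?f (a - b))^2) \<le> wsum R 1 d" unfolding sq wsum_def .
  show "0 \<le> sqrt (\<Sum>b\<in>?P. (?f (a - b))^2)" by (simp add: sum_nonneg)
 qed (simp add: wsum_nonneg)
 finally show ?thesis .
qed

lemma qq_Un1: "finite P ==> finite P' ==> P \<inter> P' = {} ==> qq (P \<union> P') R d a = qq P R d a + qq P' R d a"
 unfolding qq_def by (rule sum.union_disjoint)

lemma qq_Un2: "R \<inter> R' = {} ==> qq P (R \<union> R') d a = qq P R d a + qq P R' d a"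
 unfolding qq_def sum.distrib[symmetric] by (intro sum.cong refl) auto

lemma qq_empty: "(!!b. b \<in> P ==> a - b \<notin> R) ==> qq P R d a = 0"
 unfolding qq_def by (intro sum.neutral) auto

definition Jx :: "(int \<times> int) set => (int \<times> int) set" where "Jx J = {a \<in> J. fst a \<noteq> 0}"
definition J0 :: "(int \<times> int) set => (int \<times> int) set" where "J0 J = {a \<in> J. fst a = 0}"

lemma J_split: "J = Jx J \<union> J0 J" "Jx J \<inter> J0 J = {}" "finite J ==> finite (Jx J)" "finite J ==> finite (J0 J)"
 by (auto simp: Jx_def J0_def)

text \<open>The product of two functions of \<open>y\<close> has no mode with nonzero x-frequency,
  so every remaining term contains a factor from \<open>Jx J\<close>: the average alone cannot
  excite the other modes.\<close>

lemma qq_split_x: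
 assumes J: "finite J" and a: "fst a \<noteq> 0"
 shows "norm (qq J J d a) \<le> wsum (Jx J) 1 d + 2 * sqrt (wsum (Jx J) 1 d * wsum (J0 J) 1 d)"
proof -
 note f = J_split(3,4)[OF J]
 have "qq J J d a = qq (Jx J) J d a + qq (J0 J) J d a" by (subst (1) J_split(1)) (rule qq_Un1[OF f J_split(2)])
 also have "qq (Jx J) J d a = qq (Jx J) (Jx J) d a + qq (Jx J) (J0 J) d a" by (subst (2) J_split(1)) (rule qq_Un2[OF J_split(2)])
 also have "qq (J0 J) J d a = qq (J0 J) (Jx J) d a + qq (J0 J) (J0 J) d a" by (subst (2) J_split(1)) (rule qq_Un2[OF J_split(2)])
 also have "qq (J0 J) (J0 J) d a = 0" using a by (intro qq_empty) (auto simp: J0_def)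
 finally have "qq J J d a = qq (Jx J) (Jx J) d a + qq (Jx J) (J0 J) d a + qq (J0 J) (Jx J) d a" by simp
 also have "norm \<dots> \<le> norm (qq (Jx J) (Jx J) d a) + norm (qq (Jx J) (J0 J) d a) + norm (qq (J0 J) (Jx J) d a)"
  by (intro norm_triangle_mono order_refl)
 also have "\<dots> \<le> sqrt (wsum (Jx J) 1 d) * sqrt (wsum (Jx J) 1 d) + sqrt (wsum (Jx J) 1 d) * sqrt (wsum (J0 J) 1 d)
   + sqrt (wsum (J0 J) 1 d) * sqrt (wsum (Jx J) 1 d)" by (intro add_mono qq_bound f)
 finally show ?thesis by (simp add: real_sqrt_mult wsum_nonneg mult.commute)
qed

text \<open>A mixed product has nonzero x-frequency, so the average feels the other modes only
  through their products with each other.\<close>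

lemma qq_split_0:
 assumes J: "finite J" and a: "fst a = 0"
 shows "qq J J d a = qq (Jx J) (Jx J) d a + qq (J0 J) (J0 J) d a"
proof -
 note f = J_split(3,4)[OF J]
 have "qq J J d a = qq (Jx J) J d a + qq (J0 J) J d a" by (subst (1) J_split(1)) (rule qq_Un1[OF f J_split(2)])
 also have "qq (Jx J) J d a = qq (Jx J) (Jx J) d a + qq (Jx J) (J0 J) d a" by (subst (2) J_split(1)) (rule qq_Un2[OF J_split(2)])
 also have "qq (J0 J) J d a = qq (J0 J) (Jx J) d a + qq (J0 J) (J0 J) d a" by (subst (2) J_split(1)) (rule qq_Un2[OF J_split(2)])
 also have "qq (J0 J) (Jx J) d a = 0" using a by (intro qq_empty) (auto simp: J0_def Jx_def)
 also have "qq (Jx J) (J0 J) d a = 0" using a by (intro qq_empty) (auto simp: J0_def Jx_def)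
 finally show ?thesis by simp
qed

text \<open>The Fourier form of \<open>v_y^2 * v_yy = (v_y^3)_y / 3\<close>, whose integral
  vanishes. The sum runs over triples of frequencies with sum zero; the summand is symmetric up to
  one extra frequency factor, and adding up this factor over the three places gives zero.\<close>

lemma Burgers_cancel:
 assumes P: "finite P" "uminus ` P = P" "!!a. a \<in> P ==> fst a = 0" and h: "!!a. a \<in> P ==> d (- a) = cnj (d a)"
 shows "(\<Sum>a\<in>P. of_real (nf a) * (cnj (d a) * qq P P d a)) = 0"
proof -
 \<comment> \<open>Only two members of a triple are stored; the third is minus their sum.\<close>
 define T where "T = {x. fst x \<in> P \<and> snd x \<in> P \<and> - (fst x + snd x) \<in> P}"
 have um: "- a \<in> P \<longleftrightarrow> a \<in> P" for a using P(2) by (metis (no_types, opaque_lifting) add.inverse_inverse imageI)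
 let ?l = "%a. complex_of_real (2 * pi * of_int (snd a) / L2)"
 define g where "g x = ?l (fst x) * ?l (snd x) * ?l (- (fst x + snd x)) * (d (fst x) * d (snd x) * d (- (fst x + snd x)))" for x
 have lneg: "?l (- (p + q)) = - ?l p - ?l q" for p q :: "int \<times> int" by (simp add: algebra_simps add_divide_distrib diff_divide_distrib)
 have r1: "(\<Sum>x\<in>T. g x * ?l (fst x)) = (\<Sum>x\<in>T. g x * ?l (snd x))"
 proof (rule sum.reindex_bij_witness[where i = "%x. (snd x, fst x)" and j = "%x. (snd x, fst x)"])
  fix x :: "(int \<times> int) \<times> (int \<times> int)"
  assume x: "x \<in> T"
  show "(snd x, fst x) \<in> T" using x by (simp only: T_def mem_Collect_eq fst_conv snd_conv add.commute simp_thms)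
  thus "(snd x, fst x) \<in> T" .
  show "g (snd x, fst x) * ?l (snd (snd x, fst x)) = g x * ?l (fst x)"
   unfolding g_def fst_conv snd_conv add.commute[of "snd x" "fst x"] by (simp only: mult_ac)
 qed (simp_all only: prod.collapse fst_conv snd_conv)
 have r2: "(\<Sum>x\<in>T. g x * ?l (fst x)) = (\<Sum>x\<in>T. g x * ?l (- (fst x + snd x)))"
 proof (rule sum.reindex_bij_witness[where i = "%x. (- (fst x + snd x), snd x)" and j = "%x. (- (fst x + snd x), snd x)"])
  have e: "- (- (p + q) + q) = p" for p q :: "int \<times> int" by simp
  fix x :: "(int \<times> int) \<times> (int \<times> int)"
  show "(- (fst (- (fst x + snd x), snd x) + snd (- (fst x + snd x), snd x)), snd (- (fst x + snd x), snd x)) = x"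
   by (simp only: fst_conv snd_conv e prod.collapse)
  thus "(- (fst (- (fst x + snd x), snd x) + snd (- (fst x + snd x), snd x)), snd (- (fst x + snd x), snd x)) = x" .
  assume x: "x \<in> T"
  show "(- (fst x + snd x), snd x) \<in> T" using x by (simp only: T_def mem_Collect_eq fst_conv snd_conv e simp_thms)
  thus "(- (fst x + snd x), snd x) \<in> T" .
  show "g (- (fst x + snd x), snd x) * ?l (- (fst (- (fst x + snd x), snd x) + snd (- (fst x + snd x), snd x))) = g x * ?l (fst x)"
   unfolding g_def fst_conv snd_conv e by (simp only: mult_ac)
 qed
 have "3 * (\<Sum>x\<in>T. g x * ?l (fst x)) = (\<Sum>x\<in>T. g x * ?l (fst x)) + (\<Sum>x\<in>T. g x * ?l (snd x)) + (\<Sum>x\<in>T. g x * ?l (- (fst x + snd x)))"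
  using r1 r2 by simp
 also have "\<dots> = (\<Sum>x\<in>T. 0)" unfolding sum.distrib[symmetric]
 proof (rule sum.cong[OF refl])
  fix x :: "(int \<times> int) \<times> (int \<times> int)"
  show "g x * ?l (fst x) + g x * ?l (snd x) + g x * ?l (- (fst x + snd x)) = 0" unfolding distrib_left[symmetric] lneg by simp
 qed
 finally have zero: "(\<Sum>x\<in>T. g x * ?l (fst x)) = 0" by simp
 have "(\<Sum>a\<in>P. of_real (nf a) * (cnj (d a) * qq P P d a))
   = (\<Sum>a\<in>P. \<Sum>b\<in>P. if a - b \<in> P then of_real (nf a) * (d (- a) * (kd b (a - b) * d b * d (a - b))) else 0)"
  unfolding qq_def sum_distrib_left by (intro sum.cong refl) (auto simp: h)
 also have "\<dots> = (\<Sum>x\<in>P \<times> P. if fst x - snd x \<in> P then of_real (nf (fst x)) * (d (- fst x) * (kd (snd x) (fst x - snd x) * d (snd x) * d (fst x - snd x))) else 0)"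
  unfolding sum.cartesian_product by (simp only: case_prod_unfold)
 also have "\<dots> = (\<Sum>x\<in>{x \<in> P \<times> P. fst x - snd x \<in> P}. of_real (nf (fst x)) * (d (- fst x) * (kd (snd x) (fst x - snd x) * d (snd x) * d (fst x - snd x))))"
  using P(1) by (intro sum.inter_filter[symmetric]) simp
 \<comment> \<open>The pair \<open>(a, b)\<close> of the convolution sum becomes the triple
   \<open>(- a, b, a - b)\<close>.\<close>
 also have "\<dots> = (\<Sum>x\<in>T. - (g x * ?l (fst x)))"
 proof (rule sum.reindex_bij_witness[where i = "%x. (- fst x, snd x)" and j = "%x. (- fst x, snd x)"])
  fix x :: "(int \<times> int) \<times> (int \<times> int)"
  show "(- fst (- fst x, snd x), snd (- fst x, snd x)) = x" by (simp only: fst_conv snd_conv minus_minus prod.collapse)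
  thus "(- fst (- fst x, snd x), snd (- fst x, snd x)) = x" .
  have e: "- (- p + q) = p - q" "- p - q = - (p + q)" for p q :: "int \<times> int" by simp_all
  have um2: "- p + q \<in> P \<longleftrightarrow> p - q \<in> P" for p q using um[of "p - q"] by (simp add: add.commute)
  show "(- fst x, snd x) \<in> {x \<in> P \<times> P. fst x - snd x \<in> P}" if "x \<in> T"
   using that by (simp only: T_def mem_Collect_eq fst_conv snd_conv mem_Times_iff um e simp_thms)
  assume x: "x \<in> {x \<in> P \<times> P. fst x - snd x \<in> P}"
  thus "(- fst x, snd x) \<in> T" by (simp only: T_def mem_Collect_eq fst_conv snd_conv mem_Times_iff um um2 e simp_thms)
  have z: "fst (fst x) = 0" "fst (snd x) = 0" using P(3) x by (simp_all add: mem_Times_iff)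
  have nfa: "complex_of_real (nf (fst x)) = ?l (fst x) * ?l (fst x)" using z by (simp add: nf_def power2_eq_square)
  have kdb: "kd (snd x) (fst x - snd x) = - (?l (snd x) * ?l (fst x - snd x))"
  proof -
   have ii: "(\<i> * v) * (\<i> * w) = - (v * w)" for v w by (simp add: complex_eq_iff)
   show ?thesis unfolding kd_def mx_def my_def ii using z by simp
  qed
  have ln: "?l (- a) = - ?l a" for a by simp
  show "- (g (- fst x, snd x) * ?l (fst (- fst x, snd x)))
    = of_real (nf (fst x)) * (d (- fst x) * (kd (snd x) (fst x - snd x) * d (snd x) * d (fst x - snd x)))"
   unfolding g_def fst_conv snd_conv nfa kdb e(1) ln[of "fst x"] by (simp only: mult_minus_left mult_minus_right minus_minus mult_ac)
 qed
 finally show ?thesis unfolding sum_negf zero by simp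
qed

text \<open>The matrix \<open>mx a * Ud (a - b)\<close> is skew-hermitian because \<open>u\<close>
  is real and does not couple different x-frequencies; restriction to a finite set of modes
  preserves this.\<close>

lemma transport_cancel:
 assumes P: "finite P" and U: "!!a. Ud (- a) = cnj (Ud a)" "!!a. fst a \<noteq> 0 ==> Ud a = 0"
 shows "Re (\<Sum>a\<in>P. cnj (d a) * (mx a * (\<Sum>b\<in>P. d b * Ud (a - b)))) = 0"
proof -
 let ?S = "\<Sum>a\<in>P. \<Sum>b\<in>P. cnj (d a) * (mx a * (d b * Ud (a - b)))"
 have eq: "(\<Sum>a\<in>P. cnj (d a) * (mx a * (\<Sum>b\<in>P. d b * Ud (a - b)))) = ?S" by (simp add: sum_distrib_left)
 have t: "cnj (cnj (d a) * (mx a * (d b * Ud (a - b)))) = - (cnj (d b) * (mx b * (d a * Ud (b - a))))" for a b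
 proof (cases "fst a = fst b")
  case True
  hence "cnj (mx a) = - mx b" by (simp add: mx_def)
  moreover have "cnj (Ud (a - b)) = Ud (b - a)" using U(1)[of "a - b"] by simp
  ultimately show ?thesis by (simp add: mult_ac)
 next
  case False
  hence "Ud (a - b) = 0" "Ud (b - a) = 0" by (simp_all add: U(2))
  thus ?thesis by simp
 qed
 have "cnj ?S = - (\<Sum>a\<in>P. \<Sum>b\<in>P. cnj (d b) * (mx b * (d a * Ud (b - a))))" unfolding cnj_sum t by (simp add: sum_negf)
 also have "\<dots> = - ?S" by (subst sum.swap) simp
 finally have anti: "cnj ?S = - ?S" .
 have "Re z = 0" if "cnj z = - z" for z
 proof -
  have "Re z = - Re z" using arg_cong[OF that, of Re] by simp
  thus ?thesis by simp
 qed
 from this[OF anti] show ?thesis unfolding eq .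
qed

lemma nf_lower: "\<exists>\<kappa>>0. \<forall>a. a \<noteq> 0 --> \<kappa> \<le> nf a"
proof -
 define \<kappa> where "\<kappa> = min ((2 * pi / L1)^2) ((2 * pi / L2)^2)"
 have "\<kappa> \<le> nf a" if "a \<noteq> 0" for a
 proof -
  obtain k l where a: "a = (k, l)" by fastforce
  have one: "1 \<le> (real_of_int m)^2" if "m \<noteq> 0" for m
  proof -
   have "1 \<le> \<bar>m\<bar>" using that by simp
   hence "1 \<le> \<bar>real_of_int m\<bar>" by linarith
   thus ?thesis by (metis one_le_power power2_abs)
  qed
  have e: "nf a = (2 * pi / L1)^2 * (of_int k)^2 + (2 * pi / L2)^2 * (of_int l)^2"
   by (simp add: nf_def a power_mult_distrib power_divide)
  have n: "0 \<le> (2 * pi / L1)^2 * (real_of_int k)^2" "0 \<le> (2 * pi / L2)^2 * (real_of_int l)^2" by simp_all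
  show ?thesis
  proof (cases "k = 0")
   case True
   hence "l \<noteq> 0" using that a by (simp add: zero_prod_def)
   hence "(2 * pi / L2)^2 * 1 \<le> (2 * pi / L2)^2 * (real_of_int l)^2" by (intro mult_left_mono one) simp_all
   thus ?thesis unfolding e \<kappa>_def using n by linarith
  next
   case False
   hence "(2 * pi / L1)^2 * 1 \<le> (2 * pi / L1)^2 * (real_of_int k)^2" by (intro mult_left_mono one) simp_all
   thus ?thesis unfolding e \<kappa>_def using n by linarith
  qed
 qed
 moreover have "0 < \<kappa>" using L1 L2 by (simp add: \<kappa>_def)
 ultimately show ?thesis by blast
qed

text \<open>Since \<open>1 / (nf a)^2\<close> is summable away from 0, the high modes cost an
  arbitrarily small multiple of the squared second-order norm; the finitely many low modes are paid
  for in L2. The constant depends on neither \<open>P\<close> nor \<open>d\<close>.\<close>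

lemma l1_interp:
 assumes \<delta>: "0 < \<delta>"
 shows "\<exists>C\<ge>0. \<forall>P d. finite P \<and> 0 \<notin> P --> (\<Sum>a\<in>P. norm (d a))^2 \<le> \<delta> * wsum P 2 d + C * wsum P 0 d"
proof -
 obtain \<kappa> where \<kappa>: "0 < \<kappa>" "!!a. a \<noteq> 0 ==> \<kappa> \<le> nf a" using nf_lower by blast
 obtain K where K: "0 < K" "!!a. 1 / (1 + nf a)^2 \<le> K * wt a" using nf_wt by blast
 define g where "g a = (if a = 0 then 0 else 1 / (nf a)^2)" for a
 have g0: "0 \<le> g a" for a by (simp add: g_def)
 have gi: "integrable CS g"
 proof (rule Bochner_Integration.integrable_bound[OF integrable_mult_right[OF integrable_wt, of "(1 + 1 / \<kappa>)^2 * K"]])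
  have "g a \<le> (1 + 1 / \<kappa>)^2 * K * wt a" for a
  proof (cases "a = 0")
   case True thus ?thesis using K(1) wt_pos[of a] by (simp add: g_def)
  next
   case False
   have n: "0 < nf a" using \<kappa> False by (meson less_le_trans)
   have "1 + nf a \<le> (1 + 1 / \<kappa>) * nf a" using \<kappa>(2)[OF False] \<kappa>(1) by (simp add: field_simps)
   hence "(1 + nf a)^2 \<le> ((1 + 1 / \<kappa>) * nf a)^2" using n by (intro power_mono) simp_all
   hence m: "(1 + nf a)^2 \<le> (1 + 1 / \<kappa>)^2 * (nf a)^2" unfolding power_mult_distrib .
   have p: "0 < (1 + nf a)^2" "0 < (nf a)^2" using n by simp_all
   have "1 / (nf a)^2 \<le> (1 + 1 / \<kappa>)^2 * (1 / (1 + nf a)^2)"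
   proof (rule mult_imp_div_pos_le[OF p(2)])
    have "1 \<le> ((1 + 1 / \<kappa>)^2 * (nf a)^2) / (1 + nf a)^2" using m p(1) by (simp only: le_divide_eq_1_pos)
    thus "1 \<le> (1 + 1 / \<kappa>)^2 * (1 / (1 + nf a)^2) * (nf a)^2" by simp
   qed
   also have "\<dots> \<le> (1 + 1 / \<kappa>)^2 * (K * wt a)" by (intro mult_left_mono K(2)) simp
   finally show ?thesis using False by (simp add: g_def mult.assoc)
  qed
  thus "AE a in CS. norm (g a) \<le> norm ((1 + 1 / \<kappa>)^2 * K * wt a)"
   using g0 by (intro AE_I2) (simp add: order_trans[OF _ abs_ge_self])
 qed simp
 \<comment> \<open>Half of \<open>\<delta>\<close>, because squaring the sum of the low and the high
   part doubles each square.\<close>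
 obtain n where n: "(LINT a|CS. g a) - sum g (sbox n) < \<delta> / 2"
 proof -
  have "(%n. (LINT a|CS. g a) - sum g (sbox n)) \<longlonglongrightarrow> (LINT a|CS. g a) - (LINT a|CS. g a)"
   by (intro tendsto_intros tendsto_sbox_sum gi)
  hence "\<forall>\<^sub>F n in sequentially. (LINT a|CS. g a) - sum g (sbox n) < \<delta> / 2"
   using \<delta> by (intro order_tendstoD(2)[of _ 0]) simp_all
  then obtain m where "\<forall>n\<ge>m. (LINT a|CS. g a) - sum g (sbox n) < \<delta> / 2" unfolding eventually_sequentially by blast
  thus ?thesis using that[of m] by blast
 qed
 define C where "C = 2 * real (card (sbox n))"
 have "(\<Sum>a\<in>P. norm (d a))^2 \<le> \<delta> * wsum P 2 d + C * wsum P 0 d" if P: "finite P" "0 \<notin> P" for P d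
 proof -
  let ?A = "P \<inter> sbox n" and ?B = "P - sbox n"
  have split: "(\<Sum>a\<in>P. norm (d a)) = (\<Sum>a\<in>?A. norm (d a)) + (\<Sum>a\<in>?B. norm (d a))" using P(1) by (rule sum.Int_Diff)
  have A: "(\<Sum>a\<in>?A. norm (d a))^2 \<le> real (card (sbox n)) * wsum P 0 d"
  proof -
   have "(\<Sum>a\<in>?A. 1 * norm (d a))^2 \<le> (\<Sum>a\<in>?A. 1^2) * (\<Sum>a\<in>?A. (norm (d a))^2)" by (rule CS_sum)
   also have "\<dots> \<le> real (card (sbox n)) * wsum P 0 d"
   proof (rule mult_mono)
    show "(\<Sum>a\<in>?A. 1^2) \<le> real (card (sbox n))" by (simp add: card_mono)
    show "(\<Sum>a\<in>?A. (norm (d a))^2) \<le> wsum P 0 d" unfolding wsum_def using P(1) by (simp add: sum_mono2)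
   qed (simp_all add: sum_nonneg)
   finally show ?thesis by simp
  qed
  have B: "(\<Sum>a\<in>?B. norm (d a))^2 \<le> (\<delta> / 2) * wsum P 2 d"
  proof -
   have nz: "nf a \<noteq> 0" "a \<noteq> 0" if "a \<in> P" for a using \<kappa>(1) \<kappa>(2)[of a] that P(2) by force+
   have "(\<Sum>a\<in>?B. (1 / nf a) * (nf a * norm (d a)))^2 \<le> (\<Sum>a\<in>?B. (1 / nf a)^2) * (\<Sum>a\<in>?B. (nf a * norm (d a))^2)"
    by (rule CS_sum)
   also have "(\<Sum>a\<in>?B. (1 / nf a) * (nf a * norm (d a))) = (\<Sum>a\<in>?B. norm (d a))" using nz by (intro sum.cong refl) simp
   also have "(\<Sum>a\<in>?B. (1 / nf a)^2) = sum g ?B" using nz by (intro sum.cong refl) (simp add: g_def power_divide)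
   also have "sum g ?B * (\<Sum>a\<in>?B. (nf a * norm (d a))^2) \<le> (\<delta> / 2) * wsum P 2 d"
   proof (rule mult_mono)
    have "sum g ?B + sum g (sbox n) = sum g (?B \<union> sbox n)" using P(1) by (intro sum.union_disjoint[symmetric]) auto
    also have "\<dots> \<le> (LINT a|CS. g a)" using P(1) by (intro sum_le_CS gi g0) simp
    finally show "sum g ?B \<le> \<delta> / 2" using n by linarith
    show "(\<Sum>a\<in>?B. (nf a * norm (d a))^2) \<le> wsum P 2 d"
     unfolding wsum_def power_mult_distrib using P(1) by (intro sum_mono2) auto
   qed (use \<delta> in \<open>simp_all add: sum_nonneg\<close>)
   finally show ?thesis .
  qed
  have "(\<Sum>a\<in>P. norm (d a))^2 \<le> 2 * (\<Sum>a\<in>?A. norm (d a))^2 + 2 * (\<Sum>a\<in>?B. norm (d a))^2"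
   unfolding split using sum_squares_bound[of "\<Sum>a\<in>?A. norm (d a)" "\<Sum>a\<in>?B. norm (d a)"] by (simp add: power2_sum)
  thus ?thesis using A B by (simp add: C_def algebra_simps)
 qed
 thus ?thesis by (intro exI[of _ C]) (simp add: C_def)
qed

end

context torus2
begin

lemma wsum_young:
 assumes "0 < r"
 shows "wsum P 1 d \<le> r * wsum P 2 d + 1 / (4 * r) * wsum P 0 d"
proof -
 have "nf a \<le> r * (nf a)^2 + 1 / (4 * r)" for a
 proof -
  have "0 \<le> (2 * r * nf a - 1)^2 / (4 * r)" using assms by simp
  also have "\<dots> = r * (nf a)^2 + 1 / (4 * r) - nf a" using assms by (simp add: field_simps power2_eq_square)
  finally show ?thesis by simp
 qed
 hence "nf a ^ 1 * (norm (d a))^2 \<le> (r * (nf a)^2 + 1 / (4 * r)) * (norm (d a))^2" for a by (intro mult_right_mono) simp_all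
 hence "wsum P 1 d \<le> (\<Sum>a\<in>P. (r * (nf a)^2 + 1 / (4 * r)) * (norm (d a))^2)" unfolding wsum_def by (intro sum_mono)
 also have "\<dots> = r * wsum P 2 d + 1 / (4 * r) * wsum P 0 d"
  unfolding wsum_def sum_distrib_left sum.distrib[symmetric] by (intro sum.cong refl) (simp add: algebra_simps)
 finally show ?thesis .
qed

end

section \<open>The Galerkin vector field and its energies\<close>

locale shear_flow = torus2 +
 fixes Ud :: "coeffs"
 assumes U1: "!!a. Ud (- a) = cnj (Ud a)" and U2: "!!a. fst a \<noteq> 0 ==> Ud a = 0"
begin

text \<open>The mean is excluded: it has no dissipation, and it does not act on the other
  modes.\<close>

definition adm :: "(int \<times> int) set => bool" where
 "adm J \<longleftrightarrow> finite J \<and> 0 \<notin> J \<and> uminus ` J = J"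

text \<open>Right-hand side of the Galerkin system in the rescaled time: the equation divided by
  \<open>\<nu>\<close>, with \<open>A = 1 / \<nu>\<close> in front of the transport term.\<close>

definition Gv :: "real => (int \<times> int) set => coeffs => coeffs" where
 "Gv A J d a = - of_real ((nf a)^2 - nf a) * d a - (1 / 2) * qq J J d a
   - of_real A * (mx a * (\<Sum>b\<in>J. d b * Ud (a - b)))"

text \<open>Derivative of \<open>wsum P k\<close> along the vector field \<open>g\<close> (see
  \<open>wsum_deriv\<close>).\<close>

definition dsum :: "(int \<times> int) set => nat => coeffs => coeffs => real" where
 "dsum P k d g = 2 * (\<Sum>a\<in>P. nf a ^ k * Re (cnj (d a) * g a))"

lemma dsum_Gv:
 assumes "Re (\<Sum>a\<in>P. of_real (nf a ^ k) * (cnj (d a) * (mx a * (\<Sum>b\<in>J. d b * Ud (a - b))))) = 0"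
 shows "dsum P k d (Gv A J d) = - 2 * (\<Sum>a\<in>P. nf a ^ k * ((nf a)^2 - nf a) * (norm (d a))^2)
  - Re (\<Sum>a\<in>P. of_real (nf a ^ k) * (cnj (d a) * qq J J d a))"
proof -
 have t: "nf a ^ k * Re (cnj (d a) * Gv A J d a) = - (nf a ^ k * ((nf a)^2 - nf a) * (norm (d a))^2)
   - (1 / 2) * Re (of_real (nf a ^ k) * (cnj (d a) * qq J J d a))
   - A * Re (of_real (nf a ^ k) * (cnj (d a) * (mx a * (\<Sum>b\<in>J. d b * Ud (a - b)))))" for a
 proof -
  have "complex_of_real (nf a ^ k) * (cnj (d a) * Gv A J d a) = - of_real (nf a ^ k * ((nf a)^2 - nf a)) * (d a * cnj (d a))
   - (1 / 2) * (of_real (nf a ^ k) * (cnj (d a) * qq J J d a))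
   - of_real A * (of_real (nf a ^ k) * (cnj (d a) * (mx a * (\<Sum>b\<in>J. d b * Ud (a - b)))))" unfolding Gv_def by (simp add: algebra_simps)
  also have "d a * cnj (d a) = of_real ((norm (d a))^2)" by (simp only: complex_norm_square)
  finally have "Re (complex_of_real (nf a ^ k) * (cnj (d a) * Gv A J d a)) = Re (- of_real (nf a ^ k * ((nf a)^2 - nf a)) * of_real ((norm (d a))^2)
   - (1 / 2) * (of_real (nf a ^ k) * (cnj (d a) * qq J J d a))
   - of_real A * (of_real (nf a ^ k) * (cnj (d a) * (mx a * (\<Sum>b\<in>J. d b * Ud (a - b))))))" by (rule arg_cong)
  moreover have "Re (- of_real r * of_real s - (1 / 2) * z2 - of_real A * z3) = - (r * s) - (1 / 2) * Re z2 - A * Re z3" for r s z2 z3 by simp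
  moreover have "Re (of_real r * z) = r * Re z" for r z by simp
  ultimately show ?thesis by (simp only:)
 qed
 have "dsum P k d (Gv A J d) = - 2 * (\<Sum>a\<in>P. nf a ^ k * ((nf a)^2 - nf a) * (norm (d a))^2)
  - (\<Sum>a\<in>P. Re (of_real (nf a ^ k) * (cnj (d a) * qq J J d a)))
  - 2 * A * (\<Sum>a\<in>P. Re (of_real (nf a ^ k) * (cnj (d a) * (mx a * (\<Sum>b\<in>J. d b * Ud (a - b))))))"
  unfolding dsum_def t sum_subtractf sum_negf sum_distrib_left[symmetric] by (simp only: algebra_simps)
 thus ?thesis using assms by (simp only: Re_sum mult_zero_right diff_0_right)
qed

lemma transport_J:
 assumes "finite J"
 shows "Re (\<Sum>a\<in>J. of_real (nf a ^ 0) * (cnj (d a) * (mx a * (\<Sum>b\<in>J. d b * Ud (a - b))))) = 0"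
proof -
 have "Re (\<Sum>a\<in>J. cnj (d a) * (mx a * (\<Sum>b\<in>J. d b * Ud (a - b)))) = 0" by (rule transport_cancel[OF assms], rule U1, rule U2)
 thus ?thesis by simp
qed

text \<open>A shear does not couple different x-frequencies, so for \<open>a\<close> in
  \<open>Jx J\<close> the inner sum already runs over \<open>Jx J\<close> and skew-symmetry applies
  there.\<close>

lemma transport_Jx:
 assumes "finite J"
 shows "Re (\<Sum>a\<in>Jx J. of_real (nf a ^ 0) * (cnj (d a) * (mx a * (\<Sum>b\<in>J. d b * Ud (a - b))))) = 0"
proof -
 have "(\<Sum>b\<in>J. d b * Ud (a - b)) = (\<Sum>b\<in>Jx J. d b * Ud (a - b))" if "a \<in> Jx J" for a
 proof (rule sum.mono_neutral_right[OF assms])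
  show "\<forall>b\<in>J - Jx J. d b * Ud (a - b) = 0" using that by (auto simp: Jx_def U2)
 qed (auto simp: Jx_def)
 hence "(\<Sum>a\<in>Jx J. of_real (nf a ^ 0) * (cnj (d a) * (mx a * (\<Sum>b\<in>J. d b * Ud (a - b)))))
  = (\<Sum>a\<in>Jx J. cnj (d a) * (mx a * (\<Sum>b\<in>Jx J. d b * Ud (a - b))))" by (intro sum.cong refl) simp
 moreover have "Re (\<Sum>a\<in>Jx J. cnj (d a) * (mx a * (\<Sum>b\<in>Jx J. d b * Ud (a - b)))) = 0"
  by (rule transport_cancel[OF J_split(3)[OF assms]], rule U1, rule U2)
 ultimately show ?thesis by (simp only:)
qed

lemma transport_J0:
 "Re (\<Sum>a\<in>J0 J. of_real (nf a ^ k) * (cnj (d a) * (mx a * (\<Sum>b\<in>J. d b * Ud (a - b))))) = 0"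
proof -
 have "mx a = 0" if "a \<in> J0 J" for a using that by (simp add: mx_def J0_def)
 hence "(\<Sum>a\<in>J0 J. of_real (nf a ^ k) * (cnj (d a) * (mx a * (\<Sum>b\<in>J. d b * Ud (a - b))))) = 0" by (intro sum.neutral) simp
 thus ?thesis by simp
qed

lemma norm_sum_cnj_le:
 assumes "!!a. a \<in> P ==> norm (q a) \<le> B"
 shows "\<bar>Re (\<Sum>a\<in>P. of_real (nf a ^ k) * (cnj (d a) * q a))\<bar> \<le> (\<Sum>a\<in>P. nf a ^ k * norm (d a)) * B"
proof -
 have "\<bar>Re (\<Sum>a\<in>P. of_real (nf a ^ k) * (cnj (d a) * q a))\<bar> \<le> norm (\<Sum>a\<in>P. of_real (nf a ^ k) * (cnj (d a) * q a))"
  by (rule abs_Re_le_cmod)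
 also have "\<dots> \<le> (\<Sum>a\<in>P. nf a ^ k * norm (d a) * B)"
 proof (rule sum_norm_le)
  fix a assume a: "a \<in> P"
  have "norm (of_real (nf a ^ k) * (cnj (d a) * q a)) = nf a ^ k * norm (d a) * norm (q a)"
   using nf_nonneg[of a] by (simp add: norm_mult norm_power)
  also have "\<dots> \<le> nf a ^ k * norm (d a) * B" using assms[OF a] nf_nonneg[of a] by (intro mult_left_mono) simp_all
  finally show "norm (of_real (nf a ^ k) * (cnj (d a) * q a)) \<le> nf a ^ k * norm (d a) * B" .
 qed
 finally show ?thesis by (simp only: sum_distrib_right)
qed

lemma wsum_quad:
 "(\<Sum>a\<in>P. nf a ^ 0 * ((nf a)^2 - nf a) * (norm (d a))^2) = wsum P 2 d - wsum P 1 d"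
 unfolding wsum_def sum_subtractf[symmetric] by (intro sum.cong refl) (simp add: algebra_simps)

text \<open>A crude inequality, useful only while the energy stays below \<open>P\<close>, but with
  \<open>K\<close> independent of \<open>A\<close> and of the truncation. The cubic term is at most
  the sum of the amplitudes times \<open>wsum J 1\<close>; by \<open>l1_interp\<close> and
  \<open>wsum_interp\<close> it costs half a copy of the dissipation.\<close>

lemma energy_all:
 assumes P: "0 < P"
 shows "\<exists>K\<ge>0. \<forall>J d A. adm J \<and> wsum J 0 d \<le> P --> dsum J 0 d (Gv A J d) \<le> - wsum J 2 d + K"
proof -
 \<comment> \<open>The factor \<open>1 / (4 * P)\<close> cancels the weight \<open>P\<close> that
   the Young inequality below puts on the square of the amplitude sum.\<close>
 obtain C where C: "0 \<le> C" "!!Q d. finite Q \<and> 0 \<notin> Q ==> (\<Sum>a\<in>Q. norm (d a :: complex))^2 \<le> (1 / (4 * P)) * wsum Q 2 d + C * wsum Q 0 d"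
  using l1_interp[of "1 / (4 * P)"] P by auto
 have "dsum J 0 d (Gv A J d) \<le> - wsum J 2 d + (2 * P + C * P^2)" if J: "adm J" and E: "wsum J 0 d \<le> P" for J d A
 proof -
  have f: "finite J" "0 \<notin> J" using J by (simp_all add: adm_def)
  let ?S = "\<Sum>a\<in>J. norm (d a)" and ?X = "wsum J 1 d" and ?D = "wsum J 2 d" and ?E = "wsum J 0 d"
  note nn = wsum_nonneg[of J 0 d] wsum_nonneg[of J 1 d] wsum_nonneg[of J 2 d]
  have "dsum J 0 d (Gv A J d) = - 2 * (?D - ?X) - Re (\<Sum>a\<in>J. of_real (nf a ^ 0) * (cnj (d a) * qq J J d a))"
   unfolding dsum_Gv[OF transport_J[OF f(1)]] wsum_quad ..
  moreover have "\<bar>Re (\<Sum>a\<in>J. of_real (nf a ^ 0) * (cnj (d a) * qq J J d a))\<bar> \<le> (\<Sum>a\<in>J. nf a ^ 0 * norm (d a)) * ?X"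
   using qq_bound[OF f(1) f(1), of d] nn by (intro norm_sum_cnj_le) simp
  moreover have "?S * ?X \<le> ?D / 2 + C * P^2"
  proof -
   have "?S * ?X \<le> P * ?S^2 + ?X^2 / (4 * P)"
   proof -
    have "0 \<le> (2 * P * ?S - ?X)^2 / (4 * P)" using P by simp
    also have "\<dots> = P * ?S^2 + ?X^2 / (4 * P) - ?S * ?X" using P by (simp add: field_simps power2_eq_square)
    finally show ?thesis by simp
   qed
   moreover have "P * ?S^2 \<le> ?D / 4 + C * P^2"
   proof -
    have "P * ?S^2 \<le> P * ((1 / (4 * P)) * ?D + C * ?E)" using P C(2)[of J d] f by (intro mult_left_mono) simp_all
    also have "\<dots> = ?D / 4 + P * (C * ?E)" using P by (simp add: field_simps)
    also have "P * (C * ?E) \<le> P * (C * P)" using P C(1) E by (intro mult_left_mono) simp_all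
    finally show ?thesis by (simp add: power2_eq_square mult_ac)
   qed
   moreover have "?X^2 / (4 * P) \<le> ?D / 4"
   proof -
    have "?X^2 \<le> ?E * ?D" by (rule wsum_interp)
    also have "\<dots> \<le> P * ?D" using E nn by (intro mult_right_mono)
    finally show ?thesis using P by (simp add: field_simps)
   qed
   ultimately show ?thesis by linarith
  qed
  moreover have "2 * ?X \<le> ?D / 2 + 2 * ?E" using wsum_young[of "1/4" J d] by simp
  ultimately show ?thesis using E by simp
 qed
 thus ?thesis using P C(1) by (intro exI[of _ "2 * P + C * P^2"]) simp
qed

text \<open>All errors are absorbed or proportional to the x-dependent energy itself, because the
  average does not force these modes. So this energy grows at most exponentially, at a rate fixed by
  the bound \<open>PV\<close> on the average.\<close>

lemma energy_x:
 assumes PV: "0 \<le> PV"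
 shows "\<exists>K\<ge>0. \<forall>J d A. adm J \<and> wsum (J0 J) 1 d \<le> PV \<and> wsum (Jx J) 0 d \<le> 1 -->
  dsum (Jx J) 0 d (Gv A J d) \<le> - wsum (Jx J) 2 d + K * wsum (Jx J) 0 d"
proof -
 obtain C where C: "0 \<le> C" "!!Q d. finite Q \<and> 0 \<notin> Q ==> (\<Sum>a\<in>Q. norm (d a :: complex))^2 \<le> (1 / 16) * wsum Q 2 d + C * wsum Q 0 d"
  using l1_interp[of "1 / 16"] by auto
 have "dsum (Jx J) 0 d (Gv A J d) \<le> - wsum (Jx J) 2 d + (2 * C + 2 * PV^2 + 4) * wsum (Jx J) 0 d"
  if J: "adm J" and V: "wsum (J0 J) 1 d \<le> PV" and G: "wsum (Jx J) 0 d \<le> 1" for J d A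
 proof -
  have f: "finite J" "0 \<notin> J" using J by (simp_all add: adm_def)
  have fx: "finite (Jx J)" "0 \<notin> Jx J" using f by (simp_all add: Jx_def)
  let ?S = "\<Sum>a\<in>Jx J. norm (d a)" and ?X = "wsum (Jx J) 1 d" and ?D = "wsum (Jx J) 2 d" and ?E = "wsum (Jx J) 0 d" and ?V = "wsum (J0 J) 1 d"
  note nn = wsum_nonneg[of "Jx J" 0 d] wsum_nonneg[of "Jx J" 1 d] wsum_nonneg[of "Jx J" 2 d] wsum_nonneg[of "J0 J" 1 d]
  have eq: "dsum (Jx J) 0 d (Gv A J d) = - 2 * (?D - ?X) - Re (\<Sum>a\<in>Jx J. of_real (nf a ^ 0) * (cnj (d a) * qq J J d a))"
   unfolding dsum_Gv[OF transport_Jx[OF f(1)]] wsum_quad ..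
  have q: "\<bar>Re (\<Sum>a\<in>Jx J. of_real (nf a ^ 0) * (cnj (d a) * qq J J d a))\<bar> \<le> (\<Sum>a\<in>Jx J. nf a ^ 0 * norm (d a)) * (?X + 2 * sqrt (?X * ?V))"
   by (rule norm_sum_cnj_le, rule qq_split_x[OF f(1)]) (simp add: Jx_def)
  have a1: "?S * ?X \<le> ?S^2 + ?X^2 / 4"
  proof -
   have "0 \<le> (?S - ?X / 2)^2" by simp
   thus ?thesis by (simp add: power2_eq_square algebra_simps)
  qed
  have a2: "2 * (?S * sqrt (?X * ?V)) \<le> ?S^2 + ?X * ?V"
  proof -
   have "2 * ?S * sqrt (?X * ?V) \<le> ?S^2 + (sqrt (?X * ?V))^2" by (rule sum_squares_bound)
   also have "(sqrt (?X * ?V))^2 = ?X * ?V" using nn by simp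
   finally show ?thesis by (simp only: mult.assoc)
  qed
  have a3: "?X^2 \<le> ?D"
  proof -
   have "?X^2 \<le> ?E * ?D" by (rule wsum_interp)
   also have "\<dots> \<le> 1 * ?D" using G nn by (intro mult_right_mono)
   finally show ?thesis by simp
  qed
  have a4: "?S^2 \<le> (1 / 16) * ?D + C * ?E" using C(2)[of "Jx J" d] fx by blast
  have a5: "?X * ?V \<le> ?D / 8 + 2 * PV^2 * ?E"
  proof (cases "PV = 0")
   case True
   hence "?V = 0" using V nn by linarith
   thus ?thesis using nn by simp
  next
   case False
   hence pv: "0 < PV" using PV by simp
   have "?X * ?V \<le> ?X * PV" using V nn by (intro mult_left_mono)
   also have "\<dots> \<le> ((1 / (8 * PV)) * ?D + 1 / (4 * (1 / (8 * PV))) * ?E) * PV" using pv by (intro mult_right_mono wsum_young) simp_all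
   also have "\<dots> = ?D / 8 + 2 * PV^2 * ?E" using pv by (simp add: field_simps power2_eq_square)
   finally show ?thesis .
  qed
  have a6: "2 * ?X \<le> ?D / 4 + 4 * ?E" using wsum_young[of "1/8" "Jx J" d] by simp
  have "(\<Sum>a\<in>Jx J. nf a ^ 0 * norm (d a)) * (?X + 2 * sqrt (?X * ?V)) = ?S * ?X + 2 * (?S * sqrt (?X * ?V))" by (simp add: distrib_left)
  with q have q': "\<bar>Re (\<Sum>a\<in>Jx J. of_real (nf a ^ 0) * (cnj (d a) * qq J J d a))\<bar> \<le> ?S * ?X + 2 * (?S * sqrt (?X * ?V))"
   by (simp only:)
  \<comment> \<open>The errors consume the fractions 1/8, 1/4, 1/8 and 1/4 of \<open>D\<close>,
    which fits into the spare copy of the dissipation.\<close>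
  have arith: "- 2 * (D - X) - r \<le> - D + (2 * CE + PE + 4 * E)"
   if h: "\<bar>r\<bar> \<le> SX + 2 * SV" "SX \<le> S2 + X2 / 4" "2 * SV \<le> S2 + XV" "X2 \<le> D" "S2 \<le> (1 / 16) * D + CE" "XV \<le> D / 8 + PE"
    "2 * X \<le> D / 4 + 4 * E" "0 \<le> D" for D X r CE PE E SX SV S2 X2 XV :: real
  proof -
   have "- r \<le> SX + 2 * SV" using h(1) by (simp add: abs_le_iff)
   moreover have "4 * SX \<le> 4 * S2 + X2" "16 * S2 \<le> D + 16 * CE" "8 * XV \<le> D + 8 * PE" "8 * X \<le> D + 16 * E" using h by simp_all
   ultimately show ?thesis using h(3,4,8) by argo
  qed
  have "(2 * C + 2 * PV^2 + 4) * ?E = 2 * (C * ?E) + 2 * PV^2 * ?E + 4 * ?E" by (simp add: algebra_simps)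
  thus ?thesis using arith[OF q' a1 a2 a3 a4 a5 a6 nn(3)] unfolding eq by (simp only:)
 qed
 thus ?thesis using C(1) by (intro exI[of _ "2 * C + 2 * PV^2 + 4"]) simp
qed

text \<open>With \<open>L2 < 2 * pi\<close> each \<open>nf a\<close> is at least the square of the
  integer frequency \<open>l\<close>, and \<open>1 / l^2 \<le> 2 / (1 + l^2)\<close> reduces the sum
  to \<open>sum_inverse_squares\<close>.\<close>

lemma sum_inverse_J0:
 assumes "finite J" "0 \<notin> J" "L2 < 2 * pi"
 shows "(\<Sum>a\<in>J0 J. 1 / nf a) \<le> 10"
proof -
 obtain n where n: "J0 J \<subseteq> sbox n" using finite_subset_sbox[of "J0 J"] assms by (auto simp: J0_def)
 have le: "1 / nf a \<le> 2 * (1 / (1 + (of_int (snd a))^2))" if "a \<in> J0 J" for a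
 proof -
  have "a \<noteq> 0"
  proof
   assume "a = 0"
   thus False using that assms(2) by (simp add: J0_def)
  qed
  hence "snd a \<noteq> 0" using that by (simp add: J0_def prod_eq_iff)
  hence "1 \<le> \<bar>real_of_int (snd a)\<bar>" by linarith
  hence one: "1 \<le> (real_of_int (snd a))^2" by (metis one_le_power power2_abs)
  have "1 < 2 * pi / L2" using assms(3) L2 by simp
  hence "1 \<le> (2 * pi / L2)^2" by (simp add: one_le_power)
  hence "1 * (real_of_int (snd a))^2 \<le> (2 * pi / L2)^2 * (real_of_int (snd a))^2" by (intro mult_right_mono) simp_all
  hence "(real_of_int (snd a))^2 \<le> nf a" using that by (simp add: nf_def J0_def power_mult_distrib power_divide)
  hence "1 / nf a \<le> 1 / (real_of_int (snd a))^2" using one by (intro divide_left_mono mult_pos_pos) linarith+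
  also have "\<dots> = 2 / (2 * (real_of_int (snd a))^2)" by simp
  also have "\<dots> \<le> 2 / (1 + (real_of_int (snd a))^2)" using one by (intro divide_left_mono mult_pos_pos) linarith+
  also have "\<dots> = 2 * (1 / (1 + (real_of_int (snd a))^2))" by simp
  finally show ?thesis .
 qed
 have "(\<Sum>a\<in>J0 J. 1 / nf a) \<le> (\<Sum>a\<in>J0 J. 2 * (1 / (1 + (of_int (snd a))^2)))" by (intro sum_mono le)
 also have "\<dots> = (\<Sum>k\<in>snd ` J0 J. 2 * (1 / (1 + (of_int k)^2)))" by (subst sum.reindex) (auto simp: inj_on_def J0_def prod_eq_iff)
 also have "\<dots> \<le> (\<Sum>k=- int n..int n. 2 * (1 / (1 + (of_int k)^2)))" using n by (intro sum_mono2) (auto simp: sbox_def)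
 also have "\<dots> = 2 * (\<Sum>k=- int n..int n. 1 / (1 + (of_int k)^2))" by (simp only: sum_distrib_left)
 also have "\<dots> \<le> 2 * 5"
 proof -
  have "0 \<le> 4 / real (Suc n)" by simp
  thus ?thesis using sum_inverse_squares[of n] by linarith
 qed
 finally show ?thesis by simp
qed

text \<open>The average is measured in the first-order norm because at this level its
  self-interaction cancels (\<open>Burgers_cancel\<close>). On its modes
  \<open>nf a \<ge> (2 * pi / L2)^2 > 1\<close>, so
  \<open>(nf a)^2 - nf a \<ge> \<gamma> * (nf a)^2\<close>; what remains is the forcing by the other
  modes, quadratic in them.\<close>

lemma energy_0:
 assumes L: "L2 < 2 * pi"
 shows "\<exists>\<gamma>>0. \<exists>C\<ge>0. \<forall>J d A. adm J \<and> (\<forall>a\<in>J. d (- a) = cnj (d a)) -->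
  dsum (J0 J) 1 d (Gv A J d) \<le> - \<gamma> * wsum (J0 J) 3 d + C * wsum (Jx J) 0 d * wsum (Jx J) 2 d"
proof -
 define \<gamma> where "\<gamma> = 1 - (L2 / (2 * pi))^2"
 have "L2 / (2 * pi) < 1" using L by simp
 hence g: "0 < \<gamma>" unfolding \<gamma>_def using power_strict_mono[of "L2 / (2 * pi)" 1 2] L2 by simp
 have "dsum (J0 J) 1 d (Gv A J d) \<le> - \<gamma> * wsum (J0 J) 3 d + (10 / (4 * \<gamma>)) * wsum (Jx J) 0 d * wsum (Jx J) 2 d"
  if J: "adm J" and h: "\<forall>a\<in>J. d (- a) = cnj (d a)" for J d A
 proof -
  have f: "finite J" "0 \<notin> J" "uminus ` J = J" using J by (simp_all add: adm_def)
  have um: "- a \<in> J \<longleftrightarrow> a \<in> J" for a using f(3) by (metis (no_types, opaque_lifting) add.inverse_inverse imageI)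
  let ?X = "wsum (Jx J) 1 d" and ?DV = "wsum (J0 J) 3 d" and ?S = "\<Sum>a\<in>J0 J. nf a ^ 1 * norm (d a)"
  note nn = wsum_nonneg[of "Jx J" 0 d] wsum_nonneg[of "Jx J" 1 d] wsum_nonneg[of "Jx J" 2 d] wsum_nonneg[of "J0 J" 3 d]
  have nfl: "(2 * pi / L2)^2 \<le> nf a" if "a \<in> J0 J" for a
  proof -
   have "a \<noteq> 0"
   proof
    assume "a = 0"
    thus False using that f(2) by (simp add: J0_def)
   qed
   hence "snd a \<noteq> 0" using that by (simp add: J0_def prod_eq_iff)
   hence "1 \<le> \<bar>real_of_int (snd a)\<bar>" by linarith
   hence one: "1 \<le> (real_of_int (snd a))^2" by (metis one_le_power power2_abs)
   have "(2 * pi / L2)^2 * 1 \<le> (2 * pi / L2)^2 * (real_of_int (snd a))^2" using one by (intro mult_left_mono) simp_all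
   thus ?thesis using that by (simp add: nf_def J0_def power_mult_distrib power_divide)
  qed
  have quad: "\<gamma> * ?DV \<le> (\<Sum>a\<in>J0 J. nf a ^ 1 * ((nf a)^2 - nf a) * (norm (d a))^2)"
   unfolding wsum_def sum_distrib_left
  proof (rule sum_mono)
   fix a assume a: "a \<in> J0 J"
   have n: "0 < nf a" using nfl[OF a] L2 by (smt (verit) divide_pos_pos pi_gt_zero zero_less_power)
   have "nf a = (L2 / (2 * pi))^2 * (2 * pi / L2)^2 * nf a" using L2 by (simp add: power_divide power_mult_distrib)
   also have "\<dots> \<le> (L2 / (2 * pi))^2 * nf a * nf a" using nfl[OF a] n by (intro mult_right_mono mult_left_mono) simp_all
   finally have "\<gamma> * (nf a)^2 \<le> (nf a)^2 - nf a" unfolding \<gamma>_def by (simp add: power2_eq_square algebra_simps)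
   hence "nf a * (norm (d a))^2 * (\<gamma> * (nf a)^2) \<le> nf a * (norm (d a))^2 * ((nf a)^2 - nf a)"
    using n by (intro mult_left_mono) simp_all
   thus "\<gamma> * (nf a ^ 3 * (norm (d a))^2) \<le> nf a ^ 1 * ((nf a)^2 - nf a) * (norm (d a))^2"
    by (simp add: power3_eq_cube power2_eq_square mult_ac)
  qed
  have im: "uminus ` J0 J = J0 J"
  proof
   show "uminus ` J0 J \<subseteq> J0 J"
   proof (rule image_subsetI)
    fix b assume "b \<in> J0 J"
    thus "- b \<in> J0 J" using um[of b] by (simp add: J0_def)
   qed
   show "J0 J \<subseteq> uminus ` J0 J"
   proof
    fix a assume "a \<in> J0 J"
    hence "- a \<in> J0 J" using um[of a] by (simp add: J0_def)
    thus "a \<in> uminus ` J0 J" by (metis add.inverse_inverse imageI)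
   qed
  qed
  have B: "(\<Sum>a\<in>J0 J. of_real (nf a) * (cnj (d a) * qq (J0 J) (J0 J) d a)) = 0"
   by (rule Burgers_cancel[OF J_split(4)[OF f(1)] im]) (use h in \<open>simp_all add: J0_def\<close>)
  have "(\<Sum>a\<in>J0 J. of_real (nf a ^ 1) * (cnj (d a) * qq J J d a))
    = (\<Sum>a\<in>J0 J. of_real (nf a ^ 1) * (cnj (d a) * qq (Jx J) (Jx J) d a)) + (\<Sum>a\<in>J0 J. of_real (nf a) * (cnj (d a) * qq (J0 J) (J0 J) d a))"
   unfolding sum.distrib[symmetric]
  proof (rule sum.cong[OF refl])
   fix a assume "a \<in> J0 J"
   hence "fst a = 0" by (simp add: J0_def)
   from qq_split_0[OF f(1) this, of d]
   show "of_real (nf a ^ 1) * (cnj (d a) * qq J J d a) = of_real (nf a ^ 1) * (cnj (d a) * qq (Jx J) (Jx J) d a) + of_real (nf a) * (cnj (d a) * qq (J0 J) (J0 J) d a)"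
    by (simp add: distrib_left)
  qed
  hence qe: "(\<Sum>a\<in>J0 J. of_real (nf a ^ 1) * (cnj (d a) * qq J J d a)) = (\<Sum>a\<in>J0 J. of_real (nf a ^ 1) * (cnj (d a) * qq (Jx J) (Jx J) d a))"
   unfolding B by simp
  have q: "\<bar>Re (\<Sum>a\<in>J0 J. of_real (nf a ^ 1) * (cnj (d a) * qq (Jx J) (Jx J) d a))\<bar> \<le> ?S * ?X"
   using qq_bound[OF J_split(3)[OF f(1)] J_split(3)[OF f(1)], of d] nn by (intro norm_sum_cnj_le) simp
  have S2: "?S^2 \<le> 10 * ?DV"
  proof -
   have n: "0 < nf a" if "a \<in> J0 J" for a using nfl[OF that] L2 by (smt (verit) divide_pos_pos pi_gt_zero zero_less_power)
   have "?S = (\<Sum>a\<in>J0 J. (1 / sqrt (nf a)) * (nf a * sqrt (nf a) * norm (d a)))" by (rule sum.cong[OF refl]) (use n in force)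
   also have "\<dots>^2 \<le> (\<Sum>a\<in>J0 J. (1 / sqrt (nf a))^2) * (\<Sum>a\<in>J0 J. (nf a * sqrt (nf a) * norm (d a))^2)" by (rule CS_sum)
   also have "(\<Sum>a\<in>J0 J. (1 / sqrt (nf a))^2) = (\<Sum>a\<in>J0 J. 1 / nf a)"
    using n by (intro sum.cong refl) (simp add: power_divide less_imp_le)
   also have "(\<Sum>a\<in>J0 J. (nf a * sqrt (nf a) * norm (d a))^2) = ?DV"
    unfolding wsum_def using n by (intro sum.cong refl) (simp add: power_mult_distrib power3_eq_cube power2_eq_square less_imp_le)
   also have "(\<Sum>a\<in>J0 J. 1 / nf a) * ?DV \<le> 10 * ?DV" using nn by (intro mult_right_mono sum_inverse_J0 f L)
   finally show ?thesis .
  qed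
  \<comment> \<open>Young's inequality is balanced against \<open>S2\<close>, so that one of the two
    copies of \<open>\<gamma> * ?DV\<close> is used up.\<close>
  have "?S * ?X \<le> \<gamma> * ?DV + (10 / (4 * \<gamma>)) * ?X^2"
  proof -
   have "0 \<le> (2 * \<gamma> * ?S - 10 * ?X)^2 / (40 * \<gamma>)" using g by simp
   also have "\<dots> = (\<gamma> / 10) * ?S^2 + (10 / (4 * \<gamma>)) * ?X^2 - ?S * ?X"
    using g by (simp add: field_simps power2_eq_square)
   finally have "?S * ?X \<le> (\<gamma> / 10) * ?S^2 + (10 / (4 * \<gamma>)) * ?X^2" by simp
   moreover have "(\<gamma> / 10) * ?S^2 \<le> (\<gamma> / 10) * (10 * ?DV)" using g S2 by (intro mult_left_mono) simp_all
   ultimately show ?thesis by simp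
  qed
  moreover have "(10 / (4 * \<gamma>)) * ?X^2 \<le> (10 / (4 * \<gamma>)) * (wsum (Jx J) 0 d * wsum (Jx J) 2 d)"
   using g by (intro mult_left_mono wsum_interp) simp
  moreover have "dsum (J0 J) 1 d (Gv A J d) = - 2 * (\<Sum>a\<in>J0 J. nf a ^ 1 * ((nf a)^2 - nf a) * (norm (d a))^2)
    - Re (\<Sum>a\<in>J0 J. of_real (nf a ^ 1) * (cnj (d a) * qq (Jx J) (Jx J) d a))" unfolding dsum_Gv[OF transport_J0] qe ..
  ultimately show ?thesis using q quad unfolding mult.assoc by linarith
 qed
 thus ?thesis using g by (intro exI[of _ \<gamma>] conjI exI[of _ "10 / (4 * \<gamma>)"]) auto
qed

end

section \<open>Decay of the modes depending on x\<close>

lemma level_set_finite: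
 fixes u :: "real => real"
 assumes d: "!!y. u differentiable (at y)" and fin: "finite {y \<in> {0..<L}. deriv u y = 0}"
 shows "finite {y \<in> {0..<L}. u y = c}"
proof -
 let ?C = "{y \<in> {0..<L}. deriv u y = 0}" and ?S = "{y \<in> {0..<L}. u y = c}"
 have lt: "\<exists>z\<in>?C. y1 < z \<and> z < y2" if y: "y1 \<in> ?S" "y2 \<in> ?S" "y1 < y2" for y1 y2
 proof -
  have "continuous_on {y1..y2} u" using d by (intro continuous_at_imp_continuous_on ballI differentiable_imp_continuous_within) blast
  moreover have "u y1 = u y2" using y by simp
  ultimately obtain z where z: "y1 < z" "z < y2" "DERIV u z :> 0" using Rolle[OF y(3)] d by blast
  hence "z \<in> ?C" using y DERIV_imp_deriv[OF z(3)] by simp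
  thus ?thesis using z(1,2) by blast
 qed
 \<comment> \<open>By Rolle, a point of the level set is determined by the critical points to its left.\<close>
 have "inj_on (%y. {x \<in> ?C. x < y}) ?S"
 proof (rule inj_onI, rule ccontr)
  fix x y assume xy: "x \<in> ?S" "y \<in> ?S" "{z \<in> ?C. z < x} = {z \<in> ?C. z < y}" "x \<noteq> y"
  show False
  proof (cases "x < y")
   case True
   then obtain z where "z \<in> ?C" "x < z" "z < y" using lt[OF xy(1,2)] by blast
   hence "z \<in> {z \<in> ?C. z < y}" "z \<notin> {z \<in> ?C. z < x}" by simp_all
   thus False using xy(3) by blast
  next
   case False
   then obtain z where "z \<in> ?C" "y < z" "z < x" using lt[OF xy(2,1)] xy(4) by auto
   hence "z \<in> {z \<in> ?C. z < x}" "z \<notin> {z \<in> ?C. z < y}" by simp_all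
   thus False using xy(3) by blast
  qed
 qed
 moreover have "finite ((%y. {x \<in> ?C. x < y}) ` ?S)" by (rule finite_subset[of _ "Pow ?C"]) (use fin in auto)
 ultimately show ?thesis by (rule finite_imageD[rotated])
qed

definition uhat :: "real => (real => real) => int => complex" where
 "uhat L u k = (LINT y|lborel. indicator {0..<L} y *\<^sub>R (of_real (u y) * cis (2 * pi * (of_int (- k) * y / L)))) / L"

text \<open>One-dimensional orthogonality, read off from a torus whose second side has length
  1.\<close>

lemma LINT_cis:
 assumes "0 < L"
 shows "(LINT x|lborel. indicator {0..<L} x *\<^sub>R cis (2 * pi * (of_int k * x / L))) = (if k = 0 then of_real L else 0)"
proof -
 interpret torus2 L 1 by standard (use assms in simp_all)
 have "(LINT z|M. e (k, 0) z) = (LINT x|lborel. indicator {0..<L} x *\<^sub>R (LINT y|lborel. indicator {0..<1} y *\<^sub>R e (k, 0) (x, y)))"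
  by (rule integral_M_fst[OF measurable_e integrable_e])
 also have "\<dots> = (LINT x|lborel. indicator {0..<L} x *\<^sub>R cis (2 * pi * (of_int k * x / L)))"
 proof (rule arg_cong[where f = "integral\<^sup>L lborel"], rule ext)
  fix x
  have "(LINT y|lborel. indicator {0..<1} y *\<^sub>R e (k, 0) (x, y)) = cis (2 * pi * (of_int k * x / L))"
   unfolding e_def by (simp add: measure_def)
  thus "indicator {0..<L} x *\<^sub>R (LINT y|lborel. indicator {0..<1} y *\<^sub>R e (k, 0) (x, y)) = indicator {0..<L} x *\<^sub>R cis (2 * pi * (of_int k * x / L))"
   by simp
 qed
 finally have f: "(LINT z|M. e (k, 0) z) = (LINT x|lborel. indicator {0..<L} x *\<^sub>R cis (2 * pi * (of_int k * x / L)))" .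
 show ?thesis unfolding f[symmetric] integral_e by (simp add: zero_prod_def)
qed

context torus2
begin

lemma fcoef_prod:
 assumes p: "continuous_on UNIV p" and q: "continuous_on UNIV q"
 shows "fcoef (%z. of_real (p (fst z)) * of_real (q (snd z))) a = uhat L1 p (fst a) * uhat L2 q (snd a)"
proof -
 let ?E = "%L k x. cis (2 * pi * (of_int (- k) * x / L))"
 have c: "continuous_on UNIV (%z. complex_of_real (p (fst z)) * of_real (q (snd z)) * e (- a) z)"
  by (intro continuous_intros continuous_on_compose2[OF p] continuous_on_compose2[OF q]) auto
 have "(LINT z|M. of_real (p (fst z)) * of_real (q (snd z)) * e (- a) z)
  = (LINT x|lborel. indicator {0..<L1} x *\<^sub>R (LINT y|lborel. indicator {0..<L2} y *\<^sub>R (of_real (p x) * of_real (q y) * e (- a) (x, y))))"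
  using integral_M_fst[OF borel_measurable_continuous_onI[OF c] integrable_continuous[OF c]] by simp
 also have "\<dots> = (LINT x|lborel. (indicator {0..<L1} x *\<^sub>R (of_real (p x) * ?E L1 (fst a) x)) * (uhat L2 q (snd a) * L2))"
 proof (rule arg_cong[where f = "integral\<^sup>L lborel"], rule ext)
  fix x
  have "e (- a) (x, y) = ?E L1 (fst a) x * ?E L2 (snd a) y" for y by (simp add: e_def cis_mult algebra_simps)
  hence "(LINT y|lborel. indicator {0..<L2} y *\<^sub>R (of_real (p x) * of_real (q y) * e (- a) (x, y)))
   = (LINT y|lborel. (of_real (p x) * ?E L1 (fst a) x) * (indicator {0..<L2} y *\<^sub>R (of_real (q y) * ?E L2 (snd a) y)))"
   by (simp only: mult_scaleR_right mult_ac)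
  also have "\<dots> = (of_real (p x) * ?E L1 (fst a) x) * (uhat L2 q (snd a) * L2)" using L2 unfolding integral_mult_right_zero uhat_def by simp
  finally show "indicator {0..<L1} x *\<^sub>R (LINT y|lborel. indicator {0..<L2} y *\<^sub>R (of_real (p x) * of_real (q y) * e (- a) (x, y)))
   = (indicator {0..<L1} x *\<^sub>R (of_real (p x) * ?E L1 (fst a) x)) * (uhat L2 q (snd a) * L2)" by simp
 qed
 also have "\<dots> = (uhat L1 p (fst a) * L1) * (uhat L2 q (snd a) * L2)" using L1 unfolding integral_mult_left_zero uhat_def by simp
 finally show ?thesis using L1 L2 by (simp add: fcoef_def)
qed

lemma uhat_1: "0 < L ==> uhat L (%y. 1) k = (if k = 0 then 1 else 0)" using LINT_cis[of L "- k"] by (simp add: uhat_def)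

lemma fcoef_snd: "continuous_on UNIV u ==> fcoef (%z. of_real (u (snd z))) a = (if fst a = 0 then uhat L2 u (snd a) else 0)"
 using fcoef_prod[of "%x. 1" u a] uhat_1[OF L1] by simp

lemma fcoef_fst: "continuous_on UNIV u ==> fcoef (%z. of_real (u (fst z))) a = (if snd a = 0 then uhat L1 u (fst a) else 0)"
 using fcoef_prod[of u "%y. 1" a] uhat_1[OF L2] by simp

lemma fcoef_mult_psum:
 assumes w: "sq_int M w" and F: "finite F"
 shows "fcoef (%z. w z * psum h F z) a = (\<Sum>b\<in>F. h b * fcoef w (a - b))"
proof -
 have i: "integrable M (%z. w z * e b z)" for b by (intro sq_int_mult_integrable w sq_int_e)
 have "(LINT z|M. w z * psum h F z * e (- a) z) = (LINT z|M. (\<Sum>b\<in>F. h b * (w z * e (- (a - b)) z)))"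
 proof (rule arg_cong[where f = "integral\<^sup>L M"], rule ext)
  fix z
  have "e (- (a - b)) z = e b z * e (- a) z" for b unfolding e_add[symmetric] by (rule arg_cong2[where f = e]) simp_all
  thus "w z * psum h F z * e (- a) z = (\<Sum>b\<in>F. h b * (w z * e (- (a - b)) z))"
   unfolding psum_def by (simp only: sum_distrib_left sum_distrib_right mult_ac)
 qed
 also have "\<dots> = (\<Sum>b\<in>F. h b * (LINT z|M. w z * e (- (a - b)) z))" using i by (simp add: Bochner_Integration.integral_sum)
 finally show ?thesis by (simp only: fcoef_def sum_divide_distrib times_divide_eq_right)
qed

end

text \<open>Matrix of \<open>h -> [u, h]\<close> on the Fourier coefficients of kernels. The second
  frequency of a kernel is the negated column index, which is why the projection on mode
  \<open>l0\<close> sits at \<open>(l0, - l0)\<close>.\<close>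

abbreviation commutator_entry :: "(int => complex) => int \<times> int => coeffs" where
 "commutator_entry U a b \<equiv> (if snd a = snd b then U (fst a - fst b) else 0) - (if fst a = fst b then U (snd a - snd b) else 0)"

text \<open>The commutator equation \<open>[u, h] = |l\<^sub>0\<rangle>\<langle>l\<^sub>0|\<close> is solvable up to a small Hilbert--Schmidt error:
 its kernel form is \<open>(u(y) - u(y')) h(y, y') = e(y) cnj (e(y'))\<close>, and \<open>u(y) \<noteq> u(y')\<close> almost everywhere.\<close>
lemma commutator_kernel:
 fixes u :: "real => real"
 assumes L: "0 < L" and u: "continuous_on UNIV u" and B: "!!y. \<bar>u y\<bar> \<le> B"
  and lev: "!!c. finite {y \<in> {0..<L}. u y = c}" and \<epsilon>: "0 < \<epsilon>"
 shows "\<exists>n h. \<forall>F. finite F -->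
   (\<Sum>a\<in>F. (norm ((\<Sum>b\<in>sbox n. h b * commutator_entry (uhat L u) a b) - (if a = (l0, - l0) then 1 else 0)))^2) \<le> \<epsilon>"
proof -
 \<comment> \<open>Kernels are functions on the product of two copies of the y-circle.\<close>
 interpret torus2 L L by standard (use L in simp_all)
 define w :: "real \<times> real => complex" where "w z = of_real (u (fst z)) - of_real (u (snd z))" for z
 define q :: "real \<times> real => real" where "q z = u (fst z) - u (snd z)" for z
 have wq: "w z = of_real (q z)" for z by (simp add: w_def q_def)
 have qc: "continuous_on S q" for S unfolding q_def by (intro continuous_intros continuous_on_compose2[OF u]) auto
 have wc: "continuous_on S w" for S unfolding wq[abs_def] by (intro continuous_intros qc)
 have wb: "norm (w z) \<le> 2 * B" for z using B[of "fst z"] B[of "snd z"] unfolding wq norm_of_real q_def by linarith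
 have us: "sq_int M (%z. complex_of_real (u (fst z)))" "sq_int M (%z. complex_of_real (u (snd z)))"
  by (intro sq_int_continuous continuous_intros continuous_on_compose2[OF u]; auto)+
 have ws: "sq_int M w" unfolding w_def[abs_def] by (intro sq_int_diff us)
 have fw: "fcoef w a = (if snd a = 0 then uhat L u (fst a) else 0) - (if fst a = 0 then uhat L u (snd a) else 0)" for a
 proof -
  have "fcoef w a = fcoef (%z. of_real (u (fst z))) a - fcoef (%z. of_real (u (snd z))) a"
   using sq_int_mult_integrable[OF us(1) sq_int_e, of "- a"] sq_int_mult_integrable[OF us(2) sq_int_e, of "- a"]
   by (simp add: fcoef_def w_def left_diff_distrib diff_divide_distrib)
  thus ?thesis unfolding fcoef_fst[OF u] fcoef_snd[OF u] .
 qed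
 let ?e = "e (l0, - l0)"
 \<comment> \<open>By Fubini: for a fixed second variable the zeros form a finite level set of
   \<open>u\<close>.\<close>
 have ae: "AE z in M. q z \<noteq> 0"
 proof -
  let ?I = "%z. indicator {z. q z = 0} z :: real"
  have "closed {z. q z = 0}" by (intro closed_Collect_eq qc continuous_on_const)
  hence Im: "?I \<in> borel_measurable borel" by (intro borel_measurable_indicator borel_closed)
  have Ii: "integrable M ?I" by (rule integrable_M_bounded[OF measurable_M[OF Im], of 1]) (simp add: indicator_def)
  have "(LINT x|lborel. indicator {0..<L} x *\<^sub>R ?I (x, y)) = 0" for y
  proof -
   have "AE x in lborel. x \<notin> {x \<in> {0..<L}. u x = u y}" using finite_imp_null_set_lborel[OF lev[of "u y"]] by (rule AE_not_in)
   hence "AE x in lborel. indicator {0..<L} x *\<^sub>R ?I (x, y) = 0" by eventually_elim (simp add: indicator_def q_def)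
   thus ?thesis by (rule integral_eq_zero_AE)
  qed
  hence "(LINT z|M. ?I z) = 0" unfolding integral_M_snd[OF Im Ii] by simp
  hence "AE z in M. ?I z = 0" using integral_nonneg_eq_0_iff_AE[OF Ii] by simp
  thus ?thesis by eventually_elim (simp add: indicator_def split: if_splits)
 qed
 \<comment> \<open>Division by \<open>q\<close>, regularised near its zeros: with
   \<open>r = 1 / Suc n\<close> the residual is \<open>r / (q^2 + r)\<close>, which is at most 1 and
   tends to 0 wherever \<open>q\<close> is nonzero.\<close>
 define g where "g n z = of_real (q z / ((q z)^2 + 1 / real (Suc n))) * ?e z" for n z
 have pos: "0 < x^2 + 1 / real (Suc n)" for x and n by (intro add_nonneg_pos) simp_all
 have gc: "continuous_on S (g n)" for S n unfolding g_def using pos by (intro continuous_intros qc ballI) (metis less_irrefl)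
 have res: "norm (w z * g n z - ?e z) = (1 / real (Suc n)) / ((q z)^2 + 1 / real (Suc n))" for n z
 proof -
  have "w z * g n z - ?e z = of_real (q z * (q z / ((q z)^2 + 1 / real (Suc n))) - 1) * ?e z" unfolding g_def wq by (simp add: algebra_simps)
  also have "q z * (q z / ((q z)^2 + 1 / real (Suc n))) - 1 = - ((1 / real (Suc n)) / ((q z)^2 + 1 / real (Suc n)))"
   using pos[of "q z" n] by (simp add: field_simps power2_eq_square del: of_nat_Suc)
  finally show ?thesis using pos[of "q z" n] by (simp add: norm_mult del: of_nat_Suc of_real_divide)
 qed
 have "(%n. LINT z|M. (norm (w z * g n z - ?e z))^2) \<longlonglongrightarrow> (LINT z|M. 0)"
 proof (rule integral_dominated_convergence[where w = "%z. 1"])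
  show "(%z. (norm (w z * g n z - ?e z))^2) \<in> borel_measurable M" for n
   by (intro measurable_M borel_measurable_continuous_onI continuous_intros wc gc)
  show "AE z in M. (%n. (norm (w z * g n z - ?e z))^2) \<longlonglongrightarrow> 0" using ae
  proof eventually_elim
   case (elim z)
   have "(%n. (1 / real (Suc n)) / ((q z)^2 + 1 / real (Suc n))) \<longlonglongrightarrow> 0 / ((q z)^2 + 0)"
    using elim LIMSEQ_Suc[OF lim_1_over_n] by (intro tendsto_intros) simp_all
   hence "(%n. ((1 / real (Suc n)) / ((q z)^2 + 1 / real (Suc n)))^2) \<longlonglongrightarrow> (0 / ((q z)^2 + 0))^2"
    by (intro tendsto_power)
   thus ?case unfolding res by simp
  qed
  have "(norm (w z * g n z - ?e z))^2 \<le> 1" for n z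
  proof -
   have "(1 / real (Suc n)) / ((q z)^2 + 1 / real (Suc n)) \<le> 1" using pos[of "q z" n] by (subst divide_le_eq_1_pos) simp_all
   thus ?thesis unfolding res using pos[of "q z" n] by (intro power_le_one) simp_all
  qed
  thus "AE z in M. norm ((norm (w z * g n z - ?e z))^2) \<le> 1" for n by (intro AE_I2) simp
 qed simp_all
 hence l0: "(%n. LINT z|M. (norm (w z * g n z - ?e z))^2) \<longlonglongrightarrow> 0" by simp
 \<comment> \<open>The error consists of this residual and of the truncation of \<open>g N\<close>
   to finitely many modes; squaring the sum doubles each square, so both get half of
   \<open>LL * \<epsilon>\<close>. The denominator of \<open>\<eta>'\<close> below compensates the
   multiplication by \<open>w\<close>, which is bounded by \<open>2 * B\<close>.\<close>
 define \<eta> where "\<eta> = LL * \<epsilon> / 4"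
 have \<eta>: "0 < \<eta>" using L \<epsilon> by (simp add: \<eta>_def)
 obtain N where N: "(LINT z|M. (norm (w z * g N z - ?e z))^2) < \<eta>"
  using order_tendstoD(2)[OF l0 \<eta>] unfolding eventually_sequentially by blast
 have gs: "sq_int M (g N)" by (rule sq_int_continuous[OF gc])
 have l1: "(%n. LINT z|M. (norm (g N z - psum (fcoef (g N)) (sbox n) z))^2) \<longlonglongrightarrow> 0"
  using fourier_L2lim[OF gs] by (simp add: L2lim_def)
 define \<eta>' where "\<eta>' = \<eta> / ((2 * B)^2 + 1)"
 have "0 < (2 * B)^2 + 1" by (intro add_nonneg_pos) simp_all
 hence \<eta>': "0 < \<eta>'" "((2 * B)^2 + 1) * \<eta>' = \<eta>" using \<eta> by (simp_all add: \<eta>'_def)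
 obtain n where n: "(LINT z|M. (norm (g N z - psum (fcoef (g N)) (sbox n) z))^2) < \<eta>'"
  using order_tendstoD(2)[OF l1 \<eta>'(1)] unfolding eventually_sequentially by blast
 define h where "h = fcoef (g N)"
 let ?H = "psum h (sbox n)"
 let ?f = "%z. w z * ?H z - ?e z"
 have Hs: "sq_int M (%z. w z * ?H z)" by (rule sq_int_mult_bdd[OF ws measurable_M[OF measurable_psum] norm_psum_le])
 have fs: "sq_int M ?f" by (intro sq_int_diff Hs sq_int_e)
 have ff: "fcoef ?f a = (\<Sum>b\<in>sbox n. h b * commutator_entry (uhat L u) a b) - (if a = (l0, - l0) then 1 else 0)" for a
 proof -
  have "fcoef ?f a = fcoef (%z. w z * ?H z) a - fcoef ?e a"
   using sq_int_mult_integrable[OF Hs sq_int_e, of "- a"] sq_int_mult_integrable[OF sq_int_e sq_int_e, of "(l0, - l0)" "- a"]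
   by (simp add: fcoef_def left_diff_distrib diff_divide_distrib)
  moreover have "fcoef ?e a = (if a = (l0, - l0) then 1 else 0)" using L unfolding fcoef_def integral_e_mult by auto
  moreover have "fcoef (%z. w z * ?H z) a = (\<Sum>b\<in>sbox n. h b * commutator_entry (uhat L u) a b)"
   unfolding fcoef_mult_psum[OF ws finite_sbox] fw fst_diff snd_diff by simp
  ultimately show ?thesis by simp
 qed
 have "(LINT z|M. (norm (?f z))^2) \<le> (LINT z|M. 2 * ((2 * B)^2 * (norm (g N z - ?H z))^2) + 2 * (norm (w z * g N z - ?e z))^2)"
 proof (rule integral_mono)
  show "integrable M (%z. (norm (?f z))^2)" by (rule sq_intD(2)[OF fs])
  have i1: "integrable M (%z. (norm (g N z - ?H z))^2)" by (intro sq_intD(2) sq_int_diff gs sq_int_psum)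
  have i2: "integrable M (%z. (norm (w z * g N z - ?e z))^2)" by (intro integrable_continuous continuous_intros wc gc)
  show "integrable M (%z. 2 * ((2 * B)^2 * (norm (g N z - ?H z))^2) + 2 * (norm (w z * g N z - ?e z))^2)"
   by (intro Bochner_Integration.integrable_add integrable_mult_right i1 i2)
  fix z
  have "?f z = - (w z * (g N z - ?H z)) + (w z * g N z - ?e z)" by (simp add: algebra_simps)
  hence "norm (?f z) \<le> norm (w z * (g N z - ?H z)) + norm (w z * g N z - ?e z)" by (metis norm_minus_cancel norm_triangle_ineq)
  hence "(norm (?f z))^2 \<le> (norm (w z * (g N z - ?H z)) + norm (w z * g N z - ?e z))^2" by (intro power_mono) simp_all
  also have "\<dots> \<le> 2 * (norm (w z * (g N z - ?H z)))^2 + 2 * (norm (w z * g N z - ?e z))^2"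
   using sum_squares_bound[of "norm (w z * (g N z - ?H z))" "norm (w z * g N z - ?e z)"] by (simp add: power2_sum)
  also have "(norm (w z * (g N z - ?H z)))^2 \<le> (2 * B)^2 * (norm (g N z - ?H z))^2"
   unfolding norm_mult power_mult_distrib[of "norm (w z)"] using wb[of z] by (intro mult_right_mono power_mono) simp_all
  finally show "(norm (?f z))^2 \<le> 2 * ((2 * B)^2 * (norm (g N z - ?H z))^2) + 2 * (norm (w z * g N z - ?e z))^2" by simp
 qed
 also have "\<dots> = 2 * ((2 * B)^2 * (LINT z|M. (norm (g N z - ?H z))^2)) + 2 * (LINT z|M. (norm (w z * g N z - ?e z))^2)"
 proof -
  have i1: "integrable M (%z. (norm (g N z - ?H z))^2)" by (intro sq_intD(2) sq_int_diff gs sq_int_psum)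
  have i2: "integrable M (%z. (norm (w z * g N z - ?e z))^2)" by (intro integrable_continuous continuous_intros wc gc)
  show ?thesis using i1 i2 by simp
 qed
 also have "\<dots> \<le> 2 * \<eta> + 2 * \<eta>"
 proof (intro add_mono mult_left_mono)
  have "(2 * B)^2 * (LINT z|M. (norm (g N z - ?H z))^2) \<le> (2 * B)^2 * \<eta>'"
   using n by (intro mult_left_mono) (simp_all add: h_def)
  also have "\<dots> \<le> \<eta>" using \<eta>' by (simp add: distrib_right)
  finally show "(2 * B)^2 * (LINT z|M. (norm (g N z - ?H z))^2) \<le> \<eta>" .
 qed (use N in simp_all)
 also have "\<dots> = LL * \<epsilon>" by (simp add: \<eta>_def)
 finally have fin: "(LINT z|M. (norm (?f z))^2) \<le> LL * \<epsilon>" .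
 have "(\<Sum>a\<in>F. (norm (fcoef ?f a))^2) \<le> \<epsilon>" if "finite F" for F
 proof -
  have "LL * (\<Sum>a\<in>F. (norm (fcoef ?f a))^2) \<le> LL * \<epsilon>" using Bessel[OF that fs] fin by linarith
  thus ?thesis using LL_pos by (simp only: mult_le_cancel_left_pos)
 qed
 thus ?thesis unfolding ff by blast
qed

text \<open>This is the quadratic form of \<open>[u, h]\<close> at the vector \<open>x\<close>:
  moving \<open>u\<close> onto the two copies of \<open>x\<close> gives truncated convolutions. The
  modes of \<open>h\<close> lie inside the truncation, hence the identity is exact.\<close>

lemma commutator_identity:
 fixes x U :: "int => complex" and h :: "coeffs"
 assumes "n \<le> N"
 shows "(\<Sum>a\<in>sbox N. (cnj (x (fst a)) * x (- snd a)) * (\<Sum>b\<in>sbox n. h b * commutator_entry U a b))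
  = (\<Sum>b\<in>sbox n. h b * ((\<Sum>p=- int N..int N. cnj (x p) * U (p - fst b)) * x (- snd b)
     - cnj (x (fst b)) * (\<Sum>p=- int N..int N. x p * U (- snd b - p))))"
proof -
 let ?P = "{- int N..int N}"
 let ?y = "%a. cnj (x (fst a)) * x (- snd a)"
 let ?k = "commutator_entry U"
 have "(\<Sum>a\<in>sbox N. ?y a * (\<Sum>b\<in>sbox n. h b * ?k a b)) = (\<Sum>a\<in>sbox N. \<Sum>b\<in>sbox n. h b * (?y a * ?k a b))"
  unfolding sum_distrib_left by (intro sum.cong refl) (simp only: mult.left_commute)
 also have "\<dots> = (\<Sum>b\<in>sbox n. h b * (\<Sum>a\<in>sbox N. ?y a * ?k a b))" unfolding sum_distrib_left by (rule sum.swap)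
 also have "\<dots> = (\<Sum>b\<in>sbox n. h b * ((\<Sum>p\<in>?P. cnj (x p) * U (p - fst b)) * x (- snd b)
     - cnj (x (fst b)) * (\<Sum>p\<in>?P. x p * U (- snd b - p))))"
 proof (rule sum.cong[OF refl])
  fix b assume b: "b \<in> sbox n"
  hence bP: "fst b \<in> ?P" "snd b \<in> ?P" using assms by (auto simp: sbox_def)
  have "(\<Sum>a\<in>sbox N. ?y a * ?k a b) = (\<Sum>p\<in>?P. \<Sum>q\<in>?P. ?y (p, q) * ?k (p, q) b)"
   unfolding sbox_def sum.cartesian_product by (simp only: case_prod_unfold prod.collapse)
  also have "\<dots> = (\<Sum>p\<in>?P. \<Sum>q\<in>?P. if q = snd b then (cnj (x p) * U (p - fst b)) * x (- snd b) else 0)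
    - (\<Sum>p\<in>?P. \<Sum>q\<in>?P. if p = fst b then cnj (x (fst b)) * (x (- q) * U (q - snd b)) else 0)"
   unfolding sum_subtractf[symmetric] by (intro sum.cong refl) auto
  also have "(\<Sum>p\<in>?P. \<Sum>q\<in>?P. if q = snd b then (cnj (x p) * U (p - fst b)) * x (- snd b) else 0)
    = (\<Sum>p\<in>?P. cnj (x p) * U (p - fst b)) * x (- snd b)" using bP by (simp add: sum_distrib_right)
  also have "(\<Sum>p\<in>?P. \<Sum>q\<in>?P. if p = fst b then cnj (x (fst b)) * (x (- q) * U (q - snd b)) else 0)
    = (\<Sum>q\<in>?P. \<Sum>p\<in>?P. if p = fst b then cnj (x (fst b)) * (x (- q) * U (q - snd b)) else 0)" by (rule sum.swap)
  also have "\<dots> = cnj (x (fst b)) * (\<Sum>q\<in>?P. x (- q) * U (q - snd b))" using bP by (simp add: sum_distrib_left)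
  also have "(\<Sum>q\<in>?P. x (- q) * U (q - snd b)) = (\<Sum>p\<in>?P. x p * U (- snd b - p))"
   by (rule sum.reindex_bij_witness[where i = uminus and j = uminus]) (auto simp: algebra_simps)
  finally show "h b * (\<Sum>a\<in>sbox N. ?y a * ?k a b) = h b * ((\<Sum>p\<in>?P. cnj (x p) * U (p - fst b)) * x (- snd b)
     - cnj (x (fst b)) * (\<Sum>p\<in>?P. x p * U (- snd b - p)))" by simp
 qed
 finally show ?thesis .
qed

definition JN :: "nat => (int \<times> int) set" where "JN N = sbox N - {0}"

section \<open>Averaging of a single mode over a time window\<close>

locale shear_profile = torus2 +
 fixes u :: "real => real"
 assumes u_cont: "continuous_on UNIV u" and u_bdd: "\<exists>B. \<forall>y. \<bar>u y\<bar> \<le> B"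
  and u_level: "!!c. finite {y \<in> {0..<L2}. u y = c}"
begin

lemma Uc_eq: "Uc u a = (if fst a = 0 then uhat L2 u (snd a) else 0)" unfolding Uc_def by (rule fcoef_snd[OF u_cont])

lemma Uc_uminus: "Uc u (- a) = cnj (Uc u a)" by (simp add: Uc_def fcoef_def cnj_e flip: Bochner_Integration.integral_cnj)

lemma uhat_cnj: "cnj (uhat L2 u k) = uhat L2 u (- k)" using Uc_uminus[of "(0, k)"] by (simp add: Uc_eq)

sublocale shear_flow L1 L2 "Uc u" by unfold_locales (simp_all add: Uc_uminus, simp add: Uc_eq)

lemma adm_JN: "adm (JN N)"
proof -
 have "uminus ` JN N = uminus ` sbox N - {0}" unfolding JN_def by (subst image_set_diff) (simp_all add: inj_on_def)
 thus ?thesis by (simp add: adm_def JN_def uminus_sbox)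
qed

lemma mem_JN: "k \<noteq> 0 ==> nat \<bar>k\<bar> \<le> N ==> (k, m) \<in> JN N \<longleftrightarrow> m \<in> {- int N..int N}"
 by (auto simp: JN_def sbox_def zero_prod_def)

text \<open>For fixed x-frequency \<open>k\<close> the transport term is truncated multiplication by
  \<open>u\<close> in the y-modes. The first bracket collects the terms without the large factor
  \<open>A\<close>.\<close>

lemma Gv_mode:
 assumes k: "k \<noteq> 0" "nat \<bar>k\<bar> \<le> N"
 shows "Gv A (JN N) d (k, m) = (- of_real ((nf (k, m))^2 - nf (k, m)) * d (k, m) - (1 / 2) * qq (JN N) (JN N) d (k, m))
   - of_real A * (mx (k, 0) * (\<Sum>p=- int N..int N. d (k, p) * uhat L2 u (m - p)))"
proof -
 have fin: "finite (JN N)" by (simp add: JN_def)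
 have "(\<Sum>b\<in>JN N. d b * Uc u ((k, m) - b)) = (\<Sum>b\<in>{b \<in> JN N. fst b = k}. d b * Uc u ((k, m) - b))"
  by (rule sum.mono_neutral_right[OF fin]) (auto simp: Uc_eq)
 also have "\<dots> = (\<Sum>p=- int N..int N. d (k, p) * uhat L2 u (m - p))"
 proof (rule sum.reindex_bij_witness[where i = "%p. (k, p)" and j = snd])
  fix b assume b: "b \<in> {b \<in> JN N. fst b = k}"
  hence e: "b = (k, snd b)" by auto
  thus "(k, snd b) = b" by (rule sym)
  show "snd b \<in> {- int N..int N}" using b mem_JN[OF k, of "snd b"] e by auto
  show "d (k, snd b) * uhat L2 u (m - snd b) = d b * Uc u ((k, m) - b)" by (subst (3 4) e) (simp add: Uc_eq)
 qed (use mem_JN[OF k] in auto)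
 finally have "(\<Sum>b\<in>JN N. d b * Uc u ((k, m) - b)) = (\<Sum>p=- int N..int N. d (k, p) * uhat L2 u (m - p))" .
 moreover have "mx (k, m) = mx (k, 0)" by (simp add: mx_def)
 ultimately show ?thesis unfolding Gv_def by (simp only:)
qed

text \<open>What averaging needs of a time interval, with one constant that is independent of
  \<open>A\<close> and \<open>N\<close>; the integral of \<open>wsum 1\<close> controls the
  quadratic term.\<close>

definition window :: "real => real => nat => (int \<times> int => real => complex) => real => real => bool" where
 "window C A N c s s' \<longleftrightarrow> s \<le> s' \<and> s' - s \<le> C \<and>
  (\<forall>a\<in>JN N. \<forall>t\<in>{s..s'}. (c a has_vector_derivative Gv A (JN N) (%b. c b t) a) (at t within {s..s'})) \<and>
  (\<forall>t\<in>{s..s'}. wsum (Jx (JN N)) 0 (%b. c b t) \<le> C) \<and>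
  integral {s..s'} (%t. wsum (JN N) 1 (%b. c b t)) \<le> C"

lemma window_cont:
 assumes "window C A N c s s'" "a \<in> JN N"
 shows "continuous_on {s..s'} (c a)" using assms unfolding window_def by (intro continuous_on_vector_derivative) blast

lemma wsum_cont:
 assumes "!!a. a \<in> P ==> continuous_on S (c a)"
 shows "continuous_on S (%t. wsum P k (%b. c b t))" unfolding wsum_def by (intro continuous_intros assms)

text \<open>The bounded quantity is \<open>H\<close>, the quadratic form of \<open>h\<close> at the
  modes of x-frequency \<open>k\<close>. The terms of its derivative without the factor
  \<open>A\<close> involve only the finitely many modes of \<open>h\<close>, so their bound does not
  depend on the truncation.\<close>

lemma mode_decay:
 assumes k: "k \<noteq> 0" and \<epsilon>: "0 < \<epsilon>" and C: "0 < C"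
 shows "\<exists>A0 n0. \<forall>A\<ge>A0. \<forall>N\<ge>n0. \<forall>c s s'. window C A N c s s' -->
  integral {s..s'} (%t. (norm (c (k, l0) t))^2) \<le> \<epsilon>"
proof -
 \<comment> \<open>The Hilbert-Schmidt error acts on a vector of squared norm at most
   \<open>C\<close> during a time at most \<open>C\<close>; this choice makes its share
   \<open>\<epsilon> / 2\<close>.\<close>
 define \<epsilon>1 where "\<epsilon>1 = \<epsilon> / (2 * C^2)"
 have e1: "0 < \<epsilon>1" using \<epsilon> C by (simp add: \<epsilon>1_def)
 obtain B where B: "!!y. \<bar>u y\<bar> \<le> B" using u_bdd by blast
 obtain n h where nh: "!!F. finite F ==>
   (\<Sum>a\<in>F. (norm ((\<Sum>b\<in>sbox n. h b * commutator_entry (uhat L2 u) a b) - (if a = (l0, - l0) then 1 else 0)))^2) \<le> \<epsilon>1^2"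
  using commutator_kernel[OF L2 u_cont B u_level, of "\<epsilon>1^2" l0] e1 by auto
 define Com where "Com a = (\<Sum>b\<in>sbox n. h b * commutator_entry (uhat L2 u) a b)" for a
 define Er where "Er a = Com a - (if a = (l0, - l0) then 1 else 0)" for a
 have Er: "(\<Sum>a\<in>F. (norm (Er a))^2) \<le> \<epsilon>1^2" if "finite F" for F using nh[OF that] unfolding Er_def Com_def .
 define hs where "hs = (\<Sum>b\<in>sbox n. norm (h b))"
 have hs0: "0 \<le> hs" by (simp add: hs_def sum_nonneg)
 define \<Lambda> where "\<Lambda> = (\<Sum>m=- int n..int n. \<bar>(nf (k, m))^2 - nf (k, m)\<bar>)"
 have \<Lambda>: "\<bar>(nf (k, m))^2 - nf (k, m)\<bar> \<le> \<Lambda>" if "m \<in> {- int n..int n}" for m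
  unfolding \<Lambda>_def by (rule member_le_sum[OF that]) simp_all
 have \<Lambda>0: "0 \<le> \<Lambda>" by (simp add: \<Lambda>_def sum_nonneg)
 \<comment> \<open>\<open>\<mu>\<close> is purely imaginary; its sign change under conjugation is
   what produces a commutator rather than an anticommutator.\<close>
 define \<mu> where "\<mu> = mx (k, 0)"
 have \<mu>: "cnj \<mu> = - \<mu>" "0 < norm \<mu>" using k L1 by (simp_all add: \<mu>_def mx_def norm_mult)
 \<comment> \<open>Bounds everything without the factor \<open>A\<close>: the values of
   \<open>H\<close> at both end points and the integral of \<open>R\<close>. \<open>A0\<close> is
   chosen so that \<open>W\<close> is at most half of
   \<open>A * norm \<mu> * \<epsilon>\<close>.\<close>
 define W where "W = 2 * hs * C + 2 * hs * (\<Lambda> * C * C + sqrt C * C)"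
 have W0: "0 \<le> W" using hs0 \<Lambda>0 C by (simp add: W_def)
 define A0 where "A0 = 2 * W / (norm \<mu> * \<epsilon>) + 1"
 define n0 where "n0 = n + nat \<bar>k\<bar> + nat \<bar>l0\<bar>"
 have main: "integral {s..s'} (%t. (norm (c (k, l0) t))^2) \<le> \<epsilon>"
  if A: "A0 \<le> A" and N: "n0 \<le> N" and w: "window C A N c s s'" for A N c s s'
 proof -
  let ?J = "JN N" and ?P = "{- int N..int N}"
  have kN: "nat \<bar>k\<bar> \<le> N" and nN: "n \<le> N" and lN: "l0 \<in> ?P" using N by (auto simp: n0_def)
  have s: "s \<le> s'" "s' - s \<le> C" using w by (auto simp: window_def)
  have Apos: "0 < A" using A W0 \<mu> \<epsilon> unfolding A0_def by (smt (verit) divide_nonneg_pos mult_pos_pos)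
  have fJ: "finite ?J" by (simp add: JN_def)
  define x where "x m t = c (k, m) t" for m t
  define d where "d t b = c b t" for t b
  define \<rho> where "\<rho> m t = - of_real ((nf (k, m))^2 - nf (k, m)) * d t (k, m) - (1 / 2) * qq ?J ?J (d t) (k, m)" for m t
  define x' where "x' m t = \<rho> m t - of_real A * (\<mu> * (\<Sum>p\<in>?P. x p t * uhat L2 u (m - p)))" for m t
  have ode: "(x m has_vector_derivative x' m t) (at t within {s..s'})" if "m \<in> ?P" "t \<in> {s..s'}" for m t
  proof -
   have "(c (k, m) has_vector_derivative Gv A ?J (%b. c b t) (k, m)) (at t within {s..s'})"
    using w that mem_JN[OF k kN, of m] unfolding window_def by blast
   thus ?thesis unfolding Gv_mode[OF k kN] x'_def \<rho>_def d_def x_def \<mu>_def .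
  qed
  have cc: "continuous_on {s..s'} (c a)" if "a \<in> ?J" for a by (rule window_cont[OF w that])
  have xc: "continuous_on {s..s'} (x m)" if "m \<in> ?P" for m unfolding x_def using cc mem_JN[OF k kN, of m] that by blast
  have bb: "fst b \<in> {- int n..int n}" "snd b \<in> {- int n..int n}" "- snd b \<in> {- int n..int n}"
   "fst b \<in> ?P" "- snd b \<in> ?P" if "b \<in> sbox n" for b using that nN by (auto simp: sbox_def)
  define H where "H t = (\<Sum>b\<in>sbox n. h b * (cnj (x (fst b) t) * x (- snd b) t))" for t
  define H' where "H' t = (\<Sum>b\<in>sbox n. h b * (cnj (x (fst b) t) * x' (- snd b) t + cnj (x' (fst b) t) * x (- snd b) t))" for t
  have Hd: "(H has_vector_derivative H' t) (at t within {s..s'})" if "t \<in> {s..s'}" for t unfolding H_def H'_def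
   by (intro has_vector_derivative_sum has_vector_derivative_mult_right has_vector_derivative_mult
     has_vector_derivative_cnj ode that bb)
  define R where "R t = (\<Sum>b\<in>sbox n. h b * (cnj (x (fst b) t) * \<rho> (- snd b) t + cnj (\<rho> (fst b) t) * x (- snd b) t))" for t
  define er where "er t = (\<Sum>a\<in>sbox N. (cnj (x (fst a) t) * x (- snd a) t) * Er a)" for t
  have split: "H' t = of_real A * \<mu> * (of_real ((norm (x l0 t))^2) + er t) + R t" for t
  proof -
   have c1: "cnj (x' m t) = cnj (\<rho> m t) + of_real A * (\<mu> * (\<Sum>p\<in>?P. cnj (x p t) * uhat L2 u (p - m)))" for m
    unfolding x'_def by (simp add: \<mu>(1) uhat_cnj cnj_sum)
   have "H' t = (\<Sum>b\<in>sbox n. h b * (cnj (x (fst b) t) * \<rho> (- snd b) t + cnj (\<rho> (fst b) t) * x (- snd b) t)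
     + of_real A * \<mu> * (h b * ((\<Sum>p\<in>?P. cnj (x p t) * uhat L2 u (p - fst b)) * x (- snd b) t
     - cnj (x (fst b) t) * (\<Sum>p\<in>?P. x p t * uhat L2 u (- snd b - p)))))"
    unfolding H'_def c1 unfolding x'_def by (intro sum.cong refl) (simp add: algebra_simps)
   also have "\<dots> = R t + of_real A * \<mu> * (\<Sum>a\<in>sbox N. (cnj (x (fst a) t) * x (- snd a) t) * Com a)"
    unfolding sum.distrib R_def sum_distrib_left[symmetric] Com_def commutator_identity[OF nN, of "%m. x m t"] ..
   also have "(\<Sum>a\<in>sbox N. (cnj (x (fst a) t) * x (- snd a) t) * Com a)
     = (\<Sum>a\<in>sbox N. (cnj (x (fst a) t) * x (- snd a) t) * (if a = (l0, - l0) then 1 else 0)) + er t"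
    unfolding er_def sum.distrib[symmetric] Er_def by (intro sum.cong refl) (simp add: algebra_simps)
   also have "(\<Sum>a\<in>sbox N. (cnj (x (fst a) t) * x (- snd a) t) * (if a = (l0, - l0) then 1 else 0))
     = (\<Sum>a\<in>sbox N. if a = (l0, - l0) then cnj (x l0 t) * x l0 t else 0)" by (intro sum.cong refl) simp
   also have "\<dots> = of_real ((norm (x l0 t))^2)"
   proof -
    have "(l0, - l0) \<in> sbox N" using lN by (simp add: sbox_def)
    thus ?thesis unfolding complex_norm_square by (simp add: mult.commute)
   qed
   finally show ?thesis by simp
  qed
  let ?G = "%t. wsum (Jx ?J) 0 (%b. c b t)" and ?X = "%t. wsum ?J 1 (%b. c b t)"
  have G: "?G t \<le> C" if "t \<in> {s..s'}" for t using w that by (simp add: window_def)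
  have sumP: "(\<Sum>m\<in>?P. (norm (x m t))^2) \<le> ?G t" for t
  proof -
   have "(\<Sum>m\<in>?P. (norm (x m t))^2) = (\<Sum>b\<in>(%m. (k, m)) ` ?P. (norm (c b t))^2)"
    by (subst sum.reindex) (simp_all add: inj_on_def x_def)
   also have "\<dots> \<le> (\<Sum>b\<in>Jx ?J. (norm (c b t))^2)"
   proof (rule sum_mono2[OF J_split(3)[OF fJ]])
    have "(k, m) \<in> Jx ?J" if "m \<in> ?P" for m unfolding Jx_def using mem_JN[OF k kN, of m] that k by simp
    thus "(%m. (k, m)) ` ?P \<subseteq> Jx ?J" by (rule image_subsetI)
   qed simp
   finally show ?thesis by (simp add: wsum_def)
  qed
  have xm: "norm (x m t) \<le> sqrt C" if "m \<in> ?P" "t \<in> {s..s'}" for m t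
  proof (rule real_le_rsqrt)
   have "(norm (x m t))^2 \<le> (\<Sum>m\<in>?P. (norm (x m t))^2)" by (rule member_le_sum[OF that(1)]) simp_all
   thus "(norm (x m t))^2 \<le> C" using sumP[of t] G[OF that(2)] by linarith
  qed
  have xx: "norm (x m t) * norm (x m' t) \<le> C" if "m \<in> ?P" "m' \<in> ?P" "t \<in> {s..s'}" for m m' t
   using mult_mono[OF xm[OF that(1,3)] xm[OF that(2,3)]] C by simp
  have \<rho>b: "norm (\<rho> m t) \<le> \<Lambda> * sqrt C + ?X t" if m: "m \<in> {- int n..int n}" and t: "t \<in> {s..s'}" for m t
  proof -
   have mP: "m \<in> ?P" using m nN by auto
   have "norm (\<rho> m t) \<le> norm (of_real ((nf (k, m))^2 - nf (k, m)) * d t (k, m)) + norm ((1 / 2) * qq ?J ?J (d t) (k, m))"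
    unfolding \<rho>_def using norm_triangle_ineq4[of "- of_real ((nf (k, m))^2 - nf (k, m)) * d t (k, m)" "(1 / 2) * qq ?J ?J (d t) (k, m)"]
    by (simp only: mult_minus_left norm_minus_cancel)
   also have "norm (of_real ((nf (k, m))^2 - nf (k, m)) * d t (k, m)) \<le> \<Lambda> * sqrt C"
    unfolding norm_mult norm_of_real d_def using \<Lambda>[OF m] xm[OF mP t] \<Lambda>0 C by (intro mult_mono) (simp_all add: x_def)
   also have "norm ((1 / 2) * qq ?J ?J (d t) (k, m)) \<le> ?X t"
   proof -
    have "norm (qq ?J ?J (d t) (k, m)) \<le> sqrt (wsum ?J 1 (d t)) * sqrt (wsum ?J 1 (d t))" by (rule qq_bound[OF fJ fJ])
    also have "\<dots> = wsum ?J 1 (d t)" using wsum_nonneg[of ?J 1 "d t"] by simp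
    also have "\<dots> = ?X t" unfolding d_def[abs_def] ..
    finally show ?thesis using wsum_nonneg[of ?J 1 "%b. c b t"] by (simp add: norm_mult)
   qed
   finally show ?thesis by simp
  qed
  have Rb: "norm (R t) \<le> 2 * hs * (\<Lambda> * C + sqrt C * ?X t)" if t: "t \<in> {s..s'}" for t
  proof -
   have "norm (R t) \<le> (\<Sum>b\<in>sbox n. norm (h b) * (2 * (\<Lambda> * C + sqrt C * ?X t)))" unfolding R_def
   proof (rule sum_norm_le)
    fix b assume b: "b \<in> sbox n"
    have one: "norm (x m t) * norm (\<rho> m' t) \<le> \<Lambda> * C + sqrt C * ?X t" if "m \<in> ?P" "m' \<in> {- int n..int n}" for m m'
    proof -
     have "norm (x m t) * norm (\<rho> m' t) \<le> sqrt C * (\<Lambda> * sqrt C + ?X t)"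
      using xm[OF that(1) t] \<rho>b[OF that(2) t] C by (intro mult_mono) simp_all
     also have "\<dots> = \<Lambda> * C + sqrt C * ?X t" using C by (simp add: algebra_simps)
     finally show ?thesis .
    qed
    have "norm (cnj (x (fst b) t) * \<rho> (- snd b) t + cnj (\<rho> (fst b) t) * x (- snd b) t)
     \<le> norm (x (fst b) t) * norm (\<rho> (- snd b) t) + norm (x (- snd b) t) * norm (\<rho> (fst b) t)"
     by (rule order_trans[OF norm_triangle_ineq]) (simp add: norm_mult mult.commute)
    also have "\<dots> \<le> 2 * (\<Lambda> * C + sqrt C * ?X t)" using one[OF bb(4,3)[OF b]] one[OF bb(5,1)[OF b]] by simp
    finally show "norm (h b * (cnj (x (fst b) t) * \<rho> (- snd b) t + cnj (\<rho> (fst b) t) * x (- snd b) t)) \<le> norm (h b) * (2 * (\<Lambda> * C + sqrt C * ?X t))"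
     unfolding norm_mult[of "h b"] by (rule mult_left_mono) simp
   qed
   thus ?thesis unfolding sum_distrib_right[symmetric] hs_def[symmetric] by (simp only: mult_ac)
  qed
  \<comment> \<open>Cauchy-Schwarz against the Hilbert-Schmidt norm of the error, so the number of
    modes does not enter.\<close>
  have erb: "norm (er t) \<le> \<epsilon>1 * C" if t: "t \<in> {s..s'}" for t
  proof -
   have "norm (er t) \<le> (\<Sum>a\<in>sbox N. norm (cnj (x (fst a) t) * x (- snd a) t) * norm (Er a))"
    unfolding er_def by (rule sum_norm_le) (simp add: norm_mult)
   also have "\<dots> \<le> sqrt ((\<Sum>a\<in>sbox N. (norm (cnj (x (fst a) t) * x (- snd a) t))^2) * (\<Sum>a\<in>sbox N. (norm (Er a))^2))"
    by (rule real_le_rsqrt[OF CS_sum])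
   also have "(\<Sum>a\<in>sbox N. (norm (cnj (x (fst a) t) * x (- snd a) t))^2) = (\<Sum>m\<in>?P. (norm (x m t))^2)^2"
   proof -
    have "(\<Sum>a\<in>sbox N. (norm (cnj (x (fst a) t) * x (- snd a) t))^2) = (\<Sum>m\<in>?P. (norm (x m t))^2) * (\<Sum>m\<in>?P. (norm (x (- m) t))^2)"
     unfolding sbox_def sum_product sum.cartesian_product by (simp add: norm_mult power_mult_distrib case_prod_unfold)
    also have "(\<Sum>m\<in>?P. (norm (x (- m) t))^2) = (\<Sum>m\<in>?P. (norm (x m t))^2)"
     by (rule sum.reindex_bij_witness[where i = uminus and j = uminus]) auto
    finally show ?thesis by (simp add: power2_eq_square)
   qed
   also have "sqrt ((\<Sum>m\<in>?P. (norm (x m t))^2)^2 * (\<Sum>a\<in>sbox N. (norm (Er a))^2)) \<le> sqrt (C^2 * \<epsilon>1^2)"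
    using Er[of "sbox N"] sumP[of t] G[OF t] by (intro real_sqrt_le_mono mult_mono power_mono) (simp_all add: sum_nonneg)
   also have "\<dots> = \<epsilon>1 * C" using C e1 by (simp add: real_sqrt_mult)
   finally show ?thesis .
  qed
  have Xc: "continuous_on {s..s'} ?X" by (intro wsum_cont cc)
  have x0c: "continuous_on {s..s'} (%t. (norm (x l0 t))^2)" by (intro continuous_intros xc lN)
  have H'i: "(H' has_integral H s' - H s) {s..s'}" by (rule fundamental_theorem_of_calculus[OF s(1) Hd])
  let ?E = "%t. H' t - of_real A * \<mu> * of_real ((norm (x l0 t))^2)"
  have Eeq: "?E t = of_real A * \<mu> * er t + R t" for t unfolding split by (simp add: algebra_simps)
  have x0i: "((%t. of_real ((norm (x l0 t))^2)) has_integral complex_of_real (integral {s..s'} (%t. (norm (x l0 t))^2))) {s..s'}"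
   by (intro has_integral_of_real integrable_integral integrable_continuous_real x0c)
  have Ei: "(?E has_integral (H s' - H s - of_real A * \<mu> * of_real (integral {s..s'} (%t. (norm (x l0 t))^2)))) {s..s'}"
   by (intro has_integral_diff H'i has_integral_mult_right x0i)
  let ?b = "%t. A * norm \<mu> * (\<epsilon>1 * C) + 2 * hs * (\<Lambda> * C + sqrt C * ?X t)"
  have bi: "?b integrable_on {s..s'}" by (intro integrable_continuous_real continuous_intros Xc)
  have "norm (integral {s..s'} ?E) \<le> integral {s..s'} ?b"
  proof (rule integral_norm_bound_integral)
   show "?E integrable_on {s..s'}" using Ei by (rule has_integral_integrable)
   show "?b integrable_on {s..s'}" by (rule bi)
   fix t assume t: "t \<in> {s..s'}"
   have "norm (?E t) \<le> norm (of_real A * \<mu> * er t) + norm (R t)" unfolding Eeq by (rule norm_triangle_ineq)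
   also have "norm (of_real A * \<mu> * er t) \<le> A * norm \<mu> * (\<epsilon>1 * C)"
    unfolding norm_mult norm_of_real using Apos erb[OF t] by (intro mult_mono) simp_all
   finally show "norm (?E t) \<le> ?b t" using Rb[OF t] by simp
  qed
  also have "integral {s..s'} ?b = (A * norm \<mu> * (\<epsilon>1 * C) + 2 * hs * (\<Lambda> * C)) * (s' - s) + 2 * hs * sqrt C * integral {s..s'} ?X"
  proof -
   have "?b = (%t. (A * norm \<mu> * (\<epsilon>1 * C) + 2 * hs * (\<Lambda> * C)) + 2 * hs * sqrt C * ?X t)" by (simp add: algebra_simps)
   moreover have "((%t. (A * norm \<mu> * (\<epsilon>1 * C) + 2 * hs * (\<Lambda> * C)) + 2 * hs * sqrt C * ?X t) has_integral
     (s' - s) *\<^sub>R (A * norm \<mu> * (\<epsilon>1 * C) + 2 * hs * (\<Lambda> * C)) + 2 * hs * sqrt C * integral {s..s'} ?X) {s..s'}"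
    using has_integral_const_real[of "A * norm \<mu> * (\<epsilon>1 * C) + 2 * hs * (\<Lambda> * C)" s s'] s(1)
    by (intro has_integral_add has_integral_mult_right integrable_integral integrable_continuous_real Xc) simp
   ultimately show ?thesis by (simp add: integral_unique mult.commute)
  qed
  also have "\<dots> \<le> (A * norm \<mu> * (\<epsilon>1 * C) + 2 * hs * (\<Lambda> * C)) * C + 2 * hs * sqrt C * C"
   using w s Apos \<mu>(2) e1 C hs0 \<Lambda>0 unfolding window_def
   by (intro add_mono mult_left_mono) (simp_all add: mult_nonneg_nonneg add_nonneg_nonneg)
  finally have n1: "norm (integral {s..s'} ?E) \<le> A * norm \<mu> * (\<epsilon>1 * C * C) + 2 * hs * (\<Lambda> * C * C + sqrt C * C)"
   by (simp add: algebra_simps)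
  have Hb: "norm (H t) \<le> hs * C" if t: "t \<in> {s..s'}" for t
  proof -
   have "norm (H t) \<le> (\<Sum>b\<in>sbox n. norm (h b) * C)" unfolding H_def
   proof (rule sum_norm_le)
    fix b assume b: "b \<in> sbox n"
    have "norm (x (fst b) t) * norm (x (- snd b) t) \<le> C" by (rule xx[OF bb(4,5)[OF b] t])
    thus "norm (h b * (cnj (x (fst b) t) * x (- snd b) t)) \<le> norm (h b) * C" by (simp add: norm_mult mult_left_mono)
   qed
   thus ?thesis by (simp add: hs_def sum_distrib_right)
  qed
  let ?I = "integral {s..s'} (%t. (norm (x l0 t))^2)"
  have I0: "0 \<le> ?I" by (intro Henstock_Kurzweil_Integration.integral_nonneg integrable_continuous_real x0c) simp
  have "of_real A * \<mu> * of_real ?I = H s' - H s - integral {s..s'} ?E" unfolding integral_unique[OF Ei] by simp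
  hence "norm (of_real A * \<mu> * of_real ?I) = norm (H s' - H s - integral {s..s'} ?E)" by (rule arg_cong)
  hence "norm (of_real A * \<mu> * of_real ?I) \<le> norm (H s') + norm (H s) + norm (integral {s..s'} ?E)"
   using norm_triangle_ineq4[of "H s' - H s" "integral {s..s'} ?E"] norm_triangle_ineq4[of "H s'" "H s"] by linarith
  also have "norm (of_real A * \<mu> * of_real ?I) = A * norm \<mu> * ?I" using Apos I0 by (simp add: norm_mult)
  also have "norm (H s') + norm (H s) + norm (integral {s..s'} ?E) \<le> A * norm \<mu> * (\<epsilon>1 * C * C) + W"
   using Hb[of s] Hb[of s'] s(1) n1 unfolding W_def by simp
  also have "\<epsilon>1 * C * C = \<epsilon> / 2" using C by (simp add: \<epsilon>1_def power2_eq_square)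
  also have "W \<le> A * norm \<mu> * (\<epsilon> / 2)"
  proof -
   have "2 * W / (norm \<mu> * \<epsilon>) \<le> A" using A unfolding A0_def by linarith
   hence "2 * W \<le> A * (norm \<mu> * \<epsilon>)" using \<mu>(2) \<epsilon> by (simp add: pos_divide_le_eq)
   thus ?thesis by (simp add: mult_ac)
  qed
  finally have "A * norm \<mu> * ?I \<le> A * norm \<mu> * \<epsilon>" by (simp add: algebra_simps)
  hence "?I \<le> \<epsilon>" using Apos \<mu>(2) by (simp only: mult_le_cancel_left_pos mult_pos_pos)
  thus ?thesis by (simp add: x_def)
 qed
 thus ?thesis by blast
qed

end

section \<open>Bounds for the Galerkin systems\<close>

lemma deriv_le_integral:
 fixes f g :: "real => real"
 assumes ab: "a \<le> b" and d: "!!t. t \<in> {a..b} ==> (f has_real_derivative f' t) (at t within {a..b})"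
  and g: "continuous_on {a..b} g" and le: "!!t. t \<in> {a..b} ==> f' t \<le> g t"
 shows "f b - f a \<le> integral {a..b} g"
proof -
 have "(f' has_integral f b - f a) {a..b}"
  using d by (intro fundamental_theorem_of_calculus ab) (simp add: has_real_derivative_iff_has_vector_derivative)
 thus ?thesis by (rule has_integral_le[OF _ integrable_integral[OF integrable_continuous_real[OF g]]]) (rule le)
qed

lemma gronwall:
 fixes f :: "real => real"
 assumes ab: "a \<le> b" and d: "!!t. t \<in> {a..b} ==> (f has_real_derivative f' t) (at t within {a..b})"
  and le: "!!t. t \<in> {a..b} ==> f' t \<le> k * f t"
 shows "f b \<le> exp (k * (b - a)) * f a"
proof -
 have "exp (- k * (b - a)) * f b - exp (- k * (a - a)) * f a \<le> integral {a..b} (%_. 0)"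
 proof (rule deriv_le_integral[OF ab])
  fix t assume t: "t \<in> {a..b}"
  have "((%t. exp (- k * (t - a))) has_real_derivative - k * exp (- k * (t - a))) (at t within {a..b})"
   by (auto intro!: derivative_eq_intros)
  from DERIV_mult[OF this d[OF t]]
  show "((%t. exp (- k * (t - a)) * f t) has_real_derivative exp (- k * (t - a)) * (f' t - k * f t)) (at t within {a..b})"
   by (simp add: algebra_simps)
  show "exp (- k * (t - a)) * (f' t - k * f t) \<le> 0" using le[OF t] by (intro mult_nonneg_nonpos) simp_all
 qed simp
 hence "exp (- k * (b - a)) * f b \<le> f a" by simp
 hence "exp (k * (b - a)) * (exp (- k * (b - a)) * f b) \<le> exp (k * (b - a)) * f a" by (rule mult_left_mono) simp
 thus ?thesis by (simp add: mult.assoc[symmetric] exp_add[symmetric])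
qed

text \<open>Continuity method: the weak bound up to time \<open>t\<close> is improved to a strict
  one at \<open>t\<close>, so \<open>f\<close> has no first time at level \<open>c\<close>.\<close>

lemma barrier:
 fixes f :: "real => real"
 assumes f: "continuous_on {a..b} f" and a: "f a < c"
  and step: "!!t. t \<in> {a..b} ==> (\<forall>s\<in>{a..t}. f s \<le> c) ==> f t < c" and t: "t \<in> {a..b}"
 shows "f t < c"
proof (rule ccontr)
 assume n: "\<not> f t < c"
 let ?S = "{x \<in> {a..b}. f x = c}"
 have ivt: "\<exists>x\<in>?S. x \<le> s" if s: "s \<in> {a..b}" "c \<le> f s" for s
 proof -
  have "continuous_on {a..s} f" by (rule continuous_on_subset[OF f]) (use s in auto)
  then obtain x where "a \<le> x" "x \<le> s" "f x = c" using IVT'[of f a c s] s a by auto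
  thus ?thesis using s by (intro bexI[of _ x]) auto
 qed
 have "closed ?S" by (rule continuous_closed_preimage_constant[OF f]) simp
 hence "compact ?S" by (intro bounded_closed_imp_seq_compact[unfolded compact_eq_seq_compact_metric[symmetric]] bounded_subset[OF bounded_closed_interval[of a b]]) auto
 moreover have "?S \<noteq> {}" using ivt[OF t] n by auto
 ultimately obtain x where x: "x \<in> ?S" "!!y. y \<in> ?S ==> x \<le> y" using compact_attains_inf[of ?S] by blast
 have "f s \<le> c" if s: "s \<in> {a..x}" for s
 proof (rule ccontr)
  assume "\<not> f s \<le> c"
  moreover have "s \<in> {a..b}" using s x(1) by simp
  ultimately obtain y where y: "y \<in> ?S" "y \<le> s" using ivt[of s] by auto
  hence "y = s" using x(2)[OF y(1)] s by simp
  thus False using y \<open>\<not> f s \<le> c\<close> by simp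
 qed
 thus False using step[of x] x(1) by simp
qed

lemma mean_le:
 fixes g :: "real => real"
 assumes ab: "a < b" and g: "continuous_on {a..b} g" and le: "integral {a..b} g \<le> c * (b - a)"
 shows "\<exists>t\<in>{a..b}. g t \<le> c"
proof -
 obtain t where t: "t \<in> {a..b}" "!!s. s \<in> {a..b} ==> g t \<le> g s"
  using continuous_attains_inf[of "{a..b}" g] g ab by (auto simp: compact_Icc)
 have "integral {a..b} (%_. g t) \<le> integral {a..b} g" by (rule integral_le) (simp_all add: integrable_continuous_real g t(2))
 moreover have "integral {a..b} (%_. g t) = g t * (b - a)" using ab by (simp add: mult.commute)
 ultimately have "g t * (b - a) \<le> c * (b - a)" using le by linarith
 thus ?thesis using ab t(1) by (intro bexI[of _ t]) simp_all
qed

context torus2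
begin

lemma nf_large: "\<exists>n. \<forall>a. a \<notin> sbox n --> \<Lambda> \<le> nf a"
proof -
 define \<kappa> where "\<kappa> = min ((2 * pi / L1)^2) ((2 * pi / L2)^2)"
 have k0: "0 < \<kappa>" using L1 L2 by (simp add: \<kappa>_def)
 obtain n :: nat where n: "\<bar>\<Lambda>\<bar> / \<kappa> + 1 \<le> real n" using real_arch_simple by blast
 have "\<Lambda> \<le> nf a" if a: "a \<notin> sbox n" for a
 proof -
  have big: "\<bar>\<Lambda>\<bar> / \<kappa> \<le> (real_of_int m)^2" if "m \<notin> {- int n..int n}" for m
  proof -
   have "real n \<le> \<bar>real_of_int m\<bar>" using that by auto
   hence "\<bar>\<Lambda>\<bar> / \<kappa> + 1 \<le> \<bar>real_of_int m\<bar>" using n by linarith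
   moreover have "\<bar>real_of_int m\<bar> * 1 \<le> \<bar>real_of_int m\<bar> * \<bar>real_of_int m\<bar>"
    using that by (intro mult_left_mono) auto
   ultimately show ?thesis by (simp add: power2_eq_square)
  qed
  have "fst a \<notin> {- int n..int n} \<or> snd a \<notin> {- int n..int n}" using a by (auto simp: sbox_def mem_Times_iff)
  hence "\<bar>\<Lambda>\<bar> / \<kappa> \<le> (real_of_int (fst a))^2 + (real_of_int (snd a))^2"
   using big[of "fst a"] big[of "snd a"] zero_le_power2[of "real_of_int (fst a)"] zero_le_power2[of "real_of_int (snd a)"] by linarith
  hence "\<bar>\<Lambda>\<bar> \<le> \<kappa> * ((real_of_int (fst a))^2 + (real_of_int (snd a))^2)"
   using k0 by (simp add: pos_divide_le_eq mult.commute)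
  also have "\<dots> \<le> (2 * pi / L1)^2 * (real_of_int (fst a))^2 + (2 * pi / L2)^2 * (real_of_int (snd a))^2"
   unfolding distrib_left by (intro add_mono mult_right_mono) (simp_all add: \<kappa>_def)
  also have "\<dots> = nf a" by (simp add: nf_def power_mult_distrib power_divide)
  finally show ?thesis by linarith
 qed
 thus ?thesis by blast
qed

text \<open>\<open>L2 < 2 * pi\<close> makes \<open>nf a \<ge> 1\<close> on the modes of the
  average.\<close>

lemma wsum_J0_mono:
 assumes L: "L2 < 2 * pi" and J: "0 \<notin> J"
 shows "wsum (J0 J) k d \<le> wsum (J0 J) (Suc k) d" unfolding wsum_def
proof (rule sum_mono)
 fix a assume a: "a \<in> J0 J"
 have "snd a \<noteq> 0"
 proof
  assume "snd a = 0"
  hence "a = 0" using a by (simp add: J0_def prod_eq_iff)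
  thus False using a J by (simp add: J0_def)
 qed
 hence "1 \<le> \<bar>real_of_int (snd a)\<bar>" by linarith
 hence "1 * 1 \<le> (2 * pi / L2) * \<bar>real_of_int (snd a)\<bar>" using L L2 by (intro mult_mono) simp_all
 hence "1^2 \<le> ((2 * pi / L2) * \<bar>real_of_int (snd a)\<bar>)^2" by (intro power_mono) simp_all
 hence "1 \<le> nf a" using a by (simp add: nf_def J0_def power_mult_distrib power_divide)
 hence "nf a ^ k * 1 \<le> nf a ^ k * nf a" by (intro mult_left_mono) simp_all
 thus "nf a ^ k * (norm (d a))^2 \<le> nf a ^ Suc k * (norm (d a))^2" by (intro mult_right_mono) (simp_all add: mult.commute)
qed

lemma wsum_split: "finite J ==> wsum J k d = wsum (Jx J) k d + wsum (J0 J) k d"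
 by (subst J_split(1)) (rule wsum_Un[OF J_split(3,4) J_split(2)])

end

context shear_flow
begin

lemma wsum_deriv:
 assumes "!!a. a \<in> P ==> (c a has_vector_derivative c' a) (at t within S)"
 shows "((%t. wsum P k (%b. c b t)) has_real_derivative dsum P k (%b. c b t) c') (at t within S)"
 unfolding wsum_def dsum_def sum_distrib_left
proof (rule DERIV_sum)
 fix a assume a: "a \<in> P"
 note d = assms[OF a]
 have "((%t. Re (cnj (c a t) * c a t)) has_vector_derivative Re (cnj (c a t) * c' a + cnj (c' a) * c a t)) (at t within S)"
  by (intro bounded_linear.has_vector_derivative[OF bounded_linear_Re] has_vector_derivative_mult has_vector_derivative_cnj d)
 moreover have "Re (cnj (c a t) * c' a + cnj (c' a) * c a t) = 2 * Re (cnj (c a t) * c' a)" by simp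
 moreover have "Re (cnj (c a t) * c a t) = (norm (c a t))^2" for t unfolding cmod_power2 by (simp add: power2_eq_square)
 ultimately have "((%t. (norm (c a t))^2) has_real_derivative 2 * Re (cnj (c a t) * c' a)) (at t within S)"
  by (simp only: has_real_derivative_iff_has_vector_derivative)
 from DERIV_cmult[OF this, of "nf a ^ k"]
 show "((%t. nf a ^ k * (norm (c a t))^2) has_real_derivative 2 * (nf a ^ k * Re (cnj (c a t) * c' a))) (at t within S)"
  by (simp only: mult.left_commute)
qed

end

context shear_profile
begin

text \<open>Outside a finite box \<open>nf\<close> is so large that the bounded dissipation integral
  leaves at most \<open>\<epsilon> / 2\<close>; each of the finitely many remaining modes is handled
  by \<open>mode_decay\<close>.\<close>

lemma x_decay:
 assumes \<epsilon>: "0 < \<epsilon>" and C: "0 < C"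
 shows "\<exists>A0 n0. \<forall>A\<ge>A0. \<forall>N\<ge>n0. \<forall>c s s'. window C A N c s s' \<and>
  integral {s..s'} (%t. wsum (Jx (JN N)) 2 (%b. c b t)) \<le> C -->
  integral {s..s'} (%t. wsum (Jx (JN N)) 0 (%b. c b t)) \<le> \<epsilon>"
proof -
 obtain n where n: "!!a. a \<notin> sbox n ==> max 1 (2 * C / \<epsilon>) \<le> nf a" using nf_large by blast
 define F where "F = {a \<in> sbox n. fst a \<noteq> 0}"
 have F: "finite F" by (simp add: F_def)
 define \<delta> where "\<delta> = \<epsilon> / (2 * (real (card F) + 1))"
 have \<delta>: "0 < \<delta>" using \<epsilon> by (simp add: \<delta>_def)
 have "\<exists>p. \<forall>A\<ge>fst p. \<forall>N\<ge>snd p. \<forall>c s s'. window C A N c s s' --> integral {s..s'} (%t. (norm (c a t))^2) \<le> \<delta>"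
  if a: "a \<in> F" for a
 proof -
  obtain A0 n0 where "\<forall>A\<ge>A0. \<forall>N\<ge>n0. \<forall>c s s'. window C A N c s s' --> integral {s..s'} (%t. (norm (c (fst a, snd a) t))^2) \<le> \<delta>"
   using mode_decay[OF _ \<delta> C, of "fst a" "snd a"] a unfolding F_def by blast
  thus ?thesis by (intro exI[of _ "(A0, n0)"]) simp
 qed
 then obtain p where p: "!!a A N c s s'. a \<in> F ==> fst (p a) \<le> A ==> snd (p a) \<le> N ==> window C A N c s s' ==>
   integral {s..s'} (%t. (norm (c a t))^2) \<le> \<delta>" by metis
 define A0 where "A0 = (\<Sum>a\<in>F. \<bar>fst (p a)\<bar>)"
 define n0 where "n0 = n + (\<Sum>a\<in>F. snd (p a))"
 have main: "integral {s..s'} (%t. wsum (Jx (JN N)) 0 (%b. c b t)) \<le> \<epsilon>"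
  if A: "A0 \<le> A" and N: "n0 \<le> N" and w: "window C A N c s s'"
   and D: "integral {s..s'} (%t. wsum (Jx (JN N)) 2 (%b. c b t)) \<le> C" for A N c s s'
 proof -
  let ?J = "Jx (JN N)"
  have fJ: "finite ?J" by (simp add: Jx_def JN_def)
  have FJ: "F \<subseteq> ?J"
  proof
   fix a assume a: "a \<in> F"
   hence "a \<in> sbox N" using N by (auto simp: F_def sbox_def n0_def)
   thus "a \<in> ?J" using a by (auto simp: F_def Jx_def JN_def)
  qed
  have cc: "continuous_on {s..s'} (c a)" if "a \<in> ?J" for a using window_cont[OF w, of a] that by (simp add: Jx_def)
  have pt: "wsum ?J 0 d \<le> (\<Sum>a\<in>F. (norm (d a))^2) + \<epsilon> / (2 * C) * wsum ?J 2 d" for d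
  proof -
   have "wsum ?J 0 d \<le> (\<Sum>a\<in>?J. (if a \<in> F then (norm (d a))^2 else 0) + \<epsilon> / (2 * C) * (nf a ^ 2 * (norm (d a))^2))"
    unfolding wsum_def
   proof (rule sum_mono)
    fix a assume a: "a \<in> ?J"
    show "nf a ^ 0 * (norm (d a))^2 \<le> (if a \<in> F then (norm (d a))^2 else 0) + \<epsilon> / (2 * C) * (nf a ^ 2 * (norm (d a))^2)"
    proof (cases "a \<in> F")
     case True thus ?thesis using \<epsilon> C by simp
    next
     case False
     hence "max 1 (2 * C / \<epsilon>) \<le> nf a" using a by (intro n) (simp add: F_def Jx_def)
     hence "1 * (2 * C / \<epsilon>) \<le> nf a * nf a" using C \<epsilon> by (intro mult_mono) simp_all
     hence "1 \<le> \<epsilon> / (2 * C) * (nf a)^2" using C \<epsilon> by (simp add: power2_eq_square field_simps)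
     hence "1 * (norm (d a))^2 \<le> (\<epsilon> / (2 * C) * (nf a)^2) * (norm (d a))^2" by (rule mult_right_mono) simp
     thus ?thesis using False by (simp add: mult.assoc)
    qed
   qed
   also have "\<dots> = (\<Sum>a\<in>?J. if a \<in> F then (norm (d a))^2 else 0) + \<epsilon> / (2 * C) * wsum ?J 2 d"
    unfolding sum.distrib wsum_def sum_distrib_left ..
   also have "(\<Sum>a\<in>?J. if a \<in> F then (norm (d a))^2 else 0) = (\<Sum>a\<in>F. (norm (d a))^2)"
    using FJ fJ by (simp add: sum.If_cases Int_absorb1 Int_def[symmetric] Collect_mem_eq)
   finally show ?thesis .
  qed
  have cF: "continuous_on {s..s'} (%t. (norm (c a t))^2)" if "a \<in> F" for a using that FJ by (intro continuous_intros cc) blast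
  note w2 = wsum_cont[of ?J "{s..s'}" c, OF cc]
  have "integral {s..s'} (%t. wsum ?J 0 (%b. c b t)) \<le> integral {s..s'} (%t. (\<Sum>a\<in>F. (norm (c a t))^2) + \<epsilon> / (2 * C) * wsum ?J 2 (%b. c b t))"
   by (intro integral_le integrable_continuous_real continuous_intros w2 cF pt)
  also have "\<dots> = (\<Sum>a\<in>F. integral {s..s'} (%t. (norm (c a t))^2)) + \<epsilon> / (2 * C) * integral {s..s'} (%t. wsum ?J 2 (%b. c b t))"
   by (intro integral_unique has_integral_add has_integral_mult_right has_integral_sum F integrable_integral integrable_continuous_real w2 cF)
  also have "\<dots> \<le> (\<Sum>a\<in>F. \<delta>) + \<epsilon> / (2 * C) * C"
  proof (intro add_mono sum_mono mult_left_mono D)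
   fix a assume a: "a \<in> F"
   have "\<bar>fst (p a)\<bar> \<le> A0" unfolding A0_def by (rule member_le_sum[OF a]) (simp_all add: F)
   moreover have "snd (p a) \<le> (\<Sum>a\<in>F. snd (p a))" by (rule member_le_sum[OF a]) (simp_all add: F)
   ultimately show "integral {s..s'} (%t. (norm (c a t))^2) \<le> \<delta>"
    using A N unfolding n0_def by (intro p[OF a _ _ w]; linarith)
  qed (use \<epsilon> C in simp)
  also have "\<dots> = real (card F) * \<delta> + \<epsilon> / 2" using C by simp
  also have "\<dots> \<le> \<epsilon>"
  proof -
   have "(real (card F) + 1) * \<delta> = \<epsilon> / 2" by (simp add: \<delta>_def field_simps)
   thus ?thesis using \<delta> by (simp add: distrib_right)
  qed
  finally show ?thesis .
 qed
 thus ?thesis by blast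
qed

definition gal :: "real => nat => real => (int \<times> int => real => complex) => bool" where
 "gal A N T c \<longleftrightarrow>
  (\<forall>a\<in>JN N. \<forall>t\<in>{0..T}. (c a has_vector_derivative Gv A (JN N) (%b. c b t) a) (at t within {0..T})) \<and>
  (\<forall>a\<in>JN N. \<forall>t\<in>{0..T}. c (- a) t = cnj (c a t))"

lemma gal_deriv:
 assumes "gal A N T c" "a \<in> JN N" "0 \<le> s" "s' \<le> T" "t \<in> {s..s'}"
 shows "(c a has_vector_derivative Gv A (JN N) (%b. c b t) a) (at t within {s..s'})"
proof (rule has_vector_derivative_within_subset)
 show "(c a has_vector_derivative Gv A (JN N) (%b. c b t) a) (at t within {0..T})" using assms unfolding gal_def by simp
qed (use assms in auto)

lemma gal_cont:
 assumes "gal A N T c" "P \<subseteq> JN N" "0 \<le> s" "s' \<le> T"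
 shows "continuous_on {s..s'} (%t. wsum P k (%b. c b t))"
proof (rule wsum_cont)
 fix a assume "a \<in> P"
 hence "a \<in> JN N" using assms(2) by blast
 thus "continuous_on {s..s'} (c a)"
  by (intro continuous_on_vector_derivative[of _ _ "%t. Gv A (JN N) (%b. c b t) a"] gal_deriv[OF assms(1) _ assms(3,4)])
qed

lemma gal_wsum:
 assumes "gal A N T c" "P \<subseteq> JN N" "0 \<le> s" "s' \<le> T" "t \<in> {s..s'}"
 shows "((%t. wsum P k (%b. c b t)) has_real_derivative dsum P k (%b. c b t) (Gv A (JN N) (%b. c b t))) (at t within {s..s'})"
proof (rule wsum_deriv)
 fix a assume "a \<in> P"
 hence "a \<in> JN N" using assms(2) by blast
 thus "(c a has_vector_derivative Gv A (JN N) (%b. c b t) a) (at t within {s..s'})" by (rule gal_deriv[OF assms(1) _ assms(3,4,5)])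
qed

lemma Jx_sub: "Jx J \<subseteq> J" and J0_sub: "J0 J \<subseteq> J" by (auto simp: Jx_def J0_def)

lemma finite_JN: "finite (JN N)" and zero_JN: "0 \<notin> JN N" by (simp_all add: JN_def)

text \<open>The energy needs a time \<open>\<tau>\<close> to climb from \<open>\<rho>\<close> to
  \<open>\<rho> + 1\<close>. The essential point is that \<open>\<tau>\<close> is independent of
  \<open>A\<close> and \<open>N\<close>, so the shear can be made strong relative to it.\<close>

lemma short_time:
 assumes \<rho>: "0 \<le> \<rho>"
 shows "\<exists>\<tau>. 0 < \<tau> \<and> \<tau> \<le> 1 \<and> (\<forall>A N T c t. 0 \<le> t \<and> t \<le> T \<and> t \<le> \<tau> \<and> gal A N T c \<and> wsum (JN N) 0 (%b. c b 0) \<le> \<rho> -->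
  wsum (JN N) 0 (%b. c b t) \<le> \<rho> + 1 \<and> integral {0..t} (%r. wsum (JN N) 2 (%b. c b r)) \<le> \<rho> + 1)"
proof -
 obtain K where K: "0 \<le> K" "!!J d A. adm J ==> wsum J 0 d \<le> \<rho> + 1 ==> dsum J 0 d (Gv A J d) \<le> - wsum J 2 d + K"
  using energy_all[of "\<rho> + 1"] \<rho> by auto
 \<comment> \<open>The 2 in the denominator gives \<open>K * \<tau> < 1\<close> strictly and
   \<open>\<tau> \<le> 1\<close>, also for \<open>K = 0\<close>.\<close>
 define \<tau> where "\<tau> = 1 / (K + 2)"
 have \<tau>: "0 < \<tau>" "\<tau> \<le> 1" "K * \<tau> < 1" using K(1) by (simp_all add: \<tau>_def field_simps)
 have main: "wsum (JN N) 0 (%b. c b t) \<le> \<rho> + 1 \<and> integral {0..t} (%r. wsum (JN N) 2 (%b. c b r)) \<le> \<rho> + 1"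
  if t: "0 \<le> t" "t \<le> T" "t \<le> \<tau>" and g: "gal A N T c" and i: "wsum (JN N) 0 (%b. c b 0) \<le> \<rho>" for A N T c t
 proof -
  let ?E = "%r. wsum (JN N) 0 (%b. c b r)" and ?D = "%r. wsum (JN N) 2 (%b. c b r)"
  have est: "?E r + integral {0..r} ?D < \<rho> + 1" if r: "0 \<le> r" "r \<le> t" and le: "\<forall>s\<in>{0..r}. ?E s \<le> \<rho> + 1" for r
  proof -
   have rT: "r \<le> T" using r t by linarith
   have Dc: "continuous_on {0..r} ?D" by (rule gal_cont[OF g order_refl order_refl rT])
   have "?E r - ?E 0 \<le> integral {0..r} (%s. - ?D s + K)"
   proof (rule deriv_le_integral[OF r(1) gal_wsum[OF g order_refl order_refl rT]])
    show "continuous_on {0..r} (%s. - ?D s + K)" by (intro continuous_intros Dc)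
    show "dsum (JN N) 0 (%b. c b s) (Gv A (JN N) (%b. c b s)) \<le> - ?D s + K" if "s \<in> {0..r}" for s
     using le that by (intro K(2) adm_JN) blast
   qed
   also have "\<dots> = - integral {0..r} ?D + K * r"
    using has_integral_add[OF has_integral_neg[OF integrable_integral[OF integrable_continuous_real[OF Dc]]] has_integral_const_real[of K 0 r]] r(1)
    by (simp add: integral_unique mult.commute)
   also have "K * r \<le> K * \<tau>" using r t K(1) by (intro mult_left_mono) simp_all
   finally show ?thesis using i \<tau>(3) by linarith
  qed
  have D0: "0 \<le> integral {0..r} ?D" if "r \<le> t" for r
  proof (rule Henstock_Kurzweil_Integration.integral_nonneg)
   have "r \<le> T" using that t by linarith
   thus "?D integrable_on {0..r}" by (intro integrable_continuous_real gal_cont[OF g order_refl order_refl])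
  qed (rule wsum_nonneg)
  have E: "?E r < \<rho> + 1" if "r \<in> {0..t}" for r
  proof (rule barrier[OF gal_cont[OF g order_refl order_refl t(2)] _ _ that])
   show "?E s < \<rho> + 1" if "s \<in> {0..t}" "\<forall>r\<in>{0..s}. ?E r \<le> \<rho> + 1" for s
    using est[OF _ _ that(2)] D0[of s] that(1) by auto
  qed (use i in simp)
  have "?E t + integral {0..t} ?D < \<rho> + 1" using E by (intro est t(1)) (auto intro: less_imp_le)
  thus ?thesis using wsum_nonneg[of "JN N" 0 "%b. c b t"] D0[of t] by simp
 qed
 show ?thesis by (rule exI[of _ \<tau>]) (use \<tau> main in blast)
qed

end

section \<open>Bootstrap for long times\<close>

context shear_profile
begin

text \<open>A bootstrap for two quantities: \<open>G\<close>, the energy of the x-dependent modes,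
  stays below \<open>4 * \<eta>\<close>, and \<open>V\<close>, the first-order energy of the
  average, below \<open>Mv + 1\<close>. Smallness of \<open>G\<close> makes the forcing of
  \<open>V\<close> harmless; boundedness of \<open>V\<close> limits the growth of \<open>G\<close>
  to a factor 2 during a time \<open>\<tau>\<close>, and averaging finds in each window of that
  length a time with \<open>G \<le> \<eta>\<close>.\<close>

lemma long_time:
 assumes L: "L2 < 2 * pi" and Mv: "0 \<le> Mv"
 shows "\<exists>\<eta> K A0 N0. 0 < \<eta> \<and> 0 \<le> K \<and> (\<forall>A\<ge>A0. \<forall>N\<ge>N0. \<forall>T c t1 t. 0 \<le> t1 \<and> t1 \<le> t \<and> t \<le> T \<and> gal A N T c \<and>
   wsum (Jx (JN N)) 0 (%b. c b t1) \<le> \<eta> \<and> wsum (J0 (JN N)) 1 (%b. c b t1) \<le> Mv -->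
   wsum (JN N) 0 (%b. c b t) \<le> K \<and> integral {t1..t} (%r. wsum (JN N) 2 (%b. c b r)) \<le> K * (1 + (t - t1)))"
proof -
 define PV where "PV = Mv + 1"
 have PV: "1 \<le> PV" using Mv by (simp add: PV_def)
 obtain K2 where K2: "0 \<le> K2" "!!J d A. adm J ==> wsum (J0 J) 1 d \<le> PV ==> wsum (Jx J) 0 d \<le> 1 ==>
   dsum (Jx J) 0 d (Gv A J d) \<le> - wsum (Jx J) 2 d + K2 * wsum (Jx J) 0 d" using energy_x[of PV] PV by auto
 obtain \<gamma> C2 where g: "0 < \<gamma>" "0 \<le> C2" "!!J d A. adm J ==> (\<forall>a\<in>J. d (- a) = cnj (d a)) ==>
   dsum (J0 J) 1 d (Gv A J d) \<le> - \<gamma> * wsum (J0 J) 3 d + C2 * wsum (Jx J) 0 d * wsum (Jx J) 2 d" using energy_0[OF L] by blast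
 \<comment> \<open>\<open>Q\<close> collects three smallness conditions on \<open>\<eta>\<close>:
   \<open>4 * \<eta> \<le> 1\<close>, \<open>4 * C2 * \<eta> \<le> 1 / 4\<close>, and
   \<open>W0 < 1\<close> below.\<close>
 define Q where "Q = 1 + 4 * C2 + 16 * C2 * (\<gamma> + K2) / \<gamma>"
 have Qp: "0 \<le> 16 * C2 * (\<gamma> + K2) / \<gamma>" using g K2(1) by simp
 have Q: "1 \<le> Q" "4 * C2 \<le> Q" "16 * C2 * (\<gamma> + K2) / \<gamma> \<le> Q" using Qp g(2) unfolding Q_def by linarith+
 define \<eta> where "\<eta> = 1 / (4 * Q)"
 have \<eta>0: "0 < \<eta>" and \<eta>Q: "4 * (Q * \<eta>) = 1" using Q by (simp_all add: \<eta>_def)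
 have \<eta>1: "4 * \<eta> \<le> 1" using mult_right_mono[OF Q(1), of \<eta>] \<eta>0 \<eta>Q by linarith
 have \<eta>C: "4 * C2 * \<eta> \<le> 1 / 4" using mult_right_mono[OF Q(2), of \<eta>] \<eta>0 \<eta>Q by linarith
 \<comment> \<open>Under the bootstrap bound \<open>C2 * G \<le> k\<close>, so in the derivative of
   \<open>V + k * G\<close> the forcing \<open>k * DG\<close> cancels against the dissipation of
   \<open>G\<close>; \<open>W0\<close> is the level to which this combination relaxes.\<close>
 define k where "k = 4 * C2 * \<eta>"
 have k0: "0 \<le> k" using g \<eta>0 by (simp add: k_def)
 define W0 where "W0 = 4 * \<eta> * k * (\<gamma> + K2) / \<gamma>"
 have W0: "W0 < 1"
 proof -
  have "W0 = 16 * C2 * (\<gamma> + K2) / \<gamma> * \<eta> * \<eta>" by (simp add: W0_def k_def)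
  also have "\<dots> \<le> Q * \<eta> * \<eta>" using \<eta>0 by (intro mult_right_mono Q(3)) simp_all
  also have "\<dots> = \<eta> / 4" using \<eta>Q by simp
  finally show ?thesis using \<eta>1 by linarith
 qed
 \<comment> \<open>Chosen so that \<open>exp (K2 * \<tau>) \<le> 2\<close>.\<close>
 define \<tau> where "\<tau> = 1 / (2 * (K2 + 1))"
 have \<tau>: "0 < \<tau>" "K2 * \<tau> \<le> 1 / 2" "\<tau> \<le> 1" using K2(1) by (simp_all add: \<tau>_def field_simps)
 have ex2: "exp (K2 * r) \<le> 2" if "0 \<le> r" "r \<le> \<tau>" for r
 proof -
  have r: "0 \<le> K2 * r" "K2 * r \<le> 1 / 2" using that K2(1) \<tau>(2) mult_left_mono[of r \<tau> K2] by auto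
  have "norm (exp (K2 * r)) \<le> 1 + 2 * norm (K2 * r)" by (rule exp_bound_lemma) (use r in simp)
  thus ?thesis using r by simp
 qed
 \<comment> \<open>The summands cover the integrals of \<open>DG\<close> and \<open>DV\<close> over
   a window and the zeroth-order contribution to \<open>wsum 1\<close>.\<close>
 define C where "C = 2 + (PV + 2) / \<gamma> + 2 * (1 + PV)"
 have C: "2 \<le> C" "1 + PV \<le> C" using PV g(1) by (simp_all add: C_def)
 have Cp: "0 < C" using C(1) by simp
 obtain A0 n0 where dec: "!!A N c s s'. A0 \<le> A ==> n0 \<le> N ==> window C A N c s s' ==>
  integral {s..s'} (%t. wsum (Jx (JN N)) 2 (%b. c b t)) \<le> C ==>
  integral {s..s'} (%t. wsum (Jx (JN N)) 0 (%b. c b t)) \<le> \<eta> * \<tau>"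
  using x_decay[OF mult_pos_pos[OF \<eta>0 \<tau>(1)] Cp] by blast
 define K where "K = 1 + PV + 1 + K2 + (PV + 1 + K2) / \<gamma>"
 have K0: "0 \<le> K" using PV K2(1) g(1) by (simp add: K_def)
 have main: "wsum (JN N) 0 (%b. c b t) \<le> K \<and> integral {t1..t} (%r. wsum (JN N) 2 (%b. c b r)) \<le> K * (1 + (t - t1))"
  if A: "A0 \<le> A" and N: "n0 \<le> N" and t: "0 \<le> t1" "t1 \<le> t" "t \<le> T" and gl: "gal A N T c"
   and i: "wsum (Jx (JN N)) 0 (%b. c b t1) \<le> \<eta>" "wsum (J0 (JN N)) 1 (%b. c b t1) \<le> Mv" for A N T c t1 t
 proof -
  let ?J = "JN N"
  note sub = Jx_sub[of ?J] J0_sub[of ?J] order_refl[of ?J]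
  define w where "w P m r = wsum P m (%b. c b r)" for P m r
  define G where "G = w (Jx ?J) 0"
  define V where "V = w (J0 ?J) 1"
  define DG where "DG = w (Jx ?J) 2"
  define DV where "DV = w (J0 ?J) 3"
  have w0: "0 \<le> w P m r" for P m r by (simp add: w_def wsum_nonneg)
  note nn = w0[of "Jx ?J" 0, folded G_def] w0[of "J0 ?J" 1, folded V_def] w0[of "Jx ?J" 2, folded DG_def] w0[of "J0 ?J" 3, folded DV_def]
  have V3: "V r \<le> DV r" "w (J0 ?J) 2 r \<le> DV r" "w (J0 ?J) 0 r \<le> V r" for r
  proof -
   note m = wsum_J0_mono[OF L zero_JN]
   have "w (J0 ?J) 0 r \<le> w (J0 ?J) 1 r" unfolding w_def using m[of N 0] by simp
   moreover have "w (J0 ?J) 1 r \<le> w (J0 ?J) 2 r" unfolding w_def using m[of N 1] by (simp add: numeral_2_eq_2)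
   moreover have "w (J0 ?J) 2 r \<le> w (J0 ?J) 3 r" unfolding w_def using m[of N 2] by (simp add: numeral_3_eq_3 numeral_2_eq_2)
   ultimately show "V r \<le> DV r" "w (J0 ?J) 2 r \<le> DV r" "w (J0 ?J) 0 r \<le> V r" unfolding V_def DV_def by linarith+
  qed
  have sp: "w ?J m r = w (Jx ?J) m r + w (J0 ?J) m r" for m r unfolding w_def by (rule wsum_split[OF finite_JN])
  have cont: "continuous_on {s..s'} (w P m)" if "P \<subseteq> ?J" "t1 \<le> s" "s' \<le> t" for P m s s'
   unfolding w_def using that t by (intro gal_cont[OF gl]) simp_all
  define g' where "g' r = dsum (Jx ?J) 0 (%b. c b r) (Gv A ?J (%b. c b r))" for r
  define v' where "v' r = dsum (J0 ?J) 1 (%b. c b r) (Gv A ?J (%b. c b r))" for r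
  have Gd: "(G has_real_derivative g' r) (at r within {s..s'})" if "t1 \<le> s" "s' \<le> t" "r \<in> {s..s'}" for s s' r
   unfolding G_def w_def g'_def using that t by (intro gal_wsum[OF gl sub(1)]) simp_all
  have Vd: "(V has_real_derivative v' r) (at r within {s..s'})" if "t1 \<le> s" "s' \<le> t" "r \<in> {s..s'}" for s s' r
   unfolding V_def w_def v'_def using that t by (intro gal_wsum[OF gl sub(2)]) simp_all
  define ok where "ok r \<longleftrightarrow> G r \<le> 4 * \<eta> \<and> V r \<le> PV" for r
  have g'b: "g' r \<le> - DG r + K2 * G r" if "ok r" for r
   unfolding g'_def DG_def G_def w_def using that \<eta>1 by (intro K2(2) adm_JN) (auto simp: ok_def G_def V_def w_def)
  have v'b: "v' r \<le> - \<gamma> * DV r + k * DG r" if "ok r" "r \<in> {t1..t}" for r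
  proof -
   have h: "\<forall>a\<in>?J. c (- a) r = cnj (c a r)" using gl that t unfolding gal_def by auto
   have "v' r \<le> - \<gamma> * DV r + C2 * G r * DG r" unfolding v'_def DV_def G_def DG_def w_def by (rule g(3)[OF adm_JN h])
   also have "C2 * G r * DG r \<le> k * DG r" using that(1) g(2) nn(3)[of r] unfolding k_def ok_def
    by (intro mult_right_mono) (simp_all add: mult_left_mono mult.left_commute mult.assoc)
   finally show ?thesis by simp
  qed
  have intDG: "integral {s..s'} DG \<le> 1 + K2 * (s' - s)"
   if s: "t1 \<le> s" "s \<le> s'" "s' \<le> t" and o: "!!r. r \<in> {s..s'} ==> ok r" for s s'
  proof -
   note c = cont[OF sub(1) s(1,3)]
   have "G s' - G s \<le> integral {s..s'} (%r. - DG r + K2)"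
   proof (rule deriv_le_integral[OF s(2) Gd[OF s(1,3)]])
    fix r assume r: "r \<in> {s..s'}"
    have "K2 * G r \<le> K2 * 1" using o[OF r] \<eta>1 K2(1) unfolding ok_def by (intro mult_left_mono) simp_all
    thus "g' r \<le> - DG r + K2" using g'b[OF o[OF r]] by simp
   qed (use c in \<open>auto intro!: continuous_intros simp: DG_def\<close>)
   also have "\<dots> = - integral {s..s'} DG + K2 * (s' - s)"
    using has_integral_add[OF has_integral_neg[OF integrable_integral[OF integrable_continuous_real[OF c[of 2]]]] has_integral_const_real[of K2 s s']] s(2)
    by (simp add: integral_unique mult.commute DG_def)
   finally show ?thesis using o[of s] \<eta>1 s(2) nn(1)[of s'] unfolding ok_def by simp
  qed
  have intDV: "integral {s..s'} DV \<le> (PV + 1 + K2 * (s' - s)) / \<gamma>"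
   if s: "t1 \<le> s" "s \<le> s'" "s' \<le> t" and o: "!!r. r \<in> {s..s'} ==> ok r" for s s'
  proof -
   note cG = integrable_continuous_real[OF cont[OF sub(1) s(1,3), of 2]]
   note cV = integrable_continuous_real[OF cont[OF sub(2) s(1,3), of 3]]
   have "V s' - V s \<le> integral {s..s'} (%r. - \<gamma> * DV r + k * DG r)"
   proof (rule deriv_le_integral[OF s(2) Vd[OF s(1,3)]])
    fix r assume r: "r \<in> {s..s'}"
    show "v' r \<le> - \<gamma> * DV r + k * DG r" using r s by (intro v'b[OF o[OF r]]) simp
   next
    show "continuous_on {s..s'} (%r. - \<gamma> * DV r + k * DG r)" unfolding DV_def DG_def by (intro continuous_intros cont sub s)
   qed
   also have "\<dots> = - \<gamma> * integral {s..s'} DV + k * integral {s..s'} DG"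
    using cG cV unfolding DV_def DG_def by (intro integral_unique has_integral_add has_integral_mult_right integrable_integral)
   also have "k * integral {s..s'} DG \<le> 1 * (1 + K2 * (s' - s))" using intDG[OF s o] k0 \<eta>C s K2(1)
    by (intro mult_mono) (simp_all add: k_def DG_def w0 Henstock_Kurzweil_Integration.integral_nonneg cG)
   finally have "\<gamma> * integral {s..s'} DV \<le> PV + 1 + K2 * (s' - s)" using o[of s] s(2) nn(2)[of s'] unfolding ok_def by simp
   thus ?thesis using g(1) by (simp add: pos_le_divide_eq mult.commute)
  qed
  have growth: "G s' \<le> exp (K2 * (s' - s)) * G s"
   if s: "t1 \<le> s" "s \<le> s'" "s' \<le> t" and o: "!!r. r \<in> {s..s'} ==> ok r" for s s'
  proof (rule gronwall[OF s(2) Gd[OF s(1,3)]])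
   fix r assume "r \<in> {s..s'}"
   thus "g' r \<le> K2 * G r" using g'b[OF o] nn(3)[of r] by fastforce
  qed
  have step: "G r < 4 * \<eta> \<and> V r < PV" if r: "r \<in> {t1..t}" and o: "!!s. s \<in> {t1..r} ==> ok s" for r
  proof
   show "V r < PV"
   proof -
    have rr: "t1 \<le> r" "r \<le> t" using r by auto
    have "(V r + k * G r) - W0 \<le> exp (- \<gamma> * (r - t1)) * ((V t1 + k * G t1) - W0)"
    proof (rule gronwall[OF rr(1)])
     fix s assume s: "s \<in> {t1..r}"
     show "((%s. (V s + k * G s) - W0) has_real_derivative v' s + k * g' s) (at s within {t1..r})"
      using DERIV_diff[OF DERIV_add[OF Vd[OF order_refl rr(2) s] DERIV_cmult[OF Gd[OF order_refl rr(2) s], of k]] DERIV_const[of W0]] by simp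
     have "k * g' s \<le> k * (- DG s + K2 * G s)" using g'b[OF o[OF s]] k0 by (rule mult_left_mono)
     moreover have "v' s \<le> - \<gamma> * DV s + k * DG s" using s rr by (intro v'b[OF o[OF s]]) simp
     moreover have "\<gamma> * V s \<le> \<gamma> * DV s" using V3(1) g(1) by (intro mult_left_mono) simp_all
     ultimately have "v' s + k * g' s \<le> - \<gamma> * V s + k * K2 * G s" by (simp add: algebra_simps)
     also have "\<dots> = - \<gamma> * (V s + k * G s) + k * (\<gamma> + K2) * G s" by (simp add: algebra_simps)
     also have "k * (\<gamma> + K2) * G s \<le> k * (\<gamma> + K2) * (4 * \<eta>)"
      using o[OF s] k0 g(1) K2(1) unfolding ok_def by (intro mult_left_mono) simp_all
     also have "k * (\<gamma> + K2) * (4 * \<eta>) = \<gamma> * W0" using g(1) by (simp add: W0_def mult_ac)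
     finally show "v' s + k * g' s \<le> - \<gamma> * ((V s + k * G s) - W0)" by (simp add: algebra_simps)
    qed
    also have "\<dots> \<le> max 0 ((V t1 + k * G t1) - W0)"
    proof (cases "0 \<le> (V t1 + k * G t1) - W0")
     case True
     hence "exp (- \<gamma> * (r - t1)) * ((V t1 + k * G t1) - W0) \<le> 1 * ((V t1 + k * G t1) - W0)"
      using g(1) rr by (intro mult_right_mono) simp_all
     thus ?thesis by simp
    next
     case False
     hence "exp (- \<gamma> * (r - t1)) * ((V t1 + k * G t1) - W0) \<le> 0" by (intro mult_nonneg_nonpos) simp_all
     thus ?thesis by simp
    qed
    finally have "V r + k * G r \<le> max W0 (V t1 + k * G t1)" by (simp add: max_def split: if_splits)
    moreover have "k * G t1 < 1"
    proof -
     have "k * G t1 \<le> (1 / 4) * \<eta>" using \<eta>C i(1) k0 nn(1)[of t1] \<eta>0 by (intro mult_mono) (simp_all add: k_def G_def w_def)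
     thus ?thesis using \<eta>1 by linarith
    qed
    moreover have "V t1 \<le> Mv" using i(2) by (simp add: V_def w_def)
    moreover have "0 \<le> k * G r" using k0 nn(1)[of r] by simp
    ultimately show ?thesis using W0 PV unfolding PV_def by (simp add: max_def split: if_splits)
   qed
   \<comment> \<open>Close to \<open>t1\<close> the initial smallness is carried forward directly;
     later a full window of length \<open>\<tau>\<close> lies behind \<open>r\<close>, and
     \<open>mean_le\<close> yields a time in it with \<open>G \<le> \<eta>\<close>.\<close>
   show "G r < 4 * \<eta>"
   proof (cases "r - t1 \<le> \<tau>")
    case True
    have "G r \<le> exp (K2 * (r - t1)) * G t1" using r by (intro growth o) simp_all
    also have "\<dots> \<le> 2 * \<eta>" using i(1) r nn(1)[of t1] by (intro mult_mono ex2 True) (simp_all add: G_def w_def)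
    finally show ?thesis using \<eta>0 by simp
   next
    case False
    hence s: "t1 \<le> r - \<tau>" "r - \<tau> \<le> r" "r \<le> t" using \<tau>(1) r by simp_all
    have os: "ok q" if "q \<in> {r - \<tau>..r}" for q using that s by (intro o) simp
    have iD: "integral {r - \<tau>..r} DG \<le> 2" using intDG[OF s os] \<tau>(2) by simp
    have iV: "integral {r - \<tau>..r} DV \<le> (PV + 2) / \<gamma>"
     by (rule order_trans[OF intDV[OF s os]]) (use \<tau>(2) g(1) in \<open>simp_all add: divide_right_mono\<close>)
    have wi: "window C A N c (r - \<tau>) r" unfolding window_def
    proof (intro conjI ballI)
     show "r - (r - \<tau>) \<le> C" using \<tau>(3) C by simp
     fix q assume q: "q \<in> {r - \<tau>..r}"
     show "wsum (Jx ?J) 0 (%b. c b q) \<le> C" using os[OF q] \<eta>1 C unfolding ok_def G_def w_def by simp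
     fix a assume a: "a \<in> ?J"
     show "(c a has_vector_derivative Gv A ?J (%b. c b q) a) (at q within {r - \<tau>..r})"
      using s t q by (intro gal_deriv[OF gl a]) simp_all
    next
     have "integral {r - \<tau>..r} (w ?J 1) \<le> integral {r - \<tau>..r} (%q. (DG q + DV q) + (1 + PV))"
     proof (rule integral_le)
      show "w ?J 1 integrable_on {r - \<tau>..r}" by (intro integrable_continuous_real cont sub s)
      show "(%q. (DG q + DV q) + (1 + PV)) integrable_on {r - \<tau>..r}"
       unfolding DG_def DV_def by (intro integrable_continuous_real continuous_intros cont sub s)
      fix q assume q: "q \<in> {r - \<tau>..r}"
      have "w ?J 1 q \<le> w ?J 2 q + (1 / 4) * w ?J 0 q" unfolding w_def using wsum_young[of 1 ?J "%b. c b q"] by simp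
      moreover have "w ?J 0 q \<le> 1 + PV" using os[OF q] \<eta>1 V3(3)[of q] sp[of 0 q] unfolding ok_def G_def by simp
      moreover have "w ?J 2 q \<le> DG q + DV q" using V3(2)[of q] sp[of 2 q] unfolding DG_def by simp
      ultimately show "w ?J 1 q \<le> (DG q + DV q) + (1 + PV)" using w0[of ?J 0 q] by linarith
     qed
     also have "\<dots> = (integral {r - \<tau>..r} DG + integral {r - \<tau>..r} DV) + (1 + PV) * \<tau>"
     proof (rule integral_unique, intro has_integral_add integrable_integral)
      show "DG integrable_on {r - \<tau>..r}" "DV integrable_on {r - \<tau>..r}"
       unfolding DG_def DV_def by (intro integrable_continuous_real cont sub s)+
      show "((%q. 1 + PV) has_integral (1 + PV) * \<tau>) {r - \<tau>..r}"
       using has_integral_const_real[of "1 + PV" "r - \<tau>" r] \<tau>(1) by (simp add: mult.commute)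
     qed
     also have "(1 + PV) * \<tau> \<le> (1 + PV) * 1" using PV by (intro mult_left_mono \<tau>(3)) simp
     finally show "integral {r - \<tau>..r} (%q. wsum ?J 1 (%b. c b q)) \<le> C" using iD iV PV unfolding C_def w_def by simp
    qed (use s in simp)
    have "integral {r - \<tau>..r} G \<le> \<eta> * (r - (r - \<tau>))" using dec[OF A N wi] iD C unfolding G_def DG_def w_def by simp
    moreover have "continuous_on {r - \<tau>..r} G" unfolding G_def by (rule cont[OF sub(1) s(1,3)])
    ultimately have "\<exists>q\<in>{r - \<tau>..r}. G q \<le> \<eta>" using \<tau>(1) by (intro mean_le) simp_all
    then obtain q where q: "q \<in> {r - \<tau>..r}" "G q \<le> \<eta>" by blast
    have "G r \<le> exp (K2 * (r - q)) * G q" using q s by (intro growth os) simp_all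
    also have "\<dots> \<le> 2 * \<eta>" using q nn(1)[of q] by (intro mult_mono ex2) simp_all
    finally show ?thesis using \<eta>0 by simp
   qed
  qed
  have ok: "ok r" if r: "r \<in> {t1..t}" for r
  proof -
   have "max (G r - 4 * \<eta>) (V r - PV) < 0"
   proof (rule barrier[OF _ _ _ r])
    show "continuous_on {t1..t} (%r. max (G r - 4 * \<eta>) (V r - PV))"
     unfolding G_def V_def by (intro continuous_intros cont sub order_refl)
    show "max (G t1 - 4 * \<eta>) (V t1 - PV) < 0" using i \<eta>0 by (simp add: G_def V_def w_def PV_def)
    fix r assume r: "r \<in> {t1..t}" and "\<forall>s\<in>{t1..r}. max (G s - 4 * \<eta>) (V s - PV) \<le> 0"
    hence "ok s" if "s \<in> {t1..r}" for s using that unfolding ok_def by auto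
    thus "max (G r - 4 * \<eta>) (V r - PV) < 0" using step[OF r] by simp
   qed
   thus ?thesis by (simp add: ok_def)
  qed
  have E: "w ?J 0 t \<le> K" using ok[of t] t(2) \<eta>1 V3(3)[of t] sp[of 0 t] g(1) K2(1) PV unfolding ok_def G_def K_def
   by (smt (verit) atLeastAtMost_iff divide_nonneg_pos)
  have "integral {t1..t} (w ?J 2) \<le> integral {t1..t} (%q. DG q + DV q)"
  proof (rule integral_le)
   show "w ?J 2 integrable_on {t1..t}" by (intro integrable_continuous_real cont sub order_refl)
   show "(%q. DG q + DV q) integrable_on {t1..t}"
    unfolding DG_def DV_def by (intro integrable_continuous_real continuous_intros cont sub order_refl)
   show "w ?J 2 q \<le> DG q + DV q" for q using V3(2)[of q] sp[of 2 q] unfolding DG_def by simp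
  qed
  also have "\<dots> = integral {t1..t} DG + integral {t1..t} DV"
   unfolding DG_def DV_def by (intro integral_unique has_integral_add integrable_integral integrable_continuous_real cont sub order_refl)
  also have "\<dots> \<le> (1 + K2 * (t - t1)) + (PV + 1 + K2 * (t - t1)) / \<gamma>" by (intro add_mono intDG intDV t order_refl ok) simp_all
  also have "\<dots> \<le> K * (1 + (t - t1))"
  proof -
   have r: "0 \<le> t - t1" using t by simp
   have "K * (1 + x) = ((1 + K2 * x) + (PV + 1 + K2 * x) / \<gamma>)
     + (1 + PV + K2 / \<gamma> + K2 + (1 + PV) * x + x + (PV + 1) / \<gamma> * x)" for x by (simp add: K_def add_divide_distrib algebra_simps)
   moreover have "0 \<le> 1 + PV + K2 / \<gamma> + K2 + (1 + PV) * (t - t1) + (t - t1) + (PV + 1) / \<gamma> * (t - t1)"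
    using r PV K2(1) g(1) by (intro add_nonneg_nonneg mult_nonneg_nonneg divide_nonneg_nonneg) simp_all
   ultimately show ?thesis by (metis add_increasing2 order_refl)
  qed
  finally show ?thesis using E by (simp add: w_def[abs_def])
 qed
 thus ?thesis using \<eta>0 K0 by blast
qed

text \<open>Links the two regimes: inside the short-time interval there is a time \<open>t1\<close>
  at which both starting conditions of \<open>long_time\<close> hold, because the time averages of
  the x-dependent energy and of the squared second-order norm are small enough.\<close>

lemma galerkin_bound:
 assumes L: "L2 < 2 * pi" and \<rho>: "0 \<le> \<rho>"
 shows "\<exists>A0 N0. \<exists>K\<ge>0. \<forall>A\<ge>A0. \<forall>N\<ge>N0. \<forall>T c t. 0 \<le> t \<and> t \<le> T \<and> gal A N T c \<and> wsum (JN N) 0 (%b. c b 0) \<le> \<rho> -->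
  wsum (JN N) 0 (%b. c b t) \<le> K \<and> integral {0..t} (%r. wsum (JN N) 2 (%b. c b r)) \<le> K * (1 + t)"
proof -
 obtain \<tau> where \<tau>: "0 < \<tau>" "\<tau> \<le> 1" "!!A N T c t. 0 \<le> t ==> t \<le> T ==> t \<le> \<tau> ==> gal A N T c ==> wsum (JN N) 0 (%b. c b 0) \<le> \<rho> ==>
  wsum (JN N) 0 (%b. c b t) \<le> \<rho> + 1 \<and> integral {0..t} (%r. wsum (JN N) 2 (%b. c b r)) \<le> \<rho> + 1"
  using short_time[OF \<rho>] by blast
 \<comment> \<open>Together with the tolerance \<open>\<eta> * \<tau> / 3\<close> for the
   x-dependent energy, this makes both parts of \<open>?g\<close> below average at most 1/3, so
   \<open>?g \<le> 1\<close> at some time.\<close>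
 define Mv where "Mv = 3 * (\<rho> + 1) / \<tau>"
 have Mv: "0 < Mv" using \<rho> \<tau> by (simp add: Mv_def)
 obtain \<eta> K A1 N1 where lt: "0 < \<eta>" "0 \<le> K" and lt0: "\<forall>A\<ge>A1. \<forall>N\<ge>N1. \<forall>T c t1 t. 0 \<le> t1 \<and> t1 \<le> t \<and> t \<le> T \<and> gal A N T c \<and>
   wsum (Jx (JN N)) 0 (%b. c b t1) \<le> \<eta> \<and> wsum (J0 (JN N)) 1 (%b. c b t1) \<le> Mv -->
   wsum (JN N) 0 (%b. c b t) \<le> K \<and> integral {t1..t} (%r. wsum (JN N) 2 (%b. c b r)) \<le> K * (1 + (t - t1))"
  using long_time[OF L less_imp_le[OF Mv]] by (elim exE conjE) (rule that)
 define C where "C = 2 * (\<rho> + 1)"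
 have C: "0 < C" using \<rho> by (simp add: C_def)
 have e3: "0 < \<eta> * \<tau> / 3" using lt(1) \<tau>(1) by simp
 obtain A2 N2 where dec: "!!A N c s s'. A2 \<le> A ==> N2 \<le> N ==> window C A N c s s' ==>
  integral {s..s'} (%t. wsum (Jx (JN N)) 2 (%b. c b t)) \<le> C ==>
  integral {s..s'} (%t. wsum (Jx (JN N)) 0 (%b. c b t)) \<le> \<eta> * \<tau> / 3" using x_decay[OF e3 C] by blast
 define K' where "K' = K + (\<rho> + 1)"
 have main: "wsum (JN N) 0 (%b. c b t) \<le> K' \<and> integral {0..t} (%r. wsum (JN N) 2 (%b. c b r)) \<le> K' * (1 + t)"
  if A: "max A1 A2 \<le> A" and N: "max N1 N2 \<le> N" and t: "0 \<le> t" "t \<le> T" and gl: "gal A N T c"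
   and i: "wsum (JN N) 0 (%b. c b 0) \<le> \<rho>" for A N T c t
 proof (cases "t \<le> \<tau>")
  case True
  have "(\<rho> + 1) * 1 \<le> K' * (1 + t)" using \<rho> lt(2) t by (intro mult_mono) (simp_all add: K'_def)
  thus ?thesis using \<tau>(3)[OF t True gl i] lt(2) by (simp add: K'_def)
 next
  case False
  let ?J = "JN N"
  define w where "w P m r = wsum P m (%b. c b r)" for P m r
  have \<tau>T: "\<tau> \<le> T" using False t by simp
  have w0: "0 \<le> w P m r" for P m r by (simp add: w_def wsum_nonneg)
  have cont: "continuous_on {s..s'} (w P m)" if "P \<subseteq> ?J" "0 \<le> s" "s' \<le> T" for P m s s'
   unfolding w_def using that by (intro gal_cont[OF gl]) simp_all
  have sh: "w ?J 0 r \<le> \<rho> + 1" "integral {0..r} (w ?J 2) \<le> \<rho> + 1" if "r \<in> {0..\<tau>}" for r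
   unfolding w_def using \<tau>(3)[OF _ _ _ gl i, of r] that \<tau>T by simp_all
  have le: "w (Jx ?J) m r \<le> w ?J m r" for m r unfolding w_def by (rule wsum_mono[OF finite_JN Jx_sub])
  have i2: "integral {0..\<tau>} (w ?J 2) \<le> \<rho> + 1" using sh(2)[of \<tau>] \<tau>(1) by simp
  have iX: "integral {0..\<tau>} (w (Jx ?J) 2) \<le> \<rho> + 1"
   by (rule order_trans[OF integral_le i2]) (intro integrable_continuous_real cont Jx_sub order_refl \<tau>T le)+
  have wi: "window C A N c 0 \<tau>" unfolding window_def
  proof (intro conjI ballI)
   show "\<tau> - 0 \<le> C" using \<tau>(2) \<rho> by (simp add: C_def)
   fix q assume q: "q \<in> {0..\<tau>}"
   show "wsum (Jx ?J) 0 (%b. c b q) \<le> C" using sh(1)[OF q] le[of 0 q] \<rho> unfolding w_def C_def by simp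
   fix a assume a: "a \<in> ?J"
   show "(c a has_vector_derivative Gv A ?J (%b. c b q) a) (at q within {0..\<tau>})"
    using q \<tau>T by (intro gal_deriv[OF gl a]) simp_all
  next
   have "integral {0..\<tau>} (w ?J 1) \<le> integral {0..\<tau>} (%q. w ?J 2 q + (\<rho> + 1))"
   proof (rule integral_le)
    show "w ?J 1 integrable_on {0..\<tau>}" by (intro integrable_continuous_real cont order_refl \<tau>T)
    show "(%q. w ?J 2 q + (\<rho> + 1)) integrable_on {0..\<tau>}"
     by (intro integrable_continuous_real continuous_intros cont order_refl \<tau>T)
    fix q assume q: "q \<in> {0..\<tau>}"
    have "w ?J 1 q \<le> w ?J 2 q + (1 / 4) * w ?J 0 q" unfolding w_def using wsum_young[of 1 ?J "%b. c b q"] by simp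
    thus "w ?J 1 q \<le> w ?J 2 q + (\<rho> + 1)" using sh(1)[OF q] w0[of ?J 0 q] by linarith
   qed
   also have "\<dots> = integral {0..\<tau>} (w ?J 2) + (\<rho> + 1) * \<tau>"
   proof (rule integral_unique, intro has_integral_add integrable_integral)
    show "((%q. \<rho> + 1) has_integral (\<rho> + 1) * \<tau>) {0..\<tau>}"
     using has_integral_const_real[of "\<rho> + 1" 0 \<tau>] \<tau>(1) by (simp add: mult.commute)
   qed (intro integrable_continuous_real cont order_refl \<tau>T)
   also have "(\<rho> + 1) * \<tau> \<le> (\<rho> + 1) * 1" using \<rho> by (intro mult_left_mono \<tau>(2)) simp
   finally show "integral {0..\<tau>} (%q. wsum ?J 1 (%b. c b q)) \<le> C" using i2 unfolding C_def w_def by simp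
  qed (use \<tau> in simp)
  have i0: "integral {0..\<tau>} (w (Jx ?J) 0) \<le> \<eta> * \<tau> / 3" using dec[OF _ _ wi] A N iX \<rho> unfolding w_def C_def by simp
  let ?g = "%q. (1 / \<eta>) * w (Jx ?J) 0 q + (1 / Mv) * w ?J 2 q"
  have gc: "continuous_on {0..\<tau>} ?g" by (intro continuous_intros cont Jx_sub order_refl \<tau>T)
  have "integral {0..\<tau>} ?g = (1 / \<eta>) * integral {0..\<tau>} (w (Jx ?J) 0) + (1 / Mv) * integral {0..\<tau>} (w ?J 2)"
   by (intro integral_unique has_integral_add has_integral_mult_right integrable_integral integrable_continuous_real cont Jx_sub order_refl \<tau>T)
  also have "\<dots> \<le> (1 / \<eta>) * (\<eta> * \<tau> / 3) + (1 / Mv) * (\<rho> + 1)"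
   using lt(1) Mv by (intro add_mono mult_left_mono i0 i2) simp_all
  also have "(1 / Mv) * (\<rho> + 1) = \<tau> / 3"
  proof -
   have e: "1 / (3 * x / \<tau>) * x = \<tau> / 3" if "x \<noteq> 0" for x :: real using that \<tau>(1) by simp
   show ?thesis unfolding Mv_def by (rule e) (use \<rho> in simp)
  qed
  also have "(1 / \<eta>) * (\<eta> * \<tau> / 3) + \<tau> / 3 = 2 / 3 * \<tau>" using lt(1) by simp
  finally have "integral {0..\<tau>} ?g \<le> 1 * (\<tau> - 0)" using \<tau>(1) by simp
  then obtain t1 where t1: "t1 \<in> {0..\<tau>}" "?g t1 \<le> 1" using mean_le[OF \<tau>(1) gc] by blast
  have "0 \<le> (1 / \<eta>) * w (Jx ?J) 0 t1" "0 \<le> (1 / Mv) * w ?J 2 t1" using lt(1) Mv w0 by simp_all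
  hence "(1 / \<eta>) * w (Jx ?J) 0 t1 \<le> 1" "(1 / Mv) * w ?J 2 t1 \<le> 1" using t1(2) by linarith+
  hence t1b: "w (Jx ?J) 0 t1 \<le> \<eta>" "w ?J 2 t1 \<le> Mv" using lt(1) Mv by (simp_all add: pos_divide_le_eq)
  have "w (J0 ?J) 1 t1 \<le> w (J0 ?J) 2 t1" unfolding w_def using wsum_J0_mono[OF L zero_JN, of N 1] by (simp add: numeral_2_eq_2)
  also have "\<dots> \<le> w ?J 2 t1" unfolding w_def by (rule wsum_mono[OF finite_JN J0_sub])
  finally have v: "w (J0 ?J) 1 t1 \<le> Mv" using t1b(2) by simp
  have t1t: "0 \<le> t1" "t1 \<le> t" using t1(1) False by simp_all
  have fin: "w ?J 0 t \<le> K" "integral {t1..t} (w ?J 2) \<le> K * (1 + (t - t1))"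
   using lt0[rule_format, of A N t1 t T c] t1t t(2) gl A N t1b(1) v unfolding w_def by simp_all
  have "integral {0..t} (w ?J 2) = integral {0..t1} (w ?J 2) + integral {t1..t} (w ?J 2)"
   using t by (intro Henstock_Kurzweil_Integration.integral_combine[symmetric] t1t integrable_continuous_real cont) simp_all
  also have "\<dots> \<le> (\<rho> + 1) + K * (1 + (t - t1))" by (intro add_mono sh(2)[OF t1(1)] fin(2))
  also have "\<dots> \<le> (\<rho> + 1) * (1 + t) + K * (1 + t)"
  proof (intro add_mono mult_left_mono lt(2))
   have "(\<rho> + 1) * 1 \<le> (\<rho> + 1) * (1 + t)" using \<rho> t by (intro mult_left_mono) simp_all
   thus "\<rho> + 1 \<le> (\<rho> + 1) * (1 + t)" by simp
  qed (use t1t in simp_all)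
  finally have "integral {0..t} (w ?J 2) \<le> K' * (1 + t)" by (simp add: K'_def distrib_right)
  thus ?thesis using fin(1) \<rho> unfolding w_def K'_def by simp
 qed
 show ?thesis
  by (rule exI[of _ "max A1 A2"], rule exI[of _ "max N1 N2"], rule exI[of _ K']) (use main lt(2) \<rho> in \<open>auto simp: K'_def\<close>)
qed

end

section \<open>Passage to the limit\<close>

text \<open>The Cauchy property at \<open>t\<close> is borrowed from a nearby rational.\<close>

lemma equicontinuous_limit:
 fixes f :: "nat => real => complex"
 assumes eq: "!!t e. 0 < e ==> \<exists>\<delta>>0. \<forall>n s. \<bar>s - t\<bar> < \<delta> --> norm (f n s - f n t) \<le> e"
  and q: "!!q. q \<in> \<rat> ==> convergent (%n. f n q)"
 shows "convergent (%n. f n t)"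
proof -
 have "Cauchy (%n. f n t)"
 proof (rule metric_CauchyI)
  fix e :: real assume e: "0 < e"
  obtain \<delta> where \<delta>: "0 < \<delta>" "!!n s. \<bar>s - t\<bar> < \<delta> ==> norm (f n s - f n t) \<le> e / 4" using eq[of "e / 4" t] e by auto
  obtain s where s: "s \<in> \<rat>" "t < s" "s < t + \<delta>" using Rats_dense_in_real[of t "t + \<delta>"] \<delta>(1) by auto
  have "Cauchy (%n. f n s)" using q[OF s(1)] by (rule convergent_Cauchy)
  then obtain M where M: "!!m n. M \<le> m ==> M \<le> n ==> dist (f m s) (f n s) < e / 4"
   using metric_CauchyD[of "%n. f n s" "e / 4"] e by auto
  have "dist (f m t) (f n t) < e" if "M \<le> m" "M \<le> n" for m n
  proof -
   have st: "\<bar>s - t\<bar> < \<delta>" using s by simp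
   have "dist (f m t) (f n t) \<le> dist (f m s) (f m t) + dist (f m s) (f n s) + dist (f n s) (f n t)"
    using dist_triangle[of "f m t" "f n t" "f m s"] dist_triangle[of "f m s" "f n t" "f n s"] by (simp add: dist_commute)
   also have "\<dots> < e" using \<delta>(2)[OF st, of m] \<delta>(2)[OF st, of n] M[OF that] e unfolding dist_norm by argo
   finally show ?thesis .
  qed
  thus "\<exists>M. \<forall>m\<ge>M. \<forall>n\<ge>M. dist (f m t) (f n t) < e" by blast
 qed
 thus ?thesis by (simp add: Cauchy_convergent_iff)
qed

text \<open>Interchange of limits in which \<open>n0\<close> may depend on \<open>m\<close>: a sum
  cut off at \<open>m\<close> is compared with the \<open>n\<close>-th Galerkin system only once the
  box of the latter contains all modes involved.\<close>

lemma tendsto_interchange: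
 fixes x :: "nat => 'a::real_normed_vector"
 assumes x: "!!e. 0 < e ==> \<exists>m0. \<forall>m\<ge>m0. \<exists>n0. \<forall>n\<ge>n0. norm (x n - y m n) \<le> e"
  and y: "!!m. y m \<longlonglongrightarrow> z m" and z: "z \<longlonglongrightarrow> l"
 shows "x \<longlonglongrightarrow> l"
proof (rule LIMSEQ_I)
 fix r :: real assume r: "0 < r"
 obtain m0 where m0: "!!m. m0 \<le> m ==> \<exists>n0. \<forall>n\<ge>n0. norm (x n - y m n) \<le> r / 4" using x[of "r / 4"] r by auto
 obtain m1 where m1: "!!m. m1 \<le> m ==> norm (z m - l) < r / 4" using LIMSEQ_D[OF z, of "r / 4"] r by auto
 define m where "m = max m0 m1"
 obtain n0 where n0: "!!n. n0 \<le> n ==> norm (x n - y m n) \<le> r / 4" using m0[of m] by (auto simp: m_def)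
 obtain n1 where n1: "!!n. n1 \<le> n ==> norm (y m n - z m) < r / 4" using LIMSEQ_D[OF y[of m], of "r / 4"] r by auto
 have "norm (x n - l) < r" if "max n0 n1 \<le> n" for n
 proof -
  have "norm (x n - l) \<le> norm (x n - y m n) + norm (y m n - z m) + norm (z m - l)"
   using norm_triangle_ineq[of "x n - y m n" "y m n - z m"] norm_triangle_ineq[of "x n - z m" "z m - l"] by simp
  moreover have "norm (z m - l) < r / 4" by (rule m1) (simp add: m_def)
  ultimately show ?thesis using n0[of n] n1[of n] that r by simp
 qed
 thus "\<exists>no. \<forall>n\<ge>no. norm (x n - l) < r" by blast
qed

text \<open>Galerkin solutions in the original time, with the mean adjoined as mode 0. The energy
  bounds exclude this mode; \<open>past\<close> extends the coefficients constantly to negative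
  times, so that continuity holds on the whole line.\<close>

locale galerkin_family = torus2 +
 fixes u :: "real => real" and \<nu> :: real and Cn :: "nat => int \<times> int => real => complex" and Nn :: "nat => nat"
  and c0 :: "coeffs" and K :: real
 assumes u_cont: "continuous_on UNIV u"
  and \<nu>: "0 < \<nu>" and K: "0 \<le> K" and Nn: "!!n. n \<le> Nn n"
  and ini: "!!n a. a \<in> sbox (Nn n) ==> Cn n a 0 = c0 a"
  and out: "!!n a t. a \<notin> sbox (Nn n) ==> Cn n a t = 0"
  and past: "!!n a t. t \<le> 0 ==> Cn n a t = Cn n a 0"
  and hermC: "!!n a t. Cn n (- a) t = cnj (Cn n a t)"
  and contC: "!!n a. continuous_on UNIV (Cn n a)"
  and ode: "!!n a T t. a \<in> sbox (Nn n) ==> t \<in> {0..T} ==>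
   (Cn n a has_vector_derivative - (mx a * (\<Sum>b\<in>JN (Nn n). Cn n b t * Uc u (a - b)) + of_real (\<nu> * ((nf a)^2 - nf a)) * Cn n a t
    + of_real (\<nu> / 2) * qq (JN (Nn n)) (JN (Nn n)) (%b. Cn n b t) a)) (at t within {0..T})"
  and bound0: "!!n t. 0 \<le> t ==> wsum (JN (Nn n)) 0 (%b. Cn n b t) \<le> K"
  and bound2: "!!n t. 0 \<le> t ==> integral {0..t} (%r. wsum (JN (Nn n)) 2 (%b. Cn n b r)) \<le> K * (1 + t)"
begin

abbreviation "J n \<equiv> JN (Nn n)"
definition lin :: "nat => int \<times> int => real => complex" where "lin n a t = mx a * (\<Sum>b\<in>J n. Cn n b t * Uc u (a - b))"
definition Qn :: "nat => int \<times> int => real => complex" where "Qn n a t = qq (J n) (J n) (%b. Cn n b t) a"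
definition Fn :: "nat => int \<times> int => real => complex" where
 "Fn n a t = lin n a t + of_real (\<nu> * ((nf a)^2 - nf a)) * Cn n a t + of_real (\<nu> / 2) * Qn n a t"
definition w :: "nat => nat => real => real" where "w k n t = wsum (J n) k (%b. Cn n b t)"

lemma finJ: "finite (J n)" by (simp add: JN_def)

lemma contC': "continuous_on S (Cn n a)" by (rule continuous_on_subset[OF contC]) simp

lemma w_cont: "continuous_on S (w k n)" unfolding w_def wsum_def by (intro continuous_intros contC')

lemma w_nonneg: "0 \<le> w k n t" by (simp add: w_def wsum_nonneg)

lemma Qn_cont: "continuous_on S (Qn n a)" unfolding Qn_def qq_def
proof (intro continuous_on_sum)
 fix b show "continuous_on S (%t. if a - b \<in> J n then kd b (a - b) * Cn n b t * Cn n (a - b) t else 0)"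
  by (cases "a - b \<in> J n") (simp_all add: continuous_on_mult contC' continuous_on_const)
qed

lemma lin_cont: "continuous_on S (lin n a)" unfolding lin_def by (intro continuous_intros contC')

lemma Fn_cont: "continuous_on S (Fn n a)" unfolding Fn_def by (intro continuous_intros contC' lin_cont Qn_cont)

lemma ode': "a \<in> sbox (Nn n) ==> t \<in> {0..T} ==> (Cn n a has_vector_derivative - Fn n a t) (at t within {0..T})"
 unfolding Fn_def lin_def Qn_def by (rule ode)

lemma u_sq: "sq_int M (%z. complex_of_real (u (snd z)))" by (intro sq_int_continuous continuous_intros continuous_on_compose2[OF u_cont]) auto

lemma ell2_Uc: "ell2 (%b. Uc u (a - b))" unfolding Uc_def by (intro ell2_shift ell2_fcoef(1) u_sq)

definition MU :: "int \<times> int => real" where "MU a = (LINT b|CS. (norm (Uc u (a - b)))^2)"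

lemma Uc_tail: "finite F ==> (\<Sum>b\<in>F. (norm (Uc u (a - b)))^2) \<le> MU a"
 unfolding MU_def using ell2_Uc by (intro sum_le_CS) (simp_all add: ell2_def)

lemma MU0: "0 \<le> MU a" using Uc_tail[of "{}"] by simp

lemma Cauchy_Schwarz_norm:
 fixes x y :: "'a => complex"
 shows "norm (\<Sum>b\<in>F. x b * y b) \<le> sqrt (\<Sum>b\<in>F. (norm (x b))^2) * sqrt (\<Sum>b\<in>F. (norm (y b))^2)"
proof -
 have "norm (\<Sum>b\<in>F. x b * y b) \<le> (\<Sum>b\<in>F. norm (x b) * norm (y b))" by (rule sum_norm_le) (simp add: norm_mult)
 also have "\<dots> \<le> sqrt ((\<Sum>b\<in>F. (norm (x b))^2) * (\<Sum>b\<in>F. (norm (y b))^2))" by (intro real_le_rsqrt CS_sum)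
 finally show ?thesis by (simp add: real_sqrt_mult)
qed

lemma CK:
 assumes "0 \<le> t" "F \<subseteq> J n"
 shows "(\<Sum>b\<in>F. (norm (Cn n b t))^2) \<le> K"
 using bound0[OF assms(1), of n] wsum_mono[OF finJ assms(2), of 0 "%b. Cn n b t"] by (simp add: wsum_def)

lemma lin_le: "0 \<le> t ==> norm (lin n a t) \<le> norm (mx a) * (sqrt K * sqrt (MU a))" unfolding lin_def norm_mult[of "mx a"]
 by (intro mult_left_mono order_trans[OF Cauchy_Schwarz_norm] mult_mono real_sqrt_le_mono CK Uc_tail finJ) (simp_all add: K sum_nonneg)

lemma C_le: "0 \<le> t ==> a \<noteq> 0 ==> norm (Cn n a t) \<le> sqrt K"
proof (cases "a \<in> J n")
 case True
 assume t: "0 \<le> t"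
 have "(norm (Cn n a t))^2 \<le> K" using CK[OF t, of "{a}" n] True by simp
 thus ?thesis by (rule real_le_rsqrt)
qed (simp add: out JN_def K)

lemma Qn_le: "norm (Qn n a t) \<le> w 1 n t"
proof -
 have "norm (Qn n a t) \<le> sqrt (w 1 n t) * sqrt (w 1 n t)" unfolding Qn_def w_def by (rule qq_bound[OF finJ finJ])
 thus ?thesis using w_nonneg[of 1 n t] by simp
qed

definition \<alpha> :: "int \<times> int => real" where
 "\<alpha> a = norm (mx a) * (sqrt K * sqrt (MU a)) + \<nu> * \<bar>(nf a)^2 - nf a\<bar> * sqrt K"

lemma \<alpha>0: "0 \<le> \<alpha> a" using \<nu> K MU0 by (simp add: \<alpha>_def)

lemma Fn_le:
 assumes t: "0 \<le> t"
 shows "norm (Fn n a t) \<le> \<alpha> a + \<nu> / 2 * w 1 n t"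
proof -
 have "norm (Fn n a t) \<le> norm (lin n a t) + norm (of_real (\<nu> * ((nf a)^2 - nf a)) * Cn n a t) + norm (of_real (\<nu> / 2) * Qn n a t)"
  unfolding Fn_def by (intro order_trans[OF norm_triangle_ineq] add_right_mono norm_triangle_ineq)
 moreover have "norm (of_real (\<nu> * ((nf a)^2 - nf a)) * Cn n a t) \<le> \<nu> * \<bar>(nf a)^2 - nf a\<bar> * sqrt K"
 proof (cases "a = 0")
  case True
  thus ?thesis using \<nu> K by (simp add: nf_def)
 next
  case False
  have "norm (of_real (\<nu> * ((nf a)^2 - nf a)) * Cn n a t) = \<nu> * \<bar>(nf a)^2 - nf a\<bar> * norm (Cn n a t)"
   unfolding norm_mult norm_of_real abs_mult using \<nu> by simp
  also have "\<dots> \<le> \<nu> * \<bar>(nf a)^2 - nf a\<bar> * sqrt K" using \<nu> by (intro mult_left_mono C_le t False) simp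
  finally show ?thesis .
 qed
 moreover have "norm (of_real (\<nu> / 2) * Qn n a t) \<le> \<nu> / 2 * w 1 n t"
  unfolding norm_mult norm_of_real using \<nu> Qn_le[of n a t] by (simp add: mult_left_mono)
 ultimately show ?thesis using lin_le[OF t, of n a] unfolding \<alpha>_def by linarith
qed

text \<open>The free parameter \<open>r\<close> makes the first term small, uniformly over
  subintervals; the second is then small on short ones. This yields equicontinuity although the
  quadratic term is bounded only after integration in time.\<close>

lemma w1_int:
 assumes r: "0 < r" and s: "0 \<le> s" "s \<le> t"
 shows "integral {s..t} (w 1 n) \<le> r * (K * (1 + t)) + K / (4 * r) * (t - s)"
proof -
 have "integral {s..t} (w 1 n) \<le> integral {s..t} (%q. r * w 2 n q + K / (4 * r))"
 proof (intro integral_le integrable_continuous_real continuous_intros w_cont)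
  fix q assume q: "q \<in> {s..t}"
  have "w 0 n q \<le> K" unfolding w_def using q s by (intro bound0) simp
  hence "1 / (4 * r) * w 0 n q \<le> 1 / (4 * r) * K" using r by (intro mult_left_mono) simp_all
  thus "w 1 n q \<le> r * w 2 n q + K / (4 * r)" using wsum_young[OF r, of "J n" "%b. Cn n b q"] unfolding w_def by simp
 qed
 also have "\<dots> = r * integral {s..t} (w 2 n) + K / (4 * r) * (t - s)"
 proof (rule integral_unique, intro has_integral_add has_integral_mult_right integrable_integral integrable_continuous_real w_cont)
  show "((%q. K / (4 * r)) has_integral K / (4 * r) * (t - s)) {s..t}"
   using has_integral_const_real[of "K / (4 * r)" s t] s by (simp add: mult.commute)
 qed
 also have "integral {s..t} (w 2 n) \<le> integral {0..t} (w 2 n)"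
  using s w_nonneg by (intro integral_subset_le integrable_continuous_real w_cont) auto
 also have "integral {0..t} (w 2 n) \<le> K * (1 + t)" using bound2[of t n] s unfolding w_def[abs_def] by simp
 finally show ?thesis using r by simp
qed

lemma C_incr:
 assumes r: "0 < r" and s: "0 \<le> s" "s \<le> t"
 shows "norm (Cn n a t - Cn n a s) \<le> \<nu> / 2 * r * (K * (1 + t)) + (\<alpha> a + \<nu> * K / (8 * r)) * (t - s)"
proof (cases "a \<in> sbox (Nn n)")
 case True
 have f: "((%q. - Fn n a q) has_integral (Cn n a t - Cn n a s)) {s..t}"
 proof (rule fundamental_theorem_of_calculus[OF s(2)])
  fix q assume q: "q \<in> {s..t}"
  show "(Cn n a has_vector_derivative - Fn n a q) (at q within {s..t})"
   by (rule has_vector_derivative_within_subset[OF ode'[OF True, of q t]]) (use q s in auto)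
 qed
 have "norm (integral {s..t} (%q. - Fn n a q)) \<le> integral {s..t} (%q. \<alpha> a + \<nu> / 2 * w 1 n q)"
 proof (rule integral_norm_bound_integral)
  show "(%q. - Fn n a q) integrable_on {s..t}" using f by (rule has_integral_integrable)
  show "(%q. \<alpha> a + \<nu> / 2 * w 1 n q) integrable_on {s..t}" by (intro integrable_continuous_real continuous_intros w_cont)
  show "norm (- Fn n a q) \<le> \<alpha> a + \<nu> / 2 * w 1 n q" if "q \<in> {s..t}" for q using Fn_le[of q n a] that s by simp
 qed
 also have "\<dots> = \<alpha> a * (t - s) + \<nu> / 2 * integral {s..t} (w 1 n)"
 proof (rule integral_unique, intro has_integral_add has_integral_mult_right integrable_integral integrable_continuous_real w_cont)
  show "((%q. \<alpha> a) has_integral \<alpha> a * (t - s)) {s..t}"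
   using has_integral_const_real[of "\<alpha> a" s t] s by (simp add: mult.commute)
 qed
 also have "\<nu> / 2 * integral {s..t} (w 1 n) \<le> \<nu> / 2 * (r * (K * (1 + t)) + K / (4 * r) * (t - s))"
  using \<nu> by (intro mult_left_mono w1_int[OF r s]) simp
 also have "\<nu> / 2 * (r * (K * (1 + t)) + K / (4 * r) * (t - s)) = \<nu> / 2 * r * (K * (1 + t)) + \<nu> * K / (8 * r) * (t - s)"
  using r by (simp add: distrib_left)
 finally show ?thesis unfolding integral_unique[OF f] distrib_right[of "\<alpha> a"] by linarith
next
 case False
 have "0 \<le> \<nu> / 2 * r * (K * (1 + t)) + (\<alpha> a + \<nu> * K / (8 * r)) * (t - s)"
  using r s \<nu> K \<alpha>0[of a] by (intro add_nonneg_nonneg mult_nonneg_nonneg divide_nonneg_nonneg) simp_all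
 thus ?thesis using out[OF False] by simp
qed

lemma past': "Cn n a t = Cn n a (max 0 t)" using past[of t n a] by (simp add: max_def)

lemma equicont:
 fixes e t :: real
 assumes e: "0 < e"
 shows "\<exists>\<delta>>0. \<forall>n s. \<bar>s - t\<bar> < \<delta> --> norm (Cn n a s - Cn n a t) \<le> e"
proof -
 define T where "T = \<bar>t\<bar> + 1"
 \<comment> \<open>Chosen first, to make the contribution of the dissipation bound at most
   \<open>e / 2\<close>; \<open>\<delta>\<close> then handles the Lipschitz part, whose constant
   depends on \<open>r\<close>.\<close>
 define r where "r = e / (\<nu> * (K * (1 + T) + 1))"
 have T: "1 \<le> T" by (simp add: T_def)
 have dv: "x / y * y = x" "y * (x / (2 * y)) = x / 2" if "0 < y" for x y :: real using that by simp_all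
 have D: "0 < \<nu> * (K * (1 + T) + 1)" using \<nu> K T by (intro mult_pos_pos add_nonneg_pos) simp_all
 have r: "0 < r" using e D by (simp add: r_def)
 have r2: "\<nu> / 2 * r * (K * (1 + T)) \<le> e / 2"
 proof -
  have "\<nu> * r * (K * (1 + T)) \<le> \<nu> * r * (K * (1 + T) + 1)" using \<nu> r by (intro mult_left_mono) simp_all
  also have "\<dots> = r * (\<nu> * (K * (1 + T) + 1))" by (simp only: mult_ac)
  also have "\<dots> = e" unfolding r_def by (rule dv(1)[OF D])
  finally show ?thesis by simp
 qed
 define L where "L = \<alpha> a + \<nu> * K / (8 * r)"
 have L: "0 \<le> L" using \<alpha>0[of a] \<nu> K r by (simp add: L_def)
 define \<delta> where "\<delta> = min 1 (e / (2 * (L + 1)))"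
 have \<delta>: "0 < \<delta>" using e L by (simp add: \<delta>_def)
 have \<delta>2: "L * \<delta> \<le> e / 2"
 proof -
  have "(L + 1) * \<delta> \<le> (L + 1) * (e / (2 * (L + 1)))" using L by (intro mult_left_mono) (simp_all add: \<delta>_def)
  also have "\<dots> = e / 2" using L by (intro dv(2)) simp
  finally show ?thesis using \<delta> by (simp add: distrib_right)
 qed
 have key: "norm (Cn n a y - Cn n a x) \<le> e" if "0 \<le> x" "x \<le> y" "y - x \<le> \<delta>" "y \<le> T" for n x y
 proof -
  have "norm (Cn n a y - Cn n a x) \<le> \<nu> / 2 * r * (K * (1 + y)) + L * (y - x)" unfolding L_def by (rule C_incr[OF r that(1,2)])
  also have "\<dots> \<le> \<nu> / 2 * r * (K * (1 + T)) + L * \<delta>" using \<nu> r K L that by (intro add_mono mult_left_mono) simp_all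
  finally show ?thesis using r2 \<delta>2 by linarith
 qed
 have "norm (Cn n a s - Cn n a t) \<le> e" if st: "\<bar>s - t\<bar> < \<delta>" for n s
 proof -
  have d1: "\<delta> \<le> 1" by (simp add: \<delta>_def)
  have sT: "s \<le> T" "t \<le> T" using st d1 unfolding T_def by (simp_all add: abs_if split: if_splits)
  show ?thesis
  proof (cases "s \<le> t")
   case True
   have "norm (Cn n a (max 0 t) - Cn n a (max 0 s)) \<le> e" using True st sT T by (intro key) (auto simp: max_def)
   thus ?thesis unfolding past'[of n a s] past'[of n a t] by (simp add: norm_minus_commute)
  next
   case False
   have "norm (Cn n a (max 0 s) - Cn n a (max 0 t)) \<le> e" using False st sT T by (intro key) (auto simp: max_def)
   thus ?thesis unfolding past'[of n a s] past'[of n a t] .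
  qed
 qed
 thus ?thesis using \<delta> by blast
qed

text \<open>Bound for a single mode on \<open>[0, T]\<close>, from \<open>C_incr\<close> with
  \<open>r = 1\<close>. It also covers mode 0, which the energies do not see.\<close>

definition B :: "int \<times> int => real => real" where
 "B a T = norm (c0 a) + (\<nu> / 2 * (K * (1 + T)) + (\<alpha> a + \<nu> * K / 8) * T)"

lemma B_bound:
 assumes t: "0 \<le> t" "t \<le> T"
 shows "norm (Cn n a t) \<le> B a T"
proof -
 have "norm (Cn n a t - Cn n a 0) \<le> \<nu> / 2 * 1 * (K * (1 + t)) + (\<alpha> a + \<nu> * K / (8 * 1)) * (t - 0)"
  by (rule C_incr) (use t in simp_all)
 also have "\<dots> \<le> \<nu> / 2 * (K * (1 + T)) + (\<alpha> a + \<nu> * K / 8) * T"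
  using \<nu> K \<alpha>0[of a] t by (intro add_mono mult_mono) simp_all
 finally have "norm (Cn n a t - Cn n a 0) \<le> \<nu> / 2 * (K * (1 + T)) + (\<alpha> a + \<nu> * K / 8) * T" .
 moreover have "norm (Cn n a 0) \<le> norm (c0 a)" using ini[of a n] out[of a n 0] by (cases "a \<in> sbox (Nn n)") simp_all
 ultimately show ?thesis using norm_triangle_ineq[of "Cn n a t - Cn n a 0" "Cn n a 0"] unfolding B_def by simp
qed

lemma B_nonneg: "0 \<le> T ==> 0 \<le> B a T" using B_bound[of T T undefined a] norm_ge_zero order_trans by blast

text \<open>A diagonal sequence over modes and rational times; dividing by \<open>B + 1\<close>
  brings all functions under the common bound 1. Equicontinuity extends the convergence to all
  times.\<close>

lemma convergent_subsequence:
 "\<exists>k. strict_mono (k :: nat => nat) \<and> (\<forall>a t. convergent (%n. Cn (k n) a t))"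
proof -
 let ?f = "%n p. Cn n (fst p) (snd p) / of_real (B (fst p) (max 0 (snd p)) + 1)"
 have pos: "0 < B a (max 0 t) + 1" for a t using B_nonneg[of "max 0 t" a] by simp
 have le: "norm (?f n p) \<le> 1" for n p
 proof -
  have "norm (Cn n (fst p) (snd p)) \<le> B (fst p) (max 0 (snd p))" unfolding past'[of n "fst p" "snd p"] by (rule B_bound) simp_all
  thus ?thesis using pos[of "fst p" "snd p"] by (simp add: norm_divide norm_of_real)
 qed
 have "countable ((UNIV :: (int \<times> int) set) \<times> (\<rat> :: real set))" by (intro countable_SIGMA countable_rat) simp_all
 then obtain k where k: "strict_mono (k :: nat => nat)" "!!p. p \<in> UNIV \<times> \<rat> ==> \<exists>l. (%n. ?f (k n) p) \<longlonglongrightarrow> l"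
  by (rule function_convergent_subsequence[of _ ?f 1]) (use le in auto)
 have "convergent (%n. Cn (k n) a q)" if q: "q \<in> \<rat>" for a q
 proof -
  obtain l where "(%n. ?f (k n) (a, q)) \<longlonglongrightarrow> l" using k(2)[of "(a, q)"] q by auto
  hence "(%n. of_real (B a (max 0 q) + 1) * ?f (k n) (a, q)) \<longlonglongrightarrow> of_real (B a (max 0 q) + 1) * l" by (rule tendsto_mult_left)
  moreover have "of_real (B a (max 0 q) + 1) * ?f (k n) (a, q) = Cn (k n) a q" for n
  proof -
   have "complex_of_real (B a (max 0 q) + 1) \<noteq> 0" using pos[of a q] by (metis of_real_eq_0_iff less_irrefl)
   thus ?thesis by (simp del: of_real_add)
  qed
  ultimately show ?thesis by (auto simp: convergent_def)
 qed
 note rat = this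
 have "convergent (%n. Cn (k n) a t)" for a t
 proof (rule equicontinuous_limit[of "%n. Cn (k n) a" t])
  fix q :: real assume "q \<in> \<rat>"
  thus "convergent (%n. Cn (k n) a q)" by (rule rat)
 next
  fix t r :: real assume "0 < r"
  from equicont[OF this, of t a]
  show "\<exists>\<delta>>0. \<forall>n s. \<bar>s - t\<bar> < \<delta> --> norm (Cn (k n) a s - Cn (k n) a t) \<le> r" by blast
 qed
 thus ?thesis using k(1) by blast
qed

lemma subfamily:
 assumes k: "strict_mono k"
 shows "galerkin_family L1 L2 u \<nu> (%n. Cn (k n)) (%n. Nn (k n)) c0 K"
proof -
 have N: "n \<le> Nn (k n)" for n using order_trans[OF seq_suble[OF k] Nn] .
 show ?thesis by unfold_locales (assumption | rule L1 L2 u_cont \<nu> K N ini out past hermC contC ode bound0 bound2)+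
qed

end

lemma JN_mono: "m \<le> n ==> JN m \<subseteq> JN n" unfolding JN_def using sbox_mono by blast

lemma sum_sbox:
 fixes f :: "int \<times> int => 'b::comm_monoid_add"
 shows "sum f (sbox m) = f 0 + sum f (JN m)" unfolding JN_def by (rule sum.remove) (simp_all add: sbox_def zero_prod_def)

lemma Nt_dominated:
 fixes f :: "nat => real => complex"
 assumes f: "!!n. continuous_on UNIV (f n)" and le: "!!n t. 0 \<le> t ==> t < T ==> norm (f n t) \<le> C"
  and lim: "!!t. 0 \<le> t ==> t < T ==> (%n. f n t) \<longlonglongrightarrow> h t"
 shows "integrable (Nt T) h" "(%n. LINT t|Nt T. f n t) \<longlonglongrightarrow> (LINT t|Nt T. h t)"
proof -
 interpret finite_measure "Nt T" by (rule finite_measure_Nt)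
 have mf: "f n \<in> borel_measurable (Nt T)" for n by (intro measurable_Nt borel_measurable_continuous_onI f)
 have mh: "h \<in> borel_measurable (Nt T)" by (rule borel_measurable_LIMSEQ_metric[where f = f, OF mf]) (simp add: lim space_Nt)
 note * = mh mf integrable_const[of C]
 have l: "AE t in Nt T. (%n. f n t) \<longlonglongrightarrow> h t" by (rule AE_I2) (simp add: lim space_Nt)
 have b: "AE t in Nt T. norm (f n t) \<le> C" for n by (rule AE_I2) (simp add: le space_Nt)
 show "integrable (Nt T) h" by (rule integrable_dominated_convergence[OF * l b])
 show "(%n. LINT t|Nt T. f n t) \<longlonglongrightarrow> (LINT t|Nt T. h t)" by (rule integral_dominated_convergence[OF * l b])
qed

section \<open>The limit of a convergent family\<close>

locale galerkin_limit = galerkin_family +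
 fixes g :: "int \<times> int => real => complex" and \<phi>0 :: "real \<times> real => real"
 assumes limC: "!!a t. (%n. Cn n a t) \<longlonglongrightarrow> g a t"
  and init: "in_L2 L1 L2 \<phi>0" "!!a. c0 a = fcoef (%z. of_real (\<phi>0 z)) a"
begin

lemma eventually_sub: "finite F ==> \<exists>n0. \<forall>n\<ge>n0. F \<subseteq> sbox (Nn n)"
proof -
 assume "finite F"
 then obtain m where m: "F \<subseteq> sbox m" using finite_subset_sbox by blast
 have "F \<subseteq> sbox (Nn n)" if "m \<le> n" for n using m sbox_mono[OF order_trans[OF that Nn[of n]]] by blast
 thus ?thesis by blast
qed

lemma g_cont: "continuous_on S (g a)"
proof (rule continuous_on_subset[OF _ subset_UNIV])
 show "continuous_on UNIV (g a)" unfolding continuous_on_iff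
 proof (intro ballI allI impI)
  fix t r :: real assume r: "0 < r"
  obtain \<delta> where \<delta>: "0 < \<delta>" "!!n s. \<bar>s - t\<bar> < \<delta> ==> norm (Cn n a s - Cn n a t) \<le> r / 2"
   using equicont[of "r / 2" t a] r by auto
  have "dist (g a s) (g a t) < r" if s: "dist s t < \<delta>" for s
  proof -
   have "(%n. norm (Cn n a s - Cn n a t)) \<longlonglongrightarrow> norm (g a s - g a t)" by (intro tendsto_intros limC)
   hence "norm (g a s - g a t) \<le> r / 2" by (rule LIMSEQ_le_const2) (use \<delta>(2)[of s] s in \<open>auto simp: dist_real_def\<close>)
   thus ?thesis using r by (simp add: dist_norm)
  qed
  thus "\<exists>d>0. \<forall>s\<in>UNIV. dist s t < d --> dist (g a s) (g a t) < r" using \<delta>(1) by blast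
 qed
qed

lemma g_0: "g a 0 = c0 a"
proof -
 obtain n0 where n0: "\<forall>n\<ge>n0. {a} \<subseteq> sbox (Nn n)" using eventually_sub[of "{a}"] by auto
 hence "eventually (%n. Cn n a 0 = c0 a) sequentially" by (intro eventually_sequentiallyI[of n0]) (simp add: ini)
 hence "(%n. Cn n a 0) \<longlonglongrightarrow> c0 a" by (rule tendsto_eventually)
 thus ?thesis using LIMSEQ_unique limC by blast
qed

lemma g_herm: "hermitian (%a. g a t)" unfolding hermitian_def
proof
 fix a
 have "(%n. Cn n (- a) t) \<longlonglongrightarrow> cnj (g a t)" unfolding hermC by (intro tendsto_cnj limC)
 thus "g (- a) t = cnj (g a t)" using LIMSEQ_unique[OF limC] by blast
qed

lemma sum_C_le:
 assumes t: "0 \<le> t" "t \<le> T" and m: "m \<le> n"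
 shows "(\<Sum>a\<in>sbox m. (norm (Cn n a t))^2) \<le> (B 0 T)^2 + K"
proof -
 have "JN m \<subseteq> J n" by (rule JN_mono[OF order_trans[OF m Nn]])
 hence "(\<Sum>a\<in>JN m. (norm (Cn n a t))^2) \<le> K" by (rule CK[OF t(1)])
 moreover have "(norm (Cn n 0 t))^2 \<le> (B 0 T)^2" by (intro power_mono B_bound t) simp
 ultimately show ?thesis unfolding sum_sbox by linarith
qed

lemma g_l2:
 assumes t: "0 \<le> t" "t \<le> T"
 shows "(\<Sum>a\<in>sbox m. (norm (g a t))^2) \<le> (B 0 T)^2 + K"
proof (rule LIMSEQ_le_const2)
 show "(%n. \<Sum>a\<in>sbox m. (norm (Cn n a t))^2) \<longlonglongrightarrow> (\<Sum>a\<in>sbox m. (norm (g a t))^2)" by (intro tendsto_intros limC)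
 show "\<exists>N. \<forall>n\<ge>N. (\<Sum>a\<in>sbox m. (norm (Cn n a t))^2) \<le> (B 0 T)^2 + K" using sum_C_le[OF t] by blast
qed

text \<open>For a fixed box the integral passes to the limit by dominated convergence, and the
  Galerkin bound is the same for all boxes inside the truncation, so the constant does not depend on
  \<open>m\<close>.\<close>

lemma g_h2: "\<exists>C. \<forall>m. integral {0..T} (%t. \<Sum>a\<in>sbox m. (1 + nf a)^2 * (norm (g a t))^2) \<le> C"
proof (cases "0 \<le> T")
 case T: True
 let ?C = "((B 0 T)^2 + 2 * K) * T + 2 * (K * (1 + T))"
 have "integral {0..T} (%t. \<Sum>a\<in>sbox m. (1 + nf a)^2 * (norm (g a t))^2) \<le> ?C" for m
 proof (rule LIMSEQ_le_const2)
  show "(%n. integral {0..T} (%t. \<Sum>a\<in>sbox m. (1 + nf a)^2 * (norm (Cn n a t))^2))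
   \<longlonglongrightarrow> integral {0..T} (%t. \<Sum>a\<in>sbox m. (1 + nf a)^2 * (norm (g a t))^2)"
  proof (rule dominated_convergence(2))
   show "(%t. \<Sum>a\<in>sbox m. (1 + nf a)^2 * (norm (Cn n a t))^2) integrable_on {0..T}" for n
    by (intro integrable_continuous_real continuous_intros contC')
   show "(%t. \<Sum>a\<in>sbox m. (1 + nf a)^2 * (B a T)^2) integrable_on {0..T}"
    by (intro integrable_continuous_real continuous_intros)
   fix t :: real and n assume t: "t \<in> {0..T}"
   have "(\<Sum>a\<in>sbox m. (1 + nf a)^2 * (norm (Cn n a t))^2) \<le> (\<Sum>a\<in>sbox m. (1 + nf a)^2 * (B a T)^2)"
    using t by (intro sum_mono mult_left_mono power_mono B_bound) simp_all
   moreover have "0 \<le> (\<Sum>a\<in>sbox m. (1 + nf a)^2 * (norm (Cn n a t))^2)" by (intro sum_nonneg) simp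
   ultimately show "norm (\<Sum>a\<in>sbox m. (1 + nf a)^2 * (norm (Cn n a t))^2) \<le> (\<Sum>a\<in>sbox m. (1 + nf a)^2 * (B a T)^2)" by simp
  next
   fix t show "(%n. \<Sum>a\<in>sbox m. (1 + nf a)^2 * (norm (Cn n a t))^2) \<longlonglongrightarrow> (\<Sum>a\<in>sbox m. (1 + nf a)^2 * (norm (g a t))^2)"
    by (intro tendsto_intros limC)
  qed
  have "integral {0..T} (%t. \<Sum>a\<in>sbox m. (1 + nf a)^2 * (norm (Cn n a t))^2) \<le> ?C" if m: "m \<le> n" for n
  proof -
   have "integral {0..T} (%t. \<Sum>a\<in>sbox m. (1 + nf a)^2 * (norm (Cn n a t))^2) \<le> integral {0..T} (%t. ((B 0 T)^2 + 2 * K) + 2 * w 2 n t)"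
   proof (intro integral_le integrable_continuous_real continuous_intros contC' w_cont)
    fix t assume t: "t \<in> {0..T}"
    have J: "JN m \<subseteq> J n" by (rule JN_mono[OF order_trans[OF m Nn]])
    have "(\<Sum>a\<in>JN m. (1 + nf a)^2 * (norm (Cn n a t))^2) \<le> (\<Sum>a\<in>J n. (1 + nf a)^2 * (norm (Cn n a t))^2)"
     by (rule sum_mono2[OF finJ J]) simp
    also have "\<dots> \<le> (\<Sum>a\<in>J n. 2 * (nf a ^ 0 * (norm (Cn n a t))^2) + 2 * (nf a ^ 2 * (norm (Cn n a t))^2))"
    proof (rule sum_mono)
     fix a
     have "0 \<le> (1 - nf a)^2" by simp
     hence "(1 + nf a)^2 \<le> 2 + 2 * (nf a)^2" by (simp add: power2_eq_square algebra_simps)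
     hence "(1 + nf a)^2 * (norm (Cn n a t))^2 \<le> (2 + 2 * (nf a)^2) * (norm (Cn n a t))^2" by (rule mult_right_mono) simp
     thus "(1 + nf a)^2 * (norm (Cn n a t))^2 \<le> 2 * (nf a ^ 0 * (norm (Cn n a t))^2) + 2 * (nf a ^ 2 * (norm (Cn n a t))^2)"
      by (simp add: distrib_right)
    qed
    also have "\<dots> = 2 * w 0 n t + 2 * w 2 n t" unfolding w_def wsum_def sum.distrib sum_distrib_left ..
    also have "w 0 n t \<le> K" unfolding w_def using t by (intro bound0) simp
    finally have "(\<Sum>a\<in>JN m. (1 + nf a)^2 * (norm (Cn n a t))^2) \<le> 2 * K + 2 * w 2 n t" by simp
    moreover have "(norm (Cn n 0 t))^2 \<le> (B 0 T)^2" using t by (intro power_mono B_bound) simp_all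
    ultimately show "(\<Sum>a\<in>sbox m. (1 + nf a)^2 * (norm (Cn n a t))^2) \<le> ((B 0 T)^2 + 2 * K) + 2 * w 2 n t"
     unfolding sum_sbox by (simp add: nf_def)
   qed
   also have "\<dots> = ((B 0 T)^2 + 2 * K) * T + 2 * integral {0..T} (w 2 n)"
   proof (rule integral_unique, intro has_integral_add has_integral_mult_right integrable_integral integrable_continuous_real w_cont)
    show "((%t. (B 0 T)^2 + 2 * K) has_integral ((B 0 T)^2 + 2 * K) * T) {0..T}"
     using has_integral_const_real[of "(B 0 T)^2 + 2 * K" 0 T] T by (simp add: mult.commute)
   qed
   also have "integral {0..T} (w 2 n) \<le> K * (1 + T)" using bound2[OF T, of n] unfolding w_def[abs_def] .
   finally show ?thesis by simp
  qed
  thus "\<exists>N. \<forall>n\<ge>N. integral {0..T} (%t. \<Sum>a\<in>sbox m. (1 + nf a)^2 * (norm (Cn n a t))^2) \<le> ?C" by blast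
 qed
 thus ?thesis by blast
qed (auto intro: exI[of _ 0])

sublocale R: spectral_regular L1 L2 g
proof unfold_locales
 show "\<exists>C. \<forall>t\<in>{0..T}. \<forall>n. (\<Sum>a\<in>sbox n. (norm (g a t))^2) \<le> C" for T
  by (rule exI[of _ "(B 0 T)^2 + K"]) (simp add: g_l2)
qed (fact g_cont g_herm g_h2)+

lemma ell2_g: "0 \<le> t ==> ell2 (%a. g a t)"
 unfolding ell2_def by (rule integrable_CS_sbox(1)[OF _ g_l2[OF _ order_refl]]) simp_all

lemma ell2_U: "ell2 (Uc u)" unfolding Uc_def by (intro ell2_fcoef(1) u_sq)

text \<open>Tails are small uniformly in \<open>n\<close> by Cauchy-Schwarz: the solutions are
  bounded in L2 and \<open>Uc u\<close> is square summable.\<close>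

lemma lin_tendsto:
 assumes t: "0 \<le> t"
 shows "(%n. lin n a t) \<longlonglongrightarrow> mx a * conv (%b. g b t) (Uc u) a"
proof (cases "fst a = 0")
 case True
 thus ?thesis by (simp add: lin_def mx_def)
next
 case False
 \<comment> \<open>The Galerkin sum omits \<open>b = 0\<close> while the convolution contains it. In
   this case the term vanishes; in the case \<open>fst a = 0\<close> the whole expression carries
   the factor \<open>mx a = 0\<close>.\<close>
 hence U0: "Uc u (a - 0) = 0" unfolding Uc_def by (simp add: fcoef_snd[OF u_cont])
 let ?f = "%n b. Cn n b t * Uc u (a - b)"
 have "(%n. \<Sum>b\<in>J n. ?f n b) \<longlonglongrightarrow> conv (%b. g b t) (Uc u) a"
 proof (rule tendsto_interchange[where y = "%m n. \<Sum>b\<in>sbox m. ?f n b" and z = "%m. \<Sum>b\<in>sbox m. g b t * Uc u (a - b)"])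
  show "(%n. \<Sum>b\<in>sbox m. ?f n b) \<longlonglongrightarrow> (\<Sum>b\<in>sbox m. g b t * Uc u (a - b))" for m by (intro tendsto_intros limC)
  show "(%m. \<Sum>b\<in>sbox m. g b t * Uc u (a - b)) \<longlonglongrightarrow> conv (%b. g b t) (Uc u) a"
   unfolding conv_def by (intro tendsto_sbox_sum conv_integrable ell2_g ell2_U t)
  fix r :: real assume r: "0 < r"
  have lim: "(%m. \<Sum>b\<in>sbox m. (norm (Uc u (a - b)))^2) \<longlonglongrightarrow> MU a"
   unfolding MU_def using ell2_Uc by (intro tendsto_sbox_sum) (simp add: ell2_def)
  have "0 < r^2 / (K + 1)" using r K by simp
  then obtain m0 where m0: "!!m. m0 \<le> m ==> norm ((\<Sum>b\<in>sbox m. (norm (Uc u (a - b)))^2) - MU a) < r^2 / (K + 1)"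
   using LIMSEQ_D[OF lim] by blast
  have "norm ((\<Sum>b\<in>J n. ?f n b) - (\<Sum>b\<in>sbox m. ?f n b)) \<le> r" if m: "m0 \<le> m" "m \<le> n" for m n
  proof -
   have mN: "m \<le> Nn n" using m(2) Nn[of n] by simp
   let ?R = "sbox (Nn n) - sbox m"
   have RJ: "?R \<subseteq> J n" by (auto simp: JN_def sbox_def zero_prod_def)
   have "(\<Sum>b\<in>J n. ?f n b) = (\<Sum>b\<in>sbox (Nn n). ?f n b)" unfolding sum_sbox U0 by simp
   hence "(\<Sum>b\<in>J n. ?f n b) - (\<Sum>b\<in>sbox m. ?f n b) = (\<Sum>b\<in>?R. ?f n b)"
    by (simp only: sum_diff[OF finite_sbox sbox_mono[OF mN]])
   also have "norm \<dots> \<le> sqrt (\<Sum>b\<in>?R. (norm (Cn n b t))^2) * sqrt (\<Sum>b\<in>?R. (norm (Uc u (a - b)))^2)"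
    by (rule Cauchy_Schwarz_norm)
   also have "\<dots> \<le> sqrt K * sqrt (r^2 / (K + 1))"
   proof (intro mult_mono real_sqrt_le_mono CK[OF t RJ])
    have "(\<Sum>b\<in>?R. (norm (Uc u (a - b)))^2) = (\<Sum>b\<in>sbox (Nn n). (norm (Uc u (a - b)))^2) - (\<Sum>b\<in>sbox m. (norm (Uc u (a - b)))^2)"
     by (rule sum_diff[OF finite_sbox sbox_mono[OF mN]])
    also have "\<dots> \<le> MU a - (\<Sum>b\<in>sbox m. (norm (Uc u (a - b)))^2)" using Uc_tail[OF finite_sbox[of "Nn n"], of a] by simp
    also have "\<dots> \<le> r^2 / (K + 1)" using m0[OF m(1)] by (simp add: abs_le_iff)
    finally show "(\<Sum>b\<in>?R. (norm (Uc u (a - b)))^2) \<le> r^2 / (K + 1)" .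
   qed (simp_all add: K sum_nonneg)
   also have "\<dots> = sqrt (K * r^2 / (K + 1))" by (simp add: real_sqrt_mult[symmetric])
   also have "\<dots> \<le> sqrt (r^2)"
   proof (rule real_sqrt_le_mono)
    have "K * r^2 \<le> (K + 1) * r^2" by (intro mult_right_mono) simp_all
    thus "K * r^2 / (K + 1) \<le> r^2" using K by (simp add: pos_divide_le_eq mult.commute)
   qed
   also have "\<dots> = r" using r by simp
   finally show ?thesis .
  qed
  thus "\<exists>m0. \<forall>m\<ge>m0. \<exists>n0. \<forall>n\<ge>n0. norm ((\<Sum>b\<in>J n. ?f n b) - (\<Sum>b\<in>sbox m. ?f n b)) \<le> r" by blast
 qed
 thus ?thesis unfolding lin_def by (rule tendsto_mult_left)
qed

definition S :: "nat => coeffs => coeffs" where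
 "S m d a = (\<Sum>b\<in>sbox m. kd b (a - b) * d b * d (a - b))"

lemma S_Qc:
 assumes d: "H2c d"
 shows "(%m. S m d a) \<longlonglongrightarrow> Qc d a"
proof -
 have n: "norm (mx a) \<le> 1 * (1 + nf a)" "norm (my a) \<le> 1 * (1 + nf a)" for a
 proof -
  have "1 + nf a \<le> (1 + nf a)^2" using nf_nonneg[of a] by (simp add: power2_eq_square algebra_simps)
  hence "(norm (mx a))^2 \<le> (1 + nf a)^2" "(norm (my a))^2 \<le> (1 + nf a)^2"
   using norm_mx[of a] zero_le_power2[of "norm (mx a)"] zero_le_power2[of "norm (my a)"] by linarith+
  thus "norm (mx a) \<le> 1 * (1 + nf a)" "norm (my a) \<le> 1 * (1 + nf a)" using nf_nonneg[of a] by (auto intro: power2_le_imp_le)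
 qed
 note e = H2c_weighted[OF d n(1)] H2c_weighted[OF d n(2)]
 have "(%m. (\<Sum>b\<in>sbox m. (mx b * d b) * (mx (a - b) * d (a - b))) + (\<Sum>b\<in>sbox m. (my b * d b) * (my (a - b) * d (a - b)))) \<longlonglongrightarrow> Qc d a"
  unfolding Qc_def conv_def by (intro tendsto_add tendsto_sbox_sum conv_integrable e)
 moreover have "S m d a = (\<Sum>b\<in>sbox m. (mx b * d b) * (mx (a - b) * d (a - b))) + (\<Sum>b\<in>sbox m. (my b * d b) * (my (a - b) * d (a - b)))" for m
  unfolding S_def sum.distrib[symmetric] kd_def by (intro sum.cong refl) (simp add: algebra_simps)
 ultimately show ?thesis by simp
qed

text \<open>Supplies a majorant independent of \<open>m\<close>, which at almost every time is
  \<open>KK\<close> and hence integrable in time.\<close>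

lemma S_le:
 assumes d: "H2c d"
 shows "norm (S m d a) \<le> (LINT b|CS. (1 + nf b)^2 * (norm (d b))^2)"
proof -
 let ?h = "%b. (1 + nf b)^2 * (norm (d b))^2"
 have hi: "integrable CS ?h" using d by (simp add: H2c_def)
 have "norm (S m d a) \<le> (\<Sum>b\<in>sbox m. (?h b + ?h (a - b)) / 2)" unfolding S_def
 proof (rule sum_norm_le)
  fix b
  have nh: "(sqrt (nf b) * norm (d b))^2 \<le> ?h b" for b
  proof -
   have "nf b \<le> (1 + nf b)^2" using nf_nonneg[of b] by (simp add: power2_eq_square algebra_simps)
   thus ?thesis unfolding power_mult_distrib using nf_nonneg[of b] by (simp add: mult_right_mono)
  qed
  have "norm (kd b (a - b) * d b * d (a - b)) \<le> (sqrt (nf b) * sqrt (nf (a - b))) * (norm (d b) * norm (d (a - b)))"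
   unfolding norm_mult mult.assoc[of "norm (kd b (a - b))"] by (intro mult_right_mono norm_kd_le) simp
  also have "\<dots> = (sqrt (nf b) * norm (d b)) * (sqrt (nf (a - b)) * norm (d (a - b)))" by (simp only: mult_ac)
  also have "\<dots> \<le> ((sqrt (nf b) * norm (d b))^2 + (sqrt (nf (a - b)) * norm (d (a - b)))^2) / 2"
   using sum_squares_bound[of "sqrt (nf b) * norm (d b)" "sqrt (nf (a - b)) * norm (d (a - b))"] by simp
  also have "\<dots> \<le> (?h b + ?h (a - b)) / 2" using nh[of b] nh[of "a - b"] by simp
  finally show "norm (kd b (a - b) * d b * d (a - b)) \<le> (?h b + ?h (a - b)) / 2" .
 qed
 also have "\<dots> = (sum ?h (sbox m) + (\<Sum>b\<in>sbox m. ?h (a - b))) / 2" by (simp only: sum_divide_distrib[symmetric] sum.distrib)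
 also have "sum ?h (sbox m) \<le> (LINT b|CS. ?h b)" by (rule sum_le_CS[OF hi]) simp_all
 also have "(\<Sum>b\<in>sbox m. ?h (a - b)) \<le> (LINT b|CS. ?h (a - b))"
  using hi by (intro sum_le_CS) (simp_all only: integrable_CS_shift(1)[of ?h a] finite_sbox mult_nonneg_nonneg zero_le_power2)
 also have "(LINT b|CS. ?h (a - b)) = (LINT b|CS. ?h b)" by (rule integrable_CS_shift(2)[of ?h a])
 finally show ?thesis by simp
qed

text \<open>In the difference the first factor has high frequency, where the first-order norm is a
  small fraction of the second-order norm, whose time integral is bounded. Thus convergence of the
  modes one at a time suffices for the quadratic term.\<close>

lemma Qn_tail:
 assumes \<delta>: "0 < \<delta>"
 shows "\<exists>m0. \<forall>m\<ge>m0. \<exists>n0. \<forall>n\<ge>n0. \<forall>t. norm (Qn n a t - S m (%b. Cn n b t) a) \<le> \<delta> * w 2 n t"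
proof -
 obtain \<kappa> where \<kappa>: "0 < \<kappa>" "!!a. a \<noteq> 0 ==> \<kappa> \<le> nf a" using nf_lower by blast
 \<comment> \<open>The threshold makes the product of the two factors below,
   \<open>\<kappa> * \<delta>^2\<close> for the high modes and \<open>1 / \<kappa>\<close> for all
   modes, equal to \<open>\<delta>^2\<close>.\<close>
 obtain m0 where m0: "!!a. a \<notin> sbox m0 ==> 1 / (\<kappa> * \<delta>^2) \<le> nf a" using nf_large by blast
 have step: "wsum P 1 d \<le> s * wsum P 2 d" if "0 < s" "!!b. b \<in> P ==> 1 / s \<le> nf b" for P d s
  unfolding wsum_def sum_distrib_left
 proof (rule sum_mono)
  fix b assume b: "b \<in> P"
  have "1 \<le> s * nf b" using that(2)[OF b] that(1) by (simp add: pos_divide_le_eq mult.commute)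
  hence "1 * (nf b * (norm (d b))^2) \<le> (s * nf b) * (nf b * (norm (d b))^2)"
   using nf_nonneg[of b] by (intro mult_right_mono) simp_all
  thus "nf b ^ 1 * (norm (d b))^2 \<le> s * (nf b ^ 2 * (norm (d b))^2)" by (simp add: power2_eq_square mult_ac)
 qed
 have "\<exists>n0. \<forall>n\<ge>n0. \<forall>t. norm (Qn n a t - S m (%b. Cn n b t) a) \<le> \<delta> * w 2 n t" if m: "m0 \<le> m" for m
 proof -
  have "finite (sbox m \<union> (%b. a - b) ` sbox m)" by simp
  then obtain n0 where n0: "\<forall>n\<ge>n0. sbox m \<union> (%b. a - b) ` sbox m \<subseteq> sbox (Nn n)" using eventually_sub by blast
  have "norm (Qn n a t - S m (%b. Cn n b t) a) \<le> \<delta> * w 2 n t" if n: "n0 \<le> n" for n t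
  proof -
   let ?d = "%b. Cn n b t"
   have sub: "b \<in> sbox (Nn n)" "a - b \<in> sbox (Nn n)" if "b \<in> sbox m" for b using n0 n that by blast+
   let ?R = "J n - JN m"
   have Jm: "JN m \<subseteq> J n" using sub(1) by (auto simp: JN_def)
   have "Qn n a t = qq (JN m \<union> ?R) (J n) ?d a" unfolding Qn_def using Jm by (simp add: Un_absorb1)
   also have "\<dots> = qq (JN m) (J n) ?d a + qq ?R (J n) ?d a" by (rule qq_Un1) (auto simp: finJ intro: finite_subset[OF Jm finJ])
   also have "qq (JN m) (J n) ?d a = (\<Sum>b\<in>JN m. kd b (a - b) * ?d b * ?d (a - b))" unfolding qq_def
   proof (rule sum.cong[OF refl])
    fix b assume b: "b \<in> JN m"
    show "(if a - b \<in> J n then kd b (a - b) * ?d b * ?d (a - b) else 0) = kd b (a - b) * ?d b * ?d (a - b)"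
    proof (cases "a - b = 0")
     case True
     have "kd b 0 = 0" by (simp add: kd_def mx_def my_def)
     thus ?thesis unfolding True by simp
    next
     case False
     hence "a - b \<in> J n" using sub(2)[of b] b by (simp add: JN_def)
     thus ?thesis by simp
    qed
   qed
   also have "(\<Sum>b\<in>JN m. kd b (a - b) * ?d b * ?d (a - b)) = S m ?d a" unfolding S_def sum_sbox by (simp add: kd_def mx_def my_def)
   finally have "Qn n a t - S m ?d a = qq ?R (J n) ?d a" by simp
   also have "norm \<dots> \<le> sqrt (wsum ?R 1 ?d) * sqrt (wsum (J n) 1 ?d)" by (rule qq_bound) (simp_all add: finJ)
   also have "\<dots> \<le> sqrt (\<kappa> * \<delta>^2 * w 2 n t) * sqrt ((1 / \<kappa>) * w 2 n t)"
   proof (intro mult_mono real_sqrt_le_mono)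
    have "wsum ?R 1 ?d \<le> \<kappa> * \<delta>^2 * wsum ?R 2 ?d"
    proof (rule step)
     fix b assume "b \<in> ?R"
     hence "b \<notin> sbox m0" using sbox_mono[OF m] by (auto simp: JN_def)
     thus "1 / (\<kappa> * \<delta>^2) \<le> nf b" by (rule m0)
    qed (use \<kappa> \<delta> in simp)
    also have "\<dots> \<le> \<kappa> * \<delta>^2 * w 2 n t"
     unfolding w_def using \<kappa>(1) by (intro mult_left_mono wsum_mono finJ) auto
    finally show "wsum ?R 1 ?d \<le> \<kappa> * \<delta>^2 * w 2 n t" .
    show "wsum (J n) 1 ?d \<le> (1 / \<kappa>) * w 2 n t" unfolding w_def
    proof (rule step)
     show "1 / (1 / \<kappa>) \<le> nf b" if "b \<in> J n" for b using \<kappa>(2)[of b] that by (simp add: JN_def)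
    qed (use \<kappa> in simp)
   qed (use \<kappa>(1) in \<open>simp_all add: wsum_nonneg w_nonneg\<close>)
   also have "\<dots> = sqrt ((\<kappa> * \<delta>^2 * w 2 n t) * ((1 / \<kappa>) * w 2 n t))" by (rule real_sqrt_mult[symmetric])
   also have "(\<kappa> * \<delta>^2 * w 2 n t) * ((1 / \<kappa>) * w 2 n t) = (\<delta> * w 2 n t)^2"
    using \<kappa>(1) by (simp add: power2_eq_square)
   also have "sqrt ((\<delta> * w 2 n t)^2) = \<delta> * w 2 n t" using \<delta> w_nonneg[of 2 n t] by simp
   finally show ?thesis .
  qed
  thus ?thesis by blast
 qed
 thus ?thesis by blast
qed

text \<open>The sums \<open>S m\<close> involve finitely many modes and pass to the limit in
  \<open>n\<close>; \<open>Qn_tail\<close> and the dissipation bound control the difference after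
  integration in time, and \<open>S_le\<close> gives the limit in \<open>m\<close>.\<close>

lemma Q_tendsto:
 fixes p :: "real => complex"
 assumes T: "0 < T" and p: "continuous_on UNIV p" and P: "!!t. t \<in> {0..T} ==> norm (p t) \<le> P"
 shows "integrable (Nt T) (%t. Qc (%b. g b t) a * p t)"
  "(%n. LINT t|Nt T. Qn n a t * p t) \<longlonglongrightarrow> (LINT t|Nt T. Qc (%b. g b t) a * p t)"
proof -
 have P0: "0 \<le> P" using order_trans[OF norm_ge_zero P[of 0]] T by simp
 have pS: "continuous_on X p" for X by (rule continuous_on_subset[OF p]) simp
 have Sg: "continuous_on UNIV (%t. S m (%b. g b t) a * p t)" for m unfolding S_def by (intro continuous_intros g_cont p)
 have SC: "continuous_on X (%t. S m (%b. Cn n b t) a * p t)" for m n X unfolding S_def by (intro continuous_intros contC' pS)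
 have QC: "continuous_on X (%t. Qn n a t * p t)" for n X by (intro continuous_intros Qn_cont pS)
 have mQ: "(%t. Qc (%b. g b t) a * p t) \<in> borel_measurable (Nt T)" unfolding Qc_def conv_def
  by (intro borel_measurable_times borel_measurable_add measurable_LINT_CS measurable_Nt borel_measurable_continuous_onI continuous_intros g_cont p)
 have mS: "(%t. S m (%b. g b t) a * p t) \<in> borel_measurable (Nt T)" for m
  by (intro measurable_Nt borel_measurable_continuous_onI Sg)
 have wi: "integrable (Nt T) (%t. P * R.KK t)" by (intro integrable_mult_right R.KK_integrable)
 have l: "AE t in Nt T. (%m. S m (%b. g b t) a * p t) \<longlonglongrightarrow> Qc (%b. g b t) a * p t" using R.AE_good[of T]
 proof eventually_elim
  case (elim t)
  thus ?case by (intro tendsto_mult_right S_Qc) (simp add: R.good_def)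
 qed
 have b: "AE t in Nt T. norm (S m (%b. g b t) a * p t) \<le> P * R.KK t" for m using R.AE_good[of T] AE_space
 proof eventually_elim
  case (elim t)
  have "norm (S m (%b. g b t) a) \<le> R.KK t" unfolding R.KK_def R.good_d[OF elim(1)] using elim(1) by (intro S_le) (simp add: R.good_def)
  moreover have "norm (p t) \<le> P" using elim(2) by (intro P) (simp add: space_Nt)
  ultimately have "norm (S m (%b. g b t) a) * norm (p t) \<le> R.KK t * P" using R.KK_nonneg[of t] by (intro mult_mono) simp_all
  thus ?case by (simp add: norm_mult mult.commute)
 qed
 show "integrable (Nt T) (%t. Qc (%b. g b t) a * p t)" by (rule integrable_dominated_convergence[OF mQ mS wi l b])
 show "(%n. LINT t|Nt T. Qn n a t * p t) \<longlonglongrightarrow> (LINT t|Nt T. Qc (%b. g b t) a * p t)"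
 proof (rule tendsto_interchange[where y = "%m n. LINT t|Nt T. S m (%b. Cn n b t) a * p t" and z = "%m. LINT t|Nt T. S m (%b. g b t) a * p t"])
  show "(%m. LINT t|Nt T. S m (%b. g b t) a * p t) \<longlonglongrightarrow> (LINT t|Nt T. Qc (%b. g b t) a * p t)"
   by (rule integral_dominated_convergence[OF mQ mS wi l b])
  show "(%n. LINT t|Nt T. S m (%b. Cn n b t) a * p t) \<longlonglongrightarrow> (LINT t|Nt T. S m (%b. g b t) a * p t)" for m
  proof (rule Nt_dominated(2)[where C = "(\<Sum>b\<in>sbox m. norm (kd b (a - b)) * B b T * B (a - b) T) * P"])
   show "continuous_on UNIV (%t. S m (%b. Cn n b t) a * p t)" for n by (rule SC)
   fix t :: real assume t: "0 \<le> t" "t < T"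
   show "(%n. S m (%b. Cn n b t) a * p t) \<longlonglongrightarrow> S m (%b. g b t) a * p t"
    unfolding S_def by (intro tendsto_intros limC)
   fix n
   have "norm (S m (%b. Cn n b t) a) \<le> (\<Sum>b\<in>sbox m. norm (kd b (a - b)) * B b T * B (a - b) T)" unfolding S_def
   proof (rule sum_norm_le)
    fix b
    show "norm (kd b (a - b) * Cn n b t * Cn n (a - b) t) \<le> norm (kd b (a - b)) * B b T * B (a - b) T"
     unfolding norm_mult using t T by (intro mult_mono B_bound mult_nonneg_nonneg B_nonneg) simp_all
   qed
   moreover have "norm (p t) \<le> P" using t by (intro P) simp
   ultimately show "norm (S m (%b. Cn n b t) a * p t) \<le> (\<Sum>b\<in>sbox m. norm (kd b (a - b)) * B b T * B (a - b) T) * P"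
    unfolding norm_mult using T by (intro mult_mono) (simp_all add: sum_nonneg B_nonneg)
  qed
  fix r :: real assume r: "0 < r"
  define \<delta> where "\<delta> = r / (P * (K * (1 + T)) + 1)"
  have D: "0 < P * (K * (1 + T)) + 1" using P0 K T by (intro add_nonneg_pos mult_nonneg_nonneg) simp_all
  have \<delta>: "0 < \<delta>" using r D by (simp add: \<delta>_def)
  have \<delta>r: "\<delta> * (P * (K * (1 + T))) \<le> r"
  proof -
   have "\<delta> * (P * (K * (1 + T))) \<le> \<delta> * (P * (K * (1 + T)) + 1)" using \<delta> by (intro mult_left_mono) simp_all
   also have "\<dots> = r" unfolding \<delta>_def using D by (metis less_irrefl nonzero_eq_divide_eq)
   finally show ?thesis .
  qed
  have est: "norm ((LINT t|Nt T. Qn n a t * p t) - (LINT t|Nt T. S m (%b. Cn n b t) a * p t)) \<le> r"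
   if h: "\<forall>t. norm (Qn n a t - S m (%b. Cn n b t) a) \<le> \<delta> * w 2 n t" for m n
  proof -
   have "(LINT t|Nt T. Qn n a t * p t) - (LINT t|Nt T. S m (%b. Cn n b t) a * p t)
    = integral {0..T} (%t. Qn n a t * p t) - integral {0..T} (%t. S m (%b. Cn n b t) a * p t)"
    by (simp only: integral_Nt(2)[OF QC] integral_Nt(2)[OF SC])
   also have "\<dots> = integral {0..T} (%t. Qn n a t * p t - S m (%b. Cn n b t) a * p t)"
    by (rule Henstock_Kurzweil_Integration.integral_diff[symmetric]) (intro integrable_continuous_real QC SC)+
   also have "norm \<dots> \<le> integral {0..T} (%t. \<delta> * P * w 2 n t)"
   proof (intro integral_norm_bound_integral integrable_continuous_real continuous_on_diff QC SC continuous_on_mult continuous_on_const w_cont)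
    fix t assume t: "t \<in> {0..T}"
    have "norm (Qn n a t * p t - S m (%b. Cn n b t) a * p t) = norm (Qn n a t - S m (%b. Cn n b t) a) * norm (p t)"
     by (simp only: left_diff_distrib[symmetric] norm_mult)
    also have "\<dots> \<le> (\<delta> * w 2 n t) * P" using h \<delta> w_nonneg[of 2 n t] by (intro mult_mono P t) simp_all
    finally show "norm (Qn n a t * p t - S m (%b. Cn n b t) a * p t) \<le> \<delta> * P * w 2 n t" by (simp add: mult_ac)
   qed
   also have "\<dots> = \<delta> * P * integral {0..T} (w 2 n)" by simp
   also have "\<dots> \<le> \<delta> * P * (K * (1 + T))"
    using bound2[of T n] T \<delta> P0 unfolding w_def[abs_def] by (intro mult_left_mono) simp_all
   finally show ?thesis using \<delta>r by (simp add: mult.assoc)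
  qed
  obtain m0 where m0: "\<forall>m\<ge>m0. \<exists>n0. \<forall>n\<ge>n0. \<forall>t. norm (Qn n a t - S m (%b. Cn n b t) a) \<le> \<delta> * w 2 n t"
   using Qn_tail[OF \<delta>] by blast
  show "\<exists>m0. \<forall>m\<ge>m0. \<exists>n0. \<forall>n\<ge>n0. norm ((LINT t|Nt T. Qn n a t * p t) - (LINT t|Nt T. S m (%b. Cn n b t) a * p t)) \<le> r"
  proof (rule exI[of _ m0], intro allI impI)
   fix m assume "m0 \<le> m"
   then obtain n0 where "\<forall>n\<ge>n0. \<forall>t. norm (Qn n a t - S m (%b. Cn n b t) a) \<le> \<delta> * w 2 n t" using m0 by blast
   thus "\<exists>n0. \<forall>n\<ge>n0. norm ((LINT t|Nt T. Qn n a t * p t) - (LINT t|Nt T. S m (%b. Cn n b t) a * p t)) \<le> r"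
    using est by blast
  qed
 qed
qed

lemma integral_comb4:
 fixes f1 f2 f3 f4 :: "'a => complex"
 assumes "integrable N f1" "integrable N f2" "integrable N f3" "integrable N f4"
 shows "(LINT z|N. - f1 z + (f2 z + r * f3 z + s * f4 z)) = - (LINT z|N. f1 z) + ((LINT z|N. f2 z) + r * (LINT z|N. f3 z) + s * (LINT z|N. f4 z))"
 using assms by simp

text \<open>For finite \<open>n\<close> the identity is integration by parts in time, and each of
  its terms converges.\<close>

lemma limit_equation:
 fixes p p' :: "real => complex"
 assumes T: "0 < T" and p: "!!t. (p has_vector_derivative p' t) (at t)" and p': "continuous_on UNIV p'" and pT: "p T = 0"
 shows "(LINT t|Nt T. - g a t * p' t + Fc u \<nu> (%b. g b t) a * p t) = g a 0 * p 0"
proof -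
 have pc: "continuous_on UNIV p" by (intro continuous_at_imp_continuous_on ballI has_vector_derivative_continuous[OF p])
 have cS: "continuous_on X p" "continuous_on X p'" for X using continuous_on_subset[OF pc] continuous_on_subset[OF p'] by simp_all
 have "compact (p ` {0..T})" "compact (p' ` {0..T})" by (intro compact_continuous_image cS compact_Icc)+
 then obtain P P' where PP: "\<forall>x\<in>p ` {0..T}. norm x \<le> P" "\<forall>x\<in>p' ` {0..T}. norm x \<le> P'"
  using compact_imp_bounded bounded_iff by metis
 have P: "norm (p t) \<le> P" "norm (p' t) \<le> P'" if "t \<in> {0..T}" for t using PP that by blast+
 let ?r = "complex_of_real (\<nu> * ((nf a)^2 - nf a))" and ?s = "complex_of_real (\<nu> / 2)"
 let ?L = "%t. mx a * conv (%b. g b t) (Uc u) a"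
 have C: "(%n. LINT t|Nt T. Cn n a t * q t) \<longlonglongrightarrow> (LINT t|Nt T. g a t * q t)" "integrable (Nt T) (%t. g a t * q t)"
  if q: "continuous_on UNIV q" "!!t. t \<in> {0..T} ==> norm (q t) \<le> Q" for q Q
 proof -
  have b: "norm (Cn n a t * q t) \<le> B a T * Q" if "0 \<le> t" "t < T" for n t
   unfolding norm_mult using that T by (intro mult_mono B_bound q(2) B_nonneg) simp_all
  note D = Nt_dominated[of "%n t. Cn n a t * q t" T "B a T * Q" "%t. g a t * q t"]
  show "(%n. LINT t|Nt T. Cn n a t * q t) \<longlonglongrightarrow> (LINT t|Nt T. g a t * q t)"
   by (rule D(2)) (intro continuous_on_mult contC q(1) b tendsto_mult_right limC; assumption)+
  show "integrable (Nt T) (%t. g a t * q t)" by (intro integral_Nt(1) continuous_on_mult g_cont q(1))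
 qed
 have Lb: "norm (lin n a t * p t) \<le> norm (mx a) * (sqrt K * sqrt (MU a)) * P" if "0 \<le> t" "t < T" for n t
  unfolding norm_mult using that K MU0 by (intro mult_mono lin_le P(1)) simp_all
 have L: "(%n. LINT t|Nt T. lin n a t * p t) \<longlonglongrightarrow> (LINT t|Nt T. ?L t * p t)" "integrable (Nt T) (%t. ?L t * p t)"
 proof -
  note D = Nt_dominated[of "%n t. lin n a t * p t" T "norm (mx a) * (sqrt K * sqrt (MU a)) * P" "%t. ?L t * p t"]
  show "(%n. LINT t|Nt T. lin n a t * p t) \<longlonglongrightarrow> (LINT t|Nt T. ?L t * p t)"
   by (rule D(2)) (intro continuous_on_mult lin_cont pc Lb tendsto_mult_right lin_tendsto; assumption)+
  show "integrable (Nt T) (%t. ?L t * p t)"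
   by (rule D(1)) (intro continuous_on_mult lin_cont pc Lb tendsto_mult_right lin_tendsto; assumption)+
 qed
 note Q = Q_tendsto[OF T pc P(1), of a]
 let ?X = "%n. - (LINT t|Nt T. Cn n a t * p' t) + ((LINT t|Nt T. lin n a t * p t) + ?r * (LINT t|Nt T. Cn n a t * p t) + ?s * (LINT t|Nt T. Qn n a t * p t))"
 have "?X \<longlonglongrightarrow> - (LINT t|Nt T. g a t * p' t) + ((LINT t|Nt T. ?L t * p t) + ?r * (LINT t|Nt T. g a t * p t) + ?s * (LINT t|Nt T. Qc (%b. g b t) a * p t))"
  by (intro tendsto_add tendsto_minus tendsto_mult_left C(1)[OF p' P(2)] C(1)[OF pc P(1)] L(1) Q(2))
 moreover have "?X \<longlonglongrightarrow> c0 a * p 0"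
 proof (rule tendsto_eventually)
  obtain n0 where n0: "\<forall>n\<ge>n0. {a} \<subseteq> sbox (Nn n)" using eventually_sub[of "{a}"] by auto
  have "?X n = c0 a * p 0" if n: "n0 \<le> n" for n
  proof -
   have a: "a \<in> sbox (Nn n)" using n0 n by simp
   have "?X n = (LINT t|Nt T. - (Cn n a t * p' t) + (lin n a t * p t + ?r * (Cn n a t * p t) + ?s * (Qn n a t * p t)))"
    by (rule integral_comb4[symmetric]) (intro integral_Nt(1) continuous_on_mult contC' lin_cont Qn_cont cS)+
   also have "\<dots> = (LINT t|Nt T. - (Cn n a t * p' t - Fn n a t * p t))"
    unfolding Fn_def by (intro arg_cong[where f = "integral\<^sup>L (Nt T)"] ext) (simp add: algebra_simps)
   also have "\<dots> = integral {0..T} (%t. - (Cn n a t * p' t - Fn n a t * p t))"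
    by (intro integral_Nt(2) continuous_intros contC' Fn_cont cS)
   also have "\<dots> = - (Cn n a T * p T - Cn n a 0 * p 0)"
   proof (rule integral_unique, rule has_integral_neg, rule fundamental_theorem_of_calculus)
    fix t assume t: "t \<in> {0..T}"
    have "((%t. Cn n a t * p t) has_vector_derivative (Cn n a t * p' t + (- Fn n a t) * p t)) (at t within {0..T})"
     by (intro has_vector_derivative_mult ode' a t has_vector_derivative_at_within[OF p])
    thus "((%t. Cn n a t * p t) has_vector_derivative (Cn n a t * p' t - Fn n a t * p t)) (at t within {0..T})" by simp
   qed (use T in simp)
   also have "\<dots> = c0 a * p 0" using pT ini[OF a] by simp
   finally show ?thesis .
  qed
  thus "eventually (%n. ?X n = c0 a * p 0) sequentially" by (rule eventually_sequentiallyI)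
 qed
 ultimately have "- (LINT t|Nt T. g a t * p' t) + ((LINT t|Nt T. ?L t * p t) + ?r * (LINT t|Nt T. g a t * p t) + ?s * (LINT t|Nt T. Qc (%b. g b t) a * p t)) = c0 a * p 0"
  by (rule LIMSEQ_unique)
 moreover have "(LINT t|Nt T. - g a t * p' t + Fc u \<nu> (%b. g b t) a * p t)
   = (LINT t|Nt T. - (g a t * p' t) + (?L t * p t + ?r * (g a t * p t) + ?s * (Qc (%b. g b t) a * p t)))"
  unfolding Fc_def by (intro arg_cong[where f = "integral\<^sup>L (Nt T)"] ext) (simp add: algebra_simps)
 moreover have "\<dots> = - (LINT t|Nt T. g a t * p' t) + ((LINT t|Nt T. ?L t * p t) + ?r * (LINT t|Nt T. g a t * p t) + ?s * (LINT t|Nt T. Qc (%b. g b t) a * p t))"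
  by (rule integral_comb4[OF C(2)[OF p' P(2)] L(2) C(2)[OF pc P(1)] Q(1)])
 ultimately show ?thesis by (simp only: g_0)
qed

sublocale W: spectral_solution L1 L2 g u \<nu> \<phi>0 by unfold_locales (assumption | rule u_cont init limit_equation | simp only: g_0 init(2))+

end

section \<open>Existence\<close>

lemma continuous_on_half_line:
 fixes f :: "real => 'b::topological_space"
 assumes "!!T. continuous_on {0..T} f"
 shows "continuous_on {0..} f" unfolding continuous_on_eq_continuous_within
proof
 fix x :: real assume x: "x \<in> {0..}"
 have "at x within {0..} = at x within {0..x + 1}" by (rule at_within_nhd[where S = "{..<x + 1}"]) auto
 thus "continuous (at x within {0..}) f" using assms[of "x + 1"] x unfolding continuous_on_eq_continuous_within continuous_within by simp
qed

context torus2
begin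

lemma kd_uminus: "kd (- b) (- c) = kd b c" and cnj_kd: "cnj (kd b c) = kd b c" by (simp_all add: kd_def mx_def my_def)

lemma qq_cong: "(!!b. b \<in> J ==> d b = d' b) ==> qq J J d a = qq J J d' a"
 unfolding qq_def by (intro sum.cong refl if_cong) simp_all

lemma qq_uminus:
 assumes um: "!!a. - a \<in> J \<longleftrightarrow> a \<in> J" and h: "!!a. a \<in> J ==> d (- a) = cnj (d a)"
 shows "qq J J d (- a) = cnj (qq J J d a)"
proof -
 have "cnj (qq J J d a) = (\<Sum>b\<in>J. if a - b \<in> J then kd b (a - b) * d (- b) * d (- (a - b)) else 0)" unfolding qq_def cnj_sum
 proof (rule sum.cong[OF refl])
  fix b assume b: "b \<in> J"
  show "cnj (if a - b \<in> J then kd b (a - b) * d b * d (a - b) else 0) = (if a - b \<in> J then kd b (a - b) * d (- b) * d (- (a - b)) else 0)"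
  proof (cases "a - b \<in> J")
   case True
   show ?thesis unfolding if_P[OF True] h[OF b] h[OF True] by (simp add: cnj_kd)
  qed simp
 qed
 also have "\<dots> = qq J J d (- a)" unfolding qq_def
 proof (rule sum.reindex_bij_witness[where i = uminus and j = uminus])
  fix b assume b: "b \<in> J"
  have e: "- a - (- b) = - (a - b)" by simp
  show "(if - a - - b \<in> J then kd (- b) (- a - - b) * d (- b) * d (- a - - b) else 0)
   = (if a - b \<in> J then kd b (a - b) * d (- b) * d (- (a - b)) else 0)" unfolding e um kd_uminus ..
 qed (simp_all add: um)
 finally show ?thesis by simp
qed

end

context shear_flow
begin

lemma Gv_cong: "(!!b. b \<in> J ==> d b = d' b) ==> d a = d' a ==> Gv A J d a = Gv A J d' a"
 unfolding Gv_def using qq_cong[of J d d' a] by simp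

lemma Gv_uminus:
 assumes J: "adm J" and h: "!!a. a \<in> J ==> d (- a) = cnj (d a)" and a: "a \<in> J"
 shows "Gv A J d (- a) = cnj (Gv A J d a)"
proof -
 have um: "- a \<in> J \<longleftrightarrow> a \<in> J" for a using J unfolding adm_def by (metis (no_types, opaque_lifting) add.inverse_inverse imageI)
 have "(\<Sum>b\<in>J. d b * Ud (- a - b)) = (\<Sum>b\<in>J. cnj (d b) * cnj (Ud (a - b)))"
 proof (rule sum.reindex_bij_witness[where i = uminus and j = uminus])
  fix b assume b: "b \<in> J"
  have e: "- a - b = - (a - - b)" by simp
  show "cnj (d (- b)) * cnj (Ud (a - - b)) = d b * Ud (- a - b)" unfolding e U1 h[OF b] by simp
 qed (simp_all add: um)
 hence "(\<Sum>b\<in>J. d b * Ud (- a - b)) = cnj (\<Sum>b\<in>J. d b * Ud (a - b))" by simp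
 moreover have "nf (- a) = nf a" "mx (- a) = cnj (mx a)" by (simp_all add: nf_def mx_def)
 moreover have "qq J J d (- a) = cnj (qq J J d a)" by (intro qq_uminus um h)
 ultimately show ?thesis unfolding Gv_def by (simp add: h[OF a])
qed

lemma Gv_lipschitz:
 assumes J: "finite J"
 shows "\<exists>L\<ge>0. \<forall>x y. (\<forall>j\<in>J. norm (x j) \<le> B \<and> norm (y j) \<le> B) --> (\<forall>i\<in>J. norm (Gv A J x i - Gv A J y i) \<le> L * (\<Sum>j\<in>J. norm (x j - y j)))"
proof -
 define l where "l i = \<bar>(nf i)^2 - nf i\<bar> + (\<Sum>b\<in>J. norm (kd b (i - b)) * \<bar>B\<bar>) + \<bar>A\<bar> * norm (mx i) * (\<Sum>b\<in>J. norm (Ud (i - b)))" for i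
 have l0: "0 \<le> l i" for i unfolding l_def by (intro add_nonneg_nonneg mult_nonneg_nonneg sum_nonneg) simp_all
 have main: "norm (Gv A J x i - Gv A J y i) \<le> l i * (\<Sum>j\<in>J. norm (x j - y j))"
  if b: "\<forall>j\<in>J. norm (x j) \<le> B \<and> norm (y j) \<le> B" and i: "i \<in> J" for x y i
 proof -
  let ?S = "\<Sum>j\<in>J. norm (x j - y j)"
  have S: "norm (x j - y j) \<le> ?S" if "j \<in> J" for j by (rule member_le_sum[OF that _ J]) simp
  have S0: "0 \<le> ?S" by (intro sum_nonneg) simp
  have q: "norm (qq J J x i - qq J J y i) \<le> (\<Sum>b\<in>J. norm (kd b (i - b)) * (2 * \<bar>B\<bar> * ?S))"
   unfolding qq_def sum_subtractf[symmetric]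
  proof (rule sum_norm_le)
   fix b assume bJ: "b \<in> J"
   show "norm ((if i - b \<in> J then kd b (i - b) * x b * x (i - b) else 0) - (if i - b \<in> J then kd b (i - b) * y b * y (i - b) else 0))
    \<le> norm (kd b (i - b)) * (2 * \<bar>B\<bar> * ?S)"
   proof (cases "i - b \<in> J")
    case True
    have "norm (x b * (x (i - b) - y (i - b)) + (x b - y b) * y (i - b)) \<le> norm (x b) * norm (x (i - b) - y (i - b)) + norm (x b - y b) * norm (y (i - b))"
     by (rule order_trans[OF norm_triangle_ineq]) (simp add: norm_mult)
    also have "\<dots> \<le> \<bar>B\<bar> * ?S + ?S * \<bar>B\<bar>"
    proof (intro add_mono mult_mono S bJ True S0)
     show "norm (x b) \<le> \<bar>B\<bar>" "norm (y (i - b)) \<le> \<bar>B\<bar>" using b bJ True by (meson abs_ge_self order_trans)+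
    qed simp_all
    finally have "norm (kd b (i - b)) * norm (x b * (x (i - b) - y (i - b)) + (x b - y b) * y (i - b)) \<le> norm (kd b (i - b)) * (2 * \<bar>B\<bar> * ?S)"
     by (intro mult_left_mono) simp_all
    moreover have "kd b (i - b) * x b * x (i - b) - kd b (i - b) * y b * y (i - b) = kd b (i - b) * (x b * (x (i - b) - y (i - b)) + (x b - y b) * y (i - b))"
     by (simp add: algebra_simps)
    ultimately show ?thesis using True by (simp add: norm_mult)
   next
    case False
    thus ?thesis using S0 by simp
   qed
  qed
  have t: "norm ((\<Sum>b\<in>J. x b * Ud (i - b)) - (\<Sum>b\<in>J. y b * Ud (i - b))) \<le> (\<Sum>b\<in>J. ?S * norm (Ud (i - b)))"
   unfolding sum_subtractf[symmetric] left_diff_distrib[symmetric] by (rule sum_norm_le) (simp add: norm_mult mult_right_mono S)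
  have "Gv A J x i - Gv A J y i = - of_real ((nf i)^2 - nf i) * (x i - y i) - (1 / 2) * (qq J J x i - qq J J y i)
    - of_real A * (mx i * ((\<Sum>b\<in>J. x b * Ud (i - b)) - (\<Sum>b\<in>J. y b * Ud (i - b))))" unfolding Gv_def by (simp add: algebra_simps)
  also have "norm \<dots> \<le> norm (- of_real ((nf i)^2 - nf i) * (x i - y i)) + norm ((1 / 2) * (qq J J x i - qq J J y i))
    + norm (of_real A * (mx i * ((\<Sum>b\<in>J. x b * Ud (i - b)) - (\<Sum>b\<in>J. y b * Ud (i - b)))))"
   by (intro order_trans[OF norm_triangle_ineq4] add_right_mono norm_triangle_ineq4)
  also have "\<dots> = \<bar>(nf i)^2 - nf i\<bar> * norm (x i - y i) + (1 / 2) * norm (qq J J x i - qq J J y i)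
    + \<bar>A\<bar> * norm (mx i) * norm ((\<Sum>b\<in>J. x b * Ud (i - b)) - (\<Sum>b\<in>J. y b * Ud (i - b)))"
   unfolding norm_mult norm_minus_cancel norm_of_real by simp
  also have "\<dots> \<le> \<bar>(nf i)^2 - nf i\<bar> * ?S + (1 / 2) * (\<Sum>b\<in>J. norm (kd b (i - b)) * (2 * \<bar>B\<bar> * ?S))
    + \<bar>A\<bar> * norm (mx i) * (\<Sum>b\<in>J. ?S * norm (Ud (i - b)))" by (intro add_mono mult_left_mono q t S i) simp_all
  also have "\<dots> = l i * ?S"
  proof -
   have e: "(\<Sum>b\<in>J. norm (kd b (i - b)) * (2 * \<bar>B\<bar> * s)) = 2 * (\<Sum>b\<in>J. norm (kd b (i - b)) * \<bar>B\<bar>) * s"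
    "(\<Sum>b\<in>J. s * norm (Ud (i - b))) = (\<Sum>b\<in>J. norm (Ud (i - b))) * s" for s
    unfolding sum_distrib_left sum_distrib_right by (intro sum.cong refl; simp)+
   show ?thesis unfolding l_def e by (simp add: distrib_right)
  qed
  finally show ?thesis .
 qed
 have "l i \<le> (\<Sum>i\<in>J. l i)" if "i \<in> J" for i by (rule member_le_sum[OF that l0 J])
 hence "norm (Gv A J x i - Gv A J y i) \<le> (\<Sum>i\<in>J. l i) * (\<Sum>j\<in>J. norm (x j - y j))"
  if "\<forall>j\<in>J. norm (x j) \<le> B \<and> norm (y j) \<le> B" "i \<in> J" for x y i
  using order_trans[OF main[OF that] mult_right_mono] that(2) by (simp add: sum_nonneg)
 moreover have "0 \<le> (\<Sum>i\<in>J. l i)" by (intro sum_nonneg l0)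
 ultimately show ?thesis by blast
qed

end

context shear_profile
begin

lemma uminus_JN: "- a \<in> JN N \<longleftrightarrow> a \<in> JN N"
 using adm_JN[of N] unfolding adm_def by (metis (no_types, opaque_lifting) add.inverse_inverse imageI)

lemma galerkin_exists:
 assumes bnd: "!!T c t. 0 \<le> t ==> t \<le> T ==> gal A N T c ==> wsum (JN N) 0 (%b. c b 0) \<le> \<rho> ==> wsum (JN N) 0 (%b. c b t) \<le> K"
  and K: "0 \<le> K" and h0: "!!a. c0 (- a) = cnj (c0 a)" and c0: "wsum (JN N) 0 c0 \<le> \<rho>"
 shows "\<exists>c. (\<forall>a\<in>JN N. c a 0 = c0 a) \<and> (\<forall>T. gal A N T c)"
proof -
 have ap: "norm (x i t) \<le> sqrt K"
  if x0: "!!i. i \<in> JN N ==> x i 0 = c0 i" and sy: "!!i t. i \<in> JN N ==> t \<in> {0..T} ==> x (- i) t = cnj (x i t)"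
   and de: "!!i t. i \<in> JN N ==> t \<in> {0..T} ==> (x i has_vector_derivative Gv A (JN N) (%j. x j t) i) (at t within {0..T})"
   and i: "i \<in> JN N" and t: "t \<in> {0..T}" for T x i t
 proof (rule real_le_rsqrt)
  have g: "gal A N T x" unfolding gal_def using sy de by blast
  have "wsum (JN N) 0 (%b. x b 0) = wsum (JN N) 0 c0" unfolding wsum_def by (intro sum.cong refl) (simp add: x0)
  hence "wsum (JN N) 0 (%b. x b t) \<le> K" using t c0 by (intro bnd[OF _ _ g]) simp_all
  moreover have "(norm (x i t))^2 \<le> (\<Sum>b\<in>JN N. (norm (x b t))^2)" by (rule member_le_sum[OF i]) (simp_all add: finite_JN)
  ultimately show "(norm (x i t))^2 \<le> K" by (simp add: wsum_def)
 qed
 have "\<exists>x. (\<forall>i\<in>JN N. x i 0 = c0 i) \<and> (\<forall>i\<in>JN N. \<forall>t\<ge>0. x (- i) t = cnj (x i t)) \<and>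
   (\<forall>i\<in>JN N. \<forall>T. \<forall>t\<in>{0..T}. (x i has_vector_derivative Gv A (JN N) (%j. x j t) i) (at t within {0..T}))"
 proof (rule ODE_global[where \<sigma> = uminus and f = "Gv A (JN N)" and I = "JN N" and ?B0.0 = "sqrt K"])
  show "\<exists>L\<ge>0. \<forall>x y. (\<forall>j\<in>JN N. norm (x j) \<le> B \<and> norm (y j) \<le> B) -->
    (\<forall>i\<in>JN N. norm (Gv A (JN N) x i - Gv A (JN N) y i) \<le> L * (\<Sum>j\<in>JN N. norm (x j - y j)))" for B
   by (rule Gv_lipschitz[OF finite_JN])
  show "Gv A (JN N) x (- i) = cnj (Gv A (JN N) x i)" if "!!j. j \<in> JN N ==> x (- j) = cnj (x j)" "i \<in> JN N" for x i
   by (intro Gv_uminus adm_JN that)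
 next
  fix T x i t
  assume "!!i. i \<in> JN N ==> x i 0 = c0 i" "!!i t. i \<in> JN N ==> t \<in> {0..T} ==> x (- i) t = cnj (x i t)"
   "!!i t. i \<in> JN N ==> t \<in> {0..T} ==> (x i has_vector_derivative Gv A (JN N) (%j. x j t) i) (at t within {0..T})"
   "i \<in> JN N" "t \<in> {0..T}"
  thus "norm (x i t) \<le> sqrt K" by (rule ap)
 qed (use K in \<open>simp_all add: finite_JN uminus_JN h0\<close>)
 thus ?thesis unfolding gal_def by (metis atLeastAtMost_iff)
qed

text \<open>Adjoins the mean: the linear terms vanish at frequency 0, so mode 0 is obtained by
  integrating the quadratic term alone.\<close>

definition zext :: "coeffs => nat => (int \<times> int => real => complex) => int \<times> int => real => complex" where
 "zext c0 N c a s = (if a \<in> JN N then c a s else if a = 0 then c0 0 - (1 / 2) * integral {0..s} (%r. qq (JN N) (JN N) (%b. c b r) 0) else 0)"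

lemma gal_continuous: "gal A N T c ==> a \<in> JN N ==> continuous_on {0..T} (c a)"
 by (intro continuous_on_vector_derivative[of _ _ "%t. Gv A (JN N) (%b. c b t) a"] gal_deriv[where T = T]) simp_all

lemma zext_deriv:
 assumes g: "gal A N T c" and a: "a \<in> sbox N" and s: "s \<in> {0..T}"
 shows "(zext c0 N c a has_vector_derivative Gv A (JN N) (%b. zext c0 N c b s) a) (at s within {0..T})"
proof -
 have J: "zext c0 N c b = c b" if "b \<in> JN N" for b using that by (simp add: zext_def fun_eq_iff)
 show ?thesis
 proof (cases "a \<in> JN N")
  case True
  have "Gv A (JN N) (%b. zext c0 N c b s) a = Gv A (JN N) (%b. c b s) a" by (rule Gv_cong) (simp_all add: J True)
  thus ?thesis unfolding J[OF True] using gal_deriv[OF g True order_refl order_refl s] by simp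
 next
  case False
  hence a0: "a = 0" using a by (simp add: JN_def)
  let ?q = "%r. qq (JN N) (JN N) (%b. c b r) 0"
  have qc: "continuous_on {0..T} ?q" unfolding qq_def
  proof (intro continuous_on_sum)
   fix b assume b: "b \<in> JN N"
   show "continuous_on {0..T} (%r. if 0 - b \<in> JN N then kd b (0 - b) * c b r * c (0 - b) r else 0)"
   proof (cases "0 - b \<in> JN N")
    case True
    show ?thesis unfolding if_P[OF True] by (intro continuous_intros gal_continuous[OF g] b True)
   qed simp
  qed
  have e: "zext c0 N c a = (%s. c0 0 - (1 / 2) * integral {0..s} ?q)" using False a0 by (simp add: zext_def fun_eq_iff)
  have "qq (JN N) (JN N) (%b. zext c0 N c b s) 0 = ?q s" by (rule qq_cong) (simp add: J)
  hence G: "Gv A (JN N) (%b. zext c0 N c b s) a = 0 - (1 / 2) * ?q s" unfolding Gv_def a0 by (simp add: nf_def mx_def)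
  show ?thesis unfolding e G
   by (intro has_vector_derivative_diff has_vector_derivative_const has_vector_derivative_mult_right integral_has_vector_derivative[OF qc s])
 qed
qed

text \<open>Returns from the rescaled time to the original one. \<open>A0\<close> is chosen from
  \<open>\<rho>\<close> alone, before \<open>\<nu>\<close> and \<open>c0\<close>, whereas the
  constant \<open>K\<close> of the family may depend on \<open>\<nu>\<close>.\<close>

lemma galerkin_family_exists:
 assumes L: "L2 < 2 * pi" and \<rho>: "0 \<le> \<rho>"
 shows "\<exists>A0. \<forall>\<nu> c0. 0 < \<nu> \<and> A0 \<le> 1 / \<nu> \<and> (\<forall>a. c0 (- a) = cnj (c0 a)) \<and> (\<forall>N. wsum (JN N) 0 c0 \<le> \<rho>) -->
  (\<exists>Cn Nn K. galerkin_family L1 L2 u \<nu> Cn Nn c0 K)"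
proof -
 obtain A0 N0 K where K: "0 \<le> K" and bnd0: "\<forall>A\<ge>A0. \<forall>N\<ge>N0. \<forall>T c t. 0 \<le> t \<and> t \<le> T \<and> gal A N T c \<and> wsum (JN N) 0 (%b. c b 0) \<le> \<rho> -->
  wsum (JN N) 0 (%b. c b t) \<le> K \<and> integral {0..t} (%r. wsum (JN N) 2 (%b. c b r)) \<le> K * (1 + t)"
  using galerkin_bound[OF L \<rho>] by (elim exE conjE) (rule that)
 have bnd: "wsum (JN N) 0 (%b. c b t) \<le> K" "integral {0..t} (%r. wsum (JN N) 2 (%b. c b r)) \<le> K * (1 + t)"
  if "A0 \<le> A" "N0 \<le> N" "0 \<le> t" "t \<le> T" "gal A N T c" "wsum (JN N) 0 (%b. c b 0) \<le> \<rho>" for A N T c t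
  using bnd0 that by blast+
 have "\<exists>Cn Nn K. galerkin_family L1 L2 u \<nu> Cn Nn c0 K"
  if \<nu>: "0 < \<nu>" and A: "A0 \<le> 1 / \<nu>" and h0: "!!a. c0 (- a) = cnj (c0 a)" and c0: "!!N. wsum (JN N) 0 c0 \<le> \<rho>" for \<nu> c0
 proof -
  have "\<exists>c. (\<forall>a\<in>JN (N0 + n). c a 0 = c0 a) \<and> (\<forall>T. gal (1 / \<nu>) (N0 + n) T c)" for n
  proof (rule galerkin_exists[where \<rho> = \<rho> and K = K])
   show "wsum (JN (N0 + n)) 0 (%b. c b t) \<le> K"
    if "0 \<le> t" "t \<le> T" "gal (1 / \<nu>) (N0 + n) T c" "wsum (JN (N0 + n)) 0 (%b. c b 0) \<le> \<rho>" for T c t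
    by (rule bnd(1)[OF A _ that]) simp
  qed (use K h0 c0 in simp_all)
  then obtain c where c: "!!n a. a \<in> JN (N0 + n) ==> c n a 0 = c0 a" "!!n T. gal (1 / \<nu>) (N0 + n) T (c n)" by metis
  define z where "z n = zext c0 (N0 + n) (c n)" for n
  \<comment> \<open>\<open>max 0 t\<close> freezes the solution for negative times, as
    \<open>galerkin_family\<close> demands.\<close>
  define Cn where "Cn n a t = z n a (\<nu> * max 0 t)" for n a t
  have zJ: "z n a s = c n a s" if "a \<in> JN (N0 + n)" for n a s using that by (simp add: z_def zext_def)
  have CJ: "Cn n a t = c n a (\<nu> * max 0 t)" if "a \<in> JN (N0 + n)" for n a t using zJ[OF that] by (simp add: Cn_def)
  have zd: "(z n a has_vector_derivative Gv (1 / \<nu>) (JN (N0 + n)) (%b. z n b s) a) (at s within {0..T})"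
   if "a \<in> sbox (N0 + n)" "s \<in> {0..T}" for n a s T unfolding z_def by (rule zext_deriv[OF c(2) that])
  have zout: "z n a s = 0" if "a \<notin> sbox (N0 + n)" for n a s using that by (auto simp: z_def zext_def JN_def sbox_def zero_prod_def)
  have zc: "continuous_on {0..} (z n a)" for n a
  proof (cases "a \<in> sbox (N0 + n)")
   case True
   have "continuous_on {0..T} (z n a)" for T by (rule continuous_on_vector_derivative) (rule zd[OF True])
   thus ?thesis by (rule continuous_on_half_line)
  next
   case False
   hence "z n a = (%s. 0)" using zout by (simp add: fun_eq_iff)
   thus ?thesis by simp
  qed
  have w0: "wsum (JN (N0 + n)) 0 (%b. c n b 0) \<le> \<rho>" for n
  proof -
   have "wsum (JN (N0 + n)) 0 (%b. c n b 0) = wsum (JN (N0 + n)) 0 c0" unfolding wsum_def by (intro sum.cong refl) (simp add: c(1))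
   thus ?thesis using c0 by simp
  qed
  have hc: "c n (- a) s = cnj (c n a s)" if "a \<in> JN (N0 + n)" "0 \<le> s" for n a s using c(2)[of n s] that unfolding gal_def by simp
  have herm: "z n (- a) s = cnj (z n a s)" if s: "0 \<le> s" for n a s
  proof -
   let ?J = "JN (N0 + n)"
   consider "a \<in> ?J" | "a = 0" "a \<notin> ?J" | "a \<notin> ?J" "a \<noteq> 0" by blast
   thus ?thesis
   proof cases
    case 1
    thus ?thesis using hc[OF 1 s] uminus_JN[of a "N0 + n"] by (simp add: zJ)
   next
    case 2
    let ?q = "%r. qq ?J ?J (%b. c n b r) 0"
    have "cnj (integral {0..s} ?q) = integral {0..s} (%r. cnj (?q r))" by (rule integral_cnj)
    also have "\<dots> = integral {0..s} ?q"
    proof (rule integral_cong)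
     fix r assume r: "r \<in> {0..s}"
     have "qq ?J ?J (%b. c n b r) (- 0) = cnj (?q r)" using r by (intro qq_uminus uminus_JN hc) simp_all
     thus "cnj (?q r) = ?q r" by simp
    qed
    finally show ?thesis using 2 h0[of 0] by (simp add: z_def zext_def)
   next
    case 3
    thus ?thesis using uminus_JN[of a "N0 + n"] by (simp add: z_def zext_def)
   qed
  qed
  \<comment> \<open>Undoing the time change in the dissipation integral produces the bound
    \<open>K / \<nu> + K * t\<close>, which \<open>K' * (1 + t)\<close> covers.\<close>
  define K' where "K' = K + K / \<nu>"
  have "galerkin_family L1 L2 u \<nu> Cn (%n. N0 + n) c0 K'"
  proof (unfold_locales)
   show "0 \<le> K'" using K \<nu> by (simp add: K'_def)
   show "n \<le> N0 + n" for n by simp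
   show "continuous_on UNIV u" by (rule u_cont)
   show "0 < \<nu>" by (rule \<nu>)
   show "Cn n a 0 = c0 a" if "a \<in> sbox (N0 + n)" for n a
    using that c(1)[of a n] by (cases "a = 0") (simp_all add: Cn_def z_def zext_def JN_def)
   show "Cn n a t = 0" if "a \<notin> sbox (N0 + n)" for n a t using zout[OF that] by (simp add: Cn_def)
   show "Cn n a t = Cn n a 0" if "t \<le> 0" for n a t using that by (simp add: Cn_def max_def)
   show "Cn n (- a) t = cnj (Cn n a t)" for n a t unfolding Cn_def using \<nu> by (intro herm) simp
   show "continuous_on UNIV (Cn n a)" for n a unfolding Cn_def using \<nu> by (intro continuous_on_compose2[OF zc] continuous_intros) auto
  next
   fix n a and T t :: real assume a: "a \<in> sbox (N0 + n)" and t: "t \<in> {0..T}"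
   let ?J = "JN (N0 + n)"
   have "((z n a \<circ> (%t. \<nu> * t)) has_vector_derivative \<nu> *\<^sub>R Gv (1 / \<nu>) ?J (%b. z n b (\<nu> * t)) a) (at t within {0..T})"
   proof (rule vector_diff_chain_within)
    show "((%t. \<nu> * t) has_vector_derivative \<nu>) (at t within {0..T})"
     by (auto intro!: derivative_eq_intros simp: has_real_derivative_iff_has_vector_derivative[symmetric])
    show "(z n a has_vector_derivative Gv (1 / \<nu>) ?J (%b. z n b (\<nu> * t)) a) (at (\<nu> * t) within (%t. \<nu> * t) ` {0..T})"
    proof (rule has_vector_derivative_within_subset)
     show "(z n a has_vector_derivative Gv (1 / \<nu>) ?J (%b. z n b (\<nu> * t)) a) (at (\<nu> * t) within {0..\<nu> * T})"
      using t \<nu> by (intro zd a) simp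
    qed (use \<nu> in auto)
   qed
   moreover have "\<nu> *\<^sub>R Gv (1 / \<nu>) ?J (%b. z n b (\<nu> * t)) a
    = - (mx a * (\<Sum>b\<in>?J. Cn n b t * Uc u (a - b)) + of_real (\<nu> * ((nf a)^2 - nf a)) * Cn n a t + of_real (\<nu> / 2) * qq ?J ?J (%b. Cn n b t) a)"
   proof -
    have e: "z n b (\<nu> * t) = Cn n b t" for b using t by (simp add: Cn_def max_def)
    have "of_real \<nu> * (of_real (1 / \<nu>) * x) = x" for x :: complex using \<nu> by simp
    thus ?thesis unfolding Gv_def e scaleR_conv_of_real right_diff_distrib by (simp add: algebra_simps)
   qed
   ultimately have d: "((z n a \<circ> (%t. \<nu> * t)) has_vector_derivative
    - (mx a * (\<Sum>b\<in>?J. Cn n b t * Uc u (a - b)) + of_real (\<nu> * ((nf a)^2 - nf a)) * Cn n a t + of_real (\<nu> / 2) * qq ?J ?J (%b. Cn n b t) a)) (at t within {0..T})"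
    by simp
   show "(Cn n a has_vector_derivative
    - (mx a * (\<Sum>b\<in>?J. Cn n b t * Uc u (a - b)) + of_real (\<nu> * ((nf a)^2 - nf a)) * Cn n a t + of_real (\<nu> / 2) * qq ?J ?J (%b. Cn n b t) a)) (at t within {0..T})"
    by (rule has_vector_derivative_transform[OF t _ d]) (simp add: Cn_def max_def)
  next
   fix n and t :: real assume t: "0 \<le> t"
   let ?J = "JN (N0 + n)"
   have N: "N0 \<le> N0 + n" by simp
   have \<nu>t: "0 \<le> \<nu> * t" using \<nu> t by simp
   have e: "wsum ?J k (%b. Cn n b r) = wsum ?J k (%b. c n b (\<nu> * r))" if "0 \<le> r" for r k
    unfolding wsum_def using that by (intro sum.cong refl) (simp add: CJ max_def)
   have "wsum ?J 0 (%b. Cn n b t) \<le> K" unfolding e[OF t] by (rule bnd(1)[OF A N \<nu>t order_refl c(2) w0])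
   thus "wsum ?J 0 (%b. Cn n b t) \<le> K'" using K \<nu> by (simp add: K'_def add_increasing2)
   let ?w = "%s. wsum ?J 2 (%b. c n b s)"
   have "(?w has_integral integral {0..\<nu> * t} ?w) {0..\<nu> * t}"
    by (intro integrable_integral integrable_continuous_real gal_cont[OF c(2) order_refl order_refl order_refl])
   from has_integral_stretch_real[OF this, of \<nu>]
   have "((%r. ?w (\<nu> * r)) has_integral (1 / \<nu>) * integral {0..\<nu> * t} ?w) ((%x. x / \<nu>) ` {0..\<nu> * t})"
    using \<nu> by simp
   moreover have "(%x. x / \<nu>) ` {0..\<nu> * t} = {0..t}"
   proof
    show "{0..t} \<subseteq> (%x. x / \<nu>) ` {0..\<nu> * t}"
    proof
     fix x assume x: "x \<in> {0..t}"
     show "x \<in> (%x. x / \<nu>) ` {0..\<nu> * t}" by (rule image_eqI[of _ _ "\<nu> * x"]) (use x \<nu> in simp_all)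
    qed
   qed (use \<nu> in \<open>auto simp: pos_divide_le_eq mult.commute\<close>)
   ultimately have "((%r. ?w (\<nu> * r)) has_integral (1 / \<nu>) * integral {0..\<nu> * t} ?w) {0..t}" by simp
   hence "((%r. wsum ?J 2 (%b. Cn n b r)) has_integral (1 / \<nu>) * integral {0..\<nu> * t} ?w) {0..t}"
    by (rule has_integral_eq[rotated]) (simp add: e)
   hence "integral {0..t} (%r. wsum ?J 2 (%b. Cn n b r)) = (1 / \<nu>) * integral {0..\<nu> * t} ?w" by (rule integral_unique)
   also have "\<dots> \<le> (1 / \<nu>) * (K * (1 + \<nu> * t))"
    using \<nu> by (intro mult_left_mono bnd(2)[OF A N \<nu>t order_refl c(2) w0]) simp
   also have "\<dots> = K / \<nu> + K * t" using \<nu> by (simp add: field_simps)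
   also have "\<dots> \<le> K' * (1 + t)"
   proof -
    have "K' * (1 + t) = (K / \<nu> + K * t) + (K + K * t / \<nu>)" by (simp add: K'_def algebra_simps add_divide_distrib)
    moreover have "0 \<le> K + K * t / \<nu>" using K \<nu> t by simp
    ultimately show ?thesis by linarith
   qed
   finally show "integral {0..t} (%r. wsum ?J 2 (%b. Cn n b r)) \<le> K' * (1 + t)" .
  qed
  thus ?thesis by blast
 qed
 thus ?thesis by blast
qed

lemma weak_solution_exists:
 assumes L: "L2 < 2 * pi" and R: "0 \<le> R"
 shows "\<exists>A0. \<forall>\<nu> \<phi>0. 0 < \<nu> \<and> A0 \<le> 1 / \<nu> \<and> in_L2 L1 L2 \<phi>0 \<and> L2norm L1 L2 \<phi>0 = R -->
  (\<exists>\<phi>. \<forall>T>0. weak_solution L1 L2 u \<nu> \<phi>0 T \<phi>)"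
proof -
 \<comment> \<open>By Bessel's inequality this bounds the coefficient energy of every truncation of
   a datum of norm \<open>R\<close>.\<close>
 define \<rho> where "\<rho> = R^2 / LL"
 have "0 \<le> \<rho>" using LL_pos by (simp add: \<rho>_def)
 then obtain A0 where A0: "\<forall>\<nu> c0. 0 < \<nu> \<and> A0 \<le> 1 / \<nu> \<and> (\<forall>a. c0 (- a) = cnj (c0 a)) \<and> (\<forall>N. wsum (JN N) 0 c0 \<le> \<rho>) -->
  (\<exists>Cn Nn K. galerkin_family L1 L2 u \<nu> Cn Nn c0 K)" using galerkin_family_exists[OF L] by blast
 have "\<exists>\<phi>. \<forall>T>0. weak_solution L1 L2 u \<nu> \<phi>0 T \<phi>"
  if \<nu>: "0 < \<nu>" "A0 \<le> 1 / \<nu>" and i: "in_L2 L1 L2 \<phi>0" "L2norm L1 L2 \<phi>0 = R" for \<nu> \<phi>0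
 proof -
  define c0 where "c0 = fcoef (%z. of_real (\<phi>0 z))"
  have h: "c0 (- a) = cnj (c0 a)" for a by (simp add: c0_def fcoef_def cnj_e flip: Bochner_Integration.integral_cnj)
  have sq: "sq_int M (%z. complex_of_real (\<phi>0 z))" using i(1) by (simp add: in_L2_iff)
  have w: "wsum (JN N) 0 c0 \<le> \<rho>" for N
  proof -
   have "LL * (\<Sum>a\<in>JN N. (norm (c0 a))^2) \<le> (LINT z|M. (norm (complex_of_real (\<phi>0 z)))^2)"
    unfolding c0_def by (rule Bessel[OF finite_JN sq])
   also have "\<dots> = R^2" unfolding i(2)[symmetric] L2norm_def by (simp add: Bochner_Integration.integral_nonneg)
   finally show ?thesis using LL_pos by (simp add: \<rho>_def wsum_def pos_le_divide_eq mult.commute)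
  qed
  obtain Cn Nn K where f: "galerkin_family L1 L2 u \<nu> Cn Nn c0 K" using A0 \<nu> h w by blast
  obtain k :: "nat => nat" where k: "strict_mono k" "!!a t. convergent (%n. Cn (k n) a t)"
   using galerkin_family.convergent_subsequence[OF f] by blast
  interpret F: galerkin_limit L1 L2 u \<nu> "%n. Cn (k n)" "%n. Nn (k n)" c0 K "%a t. lim (%n. Cn (k n) a t)" \<phi>0
  proof (rule galerkin_limit.intro[OF galerkin_family.subfamily[OF f k(1)]], unfold_locales)
   show "(%n. Cn (k n) a t) \<longlonglongrightarrow> lim (%n. Cn (k n) a t)" for a t
    using k(2) by (simp add: convergent_LIMSEQ_iff)
  qed (use i(1) in \<open>simp_all add: c0_def\<close>)
  show ?thesis using F.W.weak by blast
 qed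
 thus ?thesis by blast
qed

end

theorem theorem1p1:
  fixes L1 L2 :: real and u :: "real \<Rightarrow> real" and m :: nat
  assumes "0 < L1" and "0 < L2" and "L2 < 2 * pi"
    and "smooth_fun u" and "\<And>y. u (y + L2) = u y"
    and "finite {y \<in> {0..<L2}. deriv u y = 0}"
    and "2 \<le> m" and "critical_points_of_order_at_most m u"
  shows "\<forall>R\<ge>0. \<exists>\<nu>0. 0 < \<nu>0 \<and> \<nu>0 < 1 \<and>
    (\<forall>\<phi>0. in_L2 L1 L2 \<phi>0 \<and> L2norm L1 L2 \<phi>0 = R \<longrightarrow>
      (\<forall>\<nu>. 0 < \<nu> \<and> \<nu> < \<nu>0 \<longrightarrow>
        (\<exists>\<phi>. \<forall>T>0. weak_solution L1 L2 u \<nu> \<phi>0 T \<phi> \<and>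
                   in_Linf_L2 L1 L2 T \<phi> \<and> in_L2_H2 L1 L2 T \<phi>)))"
proof (intro allI impI)
 fix R :: real assume R: "0 \<le> R"
 have d: "u differentiable (at y)" for y
 proof -
  have "foldr dirD [] u differentiable (at y)" using assms(4) unfolding smooth_fun_def by blast
  thus ?thesis by simp
 qed
 have uc: "continuous_on X u" for X using d by (intro continuous_at_imp_continuous_on ballI differentiable_imp_continuous_within) blast
 have per: "u (y + real n * L2) = u y" for y n
 proof (induction n)
  case (Suc n)
  have "u (y + real (Suc n) * L2) = u ((y + real n * L2) + L2)" by (simp add: algebra_simps)
  thus ?case using assms(5) Suc by simp
 qed simp
 have bdd: "\<exists>B. \<forall>y. \<bar>u y\<bar> \<le> B"
 proof -
  have "compact (u ` {0..L2})" by (intro compact_continuous_image uc compact_Icc)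
  then obtain B where B: "\<forall>x\<in>u ` {0..L2}. norm x \<le> B" using compact_imp_bounded bounded_iff by blast
  have "\<bar>u y\<bar> \<le> B" for y
  proof -
   define k where "k = \<lfloor>y / L2\<rfloor>"
   define r where "r = y - of_int k * L2"
   have "of_int k \<le> y / L2" "y / L2 < of_int k + 1" unfolding k_def by linarith+
   hence r: "r \<in> {0..L2}" using assms(2) by (simp add: r_def pos_le_divide_eq pos_divide_less_eq distrib_right)
   have "u y = u r"
   proof (cases "0 \<le> k")
    case True
    hence "y = r + real (nat k) * L2" by (simp add: r_def)
    thus ?thesis using per[of r "nat k"] by simp
   next
    case False
    hence "r = y + real (nat (- k)) * L2" by (simp add: r_def)
    thus ?thesis using per[of y "nat (- k)"] by simp
   qed
   thus ?thesis using B r by simp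
  qed
  thus ?thesis by blast
 qed
 interpret shear_profile L1 L2 u by unfold_locales (use assms(1,2) uc bdd level_set_finite[OF d assms(6)] in simp_all)
 obtain A0 where A0: "!!\<nu> \<phi>0. 0 < \<nu> ==> A0 \<le> 1 / \<nu> ==> in_L2 L1 L2 \<phi>0 ==> L2norm L1 L2 \<phi>0 = R ==>
  \<exists>\<phi>. \<forall>T>0. weak_solution L1 L2 u \<nu> \<phi>0 T \<phi>" using weak_solution_exists[OF assms(3) R] by blast
 show "\<exists>\<nu>0. 0 < \<nu>0 \<and> \<nu>0 < 1 \<and>
  (\<forall>\<phi>0. in_L2 L1 L2 \<phi>0 \<and> L2norm L1 L2 \<phi>0 = R -->
   (\<forall>\<nu>. 0 < \<nu> \<and> \<nu> < \<nu>0 -->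
    (\<exists>\<phi>. \<forall>T>0. weak_solution L1 L2 u \<nu> \<phi>0 T \<phi> \<and>
          in_Linf_L2 L1 L2 T \<phi> \<and> in_L2_H2 L1 L2 T \<phi>)))"
 \<comment> \<open>The absolute value allows for a negative \<open>A0\<close>, and the 2 keeps the
   witness below 1; every smaller \<open>\<nu>\<close> then satisfies
   \<open>A0 \<le> 1 / \<nu>\<close>.\<close>
 proof (intro exI[of _ "1 / (2 + \<bar>A0\<bar>)"] conjI allI impI)
  show "1 / (2 + \<bar>A0\<bar>) < 1" by (subst divide_less_eq_1_pos) linarith+
  fix \<phi>0 \<nu> assume i: "in_L2 L1 L2 \<phi>0 \<and> L2norm L1 L2 \<phi>0 = R" and \<nu>: "0 < \<nu> \<and> \<nu> < 1 / (2 + \<bar>A0\<bar>)"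
  have "\<nu> * (2 + \<bar>A0\<bar>) < 1" using \<nu> by (simp add: pos_less_divide_eq)
  hence "2 + \<bar>A0\<bar> < 1 / \<nu>" using \<nu> by (simp add: pos_less_divide_eq mult.commute)
  hence "A0 \<le> 1 / \<nu>" by linarith
  then obtain \<phi> where \<phi>: "\<forall>T>0. weak_solution L1 L2 u \<nu> \<phi>0 T \<phi>" using A0 i \<nu> by blast
  hence "\<forall>T>0. weak_solution L1 L2 u \<nu> \<phi>0 T \<phi> \<and> in_Linf_L2 L1 L2 T \<phi> \<and> in_L2_H2 L1 L2 T \<phi>"
   unfolding weak_solution_def by blast
  thus "\<exists>\<phi>. \<forall>T>0. weak_solution L1 L2 u \<nu> \<phi>0 T \<phi> \<and> in_Linf_L2 L1 L2 T \<phi> \<and> in_L2_H2 L1 L2 T \<phi>" by blast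
 qed simp
qed

end
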